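(* The Riesz transforms $D\Delta_d^{-1/2}$ and $D^*\Delta_d^{-1/2}$ are bounded on the Besov spaces $\dot B^\alpha_{p,q}(\mathbb Z)$ for $\alpha\in\mathbb R$, $0<p<\infty$, $0<q\le\infty$, and bounded on the Triebel--Lizorkin spaces $\dot F^\alpha_{p,q}(\mathbb Z)$ for $\alpha\in\mathbb R$, $0<p,q<\infty$.
   Context: $\mathbb N=\{0,1,2,\dots\}$; usual modifications are made when $q=\infty$. $\Delta_d f(n)=-f(n+1)+2f(n)-f(n-1)$, $Df(n)=f(n+1)-f(n)$, $D^*f(n)=f(n)-f(n-1)$. The heat semigroup is $e^{-t\Delta_d}f(n)=\sum_mh_t(n-m)f(m)$ with $h_t(n)=\frac1\pi\int_0^\pi e^{-2t(1-\cos\theta)}\cos(n\theta)d\theta$. $\mathcal S(\mathbb Z)$: complex-valued functions $f$ on $\mathbb Z$ with $\|f\|_m=\sup_n(1+|n|)^m\sup_{0\le\ell\le m}|\Delta_d^\ell f(n)|<\infty$ for all $m\in\mathbb N$, topologized by these seminorms; $\mathcal S'(\mathbb Z)$ is its dual. $\mathcal P(\mathbb Z)$: restrictions to $\mathbb Z$ of polynomials. $\mathcal S_\infty(\mathbb Z)$: all $f\in\mathcal S(\mathbb Z)$ such that for each $k\in\mathbb N$ there is a (unique) $g_k\in\mathcal S(\mathbb Z)$ with $f=\Delta_d^kg_k$, topologized by $\|f\|_{m,k}=\|g_k\|_m$. Its dual $\mathcal S_\infty'(\mathbb Z)$ is identified with $\mathcal S'(\mathbb Z)/\mathcal P(\mathbb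 Z)$. For $f\in\mathcal S_\infty(\mathbb Z)$, $\Delta_d^{-1/2}f=c\int_0^\infty\sqrt t\,e^{-t\Delta_d}f\,\frac{dt}t$ with $c=1/\Gamma(1/2)$; this belongs to $\mathcal S_\infty(\mathbb Z)$. By duality $\Delta_d^{-1/2}$ is defined on $\mathcal S_\infty'(\mathbb Z)=\mathcal S'(\mathbb Z)/\mathcal P(\mathbb Z)$ by $\langle\Delta_d^{-1/2}f,g\rangle=\langle f,\Delta_d^{-1/2}g\rangle$; $D$ and $D^*$ act on $\mathcal S'(\mathbb Z)/\mathcal P(\mathbb Z)$ by their defining formulas. Spaces: $\mathcal F_{\mathbb Z}(f)(\theta)=\sum_nf(n)e^{in\theta}$, $\theta\in[-\pi,\pi]$. A family $(\varphi_\nu,\psi_\nu)_{\nu\in\mathbb Z,\nu\le0}$ in $\mathcal S(\mathbb Z)\times\mathcal S(\mathbb Z)$ is an admissible pair if: (i) $\operatorname{supp}\mathcal F_{\mathbb Z}(\varphi_\nu),\operatorname{supp}\mathcal F_{\mathbb Z}(\psi_\nu)\subset[-2^\nu\pi,2^\nu\pi]\setminus[-2^{\nu-2}\pi,2^{\nu-2}\pi]$; (ii) $\sum_{\nu\le0}\overline{\mathcal F_{\mathbb Z}(\varphi_\nu)(x)}\,\mathcal F_{\mathbb Z}(\psi_\nu)(x)=1$ for $x\in[-\pi,\pi]\setminus\{0\}$; (iii) there are constants $A>0$ and $A_k$, $k\ge0$, independent of $\nu$, such that $|\partial_x^k\mathcal F_{\mathbb Z}(\varphi_\nu)(x)|,|\partial_x^k\mathcal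 F_{\mathbb Z}(\psi_\nu)(x)|\le A_k2^{-k\nu}$ for $x\in[-\pi,\pi]$, $k\in\mathbb N$, and $|\mathcal F_{\mathbb Z}(\varphi_\nu)(x)|,|\mathcal F_{\mathbb Z}(\psi_\nu)(x)|\ge A$ for $x\in T_\nu$, where $T_0=[-\pi,\pi]\setminus[-\frac38\pi,\frac38\pi]$ and $T_\nu=[-3\cdot2^{\nu-2}\pi,3\cdot2^{\nu-2}\pi]\setminus[-3\cdot2^{\nu-3}\pi,3\cdot2^{\nu-3}\pi]$ for $\nu\le-1$. With an admissible pair fixed and $\varphi_\nu*f(n)=\sum_m\varphi_\nu(n-m)f(m)$, $\dot B^\alpha_{p,q}(\mathbb Z)$ and $\dot F^\alpha_{p,q}(\mathbb Z)$ are the spaces of $f\in\mathcal S'(\mathbb Z)/\mathcal P(\mathbb Z)$ with, respectively, finite quasi-norms $\big(\sum_{\nu\le0}(2^{\nu\alpha}\|\varphi_\nu*f\|_{\ell^p(\mathbb Z)})^q\big)^{1/q}$ and $\big\|\big[\sum_{\nu\le0}(2^{\nu\alpha}|\varphi_\nu*f|)^q\big]^{1/q}\big\|_{\ell^p(\mathbb Z)}$. *)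

theory Defs
  imports "HOL-Analysis.Analysis" "HOL-Computational_Algebra.Polynomial"
begin

section \<open>Difference operators and the heat semigroup\<close>

definition laplacian :: "(int \<Rightarrow> complex) \<Rightarrow> int \<Rightarrow> complex" where
  "laplacian f = (\<lambda>n. - f (n + 1) + 2 * f n - f (n - 1))"

definition forward_diff :: "(int \<Rightarrow> complex) \<Rightarrow> int \<Rightarrow> complex" where
  "forward_diff f = (\<lambda>n. f (n + 1) - f n)"

definition backward_diff :: "(int \<Rightarrow> complex) \<Rightarrow> int \<Rightarrow> complex" where
  "backward_diff f = (\<lambda>n. f n - f (n - 1))"

definition conv :: "(int \<Rightarrow> complex) \<Rightarrow> (int \<Rightarrow> complex) \<Rightarrow> int \<Rightarrow> complex" where
  "conv \<phi> f = (\<lambda>n. \<Sum>\<^sub>\<infinity>m. \<phi> (n - m) * f m)"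

definition heat_kernel :: "real \<Rightarrow> int \<Rightarrow> real" where
  "heat_kernel t n =
     1 / pi * integral {0..pi} (\<lambda>\<theta>. exp (- 2 * t * (1 - cos \<theta>)) * cos (of_int n * \<theta>))"

definition heat :: "real \<Rightarrow> (int \<Rightarrow> complex) \<Rightarrow> int \<Rightarrow> complex" where
  "heat t f = conv (\<lambda>n. of_real (heat_kernel t n)) f"

definition laplacian_inv_sqrt :: "(int \<Rightarrow> complex) \<Rightarrow> int \<Rightarrow> complex" where
  "laplacian_inv_sqrt f =
     (\<lambda>n. of_real (1 / Gamma (1 / 2)) * (LINT t:{0<..}|lborel. of_real (sqrt t / t) * heat t f n))"


section \<open>Test functions and their duals\<close>

definition schwartz_weight :: "nat \<Rightarrow> (int \<Rightarrow> complex) \<Rightarrow> int \<Rightarrow> real" where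
  "schwartz_weight m f n =
     (1 + \<bar>of_int n\<bar>) ^ m * (SUP l\<in>{..m}. norm ((laplacian ^^ l) f n))"

definition schwartz :: "(int \<Rightarrow> complex) set" where
  "schwartz = {f. \<forall>m. bdd_above (range (schwartz_weight m f))}"

definition schwartz_seminorm :: "nat \<Rightarrow> (int \<Rightarrow> complex) \<Rightarrow> real" where
  "schwartz_seminorm m f = (SUP n. schwartz_weight m f n)"

definition schwartz_inf :: "(int \<Rightarrow> complex) set" where
  "schwartz_inf = {f \<in> schwartz. \<forall>k. \<exists>g\<in>schwartz. f = (laplacian ^^ k) g}"

definition schwartz_inf_seminorm :: "nat \<Rightarrow> nat \<Rightarrow> (int \<Rightarrow> complex) \<Rightarrow> real" where
  "schwartz_inf_seminorm m k f =
     schwartz_seminorm m (THE g. g \<in> schwartz \<and> f = (laplacian ^^ k) g)"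

definition seminorm_topology ::
    "(int \<Rightarrow> complex) set \<Rightarrow> ((int \<Rightarrow> complex) \<Rightarrow> real) set \<Rightarrow> (int \<Rightarrow> complex) topology" where
  "seminorm_topology X P = topology_generated_by
     {{g \<in> X. p (\<lambda>n. g n - f n) < e} | f p e. f \<in> X \<and> p \<in> P \<and> e > 0}"

definition continuous_dual ::
    "(int \<Rightarrow> complex) set \<Rightarrow> ((int \<Rightarrow> complex) \<Rightarrow> real) set \<Rightarrow> ((int \<Rightarrow> complex) \<Rightarrow> complex) set" where
  "continuous_dual X P =
     {L \<in> extensional X.
        (\<forall>f\<in>X. \<forall>g\<in>X. L (\<lambda>n. f n + g n) = L f + L g) \<and>
        (\<forall>c. \<forall>f\<in>X. L (\<lambda>n. c * f n) = c * L f) \<and>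
        continuous_map (seminorm_topology X P) euclidean L}"

definition tempered :: "((int \<Rightarrow> complex) \<Rightarrow> complex) set" where
  "tempered = continuous_dual schwartz (range schwartz_seminorm)"

definition schwartz_inf_dual :: "((int \<Rightarrow> complex) \<Rightarrow> complex) set" where
  "schwartz_inf_dual = continuous_dual schwartz_inf {schwartz_inf_seminorm m k | m k. True}"

text \<open>A functional \<open>L\<close> and a sequence \<open>u\<close> are identified through the bilinear pairing
  \<open>L g = (\<Sum>n. u n * g n)\<close>; in particular \<open>u n\<close> is the value of \<open>L\<close> at the unit mass at \<open>n\<close>.\<close>

definition of_seq :: "(int \<Rightarrow> complex) \<Rightarrow> (int \<Rightarrow> complex) \<Rightarrow> complex" where
  "of_seq u = (\<lambda>g\<in>schwartz. \<Sum>\<^sub>\<infinity>n. u n * g n)"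

definition to_seq :: "((int \<Rightarrow> complex) \<Rightarrow> complex) \<Rightarrow> int \<Rightarrow> complex" where
  "to_seq L n = L (\<lambda>m. if m = n then 1 else 0)"


section \<open>Tempered sequences modulo polynomials\<close>

definition polynomials :: "(int \<Rightarrow> complex) set" where
  "polynomials = range (\<lambda>(p :: complex poly) n. poly p (of_int n))"

definition mod_poly_rel ::
    "(((int \<Rightarrow> complex) \<Rightarrow> complex) \<times> ((int \<Rightarrow> complex) \<Rightarrow> complex)) set" where
  "mod_poly_rel = {(L, M). L \<in> tempered \<and> M \<in> tempered \<and>
     (\<exists>u\<in>polynomials. \<forall>g\<in>schwartz. L g - M g = of_seq u g)}"

definition tempered_mod_poly :: "((int \<Rightarrow> complex) \<Rightarrow> complex) set set" where
  "tempered_mod_poly = tempered // mod_poly_rel"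

text \<open>The two directions of the identification of \<open>tempered_mod_poly\<close> with
  \<open>schwartz_inf_dual\<close>: restriction of any representative to \<open>schwartz_inf\<close>, and the set of all
  tempered extensions of a given functional.\<close>

definition class_to_dual ::
    "((int \<Rightarrow> complex) \<Rightarrow> complex) set \<Rightarrow> (int \<Rightarrow> complex) \<Rightarrow> complex" where
  "class_to_dual F = (\<lambda>g\<in>schwartz_inf. the_elem ((\<lambda>L. L g) ` F))"

definition dual_to_class ::
    "((int \<Rightarrow> complex) \<Rightarrow> complex) \<Rightarrow> ((int \<Rightarrow> complex) \<Rightarrow> complex) set" where
  "dual_to_class L = {M \<in> tempered. \<forall>g\<in>schwartz_inf. M g = L g}"

definition laplacian_inv_sqrt_dual ::
    "((int \<Rightarrow> complex) \<Rightarrow> complex) \<Rightarrow> (int \<Rightarrow> complex) \<Rightarrow> complex" where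
  "laplacian_inv_sqrt_dual =
     (\<lambda>L\<in>schwartz_inf_dual. \<lambda>g\<in>schwartz_inf. L (laplacian_inv_sqrt g))"

definition laplacian_inv_sqrt_class ::
    "((int \<Rightarrow> complex) \<Rightarrow> complex) set \<Rightarrow> ((int \<Rightarrow> complex) \<Rightarrow> complex) set" where
  "laplacian_inv_sqrt_class F = dual_to_class (laplacian_inv_sqrt_dual (class_to_dual F))"

text \<open>The map induced on classes by an operator on sequences; the union is over representatives,
  all of which give the same class when the operator preserves polynomials.\<close>

definition lift_class ::
    "((int \<Rightarrow> complex) \<Rightarrow> int \<Rightarrow> complex) \<Rightarrow>
     ((int \<Rightarrow> complex) \<Rightarrow> complex) set \<Rightarrow> ((int \<Rightarrow> complex) \<Rightarrow> complex) set" where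
  "lift_class T F = (\<Union>L\<in>F. mod_poly_rel `` {of_seq (T (to_seq L))})"

definition riesz_forward ::
    "((int \<Rightarrow> complex) \<Rightarrow> complex) set \<Rightarrow> ((int \<Rightarrow> complex) \<Rightarrow> complex) set" where
  "riesz_forward F = lift_class forward_diff (laplacian_inv_sqrt_class F)"

definition riesz_backward ::
    "((int \<Rightarrow> complex) \<Rightarrow> complex) set \<Rightarrow> ((int \<Rightarrow> complex) \<Rightarrow> complex) set" where
  "riesz_backward F = lift_class backward_diff (laplacian_inv_sqrt_class F)"


section \<open>Admissible pairs\<close>

text \<open>The Fourier series is a \<open>2 * pi\<close>-periodic function on the whole real line, so its
  derivatives at \<open>\<plusminus>pi\<close> below are genuine two-sided ones.\<close>

definition fourier :: "(int \<Rightarrow> complex) \<Rightarrow> real \<Rightarrow> complex" where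
  "fourier f \<theta> = (\<Sum>\<^sub>\<infinity>n. f n * exp (\<i> * of_int n * of_real \<theta>))"

definition fourier_supp :: "(int \<Rightarrow> complex) \<Rightarrow> real set" where
  "fourier_supp f = closure {\<theta> \<in> {-pi..pi}. fourier f \<theta> \<noteq> 0}"

definition fourier_deriv :: "nat \<Rightarrow> (int \<Rightarrow> complex) \<Rightarrow> real \<Rightarrow> complex" where
  "fourier_deriv k f = ((\<lambda>u x. vector_derivative u (at x)) ^^ k) (fourier f)"

definition freq_shell :: "int \<Rightarrow> real set" where
  "freq_shell \<nu> =
     {-(2 powi \<nu> * pi)..2 powi \<nu> * pi} - {-(2 powi (\<nu> - 2) * pi)..2 powi (\<nu> - 2) * pi}"

definition freq_core :: "int \<Rightarrow> real set" where
  "freq_core \<nu> =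
     (if \<nu> = 0 then {-pi..pi} - {-(3 / 8 * pi)..3 / 8 * pi}
      else {-(3 * 2 powi (\<nu> - 2) * pi)..3 * 2 powi (\<nu> - 2) * pi}
             - {-(3 * 2 powi (\<nu> - 3) * pi)..3 * 2 powi (\<nu> - 3) * pi})"

definition admissible_pair :: "(int \<Rightarrow> int \<Rightarrow> complex) \<Rightarrow> (int \<Rightarrow> int \<Rightarrow> complex) \<Rightarrow> bool" where
  "admissible_pair \<phi> \<psi> \<longleftrightarrow>
     (\<forall>\<nu>\<le>0. \<phi> \<nu> \<in> schwartz \<and> \<psi> \<nu> \<in> schwartz) \<and>
     (\<forall>\<nu>\<le>0. fourier_supp (\<phi> \<nu>) \<subseteq> freq_shell \<nu> \<and> fourier_supp (\<psi> \<nu>) \<subseteq> freq_shell \<nu>) \<and>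
     (\<forall>x\<in>{-pi..pi} - {0}.
        ((\<lambda>\<nu>. cnj (fourier (\<phi> \<nu>) x) * fourier (\<psi> \<nu>) x) has_sum 1) {..0}) \<and>
     (\<exists>A :: nat \<Rightarrow> real. \<forall>\<nu>\<le>0. \<forall>k. \<forall>x\<in>{-pi..pi}.
        norm (fourier_deriv k (\<phi> \<nu>) x) \<le> A k * 2 powi (- int k * \<nu>) \<and>
        norm (fourier_deriv k (\<psi> \<nu>) x) \<le> A k * 2 powi (- int k * \<nu>)) \<and>
     (\<exists>A :: real. A > 0 \<and> (\<forall>\<nu>\<le>0. \<forall>x\<in>freq_core \<nu>.
        norm (fourier (\<phi> \<nu>) x) \<ge> A \<and> norm (fourier (\<psi> \<nu>) x) \<ge> A))"


section \<open>Besov and Triebel--Lizorkin spaces\<close>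

text \<open>Real powers on \<open>[0, \<infinity>]\<close>, used only with a positive exponent.\<close>

definition ennpowr :: "ennreal \<Rightarrow> real \<Rightarrow> ennreal" where
  "ennpowr x a = (if x = \<infinity> then \<infinity> else ennreal (enn2real x powr a))"

definition lp_norm :: "ennreal \<Rightarrow> 'i set \<Rightarrow> ('i \<Rightarrow> ennreal) \<Rightarrow> ennreal" where
  "lp_norm p I u =
     (if p = \<infinity> then (SUP i\<in>I. u i)
      else ennpowr (\<Sum>\<^sub>\<infinity>i\<in>I. ennpowr (u i) (enn2real p)) (1 / enn2real p))"

definition besov_seq_norm ::
    "(int \<Rightarrow> int \<Rightarrow> complex) \<Rightarrow> real \<Rightarrow> ennreal \<Rightarrow> ennreal \<Rightarrow> (int \<Rightarrow> complex) \<Rightarrow> ennreal" where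
  "besov_seq_norm \<phi> \<alpha> p q f =
     lp_norm q {..0} (\<lambda>\<nu>. ennreal (2 powr (of_int \<nu> * \<alpha>)) *
       lp_norm p UNIV (\<lambda>n. ennreal (norm (conv (\<phi> \<nu>) f n))))"

definition triebel_lizorkin_seq_norm ::
    "(int \<Rightarrow> int \<Rightarrow> complex) \<Rightarrow> real \<Rightarrow> ennreal \<Rightarrow> ennreal \<Rightarrow> (int \<Rightarrow> complex) \<Rightarrow> ennreal" where
  "triebel_lizorkin_seq_norm \<phi> \<alpha> p q f =
     lp_norm p UNIV (\<lambda>n. lp_norm q {..0}
       (\<lambda>\<nu>. ennreal (2 powr (of_int \<nu> * \<alpha>)) * ennreal (norm (conv (\<phi> \<nu>) f n))))"

text \<open>For an admissible family, convolution with \<open>\<phi> \<nu>\<close> annihilates polynomials (its Fourier series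
  vanishes near \<open>0\<close>), so the image sets below are singletons on \<open>tempered_mod_poly\<close>.\<close>

definition besov_norm ::
    "(int \<Rightarrow> int \<Rightarrow> complex) \<Rightarrow> real \<Rightarrow> ennreal \<Rightarrow> ennreal \<Rightarrow>
     ((int \<Rightarrow> complex) \<Rightarrow> complex) set \<Rightarrow> ennreal" where
  "besov_norm \<phi> \<alpha> p q F = the_elem ((\<lambda>L. besov_seq_norm \<phi> \<alpha> p q (to_seq L)) ` F)"

definition triebel_lizorkin_norm ::
    "(int \<Rightarrow> int \<Rightarrow> complex) \<Rightarrow> real \<Rightarrow> ennreal \<Rightarrow> ennreal \<Rightarrow>
     ((int \<Rightarrow> complex) \<Rightarrow> complex) set \<Rightarrow> ennreal" where
  "triebel_lizorkin_norm \<phi> \<alpha> p q F =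
     the_elem ((\<lambda>L. triebel_lizorkin_seq_norm \<phi> \<alpha> p q (to_seq L)) ` F)"

definition besov ::
    "(int \<Rightarrow> int \<Rightarrow> complex) \<Rightarrow> real \<Rightarrow> ennreal \<Rightarrow> ennreal \<Rightarrow>
     ((int \<Rightarrow> complex) \<Rightarrow> complex) set set" where
  "besov \<phi> \<alpha> p q = {F \<in> tempered_mod_poly. besov_norm \<phi> \<alpha> p q F < \<infinity>}"

definition triebel_lizorkin ::
    "(int \<Rightarrow> int \<Rightarrow> complex) \<Rightarrow> real \<Rightarrow> ennreal \<Rightarrow> ennreal \<Rightarrow>
     ((int \<Rightarrow> complex) \<Rightarrow> complex) set set" where
  "triebel_lizorkin \<phi> \<alpha> p q = {F \<in> tempered_mod_poly. triebel_lizorkin_norm \<phi> \<alpha> p q F < \<infinity>}"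

definition bounded_on :: "'a set \<Rightarrow> ('a \<Rightarrow> ennreal) \<Rightarrow> ('a \<Rightarrow> 'a) \<Rightarrow> bool" where
  "bounded_on X N T \<longleftrightarrow> (\<exists>C :: real. \<forall>F\<in>X. T F \<in> X \<and> N (T F) \<le> ennreal C * N F)"

end

theory Submission
  imports Defs
begin

text \<open>On classes modulo polynomials everything is tested by frequency pieces. If \<open>w\<close> represents
  \<open>\<Delta>\<^sup>-\<^sup>1\<^sup>/\<^sup>2 u\<close>, then \<open>\<phi> v * D w\<close> is the convolution of \<open>u\<close> with a kernel whose symbol is that of
  \<open>\<phi> v\<close> times a function smooth at scale \<open>2\<^sup>v\<close>. A Calderon-type partition over the three scales
  \<open>v - 1, v, v + 1\<close> rewrites it as a sum of well-localised convolutions of the pieces \<open>\<phi> (v + e) * u\<close>.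
  These are dominated pointwise, through the Peetre maximal function, by averages of
  \<open>\<bar>\<phi> (v + e) * u\<bar>\<^sup>r\<close> with small \<open>r\<close>, and a vector-valued maximal inequality on the
  integers gives both norm estimates. Since \<open>D\<^sup>* w\<close> is a translate of \<open>D w\<close>, the backward transform
  needs no separate estimate.\<close>

section \<open>Rapidly decreasing sequences and sequences of polynomial growth\<close>

text \<open>The obstacle is frequency 0. The symbol 2|sin(x/2)| of the square root of the Laplacian
  has a corner there, so its kernel decays only like n^-2 and cannot be convolved with an arbitrary
  tempered sequence. Moreover the inverse square root exists only on classes, as the set of all
  tempered extensions of a functional on \<open>schwartz_inf\<close>. Two tasks therefore precede
  the estimates: to construct one extension, and to show that a tempered sequence vanishing on
  \<open>schwartz_inf\<close> is a polynomial. The second is itself derived from the admissible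
  pair, whose pieces resolve the unit mass up to frequencies near 0.

  No power of 2^v is lost because the Riesz transform has order zero: its symbol is (e^(-ix) - 1) /
  (2|sin(x/2)|), and the singularity at 0 lies off the support of every piece. Since p and q may be
  below 1, r is taken below min(1, p, q), so that the exponents q/r and p/r exceed 1. The Besov
  bound is the same estimate with q replaced by p, used at a single scale; the summation over scales
  is done afterwards, which admits q = \<infinity>.\<close>

definition wt :: "int \<Rightarrow> real" where
  "wt n = 1 + \<bar>of_int n\<bar>"

lemma wt_ge_1 [simp]: "1 \<le> wt n"
  by (simp add: wt_def)

lemma wt_pos [simp]: "0 < wt n"
  by (simp add: wt_def add_pos_nonneg)

lemma wt_nonzero [simp]: "wt n \<noteq> 0"
  using wt_pos[of n] by linarith

lemma wt_nonneg [simp]: "0 \<le> wt n"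
  using wt_pos[of n] by linarith

lemma wt_minus [simp]: "wt (- n) = wt n"
  by (simp add: wt_def)

lemma wt_minus_commute: "wt (m - n) = wt (n - m)"
  by (metis minus_diff_eq wt_minus)

lemma wt_add_le: "wt (m + n) \<le> wt m * wt n"
proof -
  have "\<bar>real_of_int m + of_int n\<bar> \<le> \<bar>real_of_int m\<bar> + \<bar>of_int n\<bar> + \<bar>real_of_int m\<bar> * \<bar>of_int n\<bar>"
    by (smt (verit) abs_ge_zero mult_nonneg_nonneg)
  then show ?thesis
    by (simp add: wt_def algebra_simps)
qed

lemma wt_triangle: "wt m \<le> wt (m - n) * wt n"
  using wt_add_le[of "m - n" n] by simp

lemma wt_power_ge_1 [simp]: "1 \<le> wt n ^ k"
  by (simp add: one_le_power)

lemma wt_power_pos [simp]: "0 < wt n ^ k"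
  by simp

lemma wt_triangle_power: "wt m ^ k \<le> wt (m - n) ^ k * wt n ^ k"
  by (metis power_mono power_mult_distrib wt_nonneg wt_triangle)

lemma inverse_wt_squared_summable: "(\<lambda>n. 1 / wt n ^ 2) summable_on UNIV"
proof -
  have s: "(\<lambda>n::nat. 1 / (1 + real n) ^ 2) summable_on UNIV"
  proof (rule summable_nonneg_imp_summable_on)
    have "summable (\<lambda>n. inverse (real (Suc n) ^ 2))"
      by (subst summable_Suc_iff) (rule inverse_power_summable, simp)
    then show "summable (\<lambda>n::nat. 1 / (1 + real n) ^ 2)"
      by (simp add: field_simps inverse_eq_divide)
  qed simp
  have "(\<lambda>n. 1 / wt n ^ 2) summable_on {0..}"
  proof -
    have "bij_betw int UNIV {0..}"
      by (rule bij_betwI[where g = nat]) auto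
    from summable_on_reindex_bij_betw[OF this, of "\<lambda>n. 1 / wt n ^ 2"] s
    show ?thesis by (simp add: wt_def)
  qed
  moreover have "(\<lambda>n. 1 / wt n ^ 2) summable_on {..0}"
  proof -
    have "bij_betw (\<lambda>n. - int n) UNIV {..0}"
      by (rule bij_betwI[where g = "\<lambda>n. nat (- n)"]) auto
    from summable_on_reindex_bij_betw[OF this, of "\<lambda>n. 1 / wt n ^ 2"] s
    show ?thesis by (simp add: wt_def)
  qed
  ultimately have "(\<lambda>n. 1 / wt n ^ 2) summable_on {0..} \<union> {..0}"
    by (rule summable_on_union)
  moreover have "{0..} \<union> {..0} = (UNIV :: int set)" by auto
  ultimately show ?thesis by simp
qed

definition wt_sum :: real where
  "wt_sum = (\<Sum>\<^sub>\<infinity>n. 1 / wt n ^ 2)"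

lemma wt_sum_nonneg: "0 \<le> wt_sum"
  unfolding wt_sum_def by (rule infsum_nonneg) simp

lemma bij_int_diff: "bij_betw (\<lambda>m. n - m) UNIV (UNIV :: int set)"
  by (rule bij_betwI[where g = "\<lambda>m. n - m"]) auto

lemma bij_int_add: "bij_betw (\<lambda>m. m + n) UNIV (UNIV :: int set)"
  by (rule bij_betwI[where g = "\<lambda>m. m - n"]) auto

lemma infsum_int_reflect: "(\<Sum>\<^sub>\<infinity>m::int. f (n - m)) = (\<Sum>\<^sub>\<infinity>m. f m)"
  by (rule infsum_reindex_bij_betw[OF bij_int_diff])

lemma infsum_int_shift: "(\<Sum>\<^sub>\<infinity>m::int. f (m + n)) = (\<Sum>\<^sub>\<infinity>m. f m)"
  by (rule infsum_reindex_bij_betw[OF bij_int_add])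

lemma summable_int_reflect: "(\<lambda>m::int. f (n - m)) summable_on UNIV \<longleftrightarrow> f summable_on UNIV"
  by (rule summable_on_reindex_bij_betw[OF bij_int_diff])

lemma abs_summable_wt:
  fixes f :: "int \<Rightarrow> complex"
  assumes "\<And>n. norm (f n) \<le> C / wt n ^ 2"
  shows "(\<lambda>n. norm (f n)) summable_on UNIV"
proof (rule summable_on_comparison_test)
  show "(\<lambda>n. C * (1 / wt n ^ 2)) summable_on UNIV"
    by (rule summable_on_cmult_right[OF inverse_wt_squared_summable])
qed (use assms in auto)

lemma summable_wt:
  fixes f :: "int \<Rightarrow> complex"
  assumes "\<And>n. norm (f n) \<le> C / wt n ^ 2"
  shows "f summable_on UNIV"
  using abs_summable_wt[OF assms] Infinite_Sum.abs_summable_summable by blast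

lemma norm_infsum_wt_le:
  fixes f :: "int \<Rightarrow> complex"
  assumes "\<And>n. norm (f n) \<le> C / wt n ^ 2"
  shows "norm (\<Sum>\<^sub>\<infinity>n. f n) \<le> C * wt_sum"
proof (rule norm_infsum_le)
  show "(f has_sum (\<Sum>\<^sub>\<infinity>n. f n)) UNIV"
    using summable_wt[OF assms] by simp
  show "((\<lambda>n. C * (1 / wt n ^ 2)) has_sum C * wt_sum) UNIV"
    unfolding wt_sum_def
    by (rule has_sum_cmult_right) (simp add: inverse_wt_squared_summable)
qed (use assms in auto)

lemma summable_wt_reflect:
  fixes f :: "int \<Rightarrow> complex"
  assumes "\<And>m. norm (f m) \<le> C / wt (n - m) ^ 2"
  shows "f summable_on UNIV" and "norm (\<Sum>\<^sub>\<infinity>m. f m) \<le> C * wt_sum"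
proof -
  have "norm (f (n - m)) \<le> C / wt m ^ 2" for m
    using assms[of "n - m"] by simp
  from summable_wt[OF this] norm_infsum_wt_le[OF this]
  show "f summable_on UNIV" and "norm (\<Sum>\<^sub>\<infinity>m. f m) \<le> C * wt_sum"
    by (simp_all add: summable_int_reflect infsum_int_reflect)
qed

text \<open>Fubini for double series through a majorant of product form. Associativity of
  \<open>conv\<close> and the adjoint of the inverse square root rest on it.\<close>

lemma infsum_swap_wt:
  fixes F :: "int \<Rightarrow> int \<Rightarrow> complex"
  assumes "\<And>m k. norm (F m k) \<le> C / (wt m ^ 2 * wt k ^ 2)"
  shows "(\<Sum>\<^sub>\<infinity>m. \<Sum>\<^sub>\<infinity>k. F m k) = (\<Sum>\<^sub>\<infinity>k. \<Sum>\<^sub>\<infinity>m. F m k)"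
proof (rule infsum_swap_banach)
  define G :: "int \<times> int \<Rightarrow> real" where "G = (\<lambda>(m, k). C * ((1 / wt m ^ 2) * (1 / wt k ^ 2)))"
  have C: "0 \<le> C"
    using order_trans[OF norm_ge_zero assms[of 0 0]] by (simp add: wt_def)
  have "(\<lambda>x. norm (G x)) summable_on UNIV \<times> UNIV"
    unfolding Infinite_Sum.abs_summable_on_Sigma_iff
  proof (intro conjI ballI)
    fix m :: int
    have "(\<lambda>k. C * (1 / wt m ^ 2) * (1 / wt k ^ 2)) summable_on UNIV"
      by (intro summable_on_cmult_right inverse_wt_squared_summable)
    then show "(\<lambda>k. norm (G (m, k))) summable_on UNIV"
      using C by (simp add: G_def abs_mult)
    have "(\<lambda>m. C * ((1 / wt m ^ 2) * wt_sum)) summable_on UNIV"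
      by (intro summable_on_cmult_right summable_on_cmult_left inverse_wt_squared_summable)
    moreover have "(\<Sum>\<^sub>\<infinity>k. norm (G (m, k))) = C * ((1 / wt m ^ 2) * wt_sum)" for m
    proof -
      have "(\<Sum>\<^sub>\<infinity>k. norm (G (m, k))) = (\<Sum>\<^sub>\<infinity>k. (C * (1 / wt m ^ 2)) * (1 / wt k ^ 2))"
        using C by (intro infsum_cong) (simp add: G_def abs_mult)
      also have "\<dots> = (C * (1 / wt m ^ 2)) * wt_sum"
        unfolding wt_sum_def by (rule infsum_cmult_right) (rule inverse_wt_squared_summable)
      finally show ?thesis by (simp add: mult.assoc)
    qed
    ultimately show "(\<lambda>m. norm (\<Sum>\<^sub>\<infinity>k. norm (G (m, k)))) summable_on UNIV"
      using C wt_sum_nonneg by (simp add: abs_mult)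
  qed
  then have "(\<lambda>x. norm (case x of (m, k) \<Rightarrow> F m k)) summable_on UNIV \<times> UNIV"
  proof (rule Infinite_Sum.abs_summable_on_comparison_test)
    fix x :: "int \<times> int"
    have "0 \<le> G x" using C by (cases x) (simp add: G_def)
    then show "norm (case x of (m, k) \<Rightarrow> F m k) \<le> norm (G x)"
      using assms[of "fst x" "snd x"] C by (cases x) (simp add: G_def abs_mult)
  qed
  then show "(\<lambda>(m, k). F m k) summable_on UNIV \<times> UNIV"
    by (rule Infinite_Sum.abs_summable_summable)
qed

text \<open>Membership in \<open>schwartz\<close> with the Laplacians left out: on the integers a
  difference operator costs nothing in decay, so both notions agree
  (\<open>schwartz_iff_rapid\<close>).\<close>

definition rapid :: "(int \<Rightarrow> complex) \<Rightarrow> bool" where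
  "rapid f \<longleftrightarrow> (\<forall>m. \<exists>C. \<forall>n. norm (f n) \<le> C / wt n ^ m)"

text \<open>These sequences represent exactly the tempered functionals
  (\<open>of_seq_tempered\<close>, \<open>tempered_eq_of_seq\<close>), so from there on
  distributions are handled as sequences.\<close>

definition pgrow :: "(int \<Rightarrow> complex) \<Rightarrow> bool" where
  "pgrow u \<longleftrightarrow> (\<exists>N C. \<forall>n. norm (u n) \<le> C * wt n ^ N)"

lemma rapidE:
  assumes "rapid f"
  obtains C where "0 \<le> C" "\<And>n. norm (f n) \<le> C / wt n ^ m"
proof -
  obtain C where C: "\<And>n. norm (f n) \<le> C / wt n ^ m"
    using assms unfolding rapid_def by blast
  have "0 \<le> C" using order_trans[OF norm_ge_zero C[of 0]] by (simp add: wt_def)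
  with C show thesis by (rule that[rotated])
qed

lemma pgrowE:
  assumes "pgrow u"
  obtains N C where "0 \<le> C" "\<And>n. norm (u n) \<le> C * wt n ^ N"
proof -
  obtain N C where C: "\<And>n. norm (u n) \<le> C * wt n ^ N"
    using assms unfolding pgrow_def by blast
  have "0 \<le> C" using order_trans[OF norm_ge_zero C[of 0]] by (simp add: wt_def)
  with C show thesis using that by blast
qed

lemma pgrowI: "(\<And>n. norm (u n) \<le> C * wt n ^ N) \<Longrightarrow> pgrow u"
  unfolding pgrow_def by blast

lemma rapidI: "(\<And>m. \<exists>C. \<forall>n. norm (f n) \<le> C / wt n ^ m) \<Longrightarrow> rapid f"
  unfolding rapid_def by blast

lemma rapid_add: "rapid f \<Longrightarrow> rapid g \<Longrightarrow> rapid (\<lambda>n. f n + g n)"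
proof (rule rapidI)
  fix m assume "rapid f" "rapid g"
  then obtain C D where "\<And>n. norm (f n) \<le> C / wt n ^ m" "\<And>n. norm (g n) \<le> D / wt n ^ m"
    by (metis rapid_def)
  then have "norm (f n + g n) \<le> (C + D) / wt n ^ m" for n
    by (metis add_divide_distrib norm_add_rule_thm)
  then show "\<exists>C. \<forall>n. norm (f n + g n) \<le> C / wt n ^ m" by blast
qed

lemma rapid_cmult: "rapid f \<Longrightarrow> rapid (\<lambda>n. c * f n)"
proof (rule rapidI)
  fix m assume "rapid f"
  then obtain C where "\<And>n. norm (f n) \<le> C / wt n ^ m" by (metis rapid_def)
  then have "norm (c * f n) \<le> (norm c * C) / wt n ^ m" for n
    using mult_left_mono[of "norm (f n)" "C / wt n ^ m" "norm c"] by (simp add: norm_mult)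
  then show "\<exists>C. \<forall>n. norm (c * f n) \<le> C / wt n ^ m" by blast
qed

lemma pgrow_add: "pgrow f \<Longrightarrow> pgrow g \<Longrightarrow> pgrow (\<lambda>n. f n + g n)"
proof -
  assume "pgrow f" "pgrow g"
  then obtain N C M D where C: "0 \<le> C" "\<And>n. norm (f n) \<le> C * wt n ^ N"
    and D: "0 \<le> D" "\<And>n. norm (g n) \<le> D * wt n ^ M"
    by (meson pgrowE)
  have "norm (f n + g n) \<le> (C + D) * wt n ^ max N M" for n
  proof -
    have "C * wt n ^ N \<le> C * wt n ^ max N M" "D * wt n ^ M \<le> D * wt n ^ max N M"
      using C(1) D(1) by (auto intro!: mult_left_mono power_increasing)
    then show ?thesis
      using C(2)[of n] D(2)[of n] norm_triangle_ineq[of "f n" "g n"]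
      by (simp add: distrib_right)
  qed
  then show ?thesis by (rule pgrowI)
qed

lemma pgrow_cmult: "pgrow f \<Longrightarrow> pgrow (\<lambda>n. c * f n)"
proof -
  assume "pgrow f"
  then obtain N C where C: "\<And>n. norm (f n) \<le> C * wt n ^ N"
    by (meson pgrowE)
  have "norm (c * f n) \<le> (norm c * C) * wt n ^ N" for n
    using mult_left_mono[OF C, of "norm c"] by (simp add: norm_mult mult.assoc)
  then show ?thesis by (rule pgrowI)
qed

lemma rapid_shift: "rapid f \<Longrightarrow> rapid (\<lambda>n. f (n + k))"
proof (rule rapidI)
  fix m assume "rapid f"
  then obtain C where C: "0 \<le> C" "\<And>n. norm (f n) \<le> C / wt n ^ m" by (metis rapidE)
  have "norm (f (n + k)) \<le> (C * wt k ^ m) / wt n ^ m" for n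
  proof -
    have "wt n ^ m \<le> wt (n + k) ^ m * wt k ^ m"
      using wt_triangle_power[of n m "- k"] by simp
    then have "C * wt n ^ m \<le> C * (wt (n + k) ^ m * wt k ^ m)"
      using C(1) mult_left_mono by blast
    then have "C / wt (n + k) ^ m \<le> (C * wt k ^ m) / wt n ^ m"
      by (simp add: divide_simps mult_ac)
    then show ?thesis using C(2)[of "n + k"] by linarith
  qed
  then show "\<exists>C. \<forall>n. norm (f (n + k)) \<le> C / wt n ^ m" by blast
qed

lemma rapid_reflect: "rapid f \<Longrightarrow> rapid (\<lambda>n. f (k - n))"
proof -
  assume "rapid f"
  then have "rapid (\<lambda>n. f (- n))" by (simp add: rapid_def) (metis wt_minus minus_minus)
  from rapid_shift[OF this, of "- k"] show ?thesis by simp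
qed

lemma pgrow_shift: "pgrow f \<Longrightarrow> pgrow (\<lambda>n. f (n + k))"
proof -
  assume "pgrow f"
  then obtain N C where C: "0 \<le> C" "\<And>n. norm (f n) \<le> C * wt n ^ N" by (metis pgrowE)
  have "norm (f (n + k)) \<le> (C * wt k ^ N) * wt n ^ N" for n
  proof -
    have "wt (n + k) ^ N \<le> wt n ^ N * wt k ^ N"
      using wt_triangle_power[of "n + k" N k] by simp
    then have "C * wt (n + k) ^ N \<le> C * (wt n ^ N * wt k ^ N)"
      using C(1) mult_left_mono by blast
    then show ?thesis using C(2)[of "n + k"] by (simp add: mult_ac)
  qed
  then show ?thesis by (rule pgrowI)
qed

lemma rapid_forward_diff: "rapid f \<Longrightarrow> rapid (forward_diff f)"
  unfolding forward_diff_def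
  using rapid_add[OF rapid_shift[of f 1] rapid_cmult[of f "-1"]] by simp

lemma pgrow_forward_diff: "pgrow f \<Longrightarrow> pgrow (forward_diff f)"
  unfolding forward_diff_def
  using pgrow_add[OF pgrow_shift[of f 1] pgrow_cmult[of f "-1"]] by simp

lemma laplacian_forward_diff: "laplacian f n = - forward_diff (forward_diff f) (n - 1)"
  by (simp add: laplacian_def forward_diff_def add.commute)

lemma laplacian_eq: "laplacian f = (\<lambda>n. - 1 * forward_diff (forward_diff f) (n + - 1))"
  by (simp add: laplacian_def forward_diff_def fun_eq_iff add.commute)

lemma rapid_laplacian: "rapid f \<Longrightarrow> rapid (laplacian f)"
  unfolding laplacian_eq
  by (intro rapid_cmult rapid_shift rapid_forward_diff)

lemma pgrow_laplacian: "pgrow f \<Longrightarrow> pgrow (laplacian f)"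
  unfolding laplacian_eq
  by (intro pgrow_cmult pgrow_shift pgrow_forward_diff)

lemma rapid_laplacian_power: "rapid f \<Longrightarrow> rapid ((laplacian ^^ k) f)"
  by (induction k) (auto intro: rapid_laplacian)

section \<open>Pairings and convolutions\<close>

lemma pairing_summable:
  assumes "pgrow u" "rapid g"
  shows "(\<lambda>n. norm (u n * g n)) summable_on UNIV"
proof -
  obtain N C where C: "0 \<le> C" "\<And>n. norm (u n) \<le> C * wt n ^ N" using assms(1) by (metis pgrowE)
  obtain D where D: "0 \<le> D" "\<And>n. norm (g n) \<le> D / wt n ^ (N + 2)" using assms(2) by (metis rapidE)
  have "norm (u n * g n) \<le> (C * D) / wt n ^ 2" for n
  proof -
    have "norm (u n * g n) \<le> (C * wt n ^ N) * (D / wt n ^ (N + 2))"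
      unfolding norm_mult using C D by (intro mult_mono) auto
    then show ?thesis by (simp add: power_add field_simps power2_eq_square)
  qed
  then show ?thesis by (rule abs_summable_wt)
qed

lemma pairing_summable': "pgrow u \<Longrightarrow> rapid g \<Longrightarrow> (\<lambda>n. u n * g n) summable_on UNIV"
  by (rule Infinite_Sum.abs_summable_summable) (rule pairing_summable)

text \<open>The growth of \<open>u\<close> at \<open>m\<close> is charged to \<open>n\<close> and to
  the distance \<open>n - m\<close>. Two spare powers in the decay of \<open>a\<close> then make the
  sum over \<open>m\<close> converge.\<close>

lemma conv_wt_term_le:
  fixes a u :: "int \<Rightarrow> complex"
  assumes "\<And>n. norm (a n) \<le> A / wt n ^ (N + 2)" "\<And>n. norm (u n) \<le> B * wt n ^ N"
  shows "norm (a (n - m) * u m) \<le> (A * B * wt n ^ N) / wt (n - m) ^ 2"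
proof -
  have A: "0 \<le> A" using order_trans[OF norm_ge_zero assms(1)[of 0]] by (simp add: wt_def)
  have B: "0 \<le> B" using order_trans[OF norm_ge_zero assms(2)[of 0]] by (simp add: wt_def)
  have "norm (a (n - m) * u m) \<le> (A / wt (n - m) ^ (N + 2)) * (B * wt m ^ N)"
    unfolding norm_mult using assms A B by (intro mult_mono) auto
  also have "\<dots> \<le> (A / wt (n - m) ^ (N + 2)) * (B * (wt (n - m) ^ N * wt n ^ N))"
    using A B wt_triangle_power[of m N n]
    by (intro mult_left_mono) (auto simp: wt_minus_commute)
  also have "\<dots> = (A * B * wt n ^ N) / wt (n - m) ^ 2"
    by (simp add: power_add numeral_eq_Suc field_simps)
  finally show ?thesis .
qed

lemma conv_wt:
  assumes "\<And>n. norm (a n) \<le> A / wt n ^ (N + 2)" "\<And>n. norm (u n) \<le> B * wt n ^ N"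
  shows "(\<lambda>m. a (n - m) * u m) summable_on UNIV"
    and "norm (conv a u n) \<le> (A * B * wt_sum) * wt n ^ N"
  using summable_wt_reflect[OF conv_wt_term_le[OF assms]]
  by (simp_all add: conv_def mult_ac)

lemma conv_summable: "rapid a \<Longrightarrow> pgrow u \<Longrightarrow> (\<lambda>m. a (n - m) * u m) summable_on UNIV"
proof -
  assume a: "rapid a" and u: "pgrow u"
  obtain N U where U: "0 \<le> U" "\<And>n. norm (u n) \<le> U * wt n ^ N" using u by (metis pgrowE)
  obtain A where A: "0 \<le> A" "\<And>n. norm (a n) \<le> A / wt n ^ (N + 2)" using a by (metis rapidE)
  show ?thesis by (rule conv_wt(1)[OF A(2) U(2)])
qed

text \<open>Finite decay of one factor survives without loss. The factor \<open>a\<close> is not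
  assumed to be rapidly decreasing, because it will be a Laplacian iterate of
  \<open>sqrt_kernel\<close>.\<close>

lemma conv_rapid_decay:
  assumes a: "\<And>n. norm (a n) \<le> A / wt n ^ K" and b: "rapid b"
  shows "\<exists>C. \<forall>n. norm (conv a b n) \<le> C / wt n ^ K"
    and "(\<lambda>m. a (n - m) * b m) summable_on UNIV"
proof -
  have A: "0 \<le> A" using order_trans[OF norm_ge_zero assms(1)[of 0]] by (simp add: wt_def)
  obtain B where B: "0 \<le> B" "\<And>n. norm (b n) \<le> B / wt n ^ (K + 2)" using b by (metis rapidE)
  have le: "norm (a (n - m) * b m) \<le> (A * B / wt n ^ K) / wt m ^ 2" for n m
  proof -
    have "norm (a (n - m) * b m) \<le> (A / wt (n - m) ^ K) * (B / wt m ^ (K + 2))"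
      unfolding norm_mult using a A B by (intro mult_mono) auto
    also have "\<dots> = (A * B) / (wt (n - m) ^ K * wt m ^ K) / wt m ^ 2"
      by (simp add: power_add numeral_eq_Suc field_simps)
    also have "\<dots> \<le> (A * B / wt n ^ K) / wt m ^ 2"
      using A B wt_triangle_power[of n K m]
      by (intro divide_right_mono divide_left_mono) auto
    finally show ?thesis .
  qed
  show "(\<lambda>m. a (n - m) * b m) summable_on UNIV"
    by (rule summable_wt[OF le])
  have "norm (conv a b n) \<le> (A * B * wt_sum) / wt n ^ K" for n
    using norm_infsum_wt_le[OF le, of n] by (simp add: conv_def)
  then show "\<exists>C. \<forall>n. norm (conv a b n) \<le> C / wt n ^ K" by blast
qed

lemma rapid_conv: "rapid a \<Longrightarrow> rapid b \<Longrightarrow> rapid (conv a b)"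
  by (rule rapidI) (metis conv_rapid_decay(1) rapid_def)

lemma conv_assoc:
  assumes a: "rapid a" and b: "rapid b" and u: "pgrow u"
  shows "conv (conv a b) u = conv a (conv b u)"
proof
  fix n
  obtain N U where U: "0 \<le> U" "\<And>n. norm (u n) \<le> U * wt n ^ N" using u by (metis pgrowE)
  obtain B where B: "0 \<le> B" "\<And>n. norm (b n) \<le> B / wt n ^ (N + 2)" using b by (metis rapidE)
  \<comment> \<open>The exponents cascade: \<open>u\<close> costs N in \<open>m\<close>, so N + 2
    powers of \<open>b\<close> leave \<open>1 / wt m ^ 2\<close>; this costs N + 2 in
    \<open>k\<close>, so N + 4 powers of \<open>a\<close> leave \<open>1 / wt k ^ 2\<close>.\<close>
  obtain A where A: "0 \<le> A" "\<And>n. norm (a n) \<le> A / wt n ^ (N + 4)" using a by (metis rapidE)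
  have le: "norm (a (n - k) * b (k - m) * u m) \<le> (A * B * U * wt n ^ (N + 4)) / (wt m ^ 2 * wt k ^ 2)" for m k
  proof -
    have "norm (a (n - k) * b (k - m) * u m) \<le> (A / wt (n - k) ^ (N + 4)) * (B / wt (k - m) ^ (N + 2)) * (U * wt m ^ N)"
      unfolding norm_mult using A B U by (intro mult_mono) auto
    also have "\<dots> \<le> (A * (wt n ^ (N + 4) / wt k ^ (N + 4))) * (B / wt (k - m) ^ (N + 2)) * (U * wt m ^ N)"
    proof (intro mult_right_mono)
      have "wt k ^ (N + 4) \<le> wt (n - k) ^ (N + 4) * wt n ^ (N + 4)"
        using wt_triangle_power[of k "N + 4" n] by (simp add: wt_minus_commute)
      then have "A * wt k ^ (N + 4) \<le> A * (wt (n - k) ^ (N + 4) * wt n ^ (N + 4))"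
        using A(1) mult_left_mono by blast
      then show "A / wt (n - k) ^ (N + 4) \<le> A * (wt n ^ (N + 4) / wt k ^ (N + 4))"
        by (simp add: divide_simps mult_ac del: power_Suc)
    qed (use B U in auto)
    also have "\<dots> \<le> (A * (wt n ^ (N + 4) / wt k ^ (N + 4))) * (B * (wt k ^ (N + 2) / wt m ^ (N + 2))) * (U * wt m ^ N)"
    proof (intro mult_right_mono mult_left_mono)
      have "wt m ^ (N + 2) \<le> wt (k - m) ^ (N + 2) * wt k ^ (N + 2)"
        using wt_triangle_power[of m "N + 2" k] by (simp add: wt_minus_commute)
      then have "B * wt m ^ (N + 2) \<le> B * (wt (k - m) ^ (N + 2) * wt k ^ (N + 2))"
        using B(1) mult_left_mono by blast
      then show "B / wt (k - m) ^ (N + 2) \<le> B * (wt k ^ (N + 2) / wt m ^ (N + 2))"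
        by (simp add: divide_simps mult_ac del: power_Suc)
    qed (use A B U in auto)
    also have "\<dots> = (A * B * U * wt n ^ (N + 4)) / (wt m ^ 2 * wt k ^ 2)"
    proof -
      have "wt k ^ (N + 4) = wt k ^ (N + 2) * wt k ^ 2" "wt m ^ (N + 2) = wt m ^ N * wt m ^ 2"
        by (simp_all add: power_add numeral_eq_Suc)
      then show ?thesis by (simp add: divide_simps del: power_Suc)
    qed
    finally show ?thesis .
  qed
  have "conv (conv a b) u n = (\<Sum>\<^sub>\<infinity>m. \<Sum>\<^sub>\<infinity>k. a (n - k) * b (k - m) * u m)"
    unfolding conv_def
  proof (rule infsum_cong)
    fix m
    have "(\<Sum>\<^sub>\<infinity>k. a (n - m - k) * b k) = (\<Sum>\<^sub>\<infinity>k. a (n - m - (k + - m)) * b (k + - m))"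
      by (rule infsum_int_shift[symmetric])
    then show "(\<Sum>\<^sub>\<infinity>k. a (n - m - k) * b k) * u m = (\<Sum>\<^sub>\<infinity>k. a (n - k) * b (k - m) * u m)"
      by (subst infsum_cmult_left') simp
  qed
  also have "\<dots> = (\<Sum>\<^sub>\<infinity>k. \<Sum>\<^sub>\<infinity>m. a (n - k) * b (k - m) * u m)"
    by (rule infsum_swap_wt[OF le])
  also have "\<dots> = conv a (conv b u) n"
    unfolding conv_def by (simp add: infsum_cmult_right' mult.assoc)
  finally show "conv (conv a b) u n = conv a (conv b u) n" .
qed

lemma conv_commute: "conv a b = conv b a"
proof
  fix n
  have "conv a b n = (\<Sum>\<^sub>\<infinity>m. a (n - (n - m)) * b (n - m))"
    unfolding conv_def by (rule infsum_int_reflect[symmetric])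
  then show "conv a b n = conv b a n"
    by (simp add: conv_def mult.commute)
qed

lemma pairing_shift:
  "(\<Sum>\<^sub>\<infinity>n::int. u (n + k) * g n) = (\<Sum>\<^sub>\<infinity>n. u n * (g (n - k) :: complex))"
  using infsum_int_shift[of "\<lambda>n. u n * g (n - k)" k] by simp

lemma pairing_laplacian:
  assumes u: "pgrow u" and g: "rapid g"
  shows "(\<Sum>\<^sub>\<infinity>n. laplacian u n * g n) = (\<Sum>\<^sub>\<infinity>n. u n * laplacian g n)"
proof -
  have s: "(\<lambda>n. u (n + i) * g (n + j)) summable_on UNIV" for i j
    by (intro pairing_summable' pgrow_shift rapid_shift u g)
  have s1: "(\<lambda>n. - (u (n + 1) * g n)) summable_on UNIV" "(\<lambda>n. 2 * (u n * g n)) summable_on UNIV"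
     "(\<lambda>n. - (u (n - 1) * g n)) summable_on UNIV" "(\<lambda>n. - (u n * g (n + 1))) summable_on UNIV"
     "(\<lambda>n. - (u n * g (n - 1))) summable_on UNIV"
    using s[of 1 0] s[of 0 0] s[of "-1" 0] s[of 0 1] s[of 0 "-1"]
    by (simp_all add: summable_on_uminus summable_on_cmult_right)
  have "(\<Sum>\<^sub>\<infinity>n. laplacian u n * g n) = (\<Sum>\<^sub>\<infinity>n. (- (u (n + 1) * g n) + 2 * (u n * g n)) + - (u (n - 1) * g n))"
    by (simp add: laplacian_def algebra_simps)
  also have "\<dots> = (\<Sum>\<^sub>\<infinity>n. - (u (n + 1) * g n)) + (\<Sum>\<^sub>\<infinity>n. 2 * (u n * g n)) + (\<Sum>\<^sub>\<infinity>n. - (u (n - 1) * g n))"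
    using s1 by (simp only: infsum_add summable_on_add)
  also have "\<dots> = (\<Sum>\<^sub>\<infinity>n. - (u n * g (n - 1))) + (\<Sum>\<^sub>\<infinity>n. 2 * (u n * g n)) + (\<Sum>\<^sub>\<infinity>n. - (u n * g (n + 1)))"
    using pairing_shift[of u 1 g] pairing_shift[of u "-1" g] by (simp add: infsum_uminus)
  also have "\<dots> = (\<Sum>\<^sub>\<infinity>n. (- (u n * g (n - 1)) + 2 * (u n * g n)) + - (u n * g (n + 1)))"
    using s1 by (simp only: infsum_add summable_on_add)
  also have "\<dots> = (\<Sum>\<^sub>\<infinity>n. u n * laplacian g n)"
    by (simp add: laplacian_def algebra_simps)
  finally show ?thesis .
qed

lemma pairing_laplacian_power:
  assumes "pgrow u" and "rapid g"
  shows "(\<Sum>\<^sub>\<infinity>n. (laplacian ^^ k) u n * g n) = (\<Sum>\<^sub>\<infinity>n. u n * (laplacian ^^ k) g n)"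
  using assms
proof (induction k arbitrary: u)
  case (Suc k)
  have "(\<Sum>\<^sub>\<infinity>n. (laplacian ^^ Suc k) u n * g n) = (\<Sum>\<^sub>\<infinity>n. (laplacian ^^ k) (laplacian u) n * g n)"
    by (simp add: funpow_swap1)
  also have "\<dots> = (\<Sum>\<^sub>\<infinity>n. laplacian u n * (laplacian ^^ k) g n)"
    using Suc by (intro Suc.IH pgrow_laplacian)
  also have "\<dots> = (\<Sum>\<^sub>\<infinity>n. u n * (laplacian ^^ Suc k) g n)"
    using Suc.prems by (simp add: pairing_laplacian rapid_laplacian_power)
  finally show ?case .
qed simp

lemma laplacian_conv:
  assumes "\<And>n. (\<lambda>m. a (n - m) * u m) summable_on UNIV"
  shows "laplacian (conv a u) = conv (laplacian a) u"
proof
  fix n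
  have s1: "(\<lambda>m. - (a (n + 1 - m) * u m)) summable_on UNIV" "(\<lambda>m. 2 * (a (n - m) * u m)) summable_on UNIV"
     "(\<lambda>m. - (a (n - 1 - m) * u m)) summable_on UNIV"
    using assms by (simp_all only: summable_on_uminus summable_on_cmult_right)
  have "conv (laplacian a) u n = (\<Sum>\<^sub>\<infinity>m. (- (a (n + 1 - m) * u m) + 2 * (a (n - m) * u m)) + - (a (n - 1 - m) * u m))"
    by (simp add: conv_def laplacian_def algebra_simps)
  also have "\<dots> = (\<Sum>\<^sub>\<infinity>m. - (a (n + 1 - m) * u m)) + (\<Sum>\<^sub>\<infinity>m. 2 * (a (n - m) * u m)) + (\<Sum>\<^sub>\<infinity>m. - (a (n - 1 - m) * u m))"
    using s1 by (simp only: infsum_add summable_on_add)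
  also have "\<dots> = laplacian (conv a u) n"
    by (simp add: laplacian_def conv_def infsum_uminus infsum_cmult_right')
  finally show "laplacian (conv a u) n = conv (laplacian a) u n" by simp
qed

section \<open>Polynomial sequences\<close>

lemma forward_diff_power_shift:
  "(forward_diff ^^ k) (\<lambda>n. f (n + c)) = (\<lambda>n. (forward_diff ^^ k) f (n + c))"
  by (induction k) (auto simp: forward_diff_def add_ac)

lemma forward_diff_power_add:
  "(forward_diff ^^ k) (\<lambda>n. f n + g n) = (\<lambda>n. (forward_diff ^^ k) f n + (forward_diff ^^ k) g n)"
  by (induction k) (auto simp: forward_diff_def)

lemma forward_diff_power_cmult:
  "(forward_diff ^^ k) (\<lambda>n. c * f n) = (\<lambda>n. c * (forward_diff ^^ k) f n)"
  by (induction k) (auto simp: forward_diff_def right_diff_distrib)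

lemma forward_diff_power_zero: "(forward_diff ^^ k) (\<lambda>n. 0) = (\<lambda>n. 0)"
  by (induction k) (auto simp: forward_diff_def)

lemma forward_diff_power_eq_zero_mono:
  assumes "(forward_diff ^^ k) f = (\<lambda>n. 0)" "k \<le> l"
  shows "(forward_diff ^^ l) f = (\<lambda>n. 0)"
proof -
  have "l = (l - k) + k" using assms(2) by simp
  then have "(forward_diff ^^ l) f = (forward_diff ^^ (l - k)) ((forward_diff ^^ k) f)"
    by (metis funpow_add comp_apply)
  then show ?thesis by (simp add: assms(1) forward_diff_power_zero)
qed

lemma laplacian_power_eq:
  "(laplacian ^^ k) f = (\<lambda>n. (- 1) ^ k * (forward_diff ^^ (2 * k)) f (n - int k))"
proof (induction k)
  case (Suc k)
  define g where "g = (forward_diff ^^ (2 * k)) f"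
  have "(laplacian ^^ Suc k) f = laplacian (\<lambda>n. (- 1) ^ k * g (n - int k))"
    by (simp add: Suc g_def)
  moreover have "(forward_diff ^^ (2 * Suc k)) f = forward_diff (forward_diff g)"
    by (simp add: g_def)
  moreover have "laplacian (\<lambda>n. (- 1) ^ k * g (n - int k)) =
      (\<lambda>n. (- 1) ^ Suc k * forward_diff (forward_diff g) (n - int (Suc k)))"
    by (simp add: laplacian_def forward_diff_def algebra_simps)
  ultimately show ?case by (simp only:)
qed simp

text \<open>The iterated Leibniz rule for multiplication by the coordinate. It drives the induction
  over the coefficients of a polynomial.\<close>

lemma forward_diff_power_times_id:
  "(forward_diff ^^ Suc k) (\<lambda>n. of_int n * f n) =
   (\<lambda>n. of_int n * (forward_diff ^^ Suc k) f n + of_nat (Suc k) * (forward_diff ^^ k) f (n + 1))"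
proof (induction k)
  case 0
  show ?case by (auto simp: forward_diff_def algebra_simps)
next
  case (Suc k)
  have "(forward_diff ^^ Suc (Suc k)) (\<lambda>n. of_int n * f n) =
     forward_diff (\<lambda>n. of_int n * (forward_diff ^^ Suc k) f n + of_nat (Suc k) * (forward_diff ^^ k) f (n + 1))"
    using Suc by (metis funpow.simps(2) comp_apply)
  also have "\<dots> = (\<lambda>n. of_int n * (forward_diff ^^ Suc (Suc k)) f n + of_nat (Suc (Suc k)) * (forward_diff ^^ Suc k) f (n + 1))"
    by (auto simp: forward_diff_def algebra_simps)
  finally show ?case .
qed

lemma poly_forward_diff_power:
  "\<exists>k. (forward_diff ^^ k) (\<lambda>n. poly p (of_int n)) = (\<lambda>n. 0)"
proof (induction p)
  case 0
  show ?case by (intro exI[of _ 0]) simp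
next
  case (pCons a p)
  then obtain k where k: "(forward_diff ^^ k) (\<lambda>n. poly p (of_int n)) = (\<lambda>n. 0)" by blast
  then have k': "(forward_diff ^^ Suc k) (\<lambda>n. poly p (of_int n)) = (\<lambda>n. 0)"
    by (rule forward_diff_power_eq_zero_mono) simp
  have "(forward_diff ^^ 1) (\<lambda>n. a) = (\<lambda>n. 0)" by (simp add: forward_diff_def)
  then have a: "(forward_diff ^^ Suc k) (\<lambda>n. a) = (\<lambda>n. 0)"
    by (rule forward_diff_power_eq_zero_mono) simp
  have "(forward_diff ^^ Suc k) (\<lambda>n. a + of_int n * poly p (of_int n)) = (\<lambda>n. 0)"
    unfolding forward_diff_power_add forward_diff_power_times_id a k k' by simp
  then show ?case by (intro exI[of _ "Suc k"]) (simp only: poly_pCons)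
qed

lemma gbinomial_poly:
  "\<exists>p :: complex poly. \<forall>n. poly p (of_int n) = (of_int n gchoose k)"
proof (induction k)
  case 0
  show ?case by (intro exI[of _ 1]) simp
next
  case (Suc k)
  then obtain p :: "complex poly" where p: "\<And>n. poly p (of_int n) = (of_int n gchoose k)" by blast
  have "poly (smult (1 / of_nat (Suc k)) ([:- of_nat k, 1:] * p)) (of_int n) = (of_int n gchoose (Suc k))" for n
  proof -
    have "of_nat (Suc k) * (of_int n gchoose (Suc k)) = (of_int n - of_nat k) * ((of_int n :: complex) gchoose k)"
      using gbinomial_mult_1[of "of_int n :: complex" k] by (simp add: algebra_simps)
    then have "(of_int n gchoose (Suc k)) = 1 / of_nat (Suc k) * ((of_int n - of_nat k) * ((of_int n :: complex) gchoose k))"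
      by (simp add: field_simps del: of_nat_Suc)
    then show ?thesis
      by (simp add: p algebra_simps del: of_nat_Suc)
  qed
  then show ?case by blast
qed

lemma forward_diff_gbinomial:
  "forward_diff (\<lambda>n. of_int n gchoose Suc k) = (\<lambda>n. of_int n gchoose k)"
  by (auto simp: forward_diff_def gbinomial_Suc_Suc)

lemma forward_diff_power_gbinomial:
  "(forward_diff ^^ k) (\<lambda>n. of_int n gchoose k) = (\<lambda>n. 1)"
proof (induction k)
  case (Suc k)
  have "(forward_diff ^^ Suc k) (\<lambda>n. of_int n gchoose Suc k) =
      (forward_diff ^^ k) (forward_diff (\<lambda>n. of_int n gchoose Suc k))"
    by (simp only: funpow_Suc_right comp_apply)
  with Suc show ?case by (simp only: forward_diff_gbinomial)
qed simp

lemma polynomials_add: "f \<in> polynomials \<Longrightarrow> g \<in> polynomials \<Longrightarrow> (\<lambda>n. f n + g n) \<in> polynomials"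
  unfolding polynomials_def image_iff
  by (elim bexE, rule_tac x = "x + xa" in bexI) (auto simp: fun_eq_iff)

lemma polynomials_cmult: "f \<in> polynomials \<Longrightarrow> (\<lambda>n. c * f n) \<in> polynomials"
  unfolding polynomials_def image_iff
  by (elim bexE, rule_tac x = "smult c x" in bexI) (auto simp: fun_eq_iff)

lemma polynomials_zero: "(\<lambda>n. 0) \<in> polynomials"
  unfolding polynomials_def by (rule range_eqI[of _ _ 0]) simp

text \<open>Induction on the order: the k-th difference of \<open>v\<close> is a constant
  \<open>c\<close>, and so is that of \<open>c\<close> times the binomial coefficient of order k.
  Subtracting the latter lowers the order by one.\<close>

lemma polynomials_if_forward_diff_power_eq_zero:
  "(forward_diff ^^ k) v = (\<lambda>n. 0) \<Longrightarrow> v \<in> polynomials"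
proof (induction k arbitrary: v)
  case 0
  then show ?case using polynomials_zero by simp
next
  case (Suc k)
  define c where "c = (forward_diff ^^ k) v 0"
  have const: "(forward_diff ^^ k) v n = c" for n
  proof -
    have step: "(forward_diff ^^ k) v (n + 1) = (forward_diff ^^ k) v n" for n
      using fun_cong[OF Suc.prems, of n] by (simp add: forward_diff_def[of "(forward_diff ^^ k) v"])
    show ?thesis
    proof (induction n rule: int_induct[where k = 0])
      case (step2 i)
      then show ?case using step[of "i - 1"] by simp
    qed (auto simp: c_def step)
  qed
  have "(forward_diff ^^ k) (\<lambda>n. v n + (- c) * (of_int n gchoose k)) = (\<lambda>n. 0)"
    unfolding forward_diff_power_add forward_diff_power_cmult forward_diff_power_gbinomial
    by (simp add: const)
  then have "(\<lambda>n. v n + (- c) * (of_int n gchoose k)) \<in> polynomials" by (rule Suc.IH)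
  moreover have "(\<lambda>n. c * (of_int n gchoose k)) \<in> polynomials"
  proof (rule polynomials_cmult)
    obtain p :: "complex poly" where "\<And>n. poly p (of_int n) = (of_int n gchoose k)"
      using gbinomial_poly by blast
    then show "(\<lambda>n. of_int n gchoose k) \<in> polynomials"
      unfolding polynomials_def by (intro range_eqI[of _ _ p]) auto
  qed
  ultimately have "(\<lambda>n. (v n + (- c) * (of_int n gchoose k)) + c * (of_int n gchoose k)) \<in> polynomials"
    by (rule polynomials_add)
  then show ?case by simp
qed

lemma polynomials_iff: "v \<in> polynomials \<longleftrightarrow> (\<exists>k. (forward_diff ^^ k) v = (\<lambda>n. 0))"
proof
  assume "v \<in> polynomials"
  then obtain p :: "complex poly" where "v = (\<lambda>n. poly p (of_int n))"
    by (auto simp: polynomials_def)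
  then show "\<exists>k. (forward_diff ^^ k) v = (\<lambda>n. 0)"
    using poly_forward_diff_power by blast
qed (blast intro: polynomials_if_forward_diff_power_eq_zero)

lemma polynomials_forward_diff: "v \<in> polynomials \<Longrightarrow> forward_diff v \<in> polynomials"
  unfolding polynomials_iff
proof -
  assume "\<exists>k. (forward_diff ^^ k) v = (\<lambda>n. 0)"
  then obtain k where "(forward_diff ^^ k) v = (\<lambda>n. 0)" by blast
  then have "(forward_diff ^^ Suc k) v = (\<lambda>n. 0)"
    by (rule forward_diff_power_eq_zero_mono) simp
  then have "(forward_diff ^^ k) (forward_diff v) = (\<lambda>n. 0)"
    by (simp only: funpow_Suc_right comp_apply)
  then show "\<exists>k. (forward_diff ^^ k) (forward_diff v) = (\<lambda>n. 0)" by blast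
qed

lemma polynomials_shift: "v \<in> polynomials \<Longrightarrow> (\<lambda>n. v (n + c)) \<in> polynomials"
  unfolding polynomials_iff forward_diff_power_shift by (erule exE, rule_tac x = k in exI) simp

lemma polynomials_if_laplacian_power_eq_zero:
  assumes "(laplacian ^^ k) v = (\<lambda>n. 0)"
  shows "v \<in> polynomials"
proof (rule polynomials_if_forward_diff_power_eq_zero)
  have "(forward_diff ^^ (2 * k)) v (n + int k - int k) = 0" for n
    using fun_cong[OF assms, of "n + int k"] unfolding laplacian_power_eq by simp
  then show "(forward_diff ^^ (2 * k)) v = (\<lambda>n. 0)" by (intro ext) simp
qed

lemma polynomials_laplacian_power:
  assumes "v \<in> polynomials"
  shows "\<exists>k. (laplacian ^^ k) v = (\<lambda>n. 0)"
proof -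
  obtain k where "(forward_diff ^^ k) v = (\<lambda>n. 0)" using assms polynomials_iff by blast
  then have "(forward_diff ^^ (2 * k)) v = (\<lambda>n. 0)"
    by (rule forward_diff_power_eq_zero_mono) simp
  then have "(laplacian ^^ k) v = (\<lambda>n. 0)" unfolding laplacian_power_eq by simp
  then show ?thesis by blast
qed

lemma pgrow_const: "pgrow (\<lambda>n. c)"
  by (rule pgrowI[of _ "norm c" 0]) simp

lemma pgrow_times_id:
  assumes "pgrow f" shows "pgrow (\<lambda>n. of_int n * f n)"
proof -
  obtain N C where C: "0 \<le> C" "\<And>n. norm (f n) \<le> C * wt n ^ N" using assms by (metis pgrowE)
  have "norm (of_int n * f n) \<le> C * wt n ^ Suc N" for n
  proof -
    have "norm (of_int n * f n) \<le> wt n * (C * wt n ^ N)"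
      unfolding norm_mult using C by (intro mult_mono) (auto simp: wt_def)
    then show ?thesis by (simp add: mult_ac)
  qed
  then show ?thesis by (rule pgrowI)
qed

lemma polynomials_pgrow: assumes "v \<in> polynomials" shows "pgrow v"
proof -
  obtain p :: "complex poly" where v: "v = (\<lambda>n. poly p (of_int n))"
    using assms by (auto simp: polynomials_def)
  show ?thesis unfolding v
    by (induction p) (auto intro: pgrow_const pgrow_add pgrow_times_id)
qed

text \<open>Summation from 0 costs a single power of growth, so the result is still tempered. Above
  all this undoes the Laplacians that are put on a kernel to make it decay.\<close>

lemma forward_diff_antiderivative:
  assumes "pgrow z"
  shows "\<exists>w. pgrow w \<and> forward_diff w = z"
proof -
  define w where "w = (\<lambda>n. if 0 \<le> n then (\<Sum>i\<in>{0..<n}. z i) else - (\<Sum>i\<in>{n..<0}. z i))"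
  obtain N C where C: "0 \<le> C" "\<And>n. norm (z n) \<le> C * wt n ^ N" using assms by (metis pgrowE)
  have zi: "norm (z i) \<le> C * wt n ^ N" if "\<bar>i\<bar> \<le> \<bar>n\<bar>" for i n
  proof -
    have "wt i \<le> wt n" using that unfolding wt_def by linarith
    then have "C * wt i ^ N \<le> C * wt n ^ N" using C(1) by (intro mult_left_mono power_mono) auto
    then show ?thesis using C(2)[of i] by linarith
  qed
  have "norm (w n) \<le> C * wt n ^ Suc N" for n
  proof -
    have "norm (w n) \<le> real (nat \<bar>n\<bar>) * (C * wt n ^ N)"
    proof (cases "0 \<le> n")
      case True
      have "norm (\<Sum>i\<in>{0..<n}. z i) \<le> (\<Sum>i\<in>{0..<n}. C * wt n ^ N)"
        by (rule sum_norm_le) (use zi in auto)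
      with True show ?thesis by (simp add: w_def)
    next
      case False
      have "norm (\<Sum>i\<in>{n..<0}. z i) \<le> (\<Sum>i\<in>{n..<0}. C * wt n ^ N)"
        by (rule sum_norm_le) (use zi in auto)
      with False show ?thesis by (simp add: w_def)
    qed
    also have "\<dots> \<le> wt n * (C * wt n ^ N)"
      using C(1) by (intro mult_right_mono) (auto simp: wt_def)
    finally show ?thesis by (simp add: mult_ac)
  qed
  then have "pgrow w" by (rule pgrowI)
  moreover have "forward_diff w n = z n" for n
  proof -
    consider "0 \<le> n" | "n = -1" | "n < -1" by linarith
    then show ?thesis
    proof cases
      case 1
      then have "{0..<n + 1} = insert n {0..<n}" by auto
      with 1 show ?thesis by (simp add: forward_diff_def w_def)
    next
      case 2
      have "{-1..<0::int} = {-1}" by auto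
      with 2 show ?thesis by (simp add: forward_diff_def w_def)
    next
      case 3
      then have "{n..<0} = insert n {n + 1..<0}" by auto
      with 3 show ?thesis by (simp add: forward_diff_def w_def)
    qed
  qed
  ultimately show ?thesis by blast
qed

lemma laplacian_antiderivative:
  assumes "pgrow z"
  shows "\<exists>w. pgrow w \<and> laplacian w = z"
proof -
  have "pgrow (\<lambda>n. - 1 * z (n + 1))" by (intro pgrow_cmult pgrow_shift assms)
  then obtain v where v: "pgrow v" "forward_diff v = (\<lambda>n. - 1 * z (n + 1))"
    using forward_diff_antiderivative by blast
  then obtain w where w: "pgrow w" "forward_diff w = v"
    using forward_diff_antiderivative by blast
  have "laplacian w = z"
    unfolding laplacian_eq w(2) v(2) by simp
  with w show ?thesis by blast
qed

lemma laplacian_power_antiderivative: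
  "pgrow z \<Longrightarrow> \<exists>w. pgrow w \<and> (laplacian ^^ k) w = z"
proof (induction k arbitrary: z)
  case (Suc k)
  then obtain v where v: "pgrow v" "laplacian v = z" using laplacian_antiderivative by blast
  then obtain w where "pgrow w" "(laplacian ^^ k) w = v" using Suc.IH by blast
  with v show ?case by (intro exI[of _ w]) simp
qed auto

section \<open>Test functions and tempered functionals\<close>

lemma laplacian_power_add:
  "(laplacian ^^ k) (\<lambda>n. f n + g n) = (\<lambda>n. (laplacian ^^ k) f n + (laplacian ^^ k) g n)"
  by (induction k) (auto simp: laplacian_def)

lemma laplacian_power_cmult:
  "(laplacian ^^ k) (\<lambda>n. c * f n) = (\<lambda>n. c * (laplacian ^^ k) f n)"
  by (induction k) (auto simp: laplacian_def algebra_simps)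

lemma laplacian_power_zero: "(laplacian ^^ k) (\<lambda>n. 0) = (\<lambda>n. 0)"
  by (induction k) (auto simp: laplacian_def)

lemma schwartz_weight_le_iff:
  "schwartz_weight m f n \<le> B \<longleftrightarrow> (\<forall>l\<le>m. wt n ^ m * norm ((laplacian ^^ l) f n) \<le> B)"
proof -
  have "schwartz_weight m f n \<le> B \<longleftrightarrow> (SUP l\<in>{..m}. norm ((laplacian ^^ l) f n)) \<le> B / wt n ^ m"
    by (simp add: schwartz_weight_def wt_def[symmetric] pos_le_divide_eq mult.commute)
  also have "\<dots> \<longleftrightarrow> (\<forall>l\<le>m. norm ((laplacian ^^ l) f n) \<le> B / wt n ^ m)"
    by (subst cSUP_le_iff) auto
  finally show ?thesis
    by (simp add: pos_le_divide_eq mult.commute)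
qed

lemma schwartz_weight_ge:
  "l \<le> m \<Longrightarrow> wt n ^ m * norm ((laplacian ^^ l) f n) \<le> schwartz_weight m f n"
  using schwartz_weight_le_iff[of m f n "schwartz_weight m f n"] by blast

text \<open>Per Laplacian, the coefficients have absolute sum 4, and moving by one site changes the
  weight by at most a factor 2, hence \<open>2 ^ m\<close> for its power.\<close>

lemma wt_laplacian_power_le:
  assumes "\<And>n. wt n ^ m * norm (f n) \<le> B"
  shows "wt n ^ m * norm ((laplacian ^^ l) f n) \<le> (4 * 2 ^ m) ^ l * B"
proof (induction l arbitrary: n)
  case 0
  then show ?case using assms by simp
next
  case (Suc l)
  define g where "g = (laplacian ^^ l) f"
  define D where "D = (4 * 2 ^ m) ^ l * B"
  have g: "wt n ^ m * norm (g n) \<le> D" for n using Suc by (simp add: g_def D_def)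
  have D: "0 \<le> D" using order_trans[OF _ g[of 0]] by simp
  have near: "wt n ^ m * norm (g k) \<le> 2 ^ m * D" if "\<bar>n - k\<bar> \<le> 1" for k
  proof -
    have "wt n \<le> 2 * wt k" using that by (simp add: wt_def)
    then have "wt n ^ m \<le> 2 ^ m * wt k ^ m" by (metis power_mono power_mult_distrib wt_nonneg)
    then have "wt n ^ m * norm (g k) \<le> 2 ^ m * wt k ^ m * norm (g k)"
      by (rule mult_right_mono) simp
    also have "\<dots> \<le> 2 ^ m * D" using g[of k] by (simp add: mult.assoc)
    finally show ?thesis .
  qed
  have "norm (laplacian g n) \<le> norm (g (n + 1)) + norm (2 * g n) + norm (g (n - 1))"
    unfolding laplacian_def
    using norm_triangle_ineq4[of "- g (n + 1) + 2 * g n" "g (n - 1)"] norm_triangle_ineq[of "- g (n + 1)" "2 * g n"]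
    by simp
  then have "wt n ^ m * norm (laplacian g n) \<le> wt n ^ m * (norm (g (n + 1)) + 2 * norm (g n) + norm (g (n - 1)))"
    by (intro mult_left_mono) (auto simp: norm_mult)
  also have "\<dots> = wt n ^ m * norm (g (n + 1)) + 2 * (wt n ^ m * norm (g n)) + wt n ^ m * norm (g (n - 1))"
    by (simp add: algebra_simps)
  also have "\<dots> \<le> 2 ^ m * D + 2 * (2 ^ m * D) + 2 ^ m * D"
    using near[of "n + 1"] near[of n] near[of "n - 1"] by linarith
  finally show ?case by (simp add: g_def D_def mult_ac)
qed

lemma schwartz_weight_le:
  assumes "\<And>n. wt n ^ m * norm (f n) \<le> B"
  shows "schwartz_weight m f n \<le> (4 * 2 ^ m) ^ m * B"
  unfolding schwartz_weight_le_iff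
proof (intro allI impI)
  fix l assume l: "l \<le> m"
  have B: "0 \<le> B" using order_trans[OF _ assms[of 0]] by simp
  have "(4 * 2 ^ m :: real) ^ l \<le> (4 * 2 ^ m) ^ m"
    using l by (intro power_increasing) (auto intro: order_trans[OF _ mult_mono[of 1 4 1 "2 ^ m"]])
  then have "(4 * 2 ^ m) ^ l * B \<le> (4 * 2 ^ m) ^ m * B"
    using B mult_right_mono by blast
  then show "wt n ^ m * norm ((laplacian ^^ l) f n) \<le> (4 * 2 ^ m) ^ m * B"
    using wt_laplacian_power_le[of m f B n l, OF assms] by linarith
qed

lemma schwartz_iff_rapid: "f \<in> schwartz \<longleftrightarrow> rapid f"
proof
  assume f: "f \<in> schwartz"
  show "rapid f"
  proof (rule rapidI)
    fix m
    obtain C where C: "\<And>n. schwartz_weight m f n \<le> C"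
      using f by (auto simp: schwartz_def bdd_above_def)
    have "norm (f n) \<le> C / wt n ^ m" for n
      using order_trans[OF schwartz_weight_ge[of 0 m n f] C[of n]] by (simp add: pos_le_divide_eq mult.commute)
    then show "\<exists>C. \<forall>n. norm (f n) \<le> C / wt n ^ m" by blast
  qed
next
  assume f: "rapid f"
  show "f \<in> schwartz"
    unfolding schwartz_def
  proof safe
    fix m
    obtain C where "\<And>n. norm (f n) \<le> C / wt n ^ m" using f by (metis rapidE)
    then have "\<And>n. wt n ^ m * norm (f n) \<le> C" by (simp add: pos_le_divide_eq mult.commute)
    from schwartz_weight_le[OF this] show "bdd_above (range (schwartz_weight m f))"
      by (auto simp: bdd_above_def)
  qed
qed

lemma schwartz_weight_le_seminorm: "f \<in> schwartz \<Longrightarrow> schwartz_weight m f n \<le> schwartz_seminorm m f"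
  unfolding schwartz_seminorm_def by (rule cSUP_upper) (auto simp: schwartz_def)

lemma schwartz_seminorm_least: "(\<And>n. schwartz_weight m f n \<le> B) \<Longrightarrow> schwartz_seminorm m f \<le> B"
  unfolding schwartz_seminorm_def by (rule cSUP_least) auto

lemma norm_le_schwartz_seminorm:
  "f \<in> schwartz \<Longrightarrow> wt n ^ m * norm (f n) \<le> schwartz_seminorm m f"
  using schwartz_weight_le_seminorm[of f m n] schwartz_weight_ge[of 0 m n f] by simp

lemma schwartz_seminorm_le:
  "(\<And>n. wt n ^ m * norm (f n) \<le> B) \<Longrightarrow> schwartz_seminorm m f \<le> (4 * 2 ^ m) ^ m * B"
  by (rule schwartz_seminorm_least) (rule schwartz_weight_le)

lemma schwartz_add: "f \<in> schwartz \<Longrightarrow> g \<in> schwartz \<Longrightarrow> (\<lambda>n. f n + g n) \<in> schwartz"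
  by (simp add: schwartz_iff_rapid rapid_add)

lemma schwartz_cmult: "f \<in> schwartz \<Longrightarrow> (\<lambda>n. c * f n) \<in> schwartz"
  by (simp add: schwartz_iff_rapid rapid_cmult)

lemma schwartz_diff: "f \<in> schwartz \<Longrightarrow> g \<in> schwartz \<Longrightarrow> (\<lambda>n. f n - g n) \<in> schwartz"
  using schwartz_add[of f "\<lambda>n. - 1 * g n"] schwartz_cmult[of g "-1"] by simp

lemma schwartz_zero: "(\<lambda>n. 0) \<in> schwartz"
  by (auto simp: schwartz_iff_rapid rapid_def intro!: exI[of _ 0])

lemma schwartz_seminorm_add:
  assumes "f \<in> schwartz" "g \<in> schwartz"
  shows "schwartz_seminorm m (\<lambda>n. f n + g n) \<le> schwartz_seminorm m f + schwartz_seminorm m g"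
proof (rule schwartz_seminorm_least)
  fix n
  show "schwartz_weight m (\<lambda>n. f n + g n) n \<le> schwartz_seminorm m f + schwartz_seminorm m g"
    unfolding schwartz_weight_le_iff
  proof (intro allI impI)
    fix l assume "l \<le> m"
    have "wt n ^ m * norm ((laplacian ^^ l) (\<lambda>n. f n + g n) n)
        \<le> wt n ^ m * (norm ((laplacian ^^ l) f n) + norm ((laplacian ^^ l) g n))"
      unfolding laplacian_power_add by (intro mult_left_mono norm_triangle_ineq) auto
    also have "\<dots> \<le> schwartz_weight m f n + schwartz_weight m g n"
      using schwartz_weight_ge[OF \<open>l \<le> m\<close>, of n] by (simp add: distrib_left add_mono)
    also have "\<dots> \<le> schwartz_seminorm m f + schwartz_seminorm m g"
      using assms by (intro add_mono schwartz_weight_le_seminorm)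
    finally show "wt n ^ m * norm ((laplacian ^^ l) (\<lambda>n. f n + g n) n) \<le> schwartz_seminorm m f + schwartz_seminorm m g" .
  qed
qed

lemma schwartz_seminorm_mono:
  assumes "f \<in> schwartz" "m \<le> M"
  shows "schwartz_seminorm m f \<le> schwartz_seminorm M f"
proof (rule schwartz_seminorm_least)
  fix n
  show "schwartz_weight m f n \<le> schwartz_seminorm M f"
    unfolding schwartz_weight_le_iff
  proof (intro allI impI)
    fix l assume l: "l \<le> m"
    have "wt n ^ m * norm ((laplacian ^^ l) f n) \<le> wt n ^ M * norm ((laplacian ^^ l) f n)"
      using assms by (intro mult_right_mono power_increasing) auto
    also have "\<dots> \<le> schwartz_weight M f n" using l assms by (intro schwartz_weight_ge) auto
    finally show "wt n ^ m * norm ((laplacian ^^ l) f n) \<le> schwartz_seminorm M f"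
      using schwartz_weight_le_seminorm[OF assms(1), of M n] by linarith
  qed
qed

lemma schwartz_seminorm_zero: "schwartz_seminorm m (\<lambda>n. 0) = 0"
proof -
  have "schwartz_weight m (\<lambda>n. 0) n = 0" for n
    by (simp add: schwartz_weight_def laplacian_power_zero)
  then show ?thesis by (simp add: schwartz_seminorm_def)
qed

text \<open>Each ball of one seminorm is a subbasic open set, so an epsilon-delta estimate in a
  single seminorm suffices. The hypothesis \<open>zero\<close> puts the centre into its own
  ball.\<close>

lemma continuous_map_seminorm_topologyI:
  fixes L :: "(int \<Rightarrow> complex) \<Rightarrow> complex"
  assumes zero: "\<And>p. p \<in> P \<Longrightarrow> p (\<lambda>n. 0) = 0"
    and cont: "\<And>f e. f \<in> X \<Longrightarrow> 0 < e \<Longrightarrow> \<exists>p\<in>P. \<exists>d>0. \<forall>g\<in>X. p (\<lambda>n. g n - f n) < d \<longrightarrow> dist (L g) (L f) < e"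
  shows "continuous_map (seminorm_topology X P) euclidean L"
  unfolding continuous_map
proof (intro conjI allI impI)
  define S where "S = {{g \<in> X. p (\<lambda>n. g n - f n) < e} | f p e. f \<in> X \<and> p \<in> P \<and> (e::real) > 0}"
  have top: "topspace (seminorm_topology X P) = \<Union>S"
    by (simp add: seminorm_topology_def S_def[symmetric])
  fix U :: "complex set" assume U: "openin euclidean U"
  let ?V = "{x \<in> topspace (seminorm_topology X P). L x \<in> U}"
  have "\<exists>B\<in>S. x \<in> B \<and> B \<subseteq> ?V" if "x \<in> ?V" for x
  proof -
    have x: "x \<in> X" using that unfolding top S_def by auto
    have "open U" "L x \<in> U" using U that by auto
    then obtain e where e: "0 < e" "ball (L x) e \<subseteq> U" by (rule openE)
    obtain p d where p: "p \<in> P" "d > 0" "\<forall>g\<in>X. p (\<lambda>n. g n - x n) < d \<longrightarrow> dist (L g) (L x) < e"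
      using cont[OF x e(1)] by blast
    define B where "B = {g \<in> X. p (\<lambda>n. g n - x n) < d}"
    have B: "B \<in> S" unfolding S_def B_def using p x by blast
    moreover have "x \<in> B" using p(2) x zero[OF p(1)] by (simp add: B_def)
    moreover have "B \<subseteq> ?V"
    proof
      fix g assume g: "g \<in> B"
      then have "dist (L g) (L x) < e" using p by (simp add: B_def)
      then have "L g \<in> U" using e by (auto simp: dist_commute)
      then show "g \<in> ?V" using g B unfolding top by blast
    qed
    ultimately show ?thesis by blast
  qed
  then have V: "?V = \<Union>{B \<in> S. B \<subseteq> ?V}" by blast
  have "openin (seminorm_topology X P) (\<Union>{B \<in> S. B \<subseteq> ?V})"
    by (rule openin_Union)
       (auto simp: seminorm_topology_def S_def[symmetric] intro: topology_generated_by_Basis)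
  then show "openin (seminorm_topology X P) ?V" using V by simp
qed auto

text \<open>The seminorms increase with their index, so a finite intersection of subbasic sets still
  contains a ball of one seminorm. A ball that is not centred at 0 is treated by the triangle
  inequality.\<close>

lemma schwartz_topology_nbhd_zero:
  assumes "generate_topology_on {{g \<in> schwartz. p (\<lambda>n. g n - f n) < e} | f p e.
      f \<in> schwartz \<and> p \<in> range schwartz_seminorm \<and> (e::real) > 0} V"
    and "(\<lambda>n. 0) \<in> V"
  shows "\<exists>M e. 0 < e \<and> {g \<in> schwartz. schwartz_seminorm M g < e} \<subseteq> V"
  using assms
proof (induction rule: generate_topology_on.induct)
  case Empty
  then show ?case by simp
next
  case (Int a b)
  then obtain M e N d where M: "0 < e" "{g \<in> schwartz. schwartz_seminorm M g < e} \<subseteq> a"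
     and N: "0 < d" "{g \<in> schwartz. schwartz_seminorm N g < d} \<subseteq> b"
    by blast
  have "{g \<in> schwartz. schwartz_seminorm (max M N) g < min e d} \<subseteq> a \<inter> b"
  proof
    fix g assume g: "g \<in> {g \<in> schwartz. schwartz_seminorm (max M N) g < min e d}"
    then have "schwartz_seminorm M g < e" "schwartz_seminorm N g < d"
      using schwartz_seminorm_mono[of g M "max M N"] schwartz_seminorm_mono[of g N "max M N"] by auto
    then show "g \<in> a \<inter> b" using g M N by auto
  qed
  moreover have "0 < min e d" using M N by simp
  ultimately show ?case by blast
next
  case (UN K)
  then obtain k where k: "k \<in> K" "(\<lambda>n. 0) \<in> k" by blast
  then obtain M e where "0 < e" "{g \<in> schwartz. schwartz_seminorm M g < e} \<subseteq> k"
    using UN by blast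
  then show ?case using k by (intro exI[of _ M] exI[of _ e]) auto
next
  case (Basis s)
  then obtain f m e where s: "s = {g \<in> schwartz. schwartz_seminorm m (\<lambda>n. g n - f n) < e}"
    and f: "f \<in> schwartz" and e: "0 < e"
    by blast
  define c where "c = schwartz_seminorm m (\<lambda>n. - 1 * f n)"
  have c: "c < e" using Basis(2) by (simp add: s c_def)
  have "{g \<in> schwartz. schwartz_seminorm m g < e - c} \<subseteq> s"
  proof
    fix g assume g: "g \<in> {g \<in> schwartz. schwartz_seminorm m g < e - c}"
    then have "schwartz_seminorm m (\<lambda>n. g n + - 1 * f n) \<le> schwartz_seminorm m g + c"
      unfolding c_def by (intro schwartz_seminorm_add schwartz_cmult f) auto
    then show "g \<in> s" using g by (simp add: s)
  qed
  moreover have "0 < e - c" using c by simp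
  ultimately show ?case by blast
qed

lemma has_sum_int_tendsto:
  assumes "(f has_sum S) (UNIV :: int set)"
  shows "(\<lambda>R. \<Sum>n\<in>{- int R..int R}. f n) \<longlonglongrightarrow> S"
proof -
  have "filterlim (\<lambda>R. {- int R..int R}) (finite_subsets_at_top UNIV) sequentially"
    unfolding filterlim_finite_subsets_at_top
  proof (intro allI impI)
    fix X :: "int set" assume X: "finite X \<and> X \<subseteq> UNIV"
    have "X \<subseteq> {- int R..int R}" if "R \<ge> nat (\<Sum>x\<in>X. \<bar>x\<bar>)" for R
    proof
      fix x assume "x \<in> X"
      then have "\<bar>x\<bar> \<le> (\<Sum>x\<in>X. \<bar>x\<bar>)" using X by (intro member_le_sum) auto
      then show "x \<in> {- int R..int R}" using that by auto
    qed
    then show "\<forall>\<^sub>F y in sequentially. finite {- int y..int y} \<and> X \<subseteq> {- int y..int y} \<and> {- int y..int y} \<subseteq> UNIV"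
      unfolding eventually_sequentially by auto
  qed
  with assms show ?thesis
    unfolding has_sum_def by (rule filterlim_compose)
qed

section \<open>Tempered functionals as sequences of polynomial growth\<close>

definition unit_mass :: "int \<Rightarrow> int \<Rightarrow> complex" where
  "unit_mass n = (\<lambda>m. if m = n then 1 else 0)"

lemma rapid_finite_support:
  assumes "finite {n. f n \<noteq> 0}"
  shows "rapid f"
proof (rule rapidI)
  fix m
  have "norm (f n) \<le> (\<Sum>k\<in>{n. f n \<noteq> 0}. wt k ^ m * norm (f k)) / wt n ^ m" for n
  proof (cases "f n = 0")
    case False
    then have "wt n ^ m * norm (f n) \<le> (\<Sum>k\<in>{n. f n \<noteq> 0}. wt k ^ m * norm (f k))"
      using assms by (intro member_le_sum) auto
    then show ?thesis by (simp add: pos_le_divide_eq mult.commute)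
  qed (auto intro!: divide_nonneg_pos sum_nonneg)
  then show "\<exists>C. \<forall>n. norm (f n) \<le> C / wt n ^ m" by blast
qed

lemma unit_mass_schwartz: "unit_mass n \<in> schwartz"
  unfolding schwartz_iff_rapid by (rule rapid_finite_support) (simp add: unit_mass_def)

lemma infsum_unit_mass: "(\<Sum>\<^sub>\<infinity>m. u m * unit_mass n m) = u n"
proof -
  have "(\<Sum>\<^sub>\<infinity>m. u m * unit_mass n m) = (\<Sum>\<^sub>\<infinity>m\<in>{n}. u m * unit_mass n m)"
    by (rule infsum_cong_neutral) (auto simp: unit_mass_def)
  then show ?thesis by (simp add: unit_mass_def)
qed

lemma to_seq_of_seq: "to_seq (of_seq u) = u"
proof
  fix n
  show "to_seq (of_seq u) n = u n"
    using unit_mass_schwartz[of n] infsum_unit_mass[of u n]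
    by (simp add: to_seq_def of_seq_def unit_mass_def)
qed

lemma pairing_bound:
  assumes "pgrow u"
  shows "\<exists>M K. \<forall>g B. (\<forall>n. wt n ^ M * norm (g n) \<le> B) \<longrightarrow> norm (\<Sum>\<^sub>\<infinity>n. u n * g n) \<le> K * B"
proof -
  obtain N C where C: "0 \<le> C" "\<And>n. norm (u n) \<le> C * wt n ^ N" using assms by (metis pgrowE)
  have "norm (\<Sum>\<^sub>\<infinity>n. u n * g n) \<le> (C * wt_sum) * B" if g: "\<forall>n. wt n ^ (N + 2) * norm (g n) \<le> B" for g B
  proof -
    have "norm (u n * g n) \<le> (C * B) / wt n ^ 2" for n
    proof -
      have "norm (g n) \<le> B / wt n ^ (N + 2)"
        using g[rule_format, of n] by (simp add: pos_le_divide_eq mult.commute del: power_Suc)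
      then have "norm (u n * g n) \<le> (C * wt n ^ N) * (B / wt n ^ (N + 2))"
        unfolding norm_mult using C by (intro mult_mono) auto
      then show ?thesis by (simp add: power_add numeral_eq_Suc field_simps)
    qed
    from norm_infsum_wt_le[OF this] show ?thesis by (simp add: mult_ac)
  qed
  then show ?thesis by (intro exI[of _ "N + 2"] exI[of _ "C * wt_sum"] allI impI)
qed

lemma pairing_add:
  assumes "pgrow u" "rapid f" "rapid g"
  shows "(\<Sum>\<^sub>\<infinity>n. u n * (f n + g n)) = (\<Sum>\<^sub>\<infinity>n. u n * f n) + (\<Sum>\<^sub>\<infinity>n. u n * g n)"
  using assms by (simp add: distrib_left infsum_add pairing_summable')

lemma pairing_cmult: "(\<Sum>\<^sub>\<infinity>n. u n * (c * f n)) = c * (\<Sum>\<^sub>\<infinity>n. u n * f n :: complex)"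
  by (subst infsum_cmult_right'[symmetric]) (simp add: mult_ac)

lemma pairing_diff:
  assumes "pgrow u" "rapid f" "rapid g"
  shows "(\<Sum>\<^sub>\<infinity>n. u n * (f n - g n)) = (\<Sum>\<^sub>\<infinity>n. u n * f n) - (\<Sum>\<^sub>\<infinity>n. u n * g n)"
  using pairing_add[OF assms(1,2) rapid_cmult[OF assms(3)], of "-1"] pairing_cmult[of u "-1" g] by simp

lemma of_seq_tempered:
  assumes u: "pgrow u"
  shows "of_seq u \<in> tempered"
proof -
  obtain M K where K: "\<And>g B. (\<forall>n. wt n ^ M * norm (g n) \<le> B) \<Longrightarrow> norm (\<Sum>\<^sub>\<infinity>n. u n * g n) \<le> K * B"
    using pairing_bound[OF u] by blast
  have cont: "continuous_map (seminorm_topology schwartz (range schwartz_seminorm)) euclidean (of_seq u)"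
  proof (rule continuous_map_seminorm_topologyI)
    fix f and e :: real assume f: "f \<in> schwartz" and e: "0 < e"
    have "dist (of_seq u g) (of_seq u f) < e"
      if g: "g \<in> schwartz" and lt: "schwartz_seminorm M (\<lambda>n. g n - f n) < e / (\<bar>K\<bar> + 1)" for g
    proof -
      have d: "(\<lambda>n. g n - f n) \<in> schwartz" using f g by (rule schwartz_diff[rotated])
      have "dist (of_seq u g) (of_seq u f) = norm (\<Sum>\<^sub>\<infinity>n. u n * (g n - f n))"
        using f g u by (simp add: of_seq_def dist_norm pairing_diff schwartz_iff_rapid)
      also have "\<dots> \<le> K * schwartz_seminorm M (\<lambda>n. g n - f n)"
        by (rule K) (use norm_le_schwartz_seminorm[OF d] in blast)
      also have "\<dots> \<le> (\<bar>K\<bar> + 1) * schwartz_seminorm M (\<lambda>n. g n - f n)"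
        using order_trans[OF _ norm_le_schwartz_seminorm[OF d, of 0 M]] by (intro mult_right_mono) auto
      also have "\<dots> < e" using lt by (simp add: pos_less_divide_eq mult.commute)
      finally show ?thesis .
    qed
    moreover have "0 < e / (\<bar>K\<bar> + 1)" using e by simp
    ultimately show "\<exists>p\<in>range schwartz_seminorm. \<exists>d>0. \<forall>g\<in>schwartz. p (\<lambda>n. g n - f n) < d \<longrightarrow> dist (of_seq u g) (of_seq u f) < e"
      by (intro bexI[of _ "schwartz_seminorm M"] exI[of _ "e / (\<bar>K\<bar> + 1)"]) auto
  qed (auto simp: schwartz_seminorm_zero)
  show ?thesis
    unfolding tempered_def continuous_dual_def
    using cont u
    by (auto simp: of_seq_def schwartz_add schwartz_cmult pairing_add pairing_cmult schwartz_iff_rapid rapid_add rapid_cmult)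
qed

text \<open>A continuous functional is dominated by one seminorm: any test function can be scaled
  into a ball on which the functional is smaller than 1.\<close>

lemma tempered_bound:
  assumes L: "L \<in> tempered"
  shows "\<exists>M K. 0 \<le> K \<and> (\<forall>g\<in>schwartz. \<forall>B\<ge>0. (\<forall>n. wt n ^ M * norm (g n) \<le> B) \<longrightarrow> norm (L g) \<le> K * B)"
proof -
  have mult: "L (\<lambda>n. c * f n) = c * L f" if "f \<in> schwartz" for c f
    using L that by (simp add: tempered_def continuous_dual_def)
  have L0: "L (\<lambda>n. 0) = 0" using mult[OF schwartz_zero, of 0] by simp
  define T where "T = seminorm_topology schwartz (range schwartz_seminorm)"
  have cont: "continuous_map T euclidean L" using L by (simp add: tempered_def continuous_dual_def T_def)
  define V where "V = {x \<in> topspace T. L x \<in> ball 0 1}"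
  have V: "openin T V"
    unfolding V_def by (rule openin_continuous_map_preimage[OF cont]) simp
  have "(\<lambda>n. 0) \<in> {g \<in> schwartz. schwartz_seminorm 0 (\<lambda>n. g n - (\<lambda>n. 0) n) < 1}"
    by (simp add: schwartz_zero schwartz_seminorm_zero)
  moreover have "{g \<in> schwartz. schwartz_seminorm 0 (\<lambda>n. g n - (\<lambda>n. 0) n) < 1} \<in>
     {{g \<in> schwartz. p (\<lambda>n. g n - f n) < e} | f p e. f \<in> schwartz \<and> p \<in> range schwartz_seminorm \<and> (e::real) > 0}"
    by (intro CollectI exI[of _ "\<lambda>n. 0"] exI[of _ "schwartz_seminorm 0"] exI[of _ 1])
       (simp add: schwartz_zero)
  ultimately have "(\<lambda>n. 0) \<in> topspace T"
    unfolding T_def seminorm_topology_def topology_generated_by_topspace by (rule UnionI[rotated])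
  then have "(\<lambda>n. 0) \<in> V" by (simp add: V_def L0)
  have "generate_topology_on {{g \<in> schwartz. p (\<lambda>n. g n - f n) < e} | f p e.
      f \<in> schwartz \<and> p \<in> range schwartz_seminorm \<and> (e::real) > 0} V"
    using V unfolding T_def seminorm_topology_def openin_topology_generated_by_iff .
  then have "\<exists>M e. 0 < e \<and> {g \<in> schwartz. schwartz_seminorm M g < e} \<subseteq> V"
    using \<open>(\<lambda>n. 0) \<in> V\<close> by (rule schwartz_topology_nbhd_zero)
  then obtain M e where e: "0 < e" "{g \<in> schwartz. schwartz_seminorm M g < e} \<subseteq> V"
    by (elim exE conjE)
  define Q where "Q = ((4 * 2 ^ M) ^ M :: real)"
  have Q: "0 < Q" by (simp add: Q_def)
  have "norm (L g) \<le> (2 * Q / e) * B"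
    if g: "g \<in> schwartz" and B: "0 \<le> B" "\<forall>n. wt n ^ M * norm (g n) \<le> B" for g B
  proof (cases "B = 0")
    case True
    then have z: "wt n ^ M * norm (g n) \<le> 0" for n using B by simp
    have "g n = 0" for n
      using z[of n] wt_power_pos[of n M] by (simp add: mult_le_0_iff)
    then have "g = (\<lambda>n. 0)" by blast
    then show ?thesis using L0 True by simp
  next
    case False
    then have Bp: "0 < B" using B by simp
    \<comment> \<open>With this factor the seminorm of the scaled function is at most
      \<open>Q * (c * B) = e / 2\<close>, inside the ball. The division by \<open>B\<close> is why
      \<open>B = 0\<close> is treated separately.\<close>
    define c where "c = e / (2 * Q * B)"
    have c: "0 < c" using e Q Bp by (simp add: c_def)
    have "schwartz_seminorm M (\<lambda>n. of_real c * g n) \<le> Q * (c * B)"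
      unfolding Q_def
    proof (rule schwartz_seminorm_le)
      fix n
      have "c * (wt n ^ M * norm (g n)) \<le> c * B" using B c by (intro mult_left_mono) auto
      then show "wt n ^ M * norm (of_real c * g n) \<le> c * B" using c by (simp add: norm_mult mult_ac)
    qed
    also have "Q * (c * B) = e / 2" using Q Bp by (simp add: c_def)
    also have "\<dots> < e" using e by simp
    finally have "schwartz_seminorm M (\<lambda>n. of_real c * g n) < e" .
    then have "(\<lambda>n. of_real c * g n) \<in> V"
      by (intro subsetD[OF e(2)]) (simp add: schwartz_cmult g)
    then have "norm (of_real c * L g) < 1" using mult[OF g] by (simp add: V_def)
    then have "c * norm (L g) < 1" using c by (simp add: norm_mult)
    then have "norm (L g) < 1 / c" using c by (simp add: field_simps)
    then show ?thesis by (simp add: c_def mult_ac)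
  qed
  moreover have "0 \<le> 2 * Q / e" using Q e by simp
  ultimately show ?thesis by (intro exI[of _ M] exI[of _ "2 * Q / e"] conjI ballI allI impI)
qed

text \<open>Finite truncations of a test function converge to it in the weighted norm that bounds
  \<open>L\<close>, so \<open>L\<close> is determined by its values at unit masses. The same bound
  applied to unit masses gives the polynomial growth.\<close>

lemma tempered_eq_of_seq:
  assumes L: "L \<in> tempered"
  shows "pgrow (to_seq L)" and "L = of_seq (to_seq L)"
proof -
  obtain M K where K: "0 \<le> K" "\<And>g B. g \<in> schwartz \<Longrightarrow> 0 \<le> B \<Longrightarrow> (\<forall>n. wt n ^ M * norm (g n) \<le> B) \<Longrightarrow> norm (L g) \<le> K * B"
    using tempered_bound[OF L] by blast
  have add: "L (\<lambda>n. f n + g n) = L f + L g" if "f \<in> schwartz" "g \<in> schwartz" for f g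
    using L that by (simp add: tempered_def continuous_dual_def)
  have mult: "L (\<lambda>n. c * f n) = c * L f" if "f \<in> schwartz" for c f
    using L that by (simp add: tempered_def continuous_dual_def)
  have L0: "L (\<lambda>n. 0) = 0" using mult[OF schwartz_zero, of 0] by simp
  have u: "to_seq L n = L (unit_mass n)" for n by (simp add: to_seq_def unit_mass_def)
  have "norm (to_seq L n) \<le> K * wt n ^ M" for n
    unfolding u by (rule K(2)[OF unit_mass_schwartz]) (auto simp: unit_mass_def)
  then show pg: "pgrow (to_seq L)" by (rule pgrowI)
  show "L = of_seq (to_seq L)"
  proof (rule extensionalityI)
    show "L \<in> extensional schwartz" using L by (simp add: tempered_def continuous_dual_def)
    show "of_seq (to_seq L) \<in> extensional schwartz" by (simp add: of_seq_def)
    fix g assume g: "g \<in> schwartz"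
    define h where "h R = (\<lambda>n. if n \<in> {- int R..int R} then g n else 0)" for R
    have hs: "h R \<in> schwartz" for R
      unfolding schwartz_iff_rapid
      by (rule rapid_finite_support) (auto simp: h_def intro: finite_subset[of _ "{- int R..int R}"])
    have fin: "L (\<lambda>n. if n \<in> F then g n else 0) = (\<Sum>n\<in>F. to_seq L n * g n)
        \<and> (\<lambda>n. if n \<in> F then g n else 0) \<in> schwartz" if "finite F" for F
      using that
    proof (induction F)
      case empty
      then show ?case by (simp add: L0 schwartz_zero)
    next
      case (insert k F)
      have eq: "(\<lambda>n. if n \<in> insert k F then g n else 0) = (\<lambda>n. g k * unit_mass k n + (if n \<in> F then g n else 0))"
        using insert by (auto simp: unit_mass_def fun_eq_iff)
      have m: "(\<lambda>n. g k * unit_mass k n) \<in> schwartz"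
        by (rule schwartz_cmult) (rule unit_mass_schwartz)
      have F: "(\<lambda>n. if n \<in> F then g n else 0) \<in> schwartz"
        "L (\<lambda>n. if n \<in> F then g n else 0) = (\<Sum>n\<in>F. to_seq L n * g n)"
        using insert.IH by (rule conjunct2, rule conjunct1)
      have "L (\<lambda>n. g k * unit_mass k n + (if n \<in> F then g n else 0)) = g k * to_seq L k + (\<Sum>n\<in>F. to_seq L n * g n)"
        unfolding add[OF m F(1)] mult[OF unit_mass_schwartz] F(2) u ..
      then show ?case
        unfolding eq using insert.hyps schwartz_add[OF m F(1)] by (auto simp: mult.commute)
    qed
    have lim1: "(\<lambda>R. L (h R)) \<longlonglongrightarrow> of_seq (to_seq L) g"
    proof -
      have "L (h R) = (\<Sum>n\<in>{- int R..int R}. to_seq L n * g n)" for R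
        unfolding h_def by (rule conjunct1[OF fin]) simp
      then have eq: "(\<lambda>R. L (h R)) = (\<lambda>R. \<Sum>n\<in>{- int R..int R}. to_seq L n * g n)"
        by (rule ext)
      have "((\<lambda>n. to_seq L n * g n) has_sum of_seq (to_seq L) g) UNIV"
        using pairing_summable'[OF pg, of g] g by (simp add: of_seq_def schwartz_iff_rapid)
      from has_sum_int_tendsto[OF this] show ?thesis unfolding eq .
    qed
    have "rapid g" using g by (simp add: schwartz_iff_rapid)
    \<comment> \<open>One power of decay beyond the weight \<open>M\<close> of the bound: outside
      the window it yields the factor \<open>inverse (real (Suc R))\<close> that sends the
      truncation error to 0.\<close>
    then obtain C where C: "0 \<le> C" "\<And>n. norm (g n) \<le> C / wt n ^ Suc M"
      by (metis rapidE)
    have diff: "norm (L (h R) - L g) \<le> K * (C * inverse (real (Suc R)))" for R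
    proof -
      have "L (\<lambda>n. h R n + - 1 * g n) = L (h R) + - 1 * L g"
        unfolding add[OF hs schwartz_cmult[OF g]] mult[OF g] ..
      moreover have "norm (L (\<lambda>n. h R n + - 1 * g n)) \<le> K * (C * inverse (real (Suc R)))"
      proof (rule K(2))
        show "(\<lambda>n. h R n + - 1 * g n) \<in> schwartz" using g hs by (intro schwartz_add schwartz_cmult)
        show "\<forall>n. wt n ^ M * norm (h R n + - 1 * g n) \<le> C * inverse (real (Suc R))"
        proof
          fix n
          show "wt n ^ M * norm (h R n + - 1 * g n) \<le> C * inverse (real (Suc R))"
          proof (cases "n \<in> {- int R..int R}")
            case True
            then have "h R n = g n" unfolding h_def by (rule if_P)
            then show ?thesis using C(1) by simp
          next
            case False
            then have "int R < \<bar>n\<bar>" by auto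
            then have "real (Suc R) \<le> wt n" unfolding wt_def by linarith
            have "wt n ^ M * norm (g n) \<le> wt n ^ M * (C / wt n ^ Suc M)"
              using C by (intro mult_left_mono) auto
            also have "\<dots> = C * inverse (wt n)" by (simp add: field_simps)
            also have "\<dots> \<le> C * inverse (real (Suc R))"
              using C \<open>real (Suc R) \<le> wt n\<close> by (intro mult_left_mono le_imp_inverse_le) auto
            finally have "wt n ^ M * norm (g n) \<le> C * inverse (real (Suc R))" .
            moreover have "h R n = 0" unfolding h_def using False by (rule if_not_P)
            ultimately show ?thesis by simp
          qed
        qed
      qed (use C in auto)
      ultimately show ?thesis by simp
    qed
    have "(\<lambda>R. K * (C * inverse (real (Suc R)))) \<longlonglongrightarrow> K * (C * 0)"
      by (rule tendsto_mult[OF tendsto_const tendsto_mult[OF tendsto_const LIMSEQ_inverse_real_of_nat]])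
    then have lim0: "(\<lambda>R. K * (C * inverse (real (Suc R)))) \<longlonglongrightarrow> 0"
      by simp
    have "(\<lambda>R. L (h R) - L g) \<longlonglongrightarrow> 0"
      by (rule Lim_null_comparison[OF _ lim0]) (rule always_eventually, rule allI, rule diff)
    then have "(\<lambda>R. L (h R)) \<longlonglongrightarrow> L g" by (simp add: LIM_zero_iff)
    from LIMSEQ_unique[OF this lim1] show "L g = of_seq (to_seq L) g" .
  qed
qed

text \<open>A power of the Laplacian that kills \<open>v\<close> can be split off from
  \<open>g\<close> and moved onto \<open>v\<close> by summation by parts.\<close>

lemma pairing_polynomial_schwartz_inf:
  assumes v: "v \<in> polynomials" and g: "g \<in> schwartz_inf"
  shows "(\<Sum>\<^sub>\<infinity>n. v n * g n) = 0"
proof -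
  obtain k where k: "(laplacian ^^ k) v = (\<lambda>n. 0)" using polynomials_laplacian_power[OF v] by blast
  obtain h where h: "h \<in> schwartz" "g = (laplacian ^^ k) h" using g by (auto simp: schwartz_inf_def)
  have "(\<Sum>\<^sub>\<infinity>n. v n * g n) = (\<Sum>\<^sub>\<infinity>n. (laplacian ^^ k) v n * h n)"
    unfolding h(2) using h v
    by (intro pairing_laplacian_power[symmetric] polynomials_pgrow) (simp_all add: schwartz_iff_rapid)
  then show ?thesis by (simp add: k)
qed

section \<open>Maximal and vector-valued inequalities\<close>

text \<open>Young's inequality termwise, after both factors are normalised by \<open>P'\<close> and
  \<open>Q'\<close>. If one of the two power sums vanishes, all terms on the left vanish.\<close>

lemma Holder_sum_weighted:
  fixes w a b :: "'i \<Rightarrow> real"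
  assumes I: "finite I"
    and w: "\<And>i. i \<in> I \<Longrightarrow> 0 \<le> w i" and a: "\<And>i. i \<in> I \<Longrightarrow> 0 \<le> a i" and b: "\<And>i. i \<in> I \<Longrightarrow> 0 \<le> b i"
    and pq: "1 < p" "1 < q" "1 / p + 1 / q = 1"
  shows "(\<Sum>i\<in>I. w i * (a i * b i)) \<le>
    (\<Sum>i\<in>I. w i * a i powr p) powr (1 / p) * (\<Sum>i\<in>I. w i * b i powr q) powr (1 / q)"
proof -
  define P where "P = (\<Sum>i\<in>I. w i * a i powr p)"
  define Q where "Q = (\<Sum>i\<in>I. w i * b i powr q)"
  have P0: "0 \<le> P" and Q0: "0 \<le> Q" unfolding P_def Q_def by (auto intro!: sum_nonneg mult_nonneg_nonneg w)
  show ?thesis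
  proof (cases "P = 0 \<or> Q = 0")
    case True
    have z: "w i * (a i * b i) = 0" if "i \<in> I" for i
    proof -
      from True show ?thesis
      proof
        assume "P = 0"
        then have "w i * a i powr p = 0"
          using that I w unfolding P_def by (subst (asm) sum_nonneg_eq_0_iff) auto
        then show ?thesis by auto
      next
        assume "Q = 0"
        then have "w i * b i powr q = 0"
          using that I w unfolding Q_def by (subst (asm) sum_nonneg_eq_0_iff) auto
        then show ?thesis by auto
      qed
    qed
    have "(\<Sum>i\<in>I. w i * (a i * b i)) = 0" by (rule sum.neutral) (use z in blast)
    then show ?thesis by simp
  next
    case False
    then have P: "0 < P" and Q: "0 < Q" using P0 Q0 by auto
    define P' where "P' = P powr (1 / p)"
    define Q' where "Q' = Q powr (1 / q)"
    have P': "0 < P'" "P' powr p = P" and Q': "0 < Q'" "Q' powr q = Q"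
      using P Q pq by (simp_all add: P'_def Q'_def powr_powr)
    have "w i * (a i * b i) \<le> P' * Q' * ((w i * a i powr p) / (p * P) + (w i * b i powr q) / (q * Q))" if i: "i \<in> I" for i
    proof -
      have "(a i / P') * (b i / Q') \<le> (a i / P') powr p / p + (b i / Q') powr q / q"
        using a[OF i] b[OF i] P' Q' pq by (intro Youngs_inequality) auto
      also have "\<dots> = a i powr p / (p * P) + b i powr q / (q * Q)"
        using a[OF i] b[OF i] P' Q' by (simp add: powr_divide mult.commute)
      finally have "a i * b i \<le> (P' * Q') * (a i powr p / (p * P) + b i powr q / (q * Q))"
        using P' Q' by (simp add: pos_divide_le_eq mult.commute)
      from mult_left_mono[OF this w[OF i]] show ?thesis
        by (simp add: algebra_simps)
    qed
    then have "(\<Sum>i\<in>I. w i * (a i * b i)) \<le>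
      (\<Sum>i\<in>I. P' * Q' * ((w i * a i powr p) / (p * P) + (w i * b i powr q) / (q * Q)))"
      by (rule sum_mono)
    also have "\<dots> = P' * Q' * (P / (p * P) + Q / (q * Q))"
      unfolding P_def Q_def by (simp add: sum_distrib_left[symmetric] sum.distrib sum_divide_distrib[symmetric])
    also have "\<dots> = P' * Q'" using P Q pq(3) by simp
    finally show ?thesis by (simp add: P_def Q_def P'_def Q'_def)
  qed
qed

lemma Holder_sum:
  fixes a b :: "'i \<Rightarrow> real"
  assumes "finite I" "\<And>i. i \<in> I \<Longrightarrow> 0 \<le> a i" "\<And>i. i \<in> I \<Longrightarrow> 0 \<le> b i"
    "1 < p" "1 < q" "1 / p + 1 / q = 1"
  shows "(\<Sum>i\<in>I. a i * b i) \<le> (\<Sum>i\<in>I. a i powr p) powr (1 / p) * (\<Sum>i\<in>I. b i powr q) powr (1 / q)"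
  using Holder_sum_weighted[of I "\<lambda>_. 1" a b p q] assms by simp

text \<open>Hoelder against the constant 1. The weights are only bounded in sum by \<open>B\<close>
  and not normalised, which produces the factor \<open>B powr (s - 1)\<close>.\<close>

lemma Jensen_sum_powr:
  fixes w x :: "'i \<Rightarrow> real"
  assumes I: "finite I"
    and w: "\<And>i. i \<in> I \<Longrightarrow> 0 \<le> w i" and x: "\<And>i. i \<in> I \<Longrightarrow> 0 \<le> x i"
    and B: "(\<Sum>i\<in>I. w i) \<le> B" and s: "1 \<le> s"
  shows "(\<Sum>i\<in>I. w i * x i) powr s \<le> B powr (s - 1) * (\<Sum>i\<in>I. w i * x i powr s)"
proof (cases "s = 1")
  case True
  have B0: "0 \<le> B" using B sum_nonneg[of I w] w by fastforce
  have nn: "0 \<le> (\<Sum>i\<in>I. w i * x i)" by (intro sum_nonneg mult_nonneg_nonneg w x)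
  have eq: "(\<Sum>i\<in>I. w i * x i powr 1) = (\<Sum>i\<in>I. w i * x i)" by (intro sum.cong) (auto simp: x)
  show ?thesis
  \<comment> \<open>\<open>0 powr 0\<close> is 0, so for \<open>B = 0\<close> the right-hand side
    vanishes and the weights must be shown to vanish too.\<close>
  proof (cases "B = 0")
    case True
    then have "(\<Sum>i\<in>I. w i) = 0" using B sum_nonneg[of I w] w by fastforce
    then have "\<forall>i\<in>I. w i = 0" using I w by (subst (asm) sum_nonneg_eq_0_iff) auto
    then show ?thesis by simp
  next
    case False
    then show ?thesis using B0 nn eq \<open>s = 1\<close> by simp
  qed
next
  case False
  then have s: "1 < s" using s by simp
  define s' where "s' = s / (s - 1)"
  have s': "1 < s'" "1 / s + 1 / s' = 1" "1 / s' * s = s - 1" using s by (auto simp: s'_def field_simps)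
  have P: "0 \<le> (\<Sum>i\<in>I. w i * x i powr s)" by (intro sum_nonneg mult_nonneg_nonneg w) auto
  have W: "0 \<le> (\<Sum>i\<in>I. w i)" by (intro sum_nonneg w)
  have "(\<Sum>i\<in>I. w i * x i) \<le> (\<Sum>i\<in>I. w i * x i powr s) powr (1 / s) * (\<Sum>i\<in>I. w i) powr (1 / s')"
    using Holder_sum_weighted[of I w x "\<lambda>_. 1" s s'] assms(1-3) s s' by simp
  then have "(\<Sum>i\<in>I. w i * x i) powr s \<le> ((\<Sum>i\<in>I. w i * x i powr s) powr (1 / s) * (\<Sum>i\<in>I. w i) powr (1 / s')) powr s"
    using s by (intro powr_mono2) (auto intro!: sum_nonneg mult_nonneg_nonneg w x)
  also have "\<dots> = (\<Sum>i\<in>I. w i * x i powr s) * (\<Sum>i\<in>I. w i) powr (s - 1)"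
    using s P W s'(3) by (simp add: powr_mult powr_powr)
  also have "\<dots> \<le> (\<Sum>i\<in>I. w i * x i powr s) * B powr (s - 1)"
    using P W B s by (intro mult_left_mono powr_mono2) auto
  finally show ?thesis by (simp add: mult.commute)
qed

text \<open>The end of a duality argument: a quantity bounded by a smaller power of itself. As a
  real number \<open>S\<close> is finite, so that power can be cancelled.\<close>

lemma powr_absorb:
  fixes S C T :: real
  assumes S: "0 \<le> S" and C: "0 \<le> C" and T: "0 \<le> T" and r: "0 < r"
    and le: "S \<le> C * T powr (1 / r) * S powr (1 - 1 / r)"
  shows "S \<le> C powr r * T"
proof (cases "S = 0")
  case True
  then show ?thesis using C T by simp
next
  case False
  then have S': "0 < S" using S by simp
  have "S powr (1 - 1 / r) * S powr (1 / r) = S" using S' by (simp add: powr_add[symmetric])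
  then have "S powr (1 - 1 / r) * S powr (1 / r) \<le> S powr (1 - 1 / r) * (C * T powr (1 / r))"
    using le by (simp add: mult_ac)
  then have "S powr (1 / r) \<le> C * T powr (1 / r)" using S' by simp
  then have "(S powr (1 / r)) powr r \<le> (C * T powr (1 / r)) powr r"
    using r by (intro powr_mono2) auto
  then show ?thesis using S' r C T by (simp add: powr_powr powr_mult)
qed

text \<open>The rising sun argument: \<open>excess g l n\<close> is the largest sum of \<open>g - l\<close> over an interval ending
  just before \<open>n\<close> (or \<open>0\<close>), and it increases only where the backward maximal function is at least \<open>l\<close>.
  Integrating the resulting inequality over \<open>l\<close> against \<open>l powr (s - 2)\<close> gives the strong maximal
  inequality without a covering lemma.\<close>

fun excess :: "(nat \<Rightarrow> real) \<Rightarrow> real \<Rightarrow> nat \<Rightarrow> real" where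
  "excess g l 0 = 0"
| "excess g l (Suc n) = max 0 (g n - l + excess g l n)"

lemma excess_nonneg: "0 \<le> excess g l n"
  by (cases n) auto

lemma excess_ge: "k \<le> n \<Longrightarrow> (\<Sum>i=k..<n. g i - l) \<le> excess g l n"
proof (induction n)
  case (Suc n)
  show ?case
  proof (cases "k \<le> n")
    case True
    then have "(\<Sum>i=k..<Suc n. g i - l) = (\<Sum>i=k..<n. g i - l) + (g n - l)" by simp
    with Suc.IH[OF True] show ?thesis by simp
  qed (use Suc in auto)
qed simp

lemma excess_attained: "\<exists>k\<le>n. excess g l n = (\<Sum>i=k..<n. g i - l)"
proof (induction n)
  case (Suc n)
  then obtain k where k: "k \<le> n" "excess g l n = (\<Sum>i=k..<n. g i - l)" by blast
  show ?case
  proof (cases "0 \<le> g n - l + excess g l n")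
    case True
    have "(\<Sum>i=k..<Suc n. g i - l) = (\<Sum>i=k..<n. g i - l) + (g n - l)" using k by simp
    with True k show ?thesis by (intro exI[of _ k]) simp
  next
    case False
    then show ?thesis by (intro exI[of _ "Suc n"]) simp
  qed
qed simp

section \<open>The one-sided maximal function\<close>

definition back_max :: "(nat \<Rightarrow> real) \<Rightarrow> nat \<Rightarrow> real" where
  "back_max g n = Max ((\<lambda>k. (\<Sum>i=k..n. g i) / real (Suc n - k)) ` {..n})"

lemma back_max_ge: "k \<le> n \<Longrightarrow> (\<Sum>i=k..n. g i) \<le> real (Suc n - k) * back_max g n"
proof -
  assume k: "k \<le> n"
  then have "(\<Sum>i=k..n. g i) / real (Suc n - k) \<le> back_max g n"
    unfolding back_max_def by (intro Max_ge) auto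
  then show ?thesis using k by (simp add: pos_divide_le_eq mult.commute)
qed

lemma back_max_attained: "\<exists>k\<le>n. (\<Sum>i=k..n. g i) = real (Suc n - k) * back_max g n"
proof -
  have "back_max g n \<in> (\<lambda>k. (\<Sum>i=k..n. g i) / real (Suc n - k)) ` {..n}"
    unfolding back_max_def by (intro Max_in) auto
  then obtain k where "k \<le> n" "back_max g n = (\<Sum>i=k..n. g i) / real (Suc n - k)" by auto
  then show ?thesis by (intro exI[of _ k]) simp
qed

lemma back_max_nonneg: "(\<And>n. 0 \<le> g n) \<Longrightarrow> 0 \<le> back_max g n"
  using back_max_ge[of n n g] by (simp add: order_trans[of 0 "g n"])

text \<open>Both sides say that some interval ending at \<open>n\<close> has a nonnegative sum of
  \<open>g - l\<close>.\<close>

lemma excess_step_iff: "0 \<le> g n - l + excess g l n \<longleftrightarrow> l \<le> back_max g n"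
proof
  assume *: "0 \<le> g n - l + excess g l n"
  obtain k where k: "k \<le> n" "excess g l n = (\<Sum>i=k..<n. g i - l)" using excess_attained by blast
  have "(\<Sum>i=k..n. g i - l) = (\<Sum>i=k..<n. g i - l) + (g n - l)"
    using k(1) by (simp add: atLeastLessThanSuc_atLeastAtMost[symmetric])
  then have "0 \<le> (\<Sum>i=k..n. g i - l)" using * k by simp
  then have "real (Suc n - k) * l \<le> (\<Sum>i=k..n. g i)" by (simp add: sum_subtractf)
  also have "\<dots> \<le> real (Suc n - k) * back_max g n" by (rule back_max_ge) (rule k)
  finally show "l \<le> back_max g n" using k(1) by simp
next
  assume *: "l \<le> back_max g n"
  obtain k where k: "k \<le> n" "(\<Sum>i=k..n. g i) = real (Suc n - k) * back_max g n"
    using back_max_attained by blast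
  have "real (Suc n - k) * l \<le> (\<Sum>i=k..n. g i)" unfolding k(2) using * by (intro mult_left_mono) auto
  then have "0 \<le> (\<Sum>i=k..n. g i - l)" by (simp add: sum_subtractf)
  also have "(\<Sum>i=k..n. g i - l) = (\<Sum>i=k..<n. g i - l) + (g n - l)"
    using k(1) by (simp add: atLeastLessThanSuc_atLeastAtMost[symmetric])
  finally show "0 \<le> g n - l + excess g l n" using excess_ge[OF k(1), of g l] by simp
qed

text \<open>The excess starts at 0, stays nonnegative, and telescopes. Where \<open>l\<close>
  exceeds the maximal function it is reset to 0, so such sites contribute nothing positive;
  elsewhere it changes by exactly \<open>g n - l\<close>.\<close>

lemma rising_sun: "0 \<le> (\<Sum>n<L. if l \<le> back_max g n then g n - l else 0)"
proof -
  have "0 \<le> excess g l L" by (rule excess_nonneg)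
  also have "\<dots> = (\<Sum>n<L. excess g l (Suc n) - excess g l n)"
    by (subst sum_lessThan_telescope) simp
  also have "\<dots> \<le> (\<Sum>n<L. if l \<le> back_max g n then g n - l else 0)"
  proof (rule sum_mono)
    fix n
    show "excess g l (Suc n) - excess g l n \<le> (if l \<le> back_max g n then g n - l else 0)"
      unfolding excess_step_iff[symmetric] using excess_nonneg[of g l n] by simp
  qed
  finally show ?thesis .
qed

lemma back_max_weighted:
  assumes g: "\<And>n. 0 \<le> g n" and s: "1 < s"
  shows "(\<Sum>n<L. back_max g n powr s) \<le> s / (s - 1) * (\<Sum>n<L. g n * back_max g n powr (s - 1))"
proof -
  define A where "A = back_max g"
  have A0: "0 \<le> A n" for n unfolding A_def by (rule back_max_nonneg) (rule g)
  \<comment> \<open>A common upper limit for the variable l, so that all sites are integrated over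
    the same interval.\<close>
  define T where "T = (\<Sum>n<L. A n)"
  have AT: "A n \<le> T" if "n < L" for n
    unfolding T_def using that A0 by (intro member_le_sum) auto
  \<comment> \<open>The term of site \<open>n\<close> in the rising sun inequality at level
    \<open>x\<close>, times \<open>x powr (s - 2)\<close>; the condition \<open>x \<le> A n\<close>
    has become the domain.\<close>
  define f where "f n x = (if x \<in> {0..A n} then g n * x powr (s - 2) - x powr (s - 1) else 0)" for n x
  have int: "(f n has_integral g n * (A n powr (s - 1) / (s - 1)) - A n powr s / s) {0..T}" if "n < L" for n
  proof -
    have i1: "((\<lambda>x. x powr (s - 2)) has_integral A n powr (s - 2 + 1) / (s - 2 + 1)) {0..A n}"
      using s A0 by (intro has_integral_powr_from_0) auto
    have i2: "((\<lambda>x. x powr (s - 1)) has_integral A n powr (s - 1 + 1) / (s - 1 + 1)) {0..A n}"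
      using s A0 by (intro has_integral_powr_from_0) auto
    have "((\<lambda>x. g n * x powr (s - 2) - x powr (s - 1)) has_integral
        g n * (A n powr (s - 1) / (s - 1)) - A n powr s / s) {0..A n}"
      using has_integral_diff[OF has_integral_mult_right[OF i1, of "g n"] i2] by (simp add: algebra_simps)
    moreover have "{0..A n} \<subseteq> {0..T}" using AT[OF that] by auto
    ultimately show ?thesis
      unfolding f_def by (subst has_integral_restrict)
  qed
  have "((\<lambda>x. \<Sum>n<L. f n x) has_integral (\<Sum>n<L. g n * (A n powr (s - 1) / (s - 1)) - A n powr s / s)) {0..T}"
    by (rule has_integral_sum) (use int in auto)
  then have "0 \<le> (\<Sum>n<L. g n * (A n powr (s - 1) / (s - 1)) - A n powr s / s)"
  proof (rule has_integral_nonneg)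
    fix x assume x: "x \<in> {0..T}"
    have "f n x = x powr (s - 2) * (if x \<le> back_max g n then g n - x else 0)" for n
    proof -
      have "x powr (s - 1) = x * x powr (s - 2)"
      proof (cases "x = 0")
        case False
        have "x powr (s - 1) = x powr (1 + (s - 2))" by (simp add: algebra_simps)
        also have "\<dots> = x powr 1 * x powr (s - 2)" by (rule powr_add)
        finally show ?thesis using x by simp
      qed simp
      then show ?thesis using x by (simp add: f_def A_def algebra_simps)
    qed
    then have "(\<Sum>n<L. f n x) = x powr (s - 2) * (\<Sum>n<L. if x \<le> back_max g n then g n - x else 0)"
      by (simp add: sum_distrib_left)
    then show "0 \<le> (\<Sum>n<L. f n x)" using rising_sun[where l = x and g = g and L = L] by simp
  qed
  also have "\<dots> = (\<Sum>n<L. g n * A n powr (s - 1)) / (s - 1) - (\<Sum>n<L. A n powr s) / s"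
    by (simp add: sum_subtractf sum_divide_distrib)
  finally show ?thesis using s unfolding A_def by (simp add: field_simps)
qed

text \<open>As in Doob's inequality: Hoelder with exponents \<open>s\<close> and
  \<open>s / (s - 1)\<close> on the weighted form reproduces the left-hand side to a smaller power,
  which is absorbed.\<close>

lemma back_max_strong:
  assumes g: "\<And>n. 0 \<le> g n" and s: "1 < s"
  shows "(\<Sum>n<L. back_max g n powr s) \<le> (s / (s - 1)) powr s * (\<Sum>n<L. g n powr s)"
proof (rule powr_absorb)
  have A0: "0 \<le> back_max g n" for n by (rule back_max_nonneg) (rule g)
  have "(\<Sum>n<L. g n * back_max g n powr (s - 1)) \<le>
     (\<Sum>n<L. g n powr s) powr (1 / s) * (\<Sum>n<L. (back_max g n powr (s - 1)) powr (s / (s - 1))) powr (1 / (s / (s - 1)))"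
    using s g by (intro Holder_sum) (auto simp: field_simps)
  also have "\<dots> = (\<Sum>n<L. g n powr s) powr (1 / s) * (\<Sum>n<L. back_max g n powr s) powr (1 - 1 / s)"
  proof -
    have "(s - 1) * (s / (s - 1)) = s" "1 / (s / (s - 1)) = 1 - 1 / s" using s by (auto simp: field_simps)
    then show ?thesis by (simp only: powr_powr)
  qed
  finally have "s / (s - 1) * (\<Sum>n<L. g n * back_max g n powr (s - 1)) \<le>
     s / (s - 1) * ((\<Sum>n<L. g n powr s) powr (1 / s) * (\<Sum>n<L. back_max g n powr s) powr (1 - 1 / s))"
    using s by (intro mult_left_mono) auto
  then show "(\<Sum>n<L. back_max g n powr s) \<le> s / (s - 1) * (\<Sum>n<L. g n powr s) powr (1 / s) * (\<Sum>n<L. back_max g n powr s) powr (1 - 1 / s)"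
    using back_max_weighted[where g = g and L = L, OF g s] by (simp add: mult.assoc)
qed (use s in \<open>auto intro!: sum_nonneg\<close>)

text \<open>Abel summation: a decreasing nonnegative kernel is a positive combination of initial
  segments, on each of which the average of \<open>h\<close> is at most \<open>M\<close>.\<close>

lemma antitone_kernel_average:
  fixes c h :: "nat \<Rightarrow> real"
  assumes c: "antimono c" "\<And>n. 0 \<le> c n" and h: "\<And>j. j \<le> J \<Longrightarrow> (\<Sum>i\<le>j. h i) \<le> real (Suc j) * M"
  shows "(\<Sum>i\<le>J. c i * h i) \<le> M * (\<Sum>i\<le>J. c i)"
proof -
  define G where "G j = (\<Sum>i\<le>j. h i - M)" for j
  have G: "G j \<le> 0" if "j \<le> J" for j using h[OF that] by (simp add: G_def sum_subtractf)
  have "(\<Sum>i\<le>j. c i * (h i - M)) \<le> c j * G j" if "j \<le> J" for j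
    using that
  proof (induction j)
    case 0
    then show ?case by (simp add: G_def)
  next
    case (Suc j)
    have "c (Suc j) \<le> c j" using c(1) by (simp add: antimono_def)
    then have "(c j - c (Suc j)) * G j \<le> 0" using G[of j] Suc.prems by (intro mult_nonneg_nonpos) auto
    moreover have "(\<Sum>i\<le>j. c i * (h i - M)) \<le> c j * G j" using Suc by simp
    ultimately show ?case by (simp add: G_def algebra_simps)
  qed
  from this[of J] have "(\<Sum>i\<le>J. c i * (h i - M)) \<le> c J * G J" by simp
  also have "\<dots> \<le> 0" using G[of J] c(2)[of J] by (simp add: mult_nonneg_nonpos)
  finally show ?thesis by (simp add: algebra_simps sum_subtractf sum_distrib_left sum_distrib_right)
qed

lemma back_average_le:
  fixes c g :: "nat \<Rightarrow> real"
  assumes g: "\<And>n. 0 \<le> g n" and c: "antimono c" "\<And>n. 0 \<le> c n" and B: "\<And>n. (\<Sum>j<n. c j) \<le> B"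
  shows "(\<Sum>k\<le>n. c (n - k) * g k) \<le> B * back_max g n"
proof -
  have "(\<Sum>k\<le>n. c (n - k) * g k) = (\<Sum>j\<le>n. c j * g (n - j))"
    by (subst sum.nat_diff_reindex[symmetric, where n = "Suc n", unfolded lessThan_Suc_atMost]) simp
  also have "\<dots> \<le> back_max g n * (\<Sum>j\<le>n. c j)"
  proof (rule antitone_kernel_average[OF c])
    fix j assume j: "j \<le> n"
    have "(\<Sum>i\<le>j. g (n - i)) = (\<Sum>i=n - j..n. g i)"
      by (rule sum.reindex_bij_witness[where i = "\<lambda>i. n - i" and j = "\<lambda>i. n - i"]) (use j in auto)
    also have "\<dots> \<le> real (Suc n - (n - j)) * back_max g n" by (rule back_max_ge) simp
    finally show "(\<Sum>i\<le>j. g (n - i)) \<le> real (Suc j) * back_max g n" using j by (simp add: Suc_diff_le)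
  qed
  also have "\<dots> \<le> back_max g n * B"
    using B[of "Suc n"] back_max_nonneg[OF g] by (intro mult_left_mono) (auto simp: lessThan_Suc_atMost)
  finally show ?thesis by (simp add: mult.commute)
qed

text \<open>\<open>2 powr s\<close> comes from splitting the power of a sum of two one-sided
  majorants, 2 counts them, \<open>B powr s\<close> is the kernel mass, and the rest is the constant
  of \<open>back_max_strong\<close>.\<close>

definition max_const :: "real \<Rightarrow> real \<Rightarrow> real" where
  "max_const B s = 2 powr s * (2 * (B powr s * (s / (s - 1)) powr s))"

lemma powr_add_le:
  fixes a b s :: real
  assumes "0 \<le> a" "0 \<le> b" "0 \<le> s"
  shows "(a + b) powr s \<le> 2 powr s * (a powr s + b powr s)"
proof -
  have "(a + b) powr s \<le> (2 * max a b) powr s" using assms by (intro powr_mono2) auto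
  also have "\<dots> = 2 powr s * max a b powr s" using assms by (simp add: powr_mult)
  also have "max a b powr s \<le> a powr s + b powr s" by (simp add: max_def)
  finally show ?thesis by simp
qed

text \<open>One majorant \<open>W\<close> serves all decreasing kernels of mass at most
  \<open>B\<close> on each side at once. This uniformity lets kernels of different scales be summed
  in the vector-valued inequality. The sum is cut at \<open>n\<close>, and its right half becomes a
  backward average of the reversed sequence \<open>h\<close>.\<close>

lemma maximal_inequality_nat:
  fixes g :: "nat \<Rightarrow> real"
  assumes g: "\<And>n. 0 \<le> g n" and s: "1 < s" and B: "0 \<le> B"
  shows "\<exists>W. (\<forall>n. 0 \<le> W n) \<and>
     (\<forall>c. antimono c \<longrightarrow> (\<forall>n. 0 \<le> c n) \<longrightarrow> (\<forall>n. (\<Sum>j<n. c j) \<le> B) \<longrightarrow>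
        (\<forall>n<L. (\<Sum>k<L. c (if k \<le> n then n - k else k - n) * g k) \<le> W n)) \<and>
     (\<Sum>n<L. W n powr s) \<le> max_const B s * (\<Sum>n<L. g n powr s)"
proof -
  define h where "h n = g (L - Suc n)" for n
  have h: "0 \<le> h n" for n using g by (simp add: h_def)
  define W where "W n = B * back_max g n + B * back_max h (L - Suc n)" for n
  have bg: "0 \<le> back_max g n" "0 \<le> back_max h n" for n by (rule back_max_nonneg, use g h in blast)+
  have W0: "0 \<le> W n" for n using bg B by (simp add: W_def)
  have le: "(\<Sum>k<L. c (if k \<le> n then n - k else k - n) * g k) \<le> W n"
    if c: "antimono c" "\<And>n. 0 \<le> c n" "\<And>n. (\<Sum>j<n. c j) \<le> B" and n: "n < L" for c n
  proof -
    have "(\<Sum>k<L. c (if k \<le> n then n - k else k - n) * g k) =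
        (\<Sum>k\<le>n. c (n - k) * g k) + (\<Sum>k\<in>{n<..<L}. c (k - n) * g k)"
    proof -
      have "{..<L} = {..n} \<union> {n<..<L}" using n by auto
      then have "(\<Sum>k<L. c (if k \<le> n then n - k else k - n) * g k) =
        (\<Sum>k\<le>n. c (if k \<le> n then n - k else k - n) * g k) + (\<Sum>k\<in>{n<..<L}. c (if k \<le> n then n - k else k - n) * g k)"
        by (simp add: sum.union_disjoint ivl_disj_int)
      then show ?thesis by simp
    qed
    \<comment> \<open>Including \<open>k = n\<close> a second time only enlarges the sum, and it
      makes the right half a full backward average.\<close>
    also have "(\<Sum>k\<in>{n<..<L}. c (k - n) * g k) \<le> (\<Sum>k\<in>{n..<L}. c (k - n) * g k)"
      using c g by (intro sum_mono2) auto
    also have "(\<Sum>k\<in>{n..<L}. c (k - n) * g k) = (\<Sum>k\<le>L - Suc n. c (L - Suc n - k) * h k)"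
      by (rule sum.reindex_bij_witness[where i = "\<lambda>k. L - Suc k" and j = "\<lambda>k. L - Suc k"])
         (use n in \<open>auto simp: h_def\<close>)
    also have "\<dots> \<le> B * back_max h (L - Suc n)" by (rule back_average_le[OF h c])
    also have "(\<Sum>k\<le>n. c (n - k) * g k) \<le> B * back_max g n" by (rule back_average_le[OF g c])
    finally show ?thesis by (simp add: W_def)
  qed
  have "(\<Sum>n<L. W n powr s) \<le> (\<Sum>n<L. 2 powr s * ((B * back_max g n) powr s + (B * back_max h (L - Suc n)) powr s))"
    unfolding W_def using s B bg by (intro sum_mono powr_add_le) auto
  also have "\<dots> = 2 powr s * (B powr s * (\<Sum>n<L. back_max g n powr s) + B powr s * (\<Sum>n<L. back_max h (L - Suc n) powr s))"
    using B bg by (simp add: powr_mult sum_distrib_left sum.distrib algebra_simps)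
  also have "(\<Sum>n<L. back_max h (L - Suc n) powr s) = (\<Sum>n<L. back_max h n powr s)"
    by (rule sum.nat_diff_reindex)
  also have "2 powr s * (B powr s * (\<Sum>n<L. back_max g n powr s) + B powr s * (\<Sum>n<L. back_max h n powr s))
     \<le> 2 powr s * (B powr s * ((s / (s - 1)) powr s * (\<Sum>n<L. g n powr s)) + B powr s * ((s / (s - 1)) powr s * (\<Sum>n<L. h n powr s)))"
    using back_max_strong[where g = g and L = L, OF g s] back_max_strong[where g = h and L = L, OF h s]
    by (intro mult_left_mono add_mono) auto
  also have "(\<Sum>n<L. h n powr s) = (\<Sum>n<L. g n powr s)"
    unfolding h_def by (rule sum.nat_diff_reindex)
  finally have "(\<Sum>n<L. W n powr s) \<le> max_const B s * (\<Sum>n<L. g n powr s)"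
    by (simp add: max_const_def algebra_simps)
  with W0 show ?thesis by (intro exI[of _ W] conjI allI impI le) blast+
qed

lemma sum_int_nat: "(\<Sum>n\<in>{- int R..int R}. f n) = (\<Sum>i<2 * R + 1. f (int i - int R))"
  by (rule sum.reindex_bij_witness[where i = "\<lambda>i. int i - int R" and j = "\<lambda>n. nat (n + int R)"]) auto

lemma maximal_inequality_int:
  fixes g :: "int \<Rightarrow> real"
  assumes g: "\<And>n. 0 \<le> g n" and s: "1 < s" and B: "0 \<le> B"
  shows "\<exists>W. (\<forall>n. 0 \<le> W n) \<and>
     (\<forall>c. antimono c \<longrightarrow> (\<forall>n. 0 \<le> c n) \<longrightarrow> (\<forall>n. (\<Sum>j<n. c j) \<le> B) \<longrightarrow>
        (\<forall>n\<in>{- int R..int R}. (\<Sum>k\<in>{- int R..int R}. c (nat \<bar>n - k\<bar>) * g k) \<le> W n)) \<and>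
     (\<Sum>n\<in>{- int R..int R}. W n powr s) \<le> max_const B s * (\<Sum>n\<in>{- int R..int R}. g n powr s)"
proof -
  define L where "L = 2 * R + 1"
  define g' where "g' i = g (int i - int R)" for i
  have g': "0 \<le> g' i" for i using g by (simp add: g'_def)
  obtain W where W: "\<And>n. 0 \<le> W n"
     "\<And>c n. antimono c \<Longrightarrow> (\<And>n. 0 \<le> c n) \<Longrightarrow> (\<And>n. (\<Sum>j<n. c j) \<le> B) \<Longrightarrow> n < L \<Longrightarrow>
         (\<Sum>k<L. c (if k \<le> n then n - k else k - n) * g' k) \<le> W n"
     "(\<Sum>n<L. W n powr s) \<le> max_const B s * (\<Sum>n<L. g' n powr s)"
    using maximal_inequality_nat[where g = g' and s = s and B = B and L = L, OF g' s B] by blast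
  define V where "V n = W (nat (n + int R))" for n
  have "(\<Sum>k\<in>{- int R..int R}. c (nat \<bar>n - k\<bar>) * g k) \<le> V n"
    if c: "antimono c" "\<And>n. 0 \<le> c n" "\<And>n. (\<Sum>j<n. c j) \<le> B" and n: "n \<in> {- int R..int R}" for c n
  proof -
    define m where "m = nat (n + int R)"
    have nm: "n = int m - int R" "m < L" using n by (auto simp: m_def L_def)
    have "(\<Sum>k\<in>{- int R..int R}. c (nat \<bar>n - k\<bar>) * g k) = (\<Sum>k<L. c (if k \<le> m then m - k else k - m) * g' k)"
      unfolding sum_int_nat L_def[symmetric] nm(1) g'_def
      by (intro sum.cong refl arg_cong2[where f = "(*)"] arg_cong[where f = c]) auto
    also have "\<dots> \<le> W m" by (rule W(2)[OF c nm(2)])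
    finally show ?thesis by (simp add: V_def m_def)
  qed
  moreover have "(\<Sum>n\<in>{- int R..int R}. V n powr s) \<le> max_const B s * (\<Sum>n\<in>{- int R..int R}. g n powr s)"
    using W(3) unfolding sum_int_nat V_def g'_def L_def by simp
  moreover have "0 \<le> V n" for n using W(1) by (simp add: V_def)
  ultimately show ?thesis by (intro exI[of _ V] conjI allI impI ballI) blast+
qed

text \<open>Duality against the maximal inequality for \<open>t > 1\<close>, Jensen for \<open>t = 1\<close>. For \<open>t < 1\<close>, Hoelder with
  the weight \<open>(\<Sum>v\<in>V. x v n powr s)\<close> to a suitable negative power reduces to the maximal inequality again.\<close>

lemma vector_valued_inequality:
  fixes K :: "'v \<Rightarrow> 'i \<Rightarrow> 'i \<Rightarrow> real" and C :: "real \<Rightarrow> real"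
  assumes I: "finite I" and V: "finite V"
    and K: "\<And>v n k. 0 \<le> K v n k" and sym: "\<And>v n k. K v n k = K v k n"
    and B: "\<And>v n. v \<in> V \<Longrightarrow> n \<in> I \<Longrightarrow> (\<Sum>k\<in>I. K v n k) \<le> B" "0 \<le> B"
    and C: "\<And>r. 1 < r \<Longrightarrow> 0 \<le> C r"
    and maximal: "\<And>g r. (\<And>n. 0 \<le> g n) \<Longrightarrow> 1 < r \<Longrightarrow> \<exists>W. (\<forall>n. 0 \<le> W n) \<and>
       (\<forall>v\<in>V. \<forall>n\<in>I. (\<Sum>k\<in>I. K v n k * g k) \<le> W n) \<and>
       (\<Sum>n\<in>I. W n powr r) \<le> C r * (\<Sum>n\<in>I. g n powr r)"
    and x: "\<And>v n. 0 \<le> x v n" and s: "1 < s" and t: "0 < t" and st: "1 < s * t"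
  defines "D \<equiv> (if t = 1 then B powr (s - 1) * B else if 1 < t
      then (B powr (s - 1) * C (t / (t - 1)) powr (1 - 1 / t)) powr t
      else B powr t * C ((s - 1) * t / (1 - t)) powr (1 - t))"
  shows "(\<Sum>n\<in>I. (\<Sum>v\<in>V. (\<Sum>k\<in>I. K v n k * x v k) powr s) powr t) \<le> D * (\<Sum>n\<in>I. (\<Sum>v\<in>V. x v n powr s) powr t)"
proof -
  define X where "X n = (\<Sum>v\<in>V. x v n powr s)" for n
  define Y where "Y n = (\<Sum>v\<in>V. (\<Sum>k\<in>I. K v n k * x v k) powr s)" for n
  have X0: "0 \<le> X n" and Y0: "0 \<le> Y n" for n by (auto simp: X_def Y_def intro!: sum_nonneg)
  have YX: "Y n \<le> B powr (s - 1) * (\<Sum>v\<in>V. \<Sum>k\<in>I. K v n k * x v k powr s)" if n: "n \<in> I" for n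
  proof -
    have "Y n \<le> (\<Sum>v\<in>V. B powr (s - 1) * (\<Sum>k\<in>I. K v n k * x v k powr s))"
      unfolding Y_def using I K x s B(1) n by (intro sum_mono Jensen_sum_powr) auto
    then show ?thesis by (simp add: sum_distrib_left)
  qed
  \<comment> \<open>By symmetry of \<open>K\<close> the averaging moves from one factor to the
    other, where the maximal majorant controls it.\<close>
  have swap: "(\<Sum>n\<in>I. y n * (\<Sum>v\<in>V. \<Sum>k\<in>I. K v n k * z v k)) = (\<Sum>v\<in>V. \<Sum>k\<in>I. z v k * (\<Sum>n\<in>I. K v k n * y n))"
    for y :: "'i \<Rightarrow> real" and z
  proof -
    have "(\<Sum>n\<in>I. y n * (\<Sum>v\<in>V. \<Sum>k\<in>I. K v n k * z v k)) = (\<Sum>n\<in>I. \<Sum>v\<in>V. \<Sum>k\<in>I. z v k * (K v k n * y n))"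
      by (simp add: sum_distrib_left mult_ac) (intro sum.cong refl arg_cong2[where f = "(*)"] sym)
    also have "\<dots> = (\<Sum>v\<in>V. \<Sum>n\<in>I. \<Sum>k\<in>I. z v k * (K v k n * y n))" by (rule sum.swap)
    also have "\<dots> = (\<Sum>v\<in>V. \<Sum>k\<in>I. \<Sum>n\<in>I. z v k * (K v k n * y n))"
      by (intro sum.cong refl sum.swap)
    finally show ?thesis by (simp add: sum_distrib_left)
  qed
  have goal: "(\<Sum>n\<in>I. Y n powr t) \<le> D * (\<Sum>n\<in>I. X n powr t)"
  proof -
    consider "t = 1" | "1 < t" | "t < 1" by linarith
    then show ?thesis
    proof cases
      case 1
      have "(\<Sum>n\<in>I. Y n) \<le> (\<Sum>n\<in>I. B powr (s - 1) * (\<Sum>v\<in>V. \<Sum>k\<in>I. K v n k * x v k powr s))"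
        by (rule sum_mono) (rule YX)
      also have "\<dots> = (\<Sum>v\<in>V. \<Sum>k\<in>I. x v k powr s * (\<Sum>n\<in>I. K v k n * B powr (s - 1)))"
        by (rule swap)
      also have "\<dots> \<le> (\<Sum>v\<in>V. \<Sum>k\<in>I. x v k powr s * (B powr (s - 1) * B))"
        using B by (intro sum_mono mult_left_mono) (auto simp: sum_distrib_right[symmetric] mult.commute[of "B powr (s - 1)" B] intro!: mult_right_mono)
      also have "\<dots> = (B powr (s - 1) * B) * (\<Sum>n\<in>I. X n)"
        unfolding X_def by (subst sum.swap) (simp add: sum_distrib_left mult_ac)
      finally show ?thesis using 1 X0 Y0 by (simp add: D_def)
    next
      case 2
      \<comment> \<open>The exponent dual to \<open>t\<close>. The maximal inequality for
        \<open>Y powr (t - 1)\<close> in this exponent gives back the sum of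
        \<open>Y powr t\<close>, which is what makes the absorption possible.\<close>
      define r where "r = t / (t - 1)"
      have r: "1 < r" "1 / t + 1 / r = 1" "(t - 1) * r = t" "1 / r = 1 - 1 / t"
        using 2 by (auto simp: r_def field_simps)
      have "0 \<le> Y n powr (t - 1)" for n by simp
      from maximal[where g = "\<lambda>n. Y n powr (t - 1)" and r = r, OF this r(1)] obtain W where W: "\<And>n. 0 \<le> W n"
        "\<And>v n. v \<in> V \<Longrightarrow> n \<in> I \<Longrightarrow> (\<Sum>k\<in>I. K v n k * Y k powr (t - 1)) \<le> W n"
        "(\<Sum>n\<in>I. W n powr r) \<le> C r * (\<Sum>n\<in>I. (Y n powr (t - 1)) powr r)" by blast
      define S where "S = (\<Sum>n\<in>I. Y n powr t)"
      define T where "T = (\<Sum>n\<in>I. X n powr t)"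
      have S0: "0 \<le> S" and T0: "0 \<le> T" by (auto simp: S_def T_def intro!: sum_nonneg)
      have "Y n powr t = Y n powr (t - 1) * Y n" for n
        using powr_mult_base[OF Y0[of n], of "t - 1"] by (simp add: mult.commute)
      then have "S = (\<Sum>n\<in>I. Y n powr (t - 1) * Y n)" by (simp add: S_def)
      also have "\<dots> \<le> (\<Sum>n\<in>I. Y n powr (t - 1) * (B powr (s - 1) * (\<Sum>v\<in>V. \<Sum>k\<in>I. K v n k * x v k powr s)))"
        by (intro sum_mono mult_left_mono YX) auto
      also have "\<dots> = B powr (s - 1) * (\<Sum>n\<in>I. Y n powr (t - 1) * (\<Sum>v\<in>V. \<Sum>k\<in>I. K v n k * x v k powr s))"
        by (simp add: sum_distrib_left mult.left_commute)
      also have "\<dots> = B powr (s - 1) * (\<Sum>v\<in>V. \<Sum>k\<in>I. x v k powr s * (\<Sum>n\<in>I. K v k n * Y n powr (t - 1)))"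
        by (subst swap) simp
      also have "\<dots> \<le> B powr (s - 1) * (\<Sum>v\<in>V. \<Sum>k\<in>I. x v k powr s * W k)"
        by (intro mult_left_mono sum_mono W) auto
      also have "(\<Sum>v\<in>V. \<Sum>k\<in>I. x v k powr s * W k) = (\<Sum>k\<in>I. X k * W k)"
        unfolding X_def by (subst sum.swap) (simp add: sum_distrib_right)
      finally have SW: "S \<le> B powr (s - 1) * (\<Sum>k\<in>I. X k * W k)" .
      have h1: "(\<Sum>k\<in>I. X k * W k) \<le> T powr (1 / t) * (\<Sum>n\<in>I. W n powr r) powr (1 / r)"
        unfolding T_def by (rule Holder_sum) (use I X0 W 2 r in auto)
      have "(\<Sum>n\<in>I. W n powr r) powr (1 / r) \<le> (C r * S) powr (1 / r)"
        using W(3) r 2 by (intro powr_mono2) (auto simp: powr_powr S_def intro!: sum_nonneg)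
      also have "(C r * S) powr (1 / r) = C r powr (1 - 1 / t) * S powr (1 - 1 / t)"
        using C[OF r(1)] S0 by (simp add: powr_mult r(4))
      finally have "T powr (1 / t) * (\<Sum>n\<in>I. W n powr r) powr (1 / r) \<le>
          T powr (1 / t) * (C r powr (1 - 1 / t) * S powr (1 - 1 / t))"
        by (rule mult_left_mono) simp
      with h1 have "(\<Sum>k\<in>I. X k * W k) \<le> T powr (1 / t) * (C r powr (1 - 1 / t) * S powr (1 - 1 / t))"
        by linarith
      then have "B powr (s - 1) * (\<Sum>k\<in>I. X k * W k) \<le>
          B powr (s - 1) * (T powr (1 / t) * (C r powr (1 - 1 / t) * S powr (1 - 1 / t)))"
        by (rule mult_left_mono) simp
      with SW have "S \<le> B powr (s - 1) * C r powr (1 - 1 / t) * T powr (1 / t) * S powr (1 - 1 / t)"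
        by (simp add: mult_ac)
      then have "S \<le> (B powr (s - 1) * C r powr (1 - 1 / t)) powr t * T"
        by (rule powr_absorb[OF S0 _ T0 t, rotated]) simp
      then show ?thesis using 2 by (simp add: D_def S_def T_def r_def)
    next
      case 3
      \<comment> \<open>Chosen so that the r-th power of \<open>G\<close> below is
        \<open>X powr t\<close>. The condition \<open>1 < r\<close> is the same as
        \<open>1 < s * t\<close>.\<close>
      define r where "r = (s - 1) * t / (1 - t)"
      have r: "1 < r" using 3 st s by (simp add: r_def field_simps)
      define G where "G n = X n powr ((1 - t) / (s - 1))" for n
      have "0 \<le> G n" for n by (simp add: G_def)
      from maximal[where g = G and r = r, OF this r] obtain W where W: "\<And>n. 0 \<le> W n"
        "\<And>v n. v \<in> V \<Longrightarrow> n \<in> I \<Longrightarrow> (\<Sum>k\<in>I. K v n k * G k) \<le> W n"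
        "(\<Sum>n\<in>I. W n powr r) \<le> C r * (\<Sum>n\<in>I. G n powr r)" by blast
      define T where "T = (\<Sum>n\<in>I. X n powr t)"
      have T0: "0 \<le> T" by (auto simp: T_def intro!: sum_nonneg)
      have Gr: "G n powr r = X n powr t" for n
        using 3 s by (simp add: G_def powr_powr r_def)
      \<comment> \<open>These weights distribute \<open>X n powr t\<close> over the indices: their
        sum over \<open>v\<close> is exactly that power.\<close>
      define P where "P v n = x v n powr s * X n powr (t - 1)" for v n
      define Q where "Q n = (\<Sum>v\<in>V. \<Sum>k\<in>I. K v n k * P v k)" for n
      have P0: "0 \<le> P v n" for v n by (simp add: P_def)
      have Q0: "0 \<le> Q n" for n by (auto simp: Q_def intro!: sum_nonneg mult_nonneg_nonneg K P0)
      have one: "(\<Sum>k\<in>I. K v n k * x v k) powr s \<le> (\<Sum>k\<in>I. K v n k * P v k) * W n powr (s - 1)"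
        if v: "v \<in> V" and n: "n \<in> I" for v n
      proof -
        define e where "e = (1 - t) / s"
        define s' where "s' = s / (s - 1)"
        have s': "1 < s'" "1 / s + 1 / s' = 1" "1 / s' * s = s - 1" "e * s' = (1 - t) / (s - 1)"
          using s by (auto simp: s'_def e_def field_simps)
        \<comment> \<open>The negative power of \<open>X\<close> is put on the factor whose s-th
          power becomes \<open>P\<close>, the positive one on the factor that becomes
          \<open>G\<close>. Where \<open>X k\<close> is 0 so is \<open>x v k\<close>, hence the
          identity survives the value 0 of \<open>powr\<close> there.\<close>
        have split: "x v k = (x v k * X k powr (- e)) * X k powr e" for k
        proof (cases "X k = 0")
          case True
          have "x v k powr s \<le> X k" unfolding X_def using V v by (intro member_le_sum) auto
          then have "x v k = 0" using True by simp
          then show ?thesis by simp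
        next
          case False
          then show ?thesis using X0[of k] by (simp add: mult.assoc powr_add[symmetric])
        qed
        have "(\<Sum>k\<in>I. K v n k * x v k) = (\<Sum>k\<in>I. K v n k * ((x v k * X k powr (- e)) * X k powr e))"
          by (intro sum.cong refl arg_cong2[where f = "(*)"] split)
        also have "\<dots> \<le> (\<Sum>k\<in>I. K v n k * (x v k * X k powr (- e)) powr s) powr (1 / s) *
            (\<Sum>k\<in>I. K v n k * (X k powr e) powr s') powr (1 / s')"
          by (rule Holder_sum_weighted) (use I K x s s' in auto)
        also have "(\<Sum>k\<in>I. K v n k * (x v k * X k powr (- e)) powr s) = (\<Sum>k\<in>I. K v n k * P v k)"
          using s x by (simp add: P_def powr_mult powr_powr e_def)
        also have "(\<Sum>k\<in>I. K v n k * (X k powr e) powr s') = (\<Sum>k\<in>I. K v n k * G k)"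
          by (simp add: G_def powr_powr s')
        also have "(\<Sum>k\<in>I. K v n k * P v k) powr (1 / s) * (\<Sum>k\<in>I. K v n k * G k) powr (1 / s') \<le>
             (\<Sum>k\<in>I. K v n k * P v k) powr (1 / s) * W n powr (1 / s')"
          using W(2)[OF v n] s' K by (intro mult_left_mono powr_mono2) (auto simp: G_def intro!: sum_nonneg)
        finally have "(\<Sum>k\<in>I. K v n k * x v k) powr s \<le> ((\<Sum>k\<in>I. K v n k * P v k) powr (1 / s) * W n powr (1 / s')) powr s"
          using s K x by (intro powr_mono2) (auto intro!: sum_nonneg)
        also have "\<dots> = (\<Sum>k\<in>I. K v n k * P v k) * W n powr (s - 1)"
          using s s'(3) W(1)[of n] K P0 by (simp add: powr_mult powr_powr sum_nonneg)
        finally show ?thesis .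
      qed
      have YQ: "Y n \<le> Q n * W n powr (s - 1)" if "n \<in> I" for n
      proof -
        have "Y n \<le> (\<Sum>v\<in>V. (\<Sum>k\<in>I. K v n k * P v k) * W n powr (s - 1))"
          unfolding Y_def by (intro sum_mono one that)
        then show ?thesis by (simp add: Q_def sum_distrib_right)
      qed
      have QT: "(\<Sum>n\<in>I. Q n) \<le> B * T"
      proof -
        have "(\<Sum>n\<in>I. Q n) = (\<Sum>v\<in>V. \<Sum>k\<in>I. P v k * (\<Sum>n\<in>I. K v k n * 1))"
          using swap[of "\<lambda>_. 1" P] by (simp add: Q_def)
        also have "\<dots> \<le> (\<Sum>v\<in>V. \<Sum>k\<in>I. P v k * B)"
          using B P0 by (intro sum_mono mult_left_mono) auto
        also have "\<dots> = B * (\<Sum>k\<in>I. \<Sum>v\<in>V. P v k)"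
          by (subst sum.swap) (simp add: sum_distrib_left mult_ac)
        also have "(\<Sum>k\<in>I. \<Sum>v\<in>V. P v k) = T"
          unfolding T_def
        proof (rule sum.cong[OF refl])
          fix k
          have "(\<Sum>v\<in>V. P v k) = X k * X k powr (t - 1)" by (simp add: P_def X_def sum_distrib_right)
          also have "\<dots> = X k powr t" using powr_mult_base[OF X0[of k], of "t - 1"] by simp
          finally show "(\<Sum>v\<in>V. P v k) = X k powr t" .
        qed
        finally show ?thesis .
      qed
      have "(\<Sum>n\<in>I. Y n powr t) \<le> (\<Sum>n\<in>I. Q n powr t * (W n powr (s - 1)) powr t)"
      proof (rule sum_mono)
        fix n assume "n \<in> I"
        then have "Y n powr t \<le> (Q n * W n powr (s - 1)) powr t"
          using YQ Y0 t by (intro powr_mono2) auto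
        then show "Y n powr t \<le> Q n powr t * (W n powr (s - 1)) powr t"
          using Q0[of n] by (simp add: powr_mult)
      qed
      \<comment> \<open>Hoelder with the dual exponents \<open>1 / t\<close> and
        \<open>1 / (1 - t)\<close>: it leaves the plain sum of \<open>Q\<close> and the sum of
        \<open>W powr r\<close>, both controlled by \<open>T\<close>.\<close>
      also have "\<dots> \<le> (\<Sum>n\<in>I. (Q n powr t) powr (1 / t)) powr (1 / (1 / t)) *
          (\<Sum>n\<in>I. ((W n powr (s - 1)) powr t) powr (1 / (1 - t))) powr (1 / (1 / (1 - t)))"
        by (rule Holder_sum) (use I 3 t in \<open>auto simp: field_simps\<close>)
      also have "\<dots> = (\<Sum>n\<in>I. Q n) powr t * (\<Sum>n\<in>I. W n powr r) powr (1 - t)"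
        using t Q0 by (simp add: powr_powr r_def)
      also have "\<dots> \<le> (B * T) powr t * (C r * T) powr (1 - t)"
        using QT W(3) 3 t Q0 by (intro mult_mono powr_mono2) (auto simp: Gr T_def intro!: sum_nonneg)
      also have "\<dots> = B powr t * C r powr (1 - t) * (T powr t * T powr (1 - t))"
        using B C[OF r] T0 by (simp add: powr_mult)
      also have "T powr t * T powr (1 - t) = T"
        using T0 t by (simp add: powr_add[symmetric])
      finally show ?thesis using 3 by (simp add: D_def T_def r_def)
    qed
  qed
  then show ?thesis by (simp add: X_def Y_def)
qed

section \<open>Fourier coefficients\<close>

definition expi :: "int \<Rightarrow> real \<Rightarrow> complex" where
  "expi n x = exp (\<i> * of_int n * of_real x)"

lemma expi_cis: "expi n x = cis (of_int n * x)"
  by (simp add: expi_def cis_conv_exp mult.assoc)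

lemma norm_expi [simp]: "norm (expi n x) = 1"
  by (simp add: expi_cis)

lemma expi_add: "expi (m + n) x = expi m x * expi n x"
  by (simp add: expi_def exp_add[symmetric] algebra_simps)

lemma expi_add_arg: "expi n (x + y) = expi n x * expi n y"
  by (simp add: expi_def exp_add[symmetric] algebra_simps)

lemma expi_0 [simp]: "expi 0 x = 1"
  by (simp add: expi_def)

lemma expi_int_period: "expi n (2 * pi * of_int k) = 1"
  by (simp add: expi_def exp_eq_1) (metis mult.commute mult.left_commute of_int_mult)

lemma expi_periodic: "expi n (x + 2 * pi * of_int k) = expi n x"
  by (simp add: expi_add_arg expi_int_period)

lemma expi_deriv: "(expi n has_vector_derivative \<i> * of_int n * expi n x) (at x)"
proof -
  have "((\<lambda>z. exp (\<i> * of_int n * z)) has_field_derivative exp (\<i> * of_int n * of_real x) * (\<i> * of_int n)) (at (of_real x))"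
    by (auto intro!: derivative_eq_intros)
  then have "((\<lambda>x. exp (\<i> * of_int n * of_real x)) has_vector_derivative exp (\<i> * of_int n * of_real x) * (\<i> * of_int n)) (at x)"
    by (rule has_vector_derivative_real_field)
  then show ?thesis by (simp add: expi_def[abs_def] mult_ac)
qed

lemma continuous_expi [continuous_intros]: "continuous_on S (expi n)"
  unfolding expi_def[abs_def] by (intro continuous_intros)

text \<open>The inverse of \<open>fourier\<close> on rapidly decreasing sequences
  (\<open>coef_fourier\<close>), hence the sign of the exponent.\<close>

definition coef :: "(real \<Rightarrow> complex) \<Rightarrow> int \<Rightarrow> complex" where
  "coef a n = of_real (1 / (2 * pi)) * integral {- pi..pi} (\<lambda>x. a x * expi (- n) x)"

lemma fourier_eq: "fourier f x = (\<Sum>\<^sub>\<infinity>n. f n * expi n x)"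
  by (simp add: fourier_def expi_def)

lemma fourier_term_le:
  assumes "\<And>n. norm (f n) \<le> C / wt n ^ 2"
  shows "norm (f n * expi n x) \<le> C / wt n ^ 2"
  using assms by (simp add: norm_mult)

lemma fourier_summable: "rapid f \<Longrightarrow> (\<lambda>n. f n * expi n x) summable_on UNIV"
proof -
  assume "rapid f"
  then obtain C where C: "\<And>n. norm (f n) \<le> C / wt n ^ 2" by (metis rapidE)
  show ?thesis by (rule summable_wt) (rule fourier_term_le[OF C])
qed

lemma fourier_periodic: "fourier f (x + 2 * pi * of_int k) = fourier f x"
  by (simp add: fourier_eq expi_periodic)

lemma rapid_times_id: "rapid f \<Longrightarrow> rapid (\<lambda>n. \<i> * of_int n * f n)"
proof (rule rapidI)
  fix m assume "rapid f"
  then obtain C where C: "0 \<le> C" "\<And>n. norm (f n) \<le> C / wt n ^ Suc m" by (metis rapidE)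
  have "norm (\<i> * of_int n * f n) \<le> C / wt n ^ m" for n
  proof -
    have "norm (\<i> * of_int n * f n) \<le> wt n * (C / wt n ^ Suc m)"
      unfolding norm_mult using C by (intro mult_mono) (auto simp: wt_def)
    then show ?thesis by simp
  qed
  then show "\<exists>C. \<forall>n. norm (\<i> * of_int n * f n) \<le> C / wt n ^ m" by blast
qed

lemma norm_expi_taylor: "norm (expi n h - 1 - \<i> * of_int n * of_real h) \<le> (of_int n * h)\<^sup>2"
proof -
  have "norm (exp (\<i> * of_int n * of_real h) - (\<Sum>k\<le>1. (\<i> * of_int n * of_real h) ^ k / fact k))
     \<le> exp \<bar>Re (\<i> * of_int n * of_real h)\<bar> * norm (\<i> * of_int n * of_real h) ^ Suc 1 / fact 1"
    by (rule Taylor_exp)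
  then show ?thesis
    by (simp add: expi_def norm_mult power2_eq_square power_mult_distrib abs_mult mult_ac algebra_simps)
qed

lemma fourier_deriv_series:
  assumes f: "rapid f"
  shows "(fourier f has_vector_derivative fourier (\<lambda>n. \<i> * of_int n * f n) x) (at x)"
proof -
  \<comment> \<open>Of the four powers of decay, two pay for the factor \<open>n^2\<close> in the
    Taylor remainder and two for the summation.\<close>
  obtain C where C: "0 \<le> C" "\<And>n. norm (f n) \<le> C / wt n ^ 4" using f by (metis rapidE)
  have bound: "norm (fourier f y - fourier f x - of_real (y - x) * fourier (\<lambda>n. \<i> * of_int n * f n) x) \<le> (C * wt_sum) * (y - x)\<^sup>2" for y
  proof -
    define h where "h = y - x"
    have y: "y = x + h" by (simp add: h_def)
    have s1: "(\<lambda>n. f n * expi n y) summable_on UNIV" "(\<lambda>n. - 1 * (f n * expi n x)) summable_on UNIV"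
      "(\<lambda>n. (- of_real h) * ((\<i> * of_int n * f n) * expi n x)) summable_on UNIV"
      by (intro fourier_summable summable_on_cmult_right f rapid_times_id)+
    have "fourier f y - fourier f x - of_real h * fourier (\<lambda>n. \<i> * of_int n * f n) x =
      fourier f y + - 1 * fourier f x + (- of_real h) * fourier (\<lambda>n. \<i> * of_int n * f n) x" by simp
    also have "\<dots> = (\<Sum>\<^sub>\<infinity>n. f n * expi n y) + (\<Sum>\<^sub>\<infinity>n. - 1 * (f n * expi n x)) + (\<Sum>\<^sub>\<infinity>n. (- of_real h) * ((\<i> * of_int n * f n) * expi n x))"
      unfolding fourier_eq infsum_cmult_right' ..
    also have "\<dots> = (\<Sum>\<^sub>\<infinity>n. f n * expi n y + - 1 * (f n * expi n x) + (- of_real h) * ((\<i> * of_int n * f n) * expi n x))"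
      using s1 by (simp only: infsum_add summable_on_add)
    also have "\<dots> = (\<Sum>\<^sub>\<infinity>n. f n * expi n x * (expi n h - 1 - \<i> * of_int n * of_real h))"
      by (simp add: y expi_add_arg algebra_simps)
    also have "norm \<dots> \<le> (C * h\<^sup>2) * wt_sum"
    proof (rule norm_infsum_wt_le)
      fix n
      have "norm (f n * expi n x * (expi n h - 1 - \<i> * of_int n * of_real h)) \<le> (C / wt n ^ 4) * (of_int n * h)\<^sup>2"
      proof -
        have "norm (f n) * norm (expi n h - 1 - \<i> * of_int n * of_real h) \<le> (C / wt n ^ 4) * (of_int n * h)\<^sup>2"
          using C norm_expi_taylor[of n h] by (intro mult_mono) auto
        then show ?thesis by (simp only: norm_mult norm_expi mult_1_right)
      qed
      also have "\<dots> = (C * h\<^sup>2 / wt n ^ 4) * (of_int n)\<^sup>2"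
        by (simp add: power_mult_distrib)
      also have "\<dots> \<le> (C * h\<^sup>2 / wt n ^ 4) * (wt n)\<^sup>2"
      proof (rule mult_left_mono)
        show "(real_of_int n)\<^sup>2 \<le> (wt n)\<^sup>2" by (rule power2_le_iff_abs_le[THEN iffD2]) (auto simp: wt_def)
      qed (use C in auto)
      also have "\<dots> = (C * h\<^sup>2) / wt n ^ 2" by (simp add: numeral_eq_Suc)
      finally show "norm (f n * expi n x * (expi n h - 1 - \<i> * of_int n * of_real h)) \<le> (C * h\<^sup>2) / wt n ^ 2" .
    qed
    finally show ?thesis by (simp add: h_def mult_ac)
  qed
  define M where "M = C * wt_sum"
  have M: "0 \<le> M" using C wt_sum_nonneg by (simp add: M_def)
  show ?thesis
    unfolding has_vector_derivative_def has_derivative_at_alt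
  proof (intro conjI allI impI)
    show "bounded_linear (\<lambda>h. h *\<^sub>R fourier (\<lambda>n. \<i> * of_int n * f n) x)"
      by (rule bounded_linear_scaleR_left)
    fix e :: real assume e: "0 < e"
    have "norm (fourier f y - fourier f x - (y - x) *\<^sub>R fourier (\<lambda>n. \<i> * of_int n * f n) x) \<le> e * norm (y - x)"
      if "norm (y - x) < e / (M + 1)" for y
    proof -
      have "M * \<bar>y - x\<bar> \<le> (M + 1) * \<bar>y - x\<bar>" by (intro mult_right_mono) auto
      also have "\<dots> \<le> e" using that M by (simp add: field_simps)
      finally have "M * \<bar>y - x\<bar> * \<bar>y - x\<bar> \<le> e * \<bar>y - x\<bar>" by (rule mult_right_mono) simp
      moreover have "M * (y - x)\<^sup>2 = M * \<bar>y - x\<bar> * \<bar>y - x\<bar>"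
        by (simp add: power2_eq_square mult.assoc abs_mult[symmetric])
      ultimately show ?thesis using bound[of y] unfolding M_def[symmetric] scaleR_conv_of_real real_norm_def by linarith
    qed
    moreover have "0 < e / (M + 1)" using e M by simp
    ultimately show "\<exists>d>0. \<forall>y. norm (y - x) < d \<longrightarrow>
        norm (fourier f y - fourier f x - (y - x) *\<^sub>R fourier (\<lambda>n. \<i> * of_int n * f n) x) \<le> e * norm (y - x)"
      by (intro exI[of _ "e / (M + 1)"] conjI allI impI)
  qed
qed

lemma rapid_times_id_power: "rapid f \<Longrightarrow> rapid (\<lambda>n. (\<i> * of_int n) ^ k * f n)"
proof (induction k)
  case (Suc k)
  from rapid_times_id[OF Suc.IH[OF Suc.prems]] show ?case by (simp add: mult.assoc)
qed simp

lemma fourier_deriv_eq: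
  assumes f: "rapid f"
  shows "fourier_deriv k f = fourier (\<lambda>n. (\<i> * of_int n) ^ k * f n)"
proof (induction k)
  case 0
  show ?case by (simp add: fourier_deriv_def)
next
  case (Suc k)
  have "fourier_deriv (Suc k) f = (\<lambda>x. vector_derivative (fourier_deriv k f) (at x))"
    by (simp add: fourier_deriv_def)
  also have "\<dots> = fourier (\<lambda>n. \<i> * of_int n * ((\<i> * of_int n) ^ k * f n))"
    unfolding Suc
    by (rule ext, rule vector_derivative_at, rule fourier_deriv_series, rule rapid_times_id_power, rule f)
  finally show ?case by (simp add: mult.assoc)
qed

lemma fourier_deriv_has_derivative:
  "rapid f \<Longrightarrow> (fourier_deriv k f has_vector_derivative fourier_deriv (Suc k) f x) (at x)"
  using fourier_deriv_series[OF rapid_times_id_power, of f k x] by (simp add: fourier_deriv_eq mult.assoc)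

lemma fourier_continuous: "rapid f \<Longrightarrow> continuous_on S (fourier f)"
  by (intro continuous_at_imp_continuous_on ballI)
     (rule has_vector_derivative_continuous, rule fourier_deriv_series)

section \<open>Bounds and calculus for Fourier coefficients\<close>

lemma coef_one: "coef (\<lambda>x. 1) n = (if n = 0 then 1 else 0)"
proof (cases "n = 0")
  case True
  then show ?thesis by (simp add: coef_def scaleR_conv_of_real)
next
  case False
  have "((\<lambda>x. \<i> * of_int (- n) * expi (- n) x) has_integral expi (- n) pi - expi (- n) (- pi)) {- pi..pi}"
    by (rule fundamental_theorem_of_calculus, simp, rule has_vector_derivative_at_within, rule expi_deriv)
  moreover have "expi (- n) pi = expi (- n) (- pi)"
    using expi_periodic[of "- n" "- pi" 1] by simp
  ultimately have "((\<lambda>x. \<i> * of_int (- n) * expi (- n) x) has_integral 0) {- pi..pi}" by simp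
  from has_integral_mult_right[OF this, of "1 / (\<i> * of_int (- n))"]
  have "(expi (- n) has_integral 0) {- pi..pi}" using False by simp
  then show ?thesis using False by (simp add: coef_def integral_unique)
qed

lemma norm_coef_le:
  assumes C: "\<And>x. x \<in> {- pi..pi} \<Longrightarrow> norm (a x) \<le> C" and "0 \<le> C"
    and d: "0 \<le> d" "d \<le> pi" and supp: "\<And>x. x \<in> {- pi..pi} \<Longrightarrow> d < \<bar>x\<bar> \<Longrightarrow> a x = 0"
  shows "norm (coef a n) \<le> C * d / pi"
proof -
  let ?f = "\<lambda>x. a x * expi (- n) x"
  have "integral {- pi..pi} ?f = integral {- pi..pi} (\<lambda>x. if x \<in> {- d..d} then ?f x else 0)"
    by (rule integral_cong) (use supp in auto)
  also have "\<dots> = integral {- d..d} ?f"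
  proof -
    have "{- pi..pi} \<inter> {- d..d} = {- d..d}" "{- d..d} \<inter> {- pi..pi} = {- d..d}" using d by auto
    then show ?thesis by (simp only: integral_restrict_Int)
  qed
  finally have eq: "integral {- pi..pi} ?f = integral {- d..d} ?f" .
  have "norm (integral {- d..d} ?f) \<le> C * (2 * d)"
  proof (cases "?f integrable_on {- d..d}")
    case True
    then have i: "(?f has_integral integral {- d..d} ?f) (cbox (- d) d)" by (simp add: integrable_integral)
    have "norm (?f x) \<le> C" if "x \<in> cbox (- d) d" for x
      using C[of x] that d by (simp add: norm_mult)
    with \<open>0 \<le> C\<close> i have "norm (integral {- d..d} ?f) \<le> C * measure lborel (cbox (- d) d)"
      by (rule has_integral_bound)
    then show ?thesis using d by simp
  next
    \<comment> \<open>The integral of a non-integrable function is 0 by convention, so no regularity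
      of \<open>a\<close> has to be assumed.\<close>
    case False
    then show ?thesis using \<open>0 \<le> C\<close> d by (simp add: not_integrable_integral)
  qed
  then have "norm (coef a n) \<le> (1 / (2 * pi)) * (C * (2 * d))"
    unfolding coef_def eq norm_mult by (intro mult_mono) (auto simp: norm_divide norm_mult)
  then show ?thesis by (simp add: mult_ac)
qed

lemma coef_bounded:
  assumes "continuous_on {- pi..pi} a"
  shows "\<exists>C. \<forall>n. norm (coef a n) \<le> C"
proof -
  have "compact (a ` {- pi..pi})" by (rule compact_continuous_image[OF assms]) simp
  then have "bounded (a ` {- pi..pi})" by (rule compact_imp_bounded)
  then obtain C where C: "\<And>x. x \<in> {- pi..pi} \<Longrightarrow> norm (a x) \<le> C" unfolding bounded_iff by blast
  have C0: "0 \<le> C" using order_trans[OF norm_ge_zero C[of 0]] by simp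
  have "norm (coef a n) \<le> C * pi / pi" for n
    by (rule norm_coef_le) (use C C0 in auto)
  then show ?thesis by blast
qed

text \<open>Dominated convergence along the symmetric partial sums of the series of
  \<open>b\<close>. Continuity of \<open>a\<close> is enough, and this matters: it is applied to
  2|sin(x/2)|, which has a corner at 0.\<close>

lemma coef_mult_fourier:
  assumes a: "continuous_on {- pi..pi} a" and b: "rapid b"
  shows "coef (\<lambda>x. a x * fourier b x) = conv (coef a) b"
proof
  fix n
  obtain A where A: "\<And>n. norm (coef a n) \<le> A" using coef_bounded[OF a] by blast
  have A0: "0 \<le> A" using order_trans[OF norm_ge_zero A[of 0]] .
  obtain B where B: "0 \<le> B" "\<And>n. norm (b n) \<le> B / wt n ^ 2" using b by (metis rapidE)
  have "compact (a ` {- pi..pi})" by (rule compact_continuous_image[OF a]) simp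
  then have "bounded (a ` {- pi..pi})" by (rule compact_imp_bounded)
  then obtain D where D: "\<And>x. x \<in> {- pi..pi} \<Longrightarrow> norm (a x) \<le> D" unfolding bounded_iff by blast
  have sb: "(\<lambda>m. norm (b m)) summable_on UNIV" by (rule abs_summable_wt[OF B(2)])
  define S where "S = (\<Sum>\<^sub>\<infinity>m. norm (b m))"
  define F where "F R x = a x * (\<Sum>m\<in>{- int R..int R}. b m * expi m x) * expi (- n) x" for R x
  have F_int: "(F R has_integral of_real (2 * pi) * (\<Sum>m\<in>{- int R..int R}. coef a (n - m) * b m)) {- pi..pi}" for R
  proof -
    have "((\<lambda>x. a x * expi (- (n - m)) x) has_integral of_real (2 * pi) * coef a (n - m)) {- pi..pi}" for m
    proof -
      have "(\<lambda>x. a x * expi (- (n - m)) x) integrable_on {- pi..pi}"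
        by (intro integrable_continuous_real continuous_intros a)
      then show ?thesis by (simp add: coef_def has_integral_integral)
    qed
    then have "((\<lambda>x. \<Sum>m\<in>{- int R..int R}. b m * (a x * expi (- (n - m)) x)) has_integral
       (\<Sum>m\<in>{- int R..int R}. b m * (of_real (2 * pi) * coef a (n - m)))) {- pi..pi}"
      by (intro has_integral_sum has_integral_mult_right) auto
    moreover have "(\<Sum>m\<in>{- int R..int R}. b m * (a x * expi (- (n - m)) x)) = F R x" for x
      by (simp add: F_def sum_distrib_left sum_distrib_right mult_ac expi_add[symmetric])
    ultimately show ?thesis by (simp add: sum_distrib_left mult_ac)
  qed
  have "(\<lambda>R. integral {- pi..pi} (F R)) \<longlonglongrightarrow> integral {- pi..pi} (\<lambda>x. a x * fourier b x * expi (- n) x)"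
  proof (rule dominated_convergence)
    show "F R integrable_on {- pi..pi}" for R using F_int by blast
    show "(\<lambda>x. D * S) integrable_on {- pi..pi}" by (rule integrable_const_ivl)
    show "norm (F R x) \<le> D * S" if "x \<in> {- pi..pi}" for R x
    proof -
      have "norm (\<Sum>m\<in>{- int R..int R}. b m * expi m x) \<le> (\<Sum>m\<in>{- int R..int R}. norm (b m))"
        by (rule order_trans[OF norm_sum]) (simp add: norm_mult)
      also have "\<dots> \<le> S" unfolding S_def by (rule finite_sum_le_infsum[OF sb]) auto
      finally have "norm (a x) * norm (\<Sum>m\<in>{- int R..int R}. b m * expi m x) \<le> D * S"
        using D[OF that] by (intro mult_mono) (auto intro: order_trans[OF norm_ge_zero])
      then show ?thesis by (simp add: F_def norm_mult)
    qed
    show "(\<lambda>R. F R x) \<longlonglongrightarrow> a x * fourier b x * expi (- n) x" if "x \<in> {- pi..pi}" for x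
    proof -
      have "((\<lambda>m. b m * expi m x) has_sum fourier b x) UNIV"
        unfolding fourier_eq using fourier_summable[OF b] by simp
      from has_sum_int_tendsto[OF this] show ?thesis
        unfolding F_def by (intro tendsto_mult tendsto_const)
    qed
  qed
  moreover have "integral {- pi..pi} (F R) = of_real (2 * pi) * (\<Sum>m\<in>{- int R..int R}. coef a (n - m) * b m)" for R
    using F_int by (rule integral_unique)
  ultimately have lim: "(\<lambda>R. of_real (2 * pi) * (\<Sum>m\<in>{- int R..int R}. coef a (n - m) * b m))
     \<longlonglongrightarrow> integral {- pi..pi} (\<lambda>x. a x * fourier b x * expi (- n) x)" by simp
  have "norm (coef a (n - m) * b m) \<le> A * B / wt m ^ 2" for m
    using mult_mono[OF A[of "n - m"] B(2)[of m]] A0 by (simp add: norm_mult)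
  then have "(\<lambda>m. coef a (n - m) * b m) summable_on UNIV" by (rule summable_wt)
  then have "((\<lambda>m. coef a (n - m) * b m) has_sum conv (coef a) b n) UNIV" by (simp add: conv_def)
  from has_sum_int_tendsto[OF this]
  have "(\<lambda>R. of_real (2 * pi) * (\<Sum>m\<in>{- int R..int R}. coef a (n - m) * b m)) \<longlonglongrightarrow> of_real (2 * pi) * conv (coef a) b n"
    by (intro tendsto_mult tendsto_const)
  from LIMSEQ_unique[OF lim this] show "coef (\<lambda>x. a x * fourier b x) n = conv (coef a) b n"
    by (simp add: coef_def)
qed

lemma conv_delta: "conv (\<lambda>n. if n = 0 then 1 else 0) b = b"
proof
  fix n
  have "conv (\<lambda>n. if n = 0 then 1 else 0) b n = (\<Sum>\<^sub>\<infinity>m. b m * unit_mass n m)"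
    unfolding conv_def by (rule infsum_cong) (auto simp: unit_mass_def)
  then show "conv (\<lambda>n. if n = 0 then 1 else 0) b n = b n" by (simp add: infsum_unit_mass)
qed

lemma coef_fourier: "rapid b \<Longrightarrow> coef (fourier b) = b"
  using coef_mult_fourier[of "\<lambda>x. 1" b] by (simp add: coef_one[abs_def] conv_delta)

lemma coef_deriv:
  assumes d: "\<And>x. (a has_vector_derivative a' x) (at x)" and per: "a pi = a (- pi)"
  shows "coef a' n = \<i> * of_int n * coef a n"
proof -
  have cont: "continuous_on {- pi..pi} a"
    by (intro continuous_at_imp_continuous_on ballI) (rule has_vector_derivative_continuous, rule d)
  have "((\<lambda>x. a x * (\<i> * of_int (- n) * expi (- n) x) + a' x * expi (- n) x) has_integral
      a pi * expi (- n) pi - a (- pi) * expi (- n) (- pi)) {- pi..pi}"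
    by (rule fundamental_theorem_of_calculus, simp, rule has_vector_derivative_at_within,
        rule has_vector_derivative_mult[OF d expi_deriv])
  moreover have "expi (- n) pi = expi (- n) (- pi)"
    using expi_periodic[of "- n" "- pi" 1] by simp
  ultimately have 1: "((\<lambda>x. a x * (\<i> * of_int (- n) * expi (- n) x) + a' x * expi (- n) x) has_integral 0) {- pi..pi}"
    using per by simp
  have "(\<lambda>x. a x * expi (- n) x) integrable_on {- pi..pi}"
    by (intro integrable_continuous_real continuous_intros cont)
  then have "((\<lambda>x. a x * expi (- n) x) has_integral of_real (2 * pi) * coef a n) {- pi..pi}"
    by (simp add: coef_def has_integral_integral)
  from has_integral_add[OF 1 has_integral_mult_right[OF this, of "\<i> * of_int n"]]
  have "((\<lambda>x. a' x * expi (- n) x) has_integral \<i> * of_int n * (of_real (2 * pi) * coef a n)) {- pi..pi}"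
    by (simp add: algebra_simps)
  then show ?thesis by (simp add: coef_def integral_unique)
qed

lemma coef_laplacian_symbol:
  assumes a: "continuous_on {- pi..pi} a"
  shows "coef (\<lambda>x. of_real (2 - 2 * cos x) * a x) = laplacian (coef a)"
proof
  fix n
  have i: "(\<lambda>x. c * (a x * expi m x)) integrable_on {- pi..pi}" for m c
    by (intro integrable_continuous_real continuous_intros a)
  have c: "of_real (2 - 2 * cos x) = 2 - expi 1 x - expi (- 1) x" for x
    by (simp add: expi_cis complex_eq_iff)
  have "integral {- pi..pi} (\<lambda>x. of_real (2 - 2 * cos x) * a x * expi (- n) x) =
    integral {- pi..pi} (\<lambda>x. 2 * (a x * expi (- n) x) - 1 * (a x * expi (- (n - 1)) x) - 1 * (a x * expi (- (n + 1)) x))"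
    by (rule integral_cong, simp only: c) (simp add: algebra_simps expi_add[symmetric])
  also have "\<dots> = integral {- pi..pi} (\<lambda>x. 2 * (a x * expi (- n) x)) - integral {- pi..pi} (\<lambda>x. 1 * (a x * expi (- (n - 1)) x))
      - integral {- pi..pi} (\<lambda>x. 1 * (a x * expi (- (n + 1)) x))"
    by (simp only: integral_diff i integrable_diff)
  also have "\<dots> = 2 * integral {- pi..pi} (\<lambda>x. a x * expi (- n) x) - integral {- pi..pi} (\<lambda>x. a x * expi (- (n - 1)) x)
      - integral {- pi..pi} (\<lambda>x. a x * expi (- (n + 1)) x)"
    by simp
  finally have eq: "integral {- pi..pi} (\<lambda>x. of_real (2 - 2 * cos x) * a x * expi (- n) x) =
     2 * integral {- pi..pi} (\<lambda>x. a x * expi (- n) x) - integral {- pi..pi} (\<lambda>x. a x * expi (- (n - 1)) x)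
      - integral {- pi..pi} (\<lambda>x. a x * expi (- (n + 1)) x)" .
  have alg: "c * (2 * u - v - z) = - (c * z) + 2 * (c * u) - c * v" for c u v z :: complex
    by (simp add: algebra_simps)
  show "coef (\<lambda>x. of_real (2 - 2 * cos x) * a x) n = laplacian (coef a) n"
    unfolding coef_def laplacian_def eq by (rule alg)
qed

section \<open>Symbols\<close>

definition per :: "(real \<Rightarrow> complex) \<Rightarrow> bool" where
  "per a \<longleftrightarrow> (\<forall>x. a (x + 2 * pi) = a x)"

lemma per_int: assumes "per a" shows "a (x + 2 * pi * of_int k) = a x"
proof -
  have nat: "a (x + 2 * pi * of_nat k) = a x" for k x
  proof (induction k arbitrary: x)
    case (Suc k)
    have "a (x + 2 * pi * of_nat (Suc k)) = a ((x + 2 * pi * of_nat k) + 2 * pi)"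
      by (simp add: algebra_simps)
    also have "\<dots> = a x" using assms Suc by (simp add: per_def)
    finally show ?case .
  qed simp
  show ?thesis
  proof (cases "0 \<le> k")
    case True
    then show ?thesis using nat[of x "nat k"] by simp
  next
    case False
    then show ?thesis using nat[of "x + 2 * pi * of_int k" "nat (- k)"] by simp
  qed
qed

lemma representative_ex: "\<exists>k::int. x + 2 * pi * of_int k \<in> {- pi..pi}"
proof -
  define k where "k = - round (x / (2 * pi))"
  have "\<bar>of_int (round (x / (2 * pi))) - x / (2 * pi)\<bar> \<le> 1 / 2"
    by (rule of_int_round_abs_le)
  then have "\<bar>x / (2 * pi) + of_int k\<bar> \<le> 1 / 2"
    unfolding k_def by (simp add: abs_minus_commute)
  then have "\<bar>x / (2 * pi) + of_int k\<bar> * (2 * pi) \<le> 1 / 2 * (2 * pi)"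
    by (intro mult_right_mono) auto
  moreover have "\<bar>x / (2 * pi) + of_int k\<bar> * (2 * pi) = \<bar>(x / (2 * pi) + of_int k) * (2 * pi)\<bar>"
    by (simp add: abs_mult)
  moreover have "(x / (2 * pi) + of_int k) * (2 * pi) = x + 2 * pi * of_int k"
    by (simp add: field_simps)
  ultimately have "x + 2 * pi * of_int k \<in> {- pi..pi}" by auto
  then show ?thesis by blast
qed

lemma per_all:
  assumes "\<And>x. x \<in> {- pi..pi} \<Longrightarrow> P (a x)" "per a"
  shows "P (a x)"
  using representative_ex[of x] per_int[OF assms(2), of x] assms(1) by metis

text \<open>A family \<open>a \<nu>\<close>, \<open>\<nu> \<le> 0\<close>, is a symbol of order \<open>k\<close> if its derivatives up to order \<open>k\<close> obey
  the scale-invariant bounds of condition (iii) for admissible pairs.\<close>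

fun symb :: "nat \<Rightarrow> (int \<Rightarrow> real \<Rightarrow> complex) \<Rightarrow> bool" where
  "symb 0 a \<longleftrightarrow> (\<forall>v\<le>0. per (a v)) \<and> (\<exists>C. \<forall>v\<le>0. \<forall>x. norm (a v x) \<le> C)"
| "symb (Suc k) a \<longleftrightarrow> (\<forall>v\<le>0. per (a v)) \<and> (\<exists>C. \<forall>v\<le>0. \<forall>x. norm (a v x) \<le> C) \<and>
     (\<exists>b. (\<forall>v\<le>0. \<forall>x. (a v has_vector_derivative of_real (2 powi (- v)) * b v x) (at x)) \<and> symb k b)"

lemma symb_imp_0: "symb k a \<Longrightarrow> symb 0 a"
  by (cases k) auto

lemma symb_SucI:
  "symb 0 a \<Longrightarrow> (\<And>v x. v \<le> 0 \<Longrightarrow> (a v has_vector_derivative of_real (2 powi (- v)) * b v x) (at x)) \<Longrightarrow> symb k b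
    \<Longrightarrow> symb (Suc k) a"
  by auto

lemma symb_SucD:
  "symb (Suc k) a \<Longrightarrow> \<exists>b. (\<forall>v\<le>0. \<forall>x. (a v has_vector_derivative of_real (2 powi (- v)) * b v x) (at x)) \<and> symb k b"
  by simp

lemma symb_down: "symb (Suc k) a \<Longrightarrow> symb k a"
proof (induction k arbitrary: a)
  case (Suc k)
  obtain b where b: "\<And>v x. v \<le> 0 \<Longrightarrow> (a v has_vector_derivative of_real (2 powi (- v)) * b v x) (at x)" "symb (Suc k) b"
    using symb_SucD[OF Suc.prems] by blast
  show ?case
    by (rule symb_SucI[OF symb_imp_0[OF Suc.prems] b(1) Suc.IH[OF b(2)]])
qed simp

lemma symb_per: "symb k a \<Longrightarrow> v \<le> 0 \<Longrightarrow> per (a v)"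
  by (cases k) auto

lemma symb_bound:
  assumes "symb k a"
  shows "\<exists>C\<ge>0. \<forall>v\<le>0. \<forall>x. norm (a v x) \<le> C"
proof -
  obtain C where C: "\<And>v x. v \<le> 0 \<Longrightarrow> norm (a v x) \<le> C" using symb_imp_0[OF assms] by auto
  have "0 \<le> C" using order_trans[OF norm_ge_zero C[of 0 0]] by simp
  with C show ?thesis by blast
qed

lemma symb_0I:
  "(\<And>v x. v \<le> 0 \<Longrightarrow> a v (x + 2 * pi) = a v x) \<Longrightarrow> (\<And>v x. v \<le> 0 \<Longrightarrow> norm (a v x) \<le> C) \<Longrightarrow> symb 0 a"
  unfolding symb.simps per_def by blast

lemma symb_const: "symb k (\<lambda>v x. c)"
proof (induction k arbitrary: c)
  case 0
  show ?case by (rule symb_0I[of _ "norm c"]) auto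
next
  case (Suc k)
  have "symb 0 (\<lambda>v x. c)" by (rule symb_0I[of _ "norm c"]) auto
  then show ?case by (rule symb_SucI[where b = "\<lambda>v x. 0"]) (use Suc in auto)
qed

lemma symb_add_0: assumes "symb 0 a" "symb 0 b" shows "symb 0 (\<lambda>v x. a v x + b v x)"
proof -
  obtain C where C: "\<And>v x. v \<le> 0 \<Longrightarrow> norm (a v x) \<le> C" using symb_bound[OF assms(1)] by blast
  obtain D where D: "\<And>v x. v \<le> 0 \<Longrightarrow> norm (b v x) \<le> D" using symb_bound[OF assms(2)] by blast
  show ?thesis
  proof (rule symb_0I)
    show "norm (a v x + b v x) \<le> C + D" if "v \<le> 0" for v x
      using C[OF that, of x] D[OF that, of x] norm_triangle_ineq[of "a v x" "b v x"] by linarith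
  qed (use assms in \<open>auto simp: per_def\<close>)
qed

lemma symb_add: "symb k a \<Longrightarrow> symb k b \<Longrightarrow> symb k (\<lambda>v x. a v x + b v x)"
proof (induction k arbitrary: a b)
  case 0
  then show ?case by (rule symb_add_0)
next
  case (Suc k)
  obtain a' where a: "\<And>v x. v \<le> 0 \<Longrightarrow> (a v has_vector_derivative of_real (2 powi (- v)) * a' v x) (at x)" "symb k a'"
    using symb_SucD[OF Suc.prems(1)] by blast
  obtain b' where b: "\<And>v x. v \<le> 0 \<Longrightarrow> (b v has_vector_derivative of_real (2 powi (- v)) * b' v x) (at x)" "symb k b'"
    using symb_SucD[OF Suc.prems(2)] by blast
  show ?case
  proof (rule symb_SucI[OF symb_add_0[OF Suc.prems[THEN symb_imp_0]] _ Suc.IH[OF a(2) b(2)]])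
    show "((\<lambda>x. a v x + b v x) has_vector_derivative of_real (2 powi (- v)) * (a' v x + b' v x)) (at x)" if "v \<le> 0" for v x
      using has_vector_derivative_add[OF a(1)[OF that] b(1)[OF that]] by (simp add: distrib_left)
  qed
qed

lemma symb_mult_0: assumes "symb 0 a" "symb 0 b" shows "symb 0 (\<lambda>v x. a v x * b v x)"
proof -
  obtain C where C: "0 \<le> C" "\<And>v x. v \<le> 0 \<Longrightarrow> norm (a v x) \<le> C" using symb_bound[OF assms(1)] by blast
  obtain D where D: "\<And>v x. v \<le> 0 \<Longrightarrow> norm (b v x) \<le> D" using symb_bound[OF assms(2)] by blast
  show ?thesis
  proof (rule symb_0I)
    show "norm (a v x * b v x) \<le> C * D" if "v \<le> 0" for v x
      unfolding norm_mult using C D that by (intro mult_mono) auto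
  qed (use assms in \<open>auto simp: per_def\<close>)
qed

lemma symb_mult: "symb k a \<Longrightarrow> symb k b \<Longrightarrow> symb k (\<lambda>v x. a v x * b v x)"
proof (induction k arbitrary: a b)
  case 0
  then show ?case by (rule symb_mult_0)
next
  case (Suc k)
  obtain a' where a: "\<And>v x. v \<le> 0 \<Longrightarrow> (a v has_vector_derivative of_real (2 powi (- v)) * a' v x) (at x)" "symb k a'"
    using symb_SucD[OF Suc.prems(1)] by blast
  obtain b' where b: "\<And>v x. v \<le> 0 \<Longrightarrow> (b v has_vector_derivative of_real (2 powi (- v)) * b' v x) (at x)" "symb k b'"
    using symb_SucD[OF Suc.prems(2)] by blast
  have "symb k (\<lambda>v x. a v x * b' v x + a' v x * b v x)"
    by (intro symb_add Suc.IH symb_down[OF Suc.prems(1)] symb_down[OF Suc.prems(2)] a b)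
  then show ?case
  proof (rule symb_SucI[OF symb_mult_0[OF Suc.prems[THEN symb_imp_0]], rotated])
    show "((\<lambda>x. a v x * b v x) has_vector_derivative of_real (2 powi (- v)) * (a v x * b' v x + a' v x * b v x)) (at x)"
      if "v \<le> 0" for v x
      using has_vector_derivative_mult[OF a(1)[OF that] b(1)[OF that]] by (simp add: algebra_simps)
  qed
qed

lemma symb_cmult: "symb k a \<Longrightarrow> symb k (\<lambda>v x. c * a v x)"
  using symb_mult[OF symb_const] .

lemma symb_diff: "symb k a \<Longrightarrow> symb k b \<Longrightarrow> symb k (\<lambda>v x. a v x - b v x)"
  using symb_add[OF _ symb_cmult[of k b "-1"], of a] by simp

lemma symb_power: "symb k a \<Longrightarrow> symb k (\<lambda>v x. a v x ^ m)"
  by (induction m) (auto intro: symb_const symb_mult)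

lemma symb_cnj: "symb k a \<Longrightarrow> symb k (\<lambda>v x. cnj (a v x))"
proof (induction k arbitrary: a)
  case 0
  then show ?case by (auto simp: per_def)
next
  case (Suc k)
  obtain a' where a: "\<And>v x. v \<le> 0 \<Longrightarrow> (a v has_vector_derivative of_real (2 powi (- v)) * a' v x) (at x)" "symb k a'"
    using symb_SucD[OF Suc.prems(1)] by blast
  have "symb 0 (\<lambda>v x. cnj (a v x))" using symb_imp_0[OF Suc.prems] by (auto simp: per_def)
  then show ?case
  proof (rule symb_SucI[OF _ _ Suc.IH[OF a(2)]])
    show "((\<lambda>x. cnj (a v x)) has_vector_derivative of_real (2 powi (- v)) * cnj (a' v x)) (at x)" if "v \<le> 0" for v x
      using has_vector_derivative_cnj[OF a(1)[OF that]] by simp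
  qed
qed

lemma powi_nonpos_le_1: "v \<le> 0 \<Longrightarrow> (2::real) powi v \<le> 1"
  by (cases "v = 0") (auto simp: power_int_def intro: power_le_one)

text \<open>A fixed exponential does not vary with the scale: its derivative is of size 1, which is
  at most the permitted \<open>2 powi (- v)\<close>. Formally the compensating factor
  \<open>2 powi v\<close> is itself a symbol.\<close>

lemma symb_expi: "symb k (\<lambda>v. expi m)"
proof (induction k)
  case 0
  show ?case using expi_periodic[of m _ 1] by (intro symb_0I[of _ 1]) auto
next
  case (Suc k)
  have sc: "symb k (\<lambda>v x. of_real (2 powi v))"
  proof -
    have z: "symb k (\<lambda>v x. 0)" by (rule symb_const)
    have s0: "symb 0 (\<lambda>v x. of_real (2 powi v))"
      by (rule symb_0I[of _ 1]) (auto simp: norm_power_int powi_nonpos_le_1)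
    show ?thesis
    proof (cases k)
      case 0
      with s0 show ?thesis by simp
    next
      case (Suc j)
      have "symb j (\<lambda>v x. 0)" by (rule symb_const)
      then show ?thesis unfolding Suc by (intro symb_SucI[OF s0, where b = "\<lambda>v x. 0"]) auto
    qed
  qed
  have "symb 0 (\<lambda>v. expi m)" using expi_periodic[of m _ 1] by (intro symb_0I[of _ 1]) auto
  then show ?case
  proof (rule symb_SucI[OF _ _ symb_mult[OF sc symb_cmult[OF Suc, of "\<i> * of_int m"]]])
    show "(expi m has_vector_derivative of_real (2 powi (- v)) * (of_real (2 powi v) * (\<i> * of_int m * expi m x))) (at x)" for v x
    proof -
      have "(2::real) powi (- v) * 2 powi v = 1" by (simp add: power_int_minus)
      then have "of_real (2 powi (- v)) * (of_real (2 powi v) * (\<i> * of_int m * expi m x)) = \<i> * of_int m * expi m x"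
        by (metis mult.assoc mult_1 of_real_1 of_real_mult)
      then show ?thesis using expi_deriv[of m x] by (simp only:)
    qed
  qed
qed

lemma symb_real_derivative:
  assumes d: "(a has_vector_derivative of_real c * b) (at x)"
    and re: "\<And>x. a x = of_real (Re (a x))" 
  shows "((\<lambda>x. Re (a x)) has_real_derivative c * Re b) (at x)" "of_real (Re b) = b \<or> c = 0"
proof -
  have 1: "((\<lambda>x. Re (a x)) has_vector_derivative Re (of_real c * b)) (at x)"
    using bounded_linear.has_vector_derivative[OF bounded_linear_Re d] .
  then show "((\<lambda>x. Re (a x)) has_real_derivative c * Re b) (at x)"
    by (simp add: has_real_derivative_iff_has_vector_derivative)
  have "((\<lambda>x. Im (a x)) has_vector_derivative Im (of_real c * b)) (at x)"
    using bounded_linear.has_vector_derivative[OF bounded_linear_Im d] .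
  moreover have "(\<lambda>x. Im (a x)) = (\<lambda>x. 0)" using re by (metis Im_complex_of_real)
  ultimately have "((\<lambda>x. 0) has_vector_derivative c * Im b) (at x)" by simp
  then have "c * Im b = 0" using vector_derivative_unique_at has_vector_derivative_const by blast
  then show "of_real (Re b) = b \<or> c = 0" by (auto simp: complex_eq_iff)
qed

text \<open>The derivative of a^(-1/2) is -1/2 times a' times the cube of a^(-1/2), again a product
  of symbols, so the induction closes. The lower bound keeps a^(-1/2) bounded.\<close>

lemma symb_rsqrt:
  assumes re: "\<And>v x. v \<le> 0 \<Longrightarrow> a v x = of_real (Re (a v x))"
    and lower: "\<And>v x. v \<le> 0 \<Longrightarrow> c \<le> Re (a v x)" and c: "0 < c"
  shows "symb k a \<Longrightarrow> symb k (\<lambda>v x. of_real (Re (a v x) powr (- 1 / 2)))"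
proof (induction k)
  case 0
  show ?case
  proof (rule symb_0I)
    show "norm (of_real (Re (a v x) powr (- 1 / 2)) :: complex) \<le> c powr (- 1 / 2)" if "v \<le> 0" for v x
      using lower[OF that, of x] c by (simp add: powr_mono2')
  qed (use 0 in \<open>auto simp: per_def\<close>)
next
  case (Suc k)
  define f where "f v x = (of_real (Re (a v x) powr (- 1 / 2)) :: complex)" for v x
  have f0: "symb 0 f"
  proof (rule symb_0I)
    show "norm (f v x) \<le> c powr (- 1 / 2)" if "v \<le> 0" for v x
      using lower[OF that, of x] c by (simp add: f_def powr_mono2')
  qed (use symb_per[OF Suc.prems] in \<open>auto simp: per_def f_def\<close>)
  have fk: "symb k f" unfolding f_def using Suc.IH[OF symb_down[OF Suc.prems]] .
  obtain b where b: "\<And>v x. v \<le> 0 \<Longrightarrow> (a v has_vector_derivative of_real (2 powi (- v)) * b v x) (at x)" "symb k b"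
    using symb_SucD[OF Suc.prems(1)] by blast
  have "symb k (\<lambda>v x. (- 1 / 2) * (b v x * (f v x * (f v x * f v x))))"
    by (intro symb_cmult symb_mult b fk)
  then have "symb (Suc k) f"
  proof (rule symb_SucI[OF f0, rotated])
    fix v :: int and x :: real assume v: "v \<le> 0"
    have d: "((\<lambda>x. Re (a v x)) has_real_derivative 2 powi (- v) * Re (b v x)) (at x)"
      and bre: "of_real (Re (b v x)) = b v x"
      using symb_real_derivative[OF b(1)[OF v, of x] re[OF v]] by auto
    have pos: "0 < Re (a v x)" using lower[OF v, of x] c by linarith
    have "((\<lambda>x. Re (a v x) powr (- 1 / 2)) has_real_derivative
        (- 1 / 2) * Re (a v x) powr (- 1 / 2 - of_nat 1) * (2 powi (- v) * Re (b v x))) (at x)"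
      by (rule DERIV_fun_powr[OF d pos])
    then have "((\<lambda>x. Re (a v x) powr (- 1 / 2)) has_real_derivative
        (- 1 / 2) * Re (a v x) powr (- 1 / 2 - 1) * (2 powi (- v) * Re (b v x))) (at x)"
      by (simp only: of_nat_1)
    moreover have "Re (a v x) powr (- 1 / 2 - 1) = (Re (a v x) powr (- 1 / 2)) ^ 3"
    proof -
      have "(Re (a v x) powr (- 1 / 2)) ^ 3 = Re (a v x) powr (of_nat 3 * (- 1 / 2))" by (rule powr_power) (use pos in simp)
      then show ?thesis by simp
    qed
    ultimately have "((\<lambda>x. Re (a v x) powr (- 1 / 2)) has_vector_derivative
        (- 1 / 2) * (Re (a v x) powr (- 1 / 2)) ^ 3 * (2 powi (- v) * Re (b v x))) (at x)"
      by (simp only: has_real_derivative_iff_has_vector_derivative)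
    from bounded_linear.has_vector_derivative[OF bounded_linear_of_real this]
    have "(f v has_vector_derivative of_real ((- 1 / 2) * (Re (a v x) powr (- 1 / 2)) ^ 3 * (2 powi (- v) * Re (b v x)))) (at x)"
      by (simp only: f_def[abs_def])
    moreover have "of_real ((- 1 / 2) * (Re (a v x) powr (- 1 / 2)) ^ 3 * (2 powi (- v) * Re (b v x))) =
       of_real (2 powi (- v)) * ((- 1 / 2) * (b v x * (f v x * (f v x * f v x))))"
      by (subst bre[symmetric]) (simp add: f_def power3_eq_cube mult_ac)
    ultimately show "(f v has_vector_derivative of_real (2 powi (- v)) * ((- 1 / 2) * (b v x * (f v x * (f v x * f v x))))) (at x)"
      by (simp only:)
  qed
  then show ?case by (simp only: f_def[abs_def])
qed

text \<open>A change of scale by \<open>e\<close> costs the constant factor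
  \<open>2 powi (- e)\<close> per derivative. Scales above 0, where nothing is known about the
  family, are replaced by 0.\<close>

lemma symb_shift:
  assumes "symb k a"
  shows "symb k (\<lambda>v x. if v + e \<le> 0 then a (v + e) x else 0)"
  using assms
proof (induction k arbitrary: a)
  case 0
  then show ?case by (auto simp: per_def) (metis norm_ge_zero order_trans order_refl)
next
  case (Suc k)
  obtain a' where a: "\<And>v x. v \<le> 0 \<Longrightarrow> (a v has_vector_derivative of_real (2 powi (- v)) * a' v x) (at x)" "symb k a'"
    using symb_SucD[OF Suc.prems(1)] by blast
  obtain C where C: "0 \<le> C" "\<And>v x. v \<le> 0 \<Longrightarrow> norm (a v x) \<le> C" using symb_bound[OF Suc.prems] by blast
  have "symb 0 (\<lambda>v x. if v + e \<le> 0 then a (v + e) x else 0)"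
    using C symb_per[OF Suc.prems] by (intro symb_0I[of _ C]) (auto simp: per_def)
  then show ?case
  proof (rule symb_SucI[OF _ _ symb_cmult[OF Suc.IH[OF a(2)], of "of_real (2 powi (- e))"]])
    fix v :: int and x assume "v \<le> 0"
    show "((\<lambda>x. if v + e \<le> 0 then a (v + e) x else 0) has_vector_derivative
       of_real (2 powi (- v)) * (of_real (2 powi (- e)) * (if v + e \<le> 0 then a' (v + e) x else 0))) (at x)"
    proof (cases "v + e \<le> 0")
      case True
      have "(2::real) powi (- (v + e)) = 2 powi (- v) * 2 powi (- e)"
        by (simp add: power_int_add[symmetric])
      then show ?thesis using a(1)[OF True, of x] True by (simp add: mult.assoc)
    qed simp
  qed
qed

text \<open>The bound is one scale wider than \<open>v\<close>, to leave room for products with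
  pieces of scale \<open>v + 1\<close>. For \<open>v = 0\<close> and \<open>v = - 1\<close> the
  condition is empty.\<close>

definition band :: "(int \<Rightarrow> real \<Rightarrow> complex) \<Rightarrow> bool" where
  "band a \<longleftrightarrow> (\<forall>v\<le>0. \<forall>x\<in>{- pi..pi}. 2 powi (v + 1) * pi < \<bar>x\<bar> \<longrightarrow> a v x = 0)"

lemma band_deriv:
  assumes a: "band a" and d: "\<And>v x. v \<le> 0 \<Longrightarrow> (a v has_vector_derivative of_real (2 powi (- v)) * b v x) (at x)"
  shows "band b"
  unfolding band_def
proof (intro allI impI ballI)
  fix v :: int and x :: real assume v: "v \<le> 0" and x: "x \<in> {- pi..pi}" and lt: "2 powi (v + 1) * pi < \<bar>x\<bar>"
  define r where "r = (2::real) powi (v + 1) * pi"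
  have r: "0 < r" "r < \<bar>x\<bar>" using lt by (simp_all add: r_def)
  \<comment> \<open>A one-sided interval towards the origin: \<open>x\<close> may be an endpoint of
    \<open>{- pi..pi}\<close>, and only points inside are covered by \<open>band\<close>. A
    one-sided derivative already determines the value.\<close>
  define S where "S = (if 0 < x then {(x + r) / 2..x} else {x..(x - r) / 2})"
  have nt: "at x within S \<noteq> bot"
  proof (cases "0 < x")
    case True
    then show ?thesis using r trivial_limit_at_left_real[of x] by (simp add: S_def at_within_Icc_at_left)
  next
    case False
    then show ?thesis using r trivial_limit_at_right_real[of x] by (simp add: S_def at_within_Icc_at_right)
  qed
  have xS: "x \<in> S" using r by (auto simp: S_def)
  have zero: "a v y = 0" if "y \<in> S" for y
  proof -
    have "y \<in> {- pi..pi}" "r < \<bar>y\<bar>" using that x r by (auto simp: S_def split: if_splits)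
    then show ?thesis using a v unfolding band_def r_def by blast
  qed
  have "(a v has_vector_derivative of_real (2 powi (- v)) * b v x) (at x within S)"
    by (rule has_vector_derivative_at_within) (rule d[OF v])
  moreover have "(a v has_vector_derivative 0) (at x within S)"
    by (rule has_vector_derivative_transform[OF xS _ has_vector_derivative_const[of 0]]) (use zero in simp)
  ultimately have "of_real (2 powi (- v)) * b v x = 0"
    using vector_derivative_unique_within[OF nt] by blast
  then show "b v x = 0" by simp
qed

lemma band_mult: "band a \<Longrightarrow> band (\<lambda>v x. a v x * b v x)"
  by (auto simp: band_def)

lemma norm_expi_minus_1_le: "norm (expi m x - 1) \<le> \<bar>of_int m * x\<bar>"
proof -
  have "expi m x - 1 = exp (\<i> * of_real (of_int m * x)) - 1" by (simp add: expi_def mult.assoc)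
  also have "norm \<dots> = norm (2 * sin (of_int m * x / 2))"
    using dist_exp_i_1[of "of_int m * x"] by simp
  also have "\<dots> \<le> \<bar>of_int m * x\<bar>"
    using abs_sin_x_le_abs_x[of "of_int m * x / 2"] by simp
  finally show ?thesis .
qed

text \<open>On the band |e^(-ix) - 1| is at most |x|, hence of size 2^v, which compensates the
  factor \<open>2 powi (- v)\<close>. Differentiating the exponential gives a term without this
  gain, but the loss is exactly the 2^(-v) granted to a derivative.\<close>

lemma symb_band_diff:
  "symb k a \<Longrightarrow> band a \<Longrightarrow> symb k (\<lambda>v x. of_real (2 powi (- v)) * (expi (- 1) x - 1) * a v x)"
proof (induction k arbitrary: a)
  case 0
  obtain C where C: "0 \<le> C" "\<And>v x. v \<le> 0 \<Longrightarrow> norm (a v x) \<le> C" using symb_bound[OF 0(1)] by blast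
  have pa: "per (\<lambda>x. of_real (2 powi (- v)) * (expi (- 1) x - 1) * a v x)" if "v \<le> 0" for v
    using symb_per[OF 0(1) that] expi_periodic[of "- 1" _ 1] by (simp add: per_def)
  have "norm (of_real (2 powi (- v)) * (expi (- 1) x - 1) * a v x) \<le> 2 * pi * C" if v: "v \<le> 0" for v x
  proof (rule per_all[OF _ pa[OF v]])
    fix x assume x: "x \<in> {- pi..pi}"
    show "norm (of_real (2 powi (- v)) * (expi (- 1) x - 1) * a v x) \<le> 2 * pi * C"
    proof (cases "2 powi (v + 1) * pi < \<bar>x\<bar>")
      case True
      then have "a v x = 0" using 0(2) v x unfolding band_def by blast
      then show ?thesis using C(1) by simp
    next
      case False
      have "2 powi (- v) * norm (expi (- 1) x - 1) \<le> 2 powi (- v) * (2 powi (v + 1) * pi)"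
        using False norm_expi_minus_1_le[of "- 1" x] by (intro mult_left_mono) auto
      also have "\<dots> = 2 * pi"
        by (simp add: power_int_add power_int_minus)
      finally have "(2 powi (- v) * norm (expi (- 1) x - 1)) * norm (a v x) \<le> 2 * pi * C"
        by (rule mult_mono) (use C v in auto)
      then show ?thesis by (simp add: norm_mult norm_power_int)
    qed
  qed
  then show ?case using pa by (intro symb_0I[of _ "2 * pi * C"]) (auto simp: per_def)
next
  case (Suc k)
  obtain b where b: "\<And>v x. v \<le> 0 \<Longrightarrow> (a v has_vector_derivative of_real (2 powi (- v)) * b v x) (at x)" "symb k b"
    using symb_SucD[OF Suc.prems(1)] by blast
  have bb: "band b" by (rule band_deriv[OF Suc.prems(2) b(1)])
  let ?g = "\<lambda>v x. of_real (2 powi (- v)) * (expi (- 1) x - 1) * a v x"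
  have g0: "symb 0 ?g"
    using Suc.IH[OF symb_down[OF Suc.prems(1)] Suc.prems(2)] by (rule symb_imp_0)
  have "symb k (\<lambda>v x. (- \<i>) * (expi (- 1) x * a v x) + of_real (2 powi (- v)) * (expi (- 1) x - 1) * b v x)"
    by (intro symb_add symb_cmult symb_mult symb_expi symb_down[OF Suc.prems(1)] Suc.IH b bb)
  then show ?case
  proof (rule symb_SucI[OF g0, rotated])
    fix v :: int and x assume v: "v \<le> 0"
    have "((\<lambda>x. expi (- 1) x - 1) has_vector_derivative \<i> * of_int (- 1) * expi (- 1) x - 0) (at x)"
      by (intro has_vector_derivative_diff expi_deriv has_vector_derivative_const)
    from has_vector_derivative_mult_right[OF has_vector_derivative_mult[OF this b(1)[OF v, of x]], of "of_real (2 powi (- v))"]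
    show "(?g v has_vector_derivative of_real (2 powi (- v)) *
        ((- \<i>) * (expi (- 1) x * a v x) + of_real (2 powi (- v)) * (expi (- 1) x - 1) * b v x)) (at x)"
      by (simp add: algebra_simps)
  qed
qed

text \<open>Each integration by parts trades a factor 2^v |n| for one derivative of the symbol. The
  remaining factor 2^v is the size of the support.\<close>

lemma symb_coef_decay_aux:
  "symb K a \<Longrightarrow> band a \<Longrightarrow> \<exists>C\<ge>0. \<forall>v\<le>0. \<forall>n. (2 powi v * \<bar>of_int n\<bar>) ^ K * norm (coef (a v) n) \<le> C * 2 powi v"
proof (induction K arbitrary: a)
  case 0
  obtain C where C: "0 \<le> C" "\<And>v x. v \<le> 0 \<Longrightarrow> norm (a v x) \<le> C" using symb_bound[OF 0(1)] by blast
  have "norm (coef (a v) n) \<le> (C * 2) * 2 powi v" if v: "v \<le> 0" for v n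
  proof -
    have "norm (coef (a v) n) \<le> C * min pi (2 powi (v + 1) * pi) / pi"
    proof (rule norm_coef_le)
      fix x assume x: "x \<in> {- pi..pi}" "min pi (2 powi (v + 1) * pi) < \<bar>x\<bar>"
      then have "2 powi (v + 1) * pi < \<bar>x\<bar>" by (auto simp: min_def split: if_splits)
      then show "a v x = 0" using 0(2) v x unfolding band_def by blast
    qed (use C v in auto)
    also have "\<dots> \<le> C * (2 powi (v + 1) * pi) / pi"
      using C by (intro divide_right_mono mult_left_mono) auto
    also have "\<dots> = (C * 2) * 2 powi v" by (simp add: power_int_add)
    finally show ?thesis .
  qed
  then show ?case using C(1) by (intro exI[of _ "C * 2"]) auto
next
  case (Suc K)
  obtain b where b: "\<And>v x. v \<le> 0 \<Longrightarrow> (a v has_vector_derivative of_real (2 powi (- v)) * b v x) (at x)" "symb K b"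
    using symb_SucD[OF Suc.prems(1)] by blast
  have bb: "band b" by (rule band_deriv[OF Suc.prems(2) b(1)])
  obtain C where C: "0 \<le> C" "\<And>v n. v \<le> 0 \<Longrightarrow> (2 powi v * \<bar>of_int n\<bar>) ^ K * norm (coef (b v) n) \<le> C * 2 powi v"
    using Suc.IH[OF b(2) bb] by blast
  have "(2 powi v * \<bar>of_int n\<bar>) ^ Suc K * norm (coef (a v) n) \<le> C * 2 powi v" if v: "v \<le> 0" for v n
  proof -
    have "a v pi = a v (- pi)" using per_int[OF symb_per[OF Suc.prems(1) v], of "- pi" 1] by simp
    from coef_deriv[OF b(1)[OF v] this]
    have "coef (\<lambda>x. of_real (2 powi (- v)) * b v x) n = \<i> * of_int n * coef (a v) n" .
    moreover have "coef (\<lambda>x. of_real (2 powi (- v)) * b v x) n = of_real (2 powi (- v)) * coef (b v) n"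
      by (simp add: coef_def mult.assoc)
    ultimately have "norm (of_real (2 powi (- v)) * coef (b v) n) = norm (\<i> * of_int n * coef (a v) n)" by simp
    then have "2 powi (- v) * norm (coef (b v) n) = \<bar>of_int n\<bar> * norm (coef (a v) n)"
      by (simp add: norm_mult norm_power_int)
    then have "2 powi v * \<bar>of_int n\<bar> * norm (coef (a v) n) = 2 powi v * (2 powi (- v) * norm (coef (b v) n))"
      by (simp add: mult.assoc)
    also have "\<dots> = norm (coef (b v) n)" by (simp add: power_int_minus)
    finally have e: "2 powi v * \<bar>of_int n\<bar> * norm (coef (a v) n) = norm (coef (b v) n)" .
    have "(2 powi v * \<bar>of_int n\<bar>) ^ Suc K * norm (coef (a v) n) =
        (2 powi v * \<bar>of_int n\<bar>) ^ K * (2 powi v * \<bar>of_int n\<bar> * norm (coef (a v) n))"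
      by (simp only: power_Suc2 mult.assoc)
    then show ?thesis using C(2)[OF v, of n] unfolding e by (simp only:)
  qed
  then show ?case using C(1) by blast
qed

lemma one_plus_power_le:
  fixes y :: real
  assumes "0 \<le> y" shows "(1 + y) ^ K \<le> 2 ^ K * (1 + y ^ K)"
proof -
  have "(1 + y) ^ K \<le> (2 * max 1 y) ^ K" using assms by (intro power_mono) auto
  also have "\<dots> = 2 ^ K * max 1 y ^ K" by (rule power_mult_distrib)
  also have "max 1 y ^ K \<le> 1 + y ^ K" using assms by (simp add: max_def)
  finally show ?thesis by simp
qed

lemma symb_coef_decay:
  assumes s: "\<And>k. symb k a" and b: "band a"
  shows "\<exists>C\<ge>0. \<forall>v\<le>0. \<forall>n. norm (coef (a v) n) \<le> C * 2 powi v / (1 + 2 powi v * \<bar>of_int n\<bar>) ^ K"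
proof -
  obtain C where C: "0 \<le> C" "\<And>v n. v \<le> 0 \<Longrightarrow> (2 powi v * \<bar>of_int n\<bar>) ^ 0 * norm (coef (a v) n) \<le> C * 2 powi v"
    using symb_coef_decay_aux[OF s b, of 0] by blast
  obtain D where D: "0 \<le> D" "\<And>v n. v \<le> 0 \<Longrightarrow> (2 powi v * \<bar>of_int n\<bar>) ^ K * norm (coef (a v) n) \<le> D * 2 powi v"
    using symb_coef_decay_aux[OF s b, of K] by blast
  have "norm (coef (a v) n) \<le> (2 ^ K * (C + D)) * 2 powi v / (1 + 2 powi v * \<bar>of_int n\<bar>) ^ K" if v: "v \<le> 0" for v n
  proof -
    define y where "y = 2 powi v * \<bar>real_of_int n\<bar>"
    have y: "0 \<le> y" by (simp add: y_def)
    have "(1 + y) ^ K * norm (coef (a v) n) \<le> (2 ^ K * (1 + y ^ K)) * norm (coef (a v) n)"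
      by (rule mult_right_mono[OF one_plus_power_le[OF y]]) simp
    also have "\<dots> = 2 ^ K * (norm (coef (a v) n) + y ^ K * norm (coef (a v) n))" by (simp add: algebra_simps)
    also have "\<dots> \<le> 2 ^ K * (C * 2 powi v + D * 2 powi v)"
      using C(2)[OF v, of n] D(2)[OF v, of n] unfolding y_def by (intro mult_left_mono add_mono) auto
    finally have "norm (coef (a v) n) * (1 + y) ^ K \<le> (2 ^ K * (C + D)) * 2 powi v" by (simp add: algebra_simps)
    then show ?thesis using y unfolding y_def[symmetric] by (subst pos_le_divide_eq) (auto intro: zero_less_power)
  qed
  moreover have "0 \<le> 2 ^ K * (C + D)" using C D by simp
  ultimately show ?thesis by blast
qed

lemma symb_coef_rapid:
  assumes s: "\<And>k. symb k a" and b: "band a" and v: "v \<le> 0"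
  shows "rapid (coef (a v))"
proof (rule rapidI)
  fix m
  obtain C where C: "0 \<le> C" "\<And>n. norm (coef (a v) n) \<le> C * 2 powi v / (1 + 2 powi v * \<bar>of_int n\<bar>) ^ m"
    using symb_coef_decay[OF s b, of m] v by blast
  have "norm (coef (a v) n) \<le> (C * 2 powi v / (2 powi v) ^ m) / wt n ^ m" for n
  proof -
    have "2 powi v * wt n \<le> 1 + 2 powi v * \<bar>real_of_int n\<bar>"
      using powi_nonpos_le_1[OF v] by (simp add: wt_def algebra_simps)
    then have "(2 powi v * wt n) ^ m \<le> (1 + 2 powi v * \<bar>real_of_int n\<bar>) ^ m"
      by (intro power_mono) auto
    then have "C * 2 powi v / (1 + 2 powi v * \<bar>of_int n\<bar>) ^ m \<le> C * 2 powi v / (2 powi v * wt n) ^ m"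
      using C(1) by (intro divide_left_mono) (auto intro!: mult_pos_pos zero_less_power add_pos_nonneg)
    then show ?thesis using C(2)[of n] by (simp add: power_mult_distrib)
  qed
  then show "\<exists>C. \<forall>n. norm (coef (a v) n) \<le> C / wt n ^ m" by blast
qed

lemma symb_continuous:
  assumes s: "\<And>k. symb k a" and v: "v \<le> 0"
  shows "continuous_on S (a v)"
proof -
  obtain b where "\<And>v x. v \<le> 0 \<Longrightarrow> (a v has_vector_derivative of_real (2 powi (- v)) * b v x) (at x)"
    using symb_SucD[OF s[of "Suc 0"]] by blast
  then show ?thesis
    using v by (intro continuous_at_imp_continuous_on ballI) (metis has_vector_derivative_continuous)
qed

section \<open>The kernel of the inverse square root of the Laplacian\<close>

lemma coef_even:
  fixes F :: "real \<Rightarrow> real"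
  assumes cont: "continuous_on {- pi..pi} F" and even: "\<And>x. F (- x) = F x"
  shows "coef (\<lambda>x. of_real (F x)) n = of_real (1 / pi * integral {0..pi} (\<lambda>x. F x * cos (of_int n * x)))"
proof -
  let ?f = "\<lambda>x. of_real (F x) * expi (- n) x"
  have c0: "continuous_on {0..pi} F" by (rule continuous_on_subset[OF cont]) auto
  have i: "?f integrable_on {- pi..pi}"
    by (intro integrable_continuous_real continuous_intros cont)
  have i1: "(\<lambda>x. of_real (F x) * expi m x) integrable_on {0..pi}" for m
    by (intro integrable_continuous_real continuous_intros c0)
  have "integral {- pi..pi} ?f = integral {- pi..0} ?f + integral {0..pi} ?f"
    using Henstock_Kurzweil_Integration.integral_combine[OF _ _ i, of 0] by simp
  also have "integral {- pi..0} ?f = integral {0..pi} (\<lambda>x. ?f (- x))"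
    using Henstock_Kurzweil_Integration.integral_reflect_real[of pi 0 "\<lambda>x. ?f (- x)"] by simp
  also have "(\<lambda>x. ?f (- x)) = (\<lambda>x. of_real (F x) * expi n x)"
    by (simp add: even expi_def)
  also have "integral {0..pi} (\<lambda>x. of_real (F x) * expi n x) + integral {0..pi} ?f =
      integral {0..pi} (\<lambda>x. of_real (F x) * expi n x + ?f x)"
    by (rule Henstock_Kurzweil_Integration.integral_add[OF i1 i1, symmetric])
  also have "\<dots> = integral {0..pi} (\<lambda>x. of_real (2 * (F x * cos (of_int n * x))))"
    by (rule integral_cong) (simp add: expi_cis complex_eq_iff)
  also have "\<dots> = of_real (integral {0..pi} (\<lambda>x. 2 * (F x * cos (of_int n * x))))"
    by (rule integral_unique, rule has_integral_of_real, rule integrable_integral, rule integrable_continuous_real)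
       (intro continuous_intros c0)
  also have "integral {0..pi} (\<lambda>x. 2 * (F x * cos (of_int n * x))) = 2 * integral {0..pi} (\<lambda>x. F x * cos (of_int n * x))"
    by simp
  finally show ?thesis by (simp add: coef_def)
qed

lemma heat_kernel_coef: "of_real (heat_kernel t n) = coef (\<lambda>x. of_real (exp (- 2 * t * (1 - cos x)))) n"
  unfolding heat_kernel_def
  by (rule coef_even[symmetric]) (auto intro!: continuous_intros)

text \<open>The kernel of the positive square root of the Laplacian. The inverse square root is this
  operator applied after one inverse Laplacian; in this form the symbol is bounded at 0 and the
  kernel is summable.\<close>

definition sqrt_kernel :: "int \<Rightarrow> complex" where
  "sqrt_kernel = coef (\<lambda>x. of_real (2 * \<bar>sin (x / 2)\<bar>))"

lemma half_integer_nonzero: "real_of_int n + 1 / 2 \<noteq> 0" "real_of_int n - 1 / 2 \<noteq> 0"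
proof -
  have "2 * n + 1 \<noteq> 0" "2 * n - 1 \<noteq> 0" by presburger+
  then have "real_of_int (2 * n + 1) \<noteq> 0" "real_of_int (2 * n - 1) \<noteq> 0" by (simp_all only: of_int_eq_0_iff not_False_eq_True)
  then show "real_of_int n + 1 / 2 \<noteq> 0" "real_of_int n - 1 / 2 \<noteq> 0" by (simp_all add: field_simps)
qed

text \<open>On \<open>{0..pi}\<close>, 2 sin(x/2) cos(nx) is a difference of two sines with
  half-integer frequencies. The closed form turns decay of differences into a statement about
  reciprocals of n - 1/2.\<close>

lemma sqrt_kernel_eq: "sqrt_kernel n = of_real (1 / pi * (1 / (of_int n + 1 / 2) - 1 / (of_int n - 1 / 2)))"
proof -
  define a where "a = real_of_int n + 1 / 2"
  define b where "b = real_of_int n - 1 / 2"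
  have ab: "a \<noteq> 0" "b \<noteq> 0" using half_integer_nonzero by (simp_all add: a_def b_def)
  have "((\<lambda>x. sin (a * x) - sin (b * x)) has_integral
      (- cos (a * pi) / a + cos (b * pi) / b) - (- cos (a * 0) / a + cos (b * 0) / b)) {0..pi}"
    by (rule fundamental_theorem_of_calculus)
       (use ab in \<open>auto intro!: derivative_eq_intros simp: has_real_derivative_iff_has_vector_derivative[symmetric]\<close>)
  moreover have "cos (a * pi) = 0" "cos (b * pi) = 0"
  proof -
    have "a * pi = pi * of_int n + pi / 2" "b * pi = pi * of_int n - pi / 2" by (simp_all add: a_def b_def algebra_simps)
    moreover have "sin (pi * of_int n) = 0"
      unfolding sin_zero_iff_int2 by (rule exI[of _ n]) simp
    ultimately show "cos (a * pi) = 0" "cos (b * pi) = 0"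
      by (simp_all only: cos_add cos_diff cos_pi_half sin_pi_half mult_zero_left mult_zero_right diff_0_right add_0_right)
  qed
  ultimately have int: "((\<lambda>x. sin (a * x) - sin (b * x)) has_integral 1 / a - 1 / b) {0..pi}" by simp
  have "sqrt_kernel n = of_real (1 / pi * integral {0..pi} (\<lambda>x. (2 * \<bar>sin (x / 2)\<bar>) * cos (of_int n * x)))"
    unfolding sqrt_kernel_def by (rule coef_even) (auto intro!: continuous_intros)
  also have "integral {0..pi} (\<lambda>x. (2 * \<bar>sin (x / 2)\<bar>) * cos (of_int n * x)) = integral {0..pi} (\<lambda>x. sin (a * x) - sin (b * x))"
  proof (rule integral_cong)
    fix x assume "x \<in> {0..pi}"
    then have "0 \<le> sin (x / 2)" by (intro sin_ge_zero) auto
    moreover have "a * x = of_int n * x + x / 2" "b * x = of_int n * x - x / 2" by (simp_all add: a_def b_def algebra_simps)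
    ultimately show "(2 * \<bar>sin (x / 2)\<bar>) * cos (of_int n * x) = sin (a * x) - sin (b * x)"
      by (simp add: sin_add sin_diff)
  qed
  also have "\<dots> = 1 / a - 1 / b" using int by (rule integral_unique)
  finally show ?thesis by (simp only: a_def b_def)
qed

lemma forward_diff_power_inverse:
  "(forward_diff ^^ j) (\<lambda>n. 1 / (of_int n - 1 / 2)) =
    (\<lambda>n. (- 1) ^ j * fact j / (\<Prod>i\<le>j. of_int n + of_nat i - 1 / 2))"
proof (induction j)
  case (Suc j)
  have nz: "(of_int n + of_nat i - 1 / 2 :: complex) \<noteq> 0" for n :: int and i :: nat
  proof -
    have "(of_int n + of_nat i - 1 / 2 :: complex) = of_real (real_of_int (n + int i) - 1 / 2)" by simp
    then show ?thesis using half_integer_nonzero(2)[of "n + int i"] by (simp only: of_real_eq_0_iff not_False_eq_True)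
  qed
  have "forward_diff (\<lambda>n. (- 1) ^ j * fact j / (\<Prod>i\<le>j. of_int n + of_nat i - 1 / 2)) n =
    (- 1) ^ Suc j * fact (Suc j) / (\<Prod>i\<le>Suc j. of_int n + of_nat i - 1 / 2 :: complex)" for n :: int
  proof -
    define c where "c = ((- 1) ^ j * fact j :: complex)"
    define P where "P = (\<Prod>i\<in>{1..j}. of_int n + of_nat i - 1 / 2 :: complex)"
    define u where "u = (of_int n + of_nat 0 - 1 / 2 :: complex)"
    define v where "v = (of_int n + of_nat (Suc j) - 1 / 2 :: complex)"
    have P0: "P \<noteq> 0" unfolding P_def using nz by simp
    have uv0: "u \<noteq> 0" "v \<noteq> 0" unfolding u_def v_def by (rule nz)+
    have 1: "(\<Prod>i\<le>j. of_int n + of_nat i - 1 / 2 :: complex) = u * P"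
    proof -
      have "{..j} = insert 0 {1..j}" by auto
      then show ?thesis by (simp add: P_def u_def)
    qed
    have 2: "(\<Prod>i\<le>j. of_int (n + 1) + of_nat i - 1 / 2 :: complex) = P * v"
    proof -
      have "(\<Prod>i\<le>j. of_int (n + 1) + of_nat i - 1 / 2 :: complex) = (\<Prod>i\<in>{1..Suc j}. of_int n + of_nat i - 1 / 2)"
        by (rule prod.reindex_bij_witness[where i = "\<lambda>i. i - 1" and j = Suc]) auto
      also have "{1..Suc j} = insert (Suc j) {1..j}" by auto
      finally show ?thesis by (simp add: P_def v_def mult.commute)
    qed
    have 3: "(\<Prod>i\<le>Suc j. of_int n + of_nat i - 1 / 2 :: complex) = u * P * v"
      unfolding prod.atMost_Suc 1 by (simp add: v_def)
    have "c / (P * v) - c / (u * P) = c * (u - v) / (u * P * v)"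
      using P0 uv0 by (simp add: field_simps)
    moreover have "u - v = - of_nat (Suc j)" by (simp add: u_def v_def)
    ultimately have "c / (P * v) - c / (u * P) = - (c * of_nat (Suc j)) / (u * P * v)"
      by (simp only: mult_minus_right)
    then show ?thesis unfolding forward_diff_def 1 2 3 c_def[symmetric]
      by (simp add: c_def mult_ac)
  qed
  then show ?case using Suc by simp
qed simp

lemma forward_diff_power_inverse_bound:
  "\<exists>C. \<forall>n. norm ((forward_diff ^^ j) (\<lambda>n. 1 / (of_int n - 1 / 2)) n) \<le> C / wt n ^ Suc j"
proof -
  have factor: "wt n \<le> real (2 * i + 4) * norm (of_int n + of_nat i - 1 / 2 :: complex)" for n i
  proof -
    have eq: "norm (of_int n + of_nat i - 1 / 2 :: complex) = \<bar>real_of_int (n + int i) - 1 / 2\<bar>"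
    proof -
      have "(of_int n + of_nat i - 1 / 2 :: complex) = of_real (real_of_int (n + int i) - 1 / 2)" by simp
      then show ?thesis by (simp only: norm_of_real)
    qed
    define y where "y = \<bar>real_of_int (n + int i) - 1 / 2\<bar>"
    have half: "1 / 2 \<le> y"
    proof -
      have "n + int i \<le> 0 \<or> 1 \<le> n + int i" by presburger
      then have "real_of_int (n + int i) \<le> 0 \<or> 1 \<le> real_of_int (n + int i)" by linarith
      then show ?thesis unfolding y_def by linarith
    qed
    have "\<bar>real_of_int n\<bar> \<le> y + real i + 1 / 2" unfolding y_def by simp
    then have "wt n \<le> 1 + (y + real i + 1 / 2)" by (simp add: wt_def)
    also have "\<dots> = y + (2 * real i + 3) * (1 / 2)" by (simp add: field_simps)
    also have "\<dots> \<le> y + (2 * real i + 3) * y"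
      using half by (intro add_left_mono mult_left_mono) auto
    also have "\<dots> = real (2 * i + 4) * y" by (simp add: algebra_simps)
    finally show ?thesis unfolding eq y_def .
  qed
  define C where "C = (fact j * (\<Prod>i\<le>j. real (2 * i + 4)) :: real)"
  have "norm ((forward_diff ^^ j) (\<lambda>n. 1 / (of_int n - 1 / 2)) n) \<le> C / wt n ^ Suc j" for n
  proof -
    define Q where "Q = norm (\<Prod>i\<le>j. of_int n + of_nat i - 1 / 2 :: complex)"
    have "(\<Prod>i\<le>j. wt n) \<le> (\<Prod>i\<le>j. real (2 * i + 4) * norm (of_int n + of_nat i - 1 / 2 :: complex))"
      by (rule prod_mono) (use factor in simp)
    then have le: "wt n ^ Suc j \<le> (\<Prod>i\<le>j. real (2 * i + 4)) * Q"
      by (simp add: prod.distrib Q_def prod_norm)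
    have "0 < wt n ^ Suc j" by (rule wt_power_pos)
    then have "0 < (\<Prod>i\<le>j. real (2 * i + 4)) * Q" using le by linarith
    then have Q: "0 < Q" by (simp add: zero_less_mult_iff Q_def) 
    have "fact j * wt n ^ Suc j \<le> fact j * ((\<Prod>i\<le>j. real (2 * i + 4)) * Q)"
      using le by (intro mult_left_mono) auto
    then have "fact j / Q \<le> C / wt n ^ Suc j"
      using Q \<open>0 < wt n ^ Suc j\<close> unfolding C_def by (simp add: divide_simps mult_ac del: power_Suc)
    moreover have "norm ((forward_diff ^^ j) (\<lambda>n. 1 / (of_int n - 1 / 2)) n) = fact j / Q"
      unfolding forward_diff_power_inverse Q_def by (simp add: norm_divide norm_mult norm_power)
    ultimately show ?thesis by simp
  qed
  then show ?thesis by blast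
qed

text \<open>Up to a constant the kernel is the forward difference of 1/(n - 1/2), so it is of order
  -2; each Laplacian is two more differences and gains two more powers. The corner of the symbol
  prevents anything better at j = 0.\<close>

lemma sqrt_kernel_decay: "\<exists>C. \<forall>n. norm ((laplacian ^^ j) sqrt_kernel n) \<le> C / wt n ^ (2 * j + 2)"
proof -
  define b where "b = (\<lambda>n. 1 / (of_int n - 1 / 2) :: complex)"
  have k: "sqrt_kernel = (\<lambda>n. of_real (1 / pi) * forward_diff b n)"
  proof
    fix n
    have "real_of_int (n + 1) - 1 / 2 = of_int n + 1 / 2" by simp
    then show "sqrt_kernel n = of_real (1 / pi) * forward_diff b n"
      unfolding sqrt_kernel_eq forward_diff_def b_def by simp
  qed
  obtain C where C: "\<And>n. norm ((forward_diff ^^ (Suc (2 * j))) b n) \<le> C / wt n ^ Suc (Suc (2 * j))"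
    using forward_diff_power_inverse_bound[of "Suc (2 * j)"] unfolding b_def by blast
  have C0: "0 \<le> C" using order_trans[OF norm_ge_zero C[of 0]] by (simp add: wt_def)
  have eq: "(laplacian ^^ j) sqrt_kernel n = (- 1) ^ j * (of_real (1 / pi) * (forward_diff ^^ Suc (2 * j)) b (n - int j))" for n
    unfolding laplacian_power_eq k forward_diff_power_cmult by (simp only: funpow_Suc_right comp_apply)
  have "norm ((laplacian ^^ j) sqrt_kernel n) \<le> (C * wt (int j) ^ (2 * j + 2)) / wt n ^ (2 * j + 2)" for n
  proof -
    have "norm ((laplacian ^^ j) sqrt_kernel n) = 1 / pi * norm ((forward_diff ^^ Suc (2 * j)) b (n - int j))"
      unfolding eq by (simp add: norm_mult norm_power norm_divide)
    also have "\<dots> \<le> 1 * (C / wt (n - int j) ^ (2 * j + 2))"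
      using C[of "n - int j"] pi_ge_two by (intro mult_mono) auto
    also have "\<dots> \<le> (C * wt (int j) ^ (2 * j + 2)) / wt n ^ (2 * j + 2)"
    proof -
      have "C * wt n ^ (2 * j + 2) \<le> C * (wt (n - int j) ^ (2 * j + 2) * wt (int j) ^ (2 * j + 2))"
        by (rule mult_left_mono[OF wt_triangle_power C0])
      then show ?thesis by (simp add: divide_simps mult_ac del: power_Suc)
    qed
    finally show ?thesis .
  qed
  then show ?thesis by blast
qed

lemma sqrt_kernel_even: "sqrt_kernel (- n) = sqrt_kernel n"
proof -
  have "1 / (- x + 1 / 2) - 1 / (- x - 1 / 2) = 1 / (x + 1 / 2) - 1 / (x - 1 / 2)"
    if "x + 1 / 2 \<noteq> 0" "x - 1 / 2 \<noteq> 0" for x :: real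
    using that by (simp add: divide_simps) (simp add: algebra_simps)
  from this[OF half_integer_nonzero] show ?thesis unfolding sqrt_kernel_eq of_int_minus by simp
qed

section \<open>Evaluation of the heat integral on images of the Laplacian\<close>

lemma fourier_shift: "fourier (\<lambda>n. g (n + k)) x = expi (- k) x * fourier g x"
proof -
  have "fourier (\<lambda>n. g (n + k)) x = (\<Sum>\<^sub>\<infinity>n. expi (- k) x * (g (n + k) * expi (n + k) x))"
    unfolding fourier_eq
  proof (rule infsum_cong)
    fix n
    have "expi n x = expi (- k) x * expi (n + k) x" by (simp add: expi_add[symmetric])
    then show "g (n + k) * expi n x = expi (- k) x * (g (n + k) * expi (n + k) x)" by simp
  qed
  also have "\<dots> = expi (- k) x * (\<Sum>\<^sub>\<infinity>n. g (n + k) * expi (n + k) x)" by (rule infsum_cmult_right')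
  also have "(\<Sum>\<^sub>\<infinity>n. g (n + k) * expi (n + k) x) = fourier g x"
    unfolding fourier_eq by (rule infsum_int_shift)
  finally show ?thesis .
qed

lemma fourier_add: "rapid f \<Longrightarrow> rapid g \<Longrightarrow> fourier (\<lambda>n. f n + g n) x = fourier f x + fourier g x"
  unfolding fourier_eq by (subst infsum_add[symmetric]) (auto intro: fourier_summable simp: distrib_right)

lemma fourier_cmult: "fourier (\<lambda>n. c * f n) x = c * fourier f x"
  unfolding fourier_eq by (subst infsum_cmult_right'[symmetric]) (simp add: mult.assoc)

lemma cos_expi: "of_real (2 - 2 * cos x) = 2 - expi 1 x - expi (- 1) x"
  by (simp add: expi_cis complex_eq_iff)

lemma fourier_forward_diff: "rapid g \<Longrightarrow> fourier (forward_diff g) x = (expi (- 1) x - 1) * fourier g x"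
  using fourier_add[OF rapid_shift[of g 1] rapid_cmult[of g "- 1"], of x] fourier_shift[of g 1 x] fourier_cmult[of "- 1" g x]
  by (simp add: forward_diff_def left_diff_distrib)

lemma fourier_laplacian: "rapid g \<Longrightarrow> fourier (laplacian g) x = of_real (2 - 2 * cos x) * fourier g x"
proof -
  assume g: "rapid g"
  have "fourier (laplacian g) x = - 1 * (expi 1 x * ((expi (- 1) x - 1) * ((expi (- 1) x - 1) * fourier g x)))"
    unfolding laplacian_eq fourier_cmult fourier_shift
    using g by (simp add: fourier_forward_diff rapid_forward_diff)
  also have "\<dots> = - (expi 1 x * (expi (- 1) x * expi (- 1) x) - 2 * (expi 1 x * expi (- 1) x) + expi 1 x) * fourier g x"
    by (simp add: algebra_simps)
  also have "\<dots> = of_real (2 - 2 * cos x) * fourier g x"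
    unfolding cos_expi by (simp add: expi_add[symmetric])
  finally show ?thesis .
qed

lemma two_minus_two_cos: "2 - 2 * cos x = (2 * \<bar>sin (x / 2)\<bar>)\<^sup>2" for x :: real
proof -
  have "cos x = 1 - 2 * (sin (x / 2))\<^sup>2" using cos_double_sin[of "x / 2"] by simp
  then show ?thesis by (simp add: power_mult_distrib)
qed

text \<open>Euler's integral for Gamma(1/2) after the substitution of w t for t. Here
  \<open>w\<close> will be the value 2 - 2 cos x of the Laplacian's symbol.\<close>

lemma gamma_half_integral:
  fixes w :: real
  assumes w: "0 < w"
  shows "has_bochner_integral lborel (\<lambda>t. indicator {0<..} t * (sqrt t / t * exp (- t * w))) (Gamma (1 / 2) / sqrt w)"
proof -
  define f where "f t = indicator {0..} t * t powr (1 / 2 - 1) / exp t" for t :: real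
  have mf: "f \<in> borel_measurable borel" unfolding f_def[abs_def] by measurable
  have f0: "0 \<le> f t" for t by (auto simp: f_def indicator_def)
  have nn: "(\<integral>\<^sup>+ t. ennreal (f t) \<partial>lborel) = ennreal (Gamma (1 / 2))"
    using Gamma_conv_nn_integral_real[of "1 / 2"] by (simp add: f_def)
  have G0: "0 \<le> Gamma (1 / 2 :: real)" using Gamma_real_pos[of "1 / 2"] by linarith
  have mf': "f \<in> borel_measurable lborel" using mf by simp
  have "has_bochner_integral lborel f (Gamma (1 / 2))"
    by (rule has_bochner_integral_nn_integral[OF mf' _ G0 nn]) (rule AE_I2, rule f0)
  then have "has_bochner_integral lborel (\<lambda>x. f (0 + w * x)) (Gamma (1 / 2) /\<^sub>R \<bar>w\<bar>)"
    using lborel_has_bochner_integral_real_affine_iff[of w f "Gamma (1 / 2)" 0] w by blast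
  then have "has_bochner_integral lborel (\<lambda>x. sqrt w * f (0 + w * x)) (sqrt w * (Gamma (1 / 2) /\<^sub>R \<bar>w\<bar>))"
    by (rule has_bochner_integral_mult_right)
  moreover have "sqrt w * f (0 + w * t) = indicator {0<..} t * (sqrt t / t * exp (- t * w))" for t
  proof (cases "0 < t")
    case True
    have pos: "0 < w * t" using w True by simp
    have "(w * t) powr (1 / 2 - 1) = (w * t) powr (- (1 / 2))" by simp
    also have "\<dots> = inverse (sqrt (w * t))"
      unfolding powr_minus using pos by (simp only: powr_half_sqrt)
    finally have f: "f (0 + w * t) = inverse (sqrt (w * t)) / exp (w * t)"
      using pos by (simp add: f_def)
    have "sqrt w * inverse (sqrt (w * t)) = inverse (sqrt t)"
      using w by (simp add: real_sqrt_mult)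
    moreover have "sqrt t / t = inverse (sqrt t)"
      using True by (intro sqrt_divide_self_eq) simp
    moreover have "exp (- t * w) = inverse (exp (w * t))" by (simp only: mult_minus_left exp_minus mult.commute[of t w])
    ultimately have "sqrt w * (inverse (sqrt (w * t)) / exp (w * t)) = sqrt t / t * exp (- t * w)"
      by (simp only: divide_inverse mult.assoc[symmetric])
    then show ?thesis using True unfolding f by simp
  next
    case False
    show ?thesis
    proof (cases "t = 0")
      case False
      then have "w * t < 0" using w \<open>\<not> 0 < t\<close> by (simp add: mult_pos_neg)
      then show ?thesis using \<open>\<not> 0 < t\<close> by (simp add: f_def)
    qed (simp add: f_def)
  qed
  moreover have "sqrt w * (c /\<^sub>R \<bar>w\<bar>) = c / sqrt w" for c
  proof -
    have "sqrt w / w = inverse (sqrt w)" using w by (intro sqrt_divide_self_eq) simp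
    moreover have "sqrt w * (c /\<^sub>R \<bar>w\<bar>) = c * (sqrt w / w)" using w by (simp add: divide_inverse)
    ultimately show ?thesis by (simp only: divide_inverse)
  qed
  ultimately show ?thesis by (simp only:)
qed

lemma heat_laplacian:
  assumes g: "rapid g"
  shows "heat t (laplacian g) n =
    coef (\<lambda>x. of_real (exp (- t * (2 - 2 * cos x))) * (of_real (2 - 2 * cos x) * fourier g x)) n"
proof -
  have e: "- 2 * t * (1 - cos x) = - t * (2 - 2 * cos x)" for x by (simp add: algebra_simps)
  have "heat t (laplacian g) = conv (coef (\<lambda>x. of_real (exp (- 2 * t * (1 - cos x))))) (laplacian g)"
    unfolding heat_def heat_kernel_coef ..
  also have "\<dots> = coef (\<lambda>x. of_real (exp (- 2 * t * (1 - cos x))) * fourier (laplacian g) x)"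
    by (rule coef_mult_fourier[symmetric]) (auto intro!: continuous_intros rapid_laplacian g)
  finally show ?thesis by (simp only: fourier_laplacian[OF g] e)
qed

text \<open>The bridge from the gauge integral inside \<open>coef\<close> to the Lebesgue integral,
  for which Fubini's theorem is applied.\<close>

lemma coef_lborel:
  assumes "continuous_on {- pi..pi} a"
  shows "coef a n = of_real (1 / (2 * pi)) * (LINT x|lborel. indicator {- pi..pi} x *\<^sub>R (a x * expi (- n) x))"
    and "integrable lborel (\<lambda>x. indicator {- pi..pi} x *\<^sub>R (a x * expi (- n) x))"
proof -
  have "continuous_on {- pi..pi} (\<lambda>x. a x * expi (- n) x)" by (intro continuous_intros assms)
  then have s: "set_integrable lborel {- pi..pi} (\<lambda>x. a x * expi (- n) x)"
    by (rule borel_integrable_atLeastAtMost')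
  then show "integrable lborel (\<lambda>x. indicator {- pi..pi} x *\<^sub>R (a x * expi (- n) x))"
    by (simp add: set_integrable_def)
  from set_borel_integral_eq_integral(2)[OF s]
  show "coef a n = of_real (1 / (2 * pi)) * (LINT x|lborel. indicator {- pi..pi} x *\<^sub>R (a x * expi (- n) x))"
    unfolding coef_def set_lebesgue_integral_def by simp
qed

text \<open>The integrals over t and x are exchanged; the one over t turns the symbol
  \<open>w\<close> of the Laplacian into \<open>w / sqrt w\<close>, which is 2|sin(x/2)|. The factor
  \<open>w\<close> supplied by the Laplacian gives absolute integrability near x = 0.\<close>

lemma laplacian_inv_sqrt_laplacian:
  assumes g: "rapid g"
  shows "laplacian_inv_sqrt (laplacian g) = conv sqrt_kernel g"
proof
  fix n
  define w where "w x = 2 - 2 * cos x" for x :: real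
  define \<Gamma> where "\<Gamma> = Gamma (1 / 2 :: real)"
  have G0: "0 < \<Gamma>" by (simp add: \<Gamma>_def)
  define H where "H x = indicator {- pi..pi} x *\<^sub>R (of_real (w x) * fourier g x * expi (- n) x)" for x
  define K where "K t x = indicator {0<..} t * (sqrt t / t * exp (- t * w x))" for t x :: real
  have w0: "0 \<le> w x" for x by (simp add: w_def)
  have cw: "continuous_on S (\<lambda>x. of_real (w x) * fourier g x)" for S
    unfolding w_def by (intro continuous_intros fourier_continuous g)
  have cs: "continuous_on S (\<lambda>x. of_real (2 * \<bar>sin (x / 2)\<bar>) * fourier g x)" for S
    by (auto intro!: continuous_intros fourier_continuous g)
  have sw: "sqrt (w x) = 2 * \<bar>sin (x / 2)\<bar>" for x
    unfolding w_def two_minus_two_cos by (subst real_sqrt_abs) simp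
  have Kint: "has_bochner_integral lborel (\<lambda>t. K t x) (\<Gamma> / sqrt (w x))" if "w x \<noteq> 0" for x
    unfolding K_def \<Gamma>_def using that w0[of x] by (intro gamma_half_integral) auto
  \<comment> \<open>At zeros of \<open>w\<close> the integral over t has no decay, but there the
    whole integrand vanishes.\<close>
  have Hz: "H x = 0" if "w x = 0" for x using that by (simp add: H_def)
  have inner: "has_bochner_integral lborel (\<lambda>t. K t x *\<^sub>R H x) ((\<Gamma> / sqrt (w x)) *\<^sub>R H x)" for x
  proof (cases "w x = 0")
    case True
    then show ?thesis by (simp add: Hz has_bochner_integral_zero)
  next
    case False
    show ?thesis by (rule has_bochner_integral_scaleR_left) (rule Kint[OF False])
  qed
  have outer_eq: "(\<Gamma> / sqrt (w x)) *\<^sub>R H x = \<Gamma> *\<^sub>R (indicator {- pi..pi} x *\<^sub>R (of_real (2 * \<bar>sin (x / 2)\<bar>) * fourier g x * expi (- n) x))" for x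
  proof (cases "w x = 0")
    case True
    then show ?thesis using sw[of x] by (simp add: Hz)
  next
    case False
    then have "0 < w x" using w0[of x] by linarith
    then have e: "w x / sqrt (w x) = 2 * \<bar>sin (x / 2)\<bar>" using real_div_sqrt[OF w0[of x]] sw[of x] by (simp only:)
    have "(\<Gamma> / sqrt (w x)) *\<^sub>R H x = \<Gamma> *\<^sub>R (indicator {- pi..pi} x *\<^sub>R (of_real (w x / sqrt (w x)) * fourier g x * expi (- n) x))"
      by (simp add: H_def scaleR_conv_of_real mult_ac)
    then show ?thesis unfolding e .
  qed
  have measf: "fourier g \<in> borel_measurable borel" by (rule borel_measurable_continuous_onI) (rule fourier_continuous[OF g])
  have mease: "expi m \<in> borel_measurable borel" for m by (rule borel_measurable_continuous_onI) (rule continuous_expi)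
  have measH: "H \<in> borel_measurable borel"
    unfolding H_def[abs_def] w_def using measf mease by measurable
  have measK: "(\<lambda>(x, t). K t x) \<in> borel_measurable (lborel \<Otimes>\<^sub>M lborel)"
    unfolding K_def w_def by measurable
  have Knn: "0 \<le> K t x" for t x by (auto simp: K_def indicator_def)
  have integ: "integrable (lborel \<Otimes>\<^sub>M lborel) (\<lambda>(x, t). K t x *\<^sub>R H x)"
  proof (rule lborel_pair.Fubini_integrable)
    show "(\<lambda>(x, t). K t x *\<^sub>R H x) \<in> borel_measurable (lborel \<Otimes>\<^sub>M lborel)"
      using measK measH by measurable
    have "(LINT t|lborel. norm (case (x, t) of (x, t) \<Rightarrow> K t x *\<^sub>R H x)) =
        norm (\<Gamma> *\<^sub>R (indicator {- pi..pi} x *\<^sub>R (of_real (2 * \<bar>sin (x / 2)\<bar>) * fourier g x * expi (- n) x)))" for x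
    proof -
      have "(LINT t|lborel. norm (case (x, t) of (x, t) \<Rightarrow> K t x *\<^sub>R H x)) = (LINT t|lborel. K t x * norm (H x))"
        using Knn by simp
      also have "\<dots> = norm ((\<Gamma> / sqrt (w x)) *\<^sub>R H x)"
      proof (cases "w x = 0")
        case True
        then show ?thesis by (simp add: Hz)
      next
        case False
        have "has_bochner_integral lborel (\<lambda>t. K t x * norm (H x)) (\<Gamma> / sqrt (w x) * norm (H x))"
          by (rule has_bochner_integral_mult_left) (rule Kint[OF False])
        from has_bochner_integral_integral_eq[OF this]
        show ?thesis using G0 w0[of x] by simp
      qed
      finally show ?thesis unfolding outer_eq .
    qed
    moreover have "integrable lborel (\<lambda>x. norm (\<Gamma> *\<^sub>R (indicator {- pi..pi} x *\<^sub>R (of_real (2 * \<bar>sin (x / 2)\<bar>) * fourier g x * expi (- n) x))))"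
      by (intro integrable_norm integrable_scaleR_right coef_lborel(2)[OF cs])
    ultimately show "integrable lborel (\<lambda>x. LINT t|lborel. norm (case (x, t) of (x, t) \<Rightarrow> K t x *\<^sub>R H x))"
      by simp
    show "AE x in lborel. integrable lborel (\<lambda>t. case (x, t) of (x, t) \<Rightarrow> K t x *\<^sub>R H x)"
      by (rule AE_I2) (simp, rule integrable.intros, rule inner)
  qed
  have heat_eq: "indicator {0<..} t *\<^sub>R (of_real (sqrt t / t) * heat t (laplacian g) n) =
      of_real (1 / (2 * pi)) * (LINT x|lborel. K t x *\<^sub>R H x)" for t
  proof -
    have c: "continuous_on {- pi..pi} (\<lambda>x. of_real (exp (- t * w x)) * (of_real (w x) * fourier g x))"
      by (intro continuous_on_mult[OF _ cw]) (unfold w_def, intro continuous_intros)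
    have "heat t (laplacian g) n = of_real (1 / (2 * pi)) *
        (LINT x|lborel. indicator {- pi..pi} x *\<^sub>R (of_real (exp (- t * w x)) * (of_real (w x) * fourier g x) * expi (- n) x))"
      unfolding heat_laplacian[OF g] w_def[symmetric] by (rule coef_lborel(1)[OF c])
    also have "(LINT x|lborel. indicator {- pi..pi} x *\<^sub>R (of_real (exp (- t * w x)) * (of_real (w x) * fourier g x) * expi (- n) x))
       = (LINT x|lborel. exp (- t * w x) *\<^sub>R H x)"
      by (rule Bochner_Integration.integral_cong) (auto simp: H_def scaleR_conv_of_real mult_ac)
    finally have "indicator {0<..} t *\<^sub>R (of_real (sqrt t / t) * heat t (laplacian g) n) =
       of_real (1 / (2 * pi)) * ((indicator {0<..} t * (sqrt t / t)) *\<^sub>R (LINT x|lborel. exp (- t * w x) *\<^sub>R H x))"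
      by (simp add: scaleR_conv_of_real mult_ac)
    also have "(indicator {0<..} t * (sqrt t / t)) *\<^sub>R (LINT x|lborel. exp (- t * w x) *\<^sub>R H x) = (LINT x|lborel. K t x *\<^sub>R H x)"
      by (subst integral_scaleR_right[symmetric]) (simp add: K_def mult.assoc)
    finally show ?thesis .
  qed
  have "(LINT t|lborel. LINT x|lborel. K t x *\<^sub>R H x) = (LINT x|lborel. LINT t|lborel. K t x *\<^sub>R H x)"
    using lborel_pair.Fubini_integral[OF integ] by simp
  also have "\<dots> = (LINT x|lborel. \<Gamma> *\<^sub>R (indicator {- pi..pi} x *\<^sub>R (of_real (2 * \<bar>sin (x / 2)\<bar>) * fourier g x * expi (- n) x)))"
    unfolding outer_eq[symmetric]
    by (rule Bochner_Integration.integral_cong[OF refl]) (rule has_bochner_integral_integral_eq[OF inner])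
  also have "\<dots> = \<Gamma> *\<^sub>R (LINT x|lborel. indicator {- pi..pi} x *\<^sub>R (of_real (2 * \<bar>sin (x / 2)\<bar>) * fourier g x * expi (- n) x))"
    by (rule integral_scaleR_right)
  finally have fub: "(LINT t|lborel. LINT x|lborel. K t x *\<^sub>R H x) =
     \<Gamma> *\<^sub>R (LINT x|lborel. indicator {- pi..pi} x *\<^sub>R (of_real (2 * \<bar>sin (x / 2)\<bar>) * fourier g x * expi (- n) x))" .
  have "laplacian_inv_sqrt (laplacian g) n = of_real (1 / \<Gamma>) * (LINT t|lborel. of_real (1 / (2 * pi)) * (LINT x|lborel. K t x *\<^sub>R H x))"
    unfolding laplacian_inv_sqrt_def set_lebesgue_integral_def heat_eq \<Gamma>_def ..
  also have "\<dots> = of_real (1 / \<Gamma>) * (of_real (1 / (2 * pi)) * (LINT t|lborel. LINT x|lborel. K t x *\<^sub>R H x))"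
    by (subst integral_mult_right_zero) simp
  also have "\<dots> = of_real (1 / (2 * pi)) * (LINT x|lborel. indicator {- pi..pi} x *\<^sub>R (of_real (2 * \<bar>sin (x / 2)\<bar>) * fourier g x * expi (- n) x))"
    unfolding fub using G0 by (simp add: scaleR_conv_of_real)
  also have "\<dots> = coef (\<lambda>x. of_real (2 * \<bar>sin (x / 2)\<bar>) * fourier g x) n"
    by (rule coef_lborel(1)[OF cs, symmetric])
  also have "coef (\<lambda>x. of_real (2 * \<bar>sin (x / 2)\<bar>) * fourier g x) = conv sqrt_kernel g"
    unfolding sqrt_kernel_def by (rule coef_mult_fourier[OF _ g]) (auto intro!: continuous_intros)
  finally show "laplacian_inv_sqrt (laplacian g) n = conv sqrt_kernel g n" .
qed

section \<open>Duality modulo polynomials\<close>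

lemma rapid_forward_diff_eq_zero:
  assumes d: "rapid d" and z: "forward_diff d = (\<lambda>n. 0)"
  shows "d = (\<lambda>n. 0)"
proof -
  have step: "d (n + 1) = d n" for n using fun_cong[OF z, of n] by (simp add: forward_diff_def)
  have const: "d n = d 0" for n
  proof (induction n rule: int_induct[where k = 0])
    case (step2 i)
    then show ?case using step[of "i - 1"] by simp
  qed (simp_all add: step)
  obtain C where C: "0 \<le> C" "\<And>n. norm (d n) \<le> C / wt n ^ 1" using d by (metis rapidE)
  have le: "norm (d 0) \<le> C * inverse (real (Suc N))" for N
    using C(2)[of "int N"] const[of "int N"] by (simp add: wt_def divide_inverse)
  have "(\<lambda>N. C * inverse (real (Suc N))) \<longlonglongrightarrow> C * 0"
    by (rule tendsto_mult[OF tendsto_const LIMSEQ_inverse_real_of_nat])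
  then have "norm (d 0) \<le> C * 0"
    by (rule LIMSEQ_le_const) (use le in blast)
  then have "d n = 0" for n using const[of n] by simp
  then show ?thesis by (rule ext)
qed

text \<open>The second difference of f - g vanishes, so the first difference is constant and
  decaying, hence 0, and then so is f - g itself. Iterated, this is the uniqueness on which the
  \<open>THE\<close> in \<open>schwartz_inf_seminorm\<close> relies.\<close>

lemma laplacian_inj:
  assumes "rapid f" "rapid g" "laplacian f = laplacian g"
  shows "f = g"
proof -
  define d where "d = (\<lambda>n. f n + - 1 * g n)"
  have d: "rapid d" unfolding d_def by (intro rapid_add rapid_cmult assms)
  have "laplacian d n = laplacian f n - laplacian g n" for n by (simp add: laplacian_def d_def)
  then have "laplacian d n = 0" for n using assms(3) by simp
  then have z: "forward_diff (forward_diff d) (n - 1) = 0" for n by (simp add: laplacian_forward_diff)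
  have "forward_diff (forward_diff d) n = 0" for n using z[of "n + 1"] by simp
  then have "forward_diff (forward_diff d) = (\<lambda>n. 0)" by (rule ext)
  then have "forward_diff d = (\<lambda>n. 0)" by (rule rapid_forward_diff_eq_zero[OF rapid_forward_diff[OF d]])
  then have "d = (\<lambda>n. 0)" by (rule rapid_forward_diff_eq_zero[OF d])
  then have "d n = 0" for n by simp
  then have "f n = g n" for n by (simp add: d_def)
  then show ?thesis by (rule ext)
qed

lemma laplacian_power_inj:
  "rapid f \<Longrightarrow> rapid g \<Longrightarrow> (laplacian ^^ k) f = (laplacian ^^ k) g \<Longrightarrow> f = g"
proof (induction k)
  case (Suc k)
  have "laplacian ((laplacian ^^ k) f) = laplacian ((laplacian ^^ k) g)" using Suc.prems(3) by simp
  then have "(laplacian ^^ k) f = (laplacian ^^ k) g"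
    by (rule laplacian_inj[OF rapid_laplacian_power[OF Suc.prems(1)] rapid_laplacian_power[OF Suc.prems(2)]])
  then show ?case by (rule Suc.IH[OF Suc.prems(1,2)])
qed simp

section \<open>Stability of \<open>schwartz_inf\<close>, also under the inverse square root\<close>

lemma schwartz_infD: "g \<in> schwartz_inf \<Longrightarrow> rapid g"
  "g \<in> schwartz_inf \<Longrightarrow> \<exists>h. rapid h \<and> g = (laplacian ^^ k) h"
  by (simp_all add: schwartz_inf_def Bex_def schwartz_iff_rapid)

lemma schwartz_infI:
  assumes "\<And>k. \<exists>h. rapid h \<and> g = (laplacian ^^ k) h"
  shows "g \<in> schwartz_inf"
proof -
  have "rapid g" using assms[of 0] by auto
  with assms show ?thesis by (simp add: schwartz_inf_def Bex_def schwartz_iff_rapid)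
qed

lemma schwartz_inf_subset: "g \<in> schwartz_inf \<Longrightarrow> g \<in> schwartz"
  by (simp add: schwartz_inf_def)

lemma schwartz_inf_add: "f \<in> schwartz_inf \<Longrightarrow> g \<in> schwartz_inf \<Longrightarrow> (\<lambda>n. f n + g n) \<in> schwartz_inf"
proof (rule schwartz_infI)
  fix k assume f: "f \<in> schwartz_inf" and g: "g \<in> schwartz_inf"
  obtain a where "rapid a" "f = (laplacian ^^ k) a" using schwartz_infD(2)[OF f] by blast
  moreover obtain b where "rapid b" "g = (laplacian ^^ k) b" using schwartz_infD(2)[OF g] by blast
  ultimately show "\<exists>h. rapid h \<and> (\<lambda>n. f n + g n) = (laplacian ^^ k) h"
    by (intro exI[of _ "\<lambda>n. a n + b n"]) (simp add: laplacian_power_add rapid_add)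
qed

lemma schwartz_inf_cmult: "f \<in> schwartz_inf \<Longrightarrow> (\<lambda>n. c * f n) \<in> schwartz_inf"
proof (rule schwartz_infI)
  fix k assume f: "f \<in> schwartz_inf"
  obtain a where "rapid a" "f = (laplacian ^^ k) a" using schwartz_infD(2)[OF f] by blast
  then show "\<exists>h. rapid h \<and> (\<lambda>n. c * f n) = (laplacian ^^ k) h"
    by (intro exI[of _ "\<lambda>n. c * a n"]) (simp add: laplacian_power_cmult rapid_cmult)
qed

lemma laplacian_power_reflect:
  "(laplacian ^^ k) (\<lambda>m. h (n - m)) = (\<lambda>m. (laplacian ^^ k) h (n - m))"
proof (induction k)
  case (Suc k)
  then show ?case by (auto simp: laplacian_def algebra_simps)
qed simp

lemma schwartz_inf_reflect: "g \<in> schwartz_inf \<Longrightarrow> (\<lambda>m. g (n - m)) \<in> schwartz_inf"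
proof (rule schwartz_infI)
  fix k assume g: "g \<in> schwartz_inf"
  obtain a where "rapid a" "g = (laplacian ^^ k) a" using schwartz_infD(2)[OF g] by blast
  then show "\<exists>h. rapid h \<and> (\<lambda>m. g (n - m)) = (laplacian ^^ k) h"
    by (intro exI[of _ "\<lambda>m. a (n - m)"]) (simp add: laplacian_power_reflect rapid_reflect)
qed

lemma forward_diff_laplacian_power: "forward_diff ((laplacian ^^ k) h) = (laplacian ^^ k) (forward_diff h)"
proof (induction k)
  case (Suc k)
  have "forward_diff (laplacian f) = laplacian (forward_diff f)" for f
    by (auto simp: forward_diff_def laplacian_def algebra_simps)
  with Suc show ?case by simp
qed simp

lemma schwartz_inf_forward_diff: "g \<in> schwartz_inf \<Longrightarrow> forward_diff g \<in> schwartz_inf"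
proof (rule schwartz_infI)
  fix k assume g: "g \<in> schwartz_inf"
  obtain a where "rapid a" "g = (laplacian ^^ k) a" using schwartz_infD(2)[OF g] by blast
  then show "\<exists>h. rapid h \<and> forward_diff g = (laplacian ^^ k) h"
    by (intro exI[of _ "forward_diff a"]) (simp add: forward_diff_laplacian_power rapid_forward_diff)
qed

lemma sqrt_kernel_conv_summable:
  "rapid h \<Longrightarrow> (\<lambda>m. (laplacian ^^ j) sqrt_kernel (n - m) * h m) summable_on UNIV"
proof -
  assume h: "rapid h"
  obtain C where C: "\<And>n. norm ((laplacian ^^ j) sqrt_kernel n) \<le> C / wt n ^ (2 * j + 2)"
    using sqrt_kernel_decay[of j] by blast
  show ?thesis by (rule conv_rapid_decay(2)[OF C h])
qed

lemma laplacian_power_sqrt_kernel_conv: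
  assumes h: "rapid h"
  shows "(laplacian ^^ j) (conv sqrt_kernel h) = conv ((laplacian ^^ j) sqrt_kernel) h"
proof (induction j)
  case (Suc j)
  have "(laplacian ^^ Suc j) (conv sqrt_kernel h) = laplacian (conv ((laplacian ^^ j) sqrt_kernel) h)"
    by (simp add: Suc)
  also have "\<dots> = conv (laplacian ((laplacian ^^ j) sqrt_kernel)) h"
    by (rule laplacian_conv) (rule sqrt_kernel_conv_summable[OF h])
  finally show ?case by simp
qed simp

lemma conv_sqrt_kernel_laplacian:
  assumes h: "rapid h"
  shows "conv sqrt_kernel (laplacian h) = laplacian (conv sqrt_kernel h)"
proof -
  have "(\<lambda>m. h (n - m) * sqrt_kernel m) summable_on UNIV" for n
  proof -
    have "(\<lambda>m. sqrt_kernel (n - m) * h m) summable_on UNIV"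
      using sqrt_kernel_conv_summable[OF h, of 0] by simp
    then have "(\<lambda>m. sqrt_kernel (n - (n - m)) * h (n - m)) summable_on UNIV"
      by (subst summable_int_reflect)
    then show ?thesis by (simp add: mult.commute)
  qed
  from laplacian_conv[OF this] show ?thesis by (simp add: conv_commute)
qed

lemma conv_sqrt_kernel_laplacian_power:
  "rapid h \<Longrightarrow> conv sqrt_kernel ((laplacian ^^ k) h) = (laplacian ^^ k) (conv sqrt_kernel h)"
proof (induction k)
  case (Suc k)
  then show ?case by (simp add: conv_sqrt_kernel_laplacian rapid_laplacian_power)
qed simp

lemma laplacian_inv_sqrt_power:
  assumes h: "rapid h"
  shows "laplacian_inv_sqrt ((laplacian ^^ Suc k) h) = (laplacian ^^ k) (conv sqrt_kernel h)"
proof -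
  have "laplacian_inv_sqrt ((laplacian ^^ Suc k) h) = laplacian_inv_sqrt (laplacian ((laplacian ^^ k) h))" by simp
  also have "\<dots> = conv sqrt_kernel ((laplacian ^^ k) h)"
    by (intro laplacian_inv_sqrt_laplacian rapid_laplacian_power h)
  also have "\<dots> = (laplacian ^^ k) (conv sqrt_kernel h)"
    by (rule conv_sqrt_kernel_laplacian_power[OF h])
  finally show ?thesis .
qed

text \<open>Decay of any order m is bought by writing \<open>h\<close> as an m-fold Laplacian and
  moving these Laplacians onto the kernel, which they improve by two powers each.\<close>

lemma rapid_conv_sqrt_kernel:
  assumes h: "rapid h" and inf: "\<And>j. \<exists>h'. rapid h' \<and> h = (laplacian ^^ j) h'"
  shows "rapid (conv sqrt_kernel h)"
proof (rule rapidI)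
  fix m
  obtain h' where h': "rapid h'" "h = (laplacian ^^ m) h'" using inf by blast
  have eq: "conv sqrt_kernel h = conv ((laplacian ^^ m) sqrt_kernel) h'"
    unfolding h'(2) conv_sqrt_kernel_laplacian_power[OF h'(1)] by (rule laplacian_power_sqrt_kernel_conv[OF h'(1)])
  obtain C where C: "\<And>n. norm ((laplacian ^^ m) sqrt_kernel n) \<le> C / wt n ^ (2 * m + 2)"
    using sqrt_kernel_decay[of m] by blast
  have C0: "0 \<le> C" using order_trans[OF norm_ge_zero C[of 0]] by (simp add: wt_def)
  have C': "norm ((laplacian ^^ m) sqrt_kernel n) \<le> C / wt n ^ m" for n
  proof -
    have "wt n ^ m \<le> wt n ^ (2 * m + 2)" by (intro power_increasing) auto
    then have "C / wt n ^ (2 * m + 2) \<le> C / wt n ^ m" using C0 by (intro divide_left_mono) auto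
    then show ?thesis using C[of n] by linarith
  qed
  show "\<exists>C. \<forall>n. norm (conv sqrt_kernel h n) \<le> C / wt n ^ m"
    unfolding eq by (rule conv_rapid_decay(1)[OF C' h'(1)])
qed

lemma laplacian_inv_sqrt_schwartz_inf:
  assumes g: "g \<in> schwartz_inf"
  shows "laplacian_inv_sqrt g \<in> schwartz_inf"
proof (rule schwartz_infI)
  fix k
  obtain h where h: "rapid h" "g = (laplacian ^^ Suc k) h" using schwartz_infD(2)[OF g] by blast
  \<comment> \<open>The chosen preimage \<open>h\<close> is itself infinitely divisible by the
    Laplacian: preimages of different orders are compatible because the Laplacian is injective on
    rapidly decreasing sequences.\<close>
  have "\<exists>h'. rapid h' \<and> h = (laplacian ^^ j) h'" for j
  proof -
    obtain h' where h': "rapid h'" "g = (laplacian ^^ (Suc k + j)) h'" using schwartz_infD(2)[OF g] by blast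
    have "(laplacian ^^ Suc k) h = (laplacian ^^ Suc k) ((laplacian ^^ j) h')"
      using h(2) h'(2) by (simp add: funpow_add)
    then have "h = (laplacian ^^ j) h'"
      by (rule laplacian_power_inj[OF h(1) rapid_laplacian_power[OF h'(1)]])
    with h'(1) show ?thesis by blast
  qed
  then have "rapid (conv sqrt_kernel h)" by (rule rapid_conv_sqrt_kernel[OF h(1)])
  moreover have "laplacian_inv_sqrt g = (laplacian ^^ k) (conv sqrt_kernel h)"
    unfolding h(2) by (rule laplacian_inv_sqrt_power[OF h(1)])
  ultimately show "\<exists>h. rapid h \<and> laplacian_inv_sqrt g = (laplacian ^^ k) h" by blast
qed

lemma laplacian_power_even:
  assumes "\<And>n. f (- n) = f n"
  shows "(laplacian ^^ k) f (- n) = (laplacian ^^ k) f n"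
proof -
  have "(laplacian ^^ k) (\<lambda>m. f (0 - m)) = (\<lambda>m. (laplacian ^^ k) f (0 - m))" by (rule laplacian_power_reflect)
  moreover have "(\<lambda>m. f (0 - m)) = f" using assms by simp
  ultimately show ?thesis by (metis diff_0)
qed

text \<open>A high power of the Laplacian makes the kernel decay fast enough to be paired with \<open>u\<close>; the
  extra power is then undone by a discrete antiderivative, which is harmless modulo polynomials.\<close>

lemma laplacian_inv_sqrt_dual_exists:
  assumes u: "pgrow u"
  shows "\<exists>w. pgrow w \<and> (\<forall>g\<in>schwartz_inf. (\<Sum>\<^sub>\<infinity>n. w n * g n) = (\<Sum>\<^sub>\<infinity>n. u n * laplacian_inv_sqrt g n))"
proof -
  obtain N U where U: "0 \<le> U" "\<And>n. norm (u n) \<le> U * wt n ^ N" using u by (metis pgrowE)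
  define a where "a = (laplacian ^^ N) sqrt_kernel"
  obtain A0 where A0: "\<And>n. norm (a n) \<le> A0 / wt n ^ (2 * N + 2)"
    using sqrt_kernel_decay[of N] unfolding a_def by blast
  have A00: "0 \<le> A0" using order_trans[OF norm_ge_zero A0[of 0]] by (simp add: wt_def)
  have A: "norm (a n) \<le> A0 / wt n ^ (N + 2)" for n
  proof -
    have "wt n ^ (N + 2) \<le> wt n ^ (2 * N + 2)" by (intro power_increasing) auto
    then have "A0 / wt n ^ (2 * N + 2) \<le> A0 / wt n ^ (N + 2)" using A00 by (intro divide_left_mono) auto
    then show ?thesis using A0[of n] by linarith
  qed
  have aeven: "a (n - m) = a (m - n)" for n m
    using laplacian_power_even[of sqrt_kernel N "m - n"] sqrt_kernel_even unfolding a_def by simp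
  define z where "z = conv a u"
  have z: "pgrow z" unfolding z_def by (rule pgrowI) (rule conv_wt(2)[OF A U(2)])
  \<comment> \<open>One Laplacian more than in \<open>a\<close>, because
    \<open>laplacian_inv_sqrt\<close> consumes one when it becomes convolution with
    \<open>sqrt_kernel\<close>.\<close>
  obtain w where w: "pgrow w" "(laplacian ^^ Suc N) w = z"
    using laplacian_power_antiderivative[OF z] by blast
  have "(\<Sum>\<^sub>\<infinity>n. w n * g n) = (\<Sum>\<^sub>\<infinity>n. u n * laplacian_inv_sqrt g n)" if g: "g \<in> schwartz_inf" for g
  proof -
    obtain h where h: "rapid h" "g = (laplacian ^^ Suc N) h" using schwartz_infD(2)[OF g] by blast
    \<comment> \<open>Two powers of \<open>h\<close> beyond the N + 2 that are spent on moving the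
      decay of \<open>a\<close> from \<open>n - m\<close> to \<open>n\<close>.\<close>
    obtain H where H: "0 \<le> H" "\<And>n. norm (h n) \<le> H / wt n ^ (N + 4)" using h(1) by (metis rapidE)
    have le: "norm (u n * (a (n - m) * h m)) \<le> (U * A0 * H) / (wt n ^ 2 * wt m ^ 2)" for n m
    proof -
      have "norm (u n * (a (n - m) * h m)) \<le> (U * wt n ^ N) * ((A0 / wt (n - m) ^ (N + 2)) * (H / wt m ^ (N + 4)))"
        unfolding norm_mult using U A A00 H by (intro mult_mono) auto
      also have "\<dots> = (U * A0 * H) * (wt n ^ N / (wt (n - m) ^ (N + 2) * wt m ^ (N + 4)))"
        by simp
      also have "\<dots> \<le> (U * A0 * H) * (1 / (wt n ^ 2 * wt m ^ 2))"
      proof (rule mult_left_mono)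
        have "wt n ^ (N + 2) \<le> wt (n - m) ^ (N + 2) * wt m ^ (N + 2)" by (rule wt_triangle_power)
        then have "wt n ^ (N + 2) * wt m ^ 2 \<le> wt (n - m) ^ (N + 2) * wt m ^ (N + 2) * wt m ^ 2"
          by (rule mult_right_mono) simp
        moreover have "wt (n - m) ^ (N + 2) * wt m ^ (N + 2) * wt m ^ 2 = wt (n - m) ^ (N + 2) * wt m ^ (N + 4)"
          "wt n ^ (N + 2) * wt m ^ 2 = wt n ^ N * (wt n ^ 2 * wt m ^ 2)"
          by (simp_all add: power_add numeral_eq_Suc)
        ultimately have "wt n ^ N * (wt n ^ 2 * wt m ^ 2) \<le> wt (n - m) ^ (N + 2) * wt m ^ (N + 4)"
          by (simp only:)
        then show "wt n ^ N / (wt (n - m) ^ (N + 2) * wt m ^ (N + 4)) \<le> 1 / (wt n ^ 2 * wt m ^ 2)"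
          by (subst divide_le_eq) (simp_all add: pos_le_divide_eq)
      qed (use U A00 H in auto)
      finally show ?thesis by simp
    qed
    have "(\<Sum>\<^sub>\<infinity>n. w n * g n) = (\<Sum>\<^sub>\<infinity>m. z m * h m)"
      unfolding h(2) pairing_laplacian_power[OF w(1) h(1), symmetric] w(2) ..
    also have "\<dots> = (\<Sum>\<^sub>\<infinity>m. \<Sum>\<^sub>\<infinity>n. u n * (a (n - m) * h m))"
    proof (rule infsum_cong)
      fix m
      have "z m * h m = (\<Sum>\<^sub>\<infinity>n. (a (m - n) * u n) * h m)"
        unfolding z_def conv_def by (rule infsum_cmult_left'[symmetric])
      also have "\<dots> = (\<Sum>\<^sub>\<infinity>n. u n * (a (n - m) * h m))"
        by (rule infsum_cong) (simp add: aeven[of _ m] mult_ac)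
      finally show "z m * h m = (\<Sum>\<^sub>\<infinity>n. u n * (a (n - m) * h m))" .
    qed
    also have "\<dots> = (\<Sum>\<^sub>\<infinity>n. \<Sum>\<^sub>\<infinity>m. u n * (a (n - m) * h m))"
      by (rule infsum_swap_wt[OF le, symmetric])
    also have "\<dots> = (\<Sum>\<^sub>\<infinity>n. u n * conv a h n)"
      unfolding conv_def by (intro infsum_cong infsum_cmult_right')
    also have "conv a h = laplacian_inv_sqrt g"
      unfolding h(2) laplacian_inv_sqrt_power[OF h(1)] a_def
      by (rule laplacian_power_sqrt_kernel_conv[OF h(1), symmetric])
    finally show ?thesis .
  qed
  with w(1) show ?thesis by blast
qed

section \<open>Classes modulo polynomials in terms of sequences\<close>

definition seq_class :: "(int \<Rightarrow> complex) \<Rightarrow> ((int \<Rightarrow> complex) \<Rightarrow> complex) set" where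
  "seq_class u = {of_seq v | v. pgrow v \<and> (\<lambda>n. v n - u n) \<in> polynomials}"

lemma polynomials_uminus: "p \<in> polynomials \<Longrightarrow> (\<lambda>n. - p n) \<in> polynomials"
  using polynomials_cmult[of p "- 1"] by simp

lemma mod_poly_rel_of_seq:
  assumes u: "pgrow u" and v: "pgrow v"
  shows "(of_seq u, of_seq v) \<in> mod_poly_rel \<longleftrightarrow> (\<lambda>n. u n - v n) \<in> polynomials"
proof
  assume "(of_seq u, of_seq v) \<in> mod_poly_rel"
  then obtain p where p: "p \<in> polynomials" "\<And>g. g \<in> schwartz \<Longrightarrow> of_seq u g - of_seq v g = of_seq p g"
    unfolding mod_poly_rel_def by blast
  have "u n - v n = p n" for n
    using p(2)[OF unit_mass_schwartz[of n]] unit_mass_schwartz[of n]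
    by (simp add: of_seq_def infsum_unit_mass)
  then have "(\<lambda>n. u n - v n) = p" by blast
  then show "(\<lambda>n. u n - v n) \<in> polynomials" using p(1) by simp
next
  assume p: "(\<lambda>n. u n - v n) \<in> polynomials"
  have "of_seq u g - of_seq v g = of_seq (\<lambda>n. u n - v n) g" if "g \<in> schwartz" for g
  proof -
    have g: "rapid g" using that by (simp add: schwartz_iff_rapid)
    have "(\<Sum>\<^sub>\<infinity>n. (u n + - 1 * v n) * g n) = (\<Sum>\<^sub>\<infinity>n. u n * g n + - 1 * (v n * g n))"
      by (rule infsum_cong) (simp add: algebra_simps)
    also have "\<dots> = (\<Sum>\<^sub>\<infinity>n. u n * g n) + (\<Sum>\<^sub>\<infinity>n. - 1 * (v n * g n))"
      by (intro infsum_add summable_on_cmult_right pairing_summable' u v g)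
    also have "(\<Sum>\<^sub>\<infinity>n. - 1 * (v n * g n)) = - 1 * (\<Sum>\<^sub>\<infinity>n. v n * g n)" by (rule infsum_cmult_right')
    finally show ?thesis using that by (simp add: of_seq_def)
  qed
  then show "(of_seq u, of_seq v) \<in> mod_poly_rel"
    unfolding mod_poly_rel_def using p u v by (auto intro: of_seq_tempered)
qed

lemma mod_poly_rel_image:
  assumes u: "pgrow u"
  shows "mod_poly_rel `` {of_seq u} = seq_class u"
proof
  show "mod_poly_rel `` {of_seq u} \<subseteq> seq_class u"
  proof
    fix M assume M: "M \<in> mod_poly_rel `` {of_seq u}"
    then have "M \<in> tempered" by (auto simp: mod_poly_rel_def)
    then obtain v where v: "pgrow v" "M = of_seq v" using tempered_eq_of_seq by blast
    have "(\<lambda>n. u n - v n) \<in> polynomials" using M mod_poly_rel_of_seq[OF u v(1)] v(2) by simp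
    from polynomials_uminus[OF this] show "M \<in> seq_class u" using v by (auto simp: seq_class_def)
  qed
  show "seq_class u \<subseteq> mod_poly_rel `` {of_seq u}"
  proof
    fix M assume "M \<in> seq_class u"
    then obtain v where v: "pgrow v" "M = of_seq v" "(\<lambda>n. v n - u n) \<in> polynomials" by (auto simp: seq_class_def)
    from polynomials_uminus[OF v(3)] show "M \<in> mod_poly_rel `` {of_seq u}"
      using mod_poly_rel_of_seq[OF u v(1)] v(2) by simp
  qed
qed

lemma seq_class_tempered_mod_poly: "pgrow u \<Longrightarrow> seq_class u \<in> tempered_mod_poly"
  unfolding tempered_mod_poly_def mod_poly_rel_image[symmetric]
  by (rule quotientI) (rule of_seq_tempered)

lemma tempered_mod_polyE:
  assumes "F \<in> tempered_mod_poly"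
  shows "\<exists>u. pgrow u \<and> F = seq_class u"
proof -
  obtain L where L: "L \<in> tempered" "F = mod_poly_rel `` {L}"
    using assms unfolding tempered_mod_poly_def by (rule quotientE)
  then show ?thesis using tempered_eq_of_seq[OF L(1)] mod_poly_rel_image by metis
qed

lemma seq_class_self: "pgrow u \<Longrightarrow> of_seq u \<in> seq_class u"
  using polynomials_zero by (auto simp: seq_class_def)

lemma seq_class_cong:
  assumes "(\<lambda>n. v n - u n) \<in> polynomials"
  shows "seq_class v = seq_class u"
proof -
  have "(\<lambda>n. x n - v n) \<in> polynomials \<longleftrightarrow> (\<lambda>n. x n - u n) \<in> polynomials" for x
  proof
    assume "(\<lambda>n. x n - v n) \<in> polynomials"
    from polynomials_add[OF this assms] show "(\<lambda>n. x n - u n) \<in> polynomials" by simp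
  next
    assume "(\<lambda>n. x n - u n) \<in> polynomials"
    from polynomials_add[OF this polynomials_uminus[OF assms]] show "(\<lambda>n. x n - v n) \<in> polynomials" by simp
  qed
  then show ?thesis by (simp add: seq_class_def)
qed

lemma pairing_cong_schwartz_inf:
  assumes "pgrow v" "pgrow u" "(\<lambda>n. v n - u n) \<in> polynomials" "g \<in> schwartz_inf"
  shows "(\<Sum>\<^sub>\<infinity>n. v n * g n) = (\<Sum>\<^sub>\<infinity>n. u n * g n)"
proof -
  have g: "rapid g" using assms(4) by (rule schwartz_infD)
  have "(\<Sum>\<^sub>\<infinity>n. v n * g n) = (\<Sum>\<^sub>\<infinity>n. u n * g n + (v n - u n) * g n)"
    by (rule infsum_cong) (simp add: algebra_simps)
  also have "\<dots> = (\<Sum>\<^sub>\<infinity>n. u n * g n) + (\<Sum>\<^sub>\<infinity>n. (v n - u n) * g n)"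
    by (intro infsum_add pairing_summable' polynomials_pgrow assms g)
  also have "(\<Sum>\<^sub>\<infinity>n. (v n - u n) * g n) = 0"
    by (rule pairing_polynomial_schwartz_inf[OF assms(3,4)])
  finally show ?thesis by simp
qed

lemma the_elem_image_const: "A \<noteq> {} \<Longrightarrow> (\<And>x. x \<in> A \<Longrightarrow> f x = c) \<Longrightarrow> the_elem (f ` A) = c"
proof -
  assume "A \<noteq> {}" "\<And>x. x \<in> A \<Longrightarrow> f x = c"
  then have "f ` A = {c}" by auto
  then show ?thesis by simp
qed

lemma class_to_dual_seq_class:
  assumes u: "pgrow u"
  shows "class_to_dual (seq_class u) = (\<lambda>g\<in>schwartz_inf. \<Sum>\<^sub>\<infinity>n. u n * g n)"
proof (rule ext)
  fix g
  show "class_to_dual (seq_class u) g = (\<lambda>g\<in>schwartz_inf. \<Sum>\<^sub>\<infinity>n. u n * g n) g"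
  proof (cases "g \<in> schwartz_inf")
    case True
    have "the_elem ((\<lambda>L. L g) ` seq_class u) = (\<Sum>\<^sub>\<infinity>n. u n * g n)"
    proof (rule the_elem_image_const)
      show "seq_class u \<noteq> {}" using seq_class_self[OF u] by blast
      fix L assume "L \<in> seq_class u"
      then obtain v where v: "pgrow v" "L = of_seq v" "(\<lambda>n. v n - u n) \<in> polynomials" by (auto simp: seq_class_def)
      show "L g = (\<Sum>\<^sub>\<infinity>n. u n * g n)"
        using pairing_cong_schwartz_inf[OF v(1) u v(3) True] schwartz_inf_subset[OF True] by (simp add: v(2) of_seq_def)
    qed
    then show ?thesis using True by (simp add: class_to_dual_def)
  qed (simp add: class_to_dual_def)
qed

lemma schwartz_inf_seminorm_zero: "schwartz_inf_seminorm m k (\<lambda>n. 0) = 0"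
proof -
  have "(THE g. g \<in> schwartz \<and> (\<lambda>n. 0) = (laplacian ^^ k) g) = (\<lambda>n. 0)"
  proof (rule the_equality)
    show "(\<lambda>n. 0) \<in> schwartz \<and> (\<lambda>n. 0) = (laplacian ^^ k) (\<lambda>n. 0)"
      by (simp add: schwartz_zero laplacian_power_zero)
    fix g assume *: "g \<in> schwartz \<and> (\<lambda>n. 0) = (laplacian ^^ k) g"
    then have g: "rapid g" by (simp add: schwartz_iff_rapid)
    have z: "rapid (\<lambda>n. 0)" using schwartz_zero by (simp add: schwartz_iff_rapid)
    have "(laplacian ^^ k) g = (laplacian ^^ k) (\<lambda>n. 0)"
      unfolding laplacian_power_zero by (rule sym, rule conjunct2[OF *])
    then show "g = (\<lambda>n. 0)" by (rule laplacian_power_inj[OF g z])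
  qed
  then show ?thesis by (simp add: schwartz_inf_seminorm_def schwartz_seminorm_zero)
qed

lemma schwartz_inf_seminorm_0: "f \<in> schwartz \<Longrightarrow> schwartz_inf_seminorm m 0 f = schwartz_seminorm m f"
proof -
  assume "f \<in> schwartz"
  then have "(THE g. g \<in> schwartz \<and> f = g) = f" by (intro the_equality) auto
  then show ?thesis by (simp add: schwartz_inf_seminorm_def)
qed

text \<open>\<open>laplacian_inv_sqrt_dual\<close> is specified only on
  \<open>schwartz_inf_dual\<close>, so membership has to be known before it can be unfolded. The
  seminorms with k = 0 already control the pairing.\<close>

lemma class_to_dual_in_dual:
  assumes u: "pgrow u"
  shows "class_to_dual (seq_class u) \<in> schwartz_inf_dual"
proof -
  let ?L = "\<lambda>g\<in>schwartz_inf. \<Sum>\<^sub>\<infinity>n. u n * g n"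
  obtain M K where K: "\<And>g B. (\<forall>n. wt n ^ M * norm (g n) \<le> B) \<Longrightarrow> norm (\<Sum>\<^sub>\<infinity>n. u n * g n) \<le> K * B"
    using pairing_bound[OF u] by blast
  have cont: "continuous_map (seminorm_topology schwartz_inf {schwartz_inf_seminorm m k | m k. True}) euclidean ?L"
  proof (rule continuous_map_seminorm_topologyI)
    fix f and e :: real assume f: "f \<in> schwartz_inf" and e: "0 < e"
    have "dist (?L g) (?L f) < e"
      if g: "g \<in> schwartz_inf" and lt: "schwartz_inf_seminorm M 0 (\<lambda>n. g n - f n) < e / (\<bar>K\<bar> + 1)" for g
    proof -
      have d: "(\<lambda>n. g n - f n) \<in> schwartz" by (intro schwartz_diff schwartz_inf_subset f g)
      have lt': "schwartz_seminorm M (\<lambda>n. g n - f n) < e / (\<bar>K\<bar> + 1)" using lt schwartz_inf_seminorm_0[OF d] by simp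
      have "dist (?L g) (?L f) = norm (\<Sum>\<^sub>\<infinity>n. u n * (g n - f n))"
        using f g u by (simp add: dist_norm pairing_diff schwartz_infD)
      also have "\<dots> \<le> K * schwartz_seminorm M (\<lambda>n. g n - f n)"
        by (rule K) (use norm_le_schwartz_seminorm[OF d] in blast)
      also have "\<dots> \<le> (\<bar>K\<bar> + 1) * schwartz_seminorm M (\<lambda>n. g n - f n)"
        using order_trans[OF _ norm_le_schwartz_seminorm[OF d, of 0 M]] by (intro mult_right_mono) auto
      also have "\<dots> < e" using lt' by (simp add: pos_less_divide_eq mult.commute)
      finally show ?thesis .
    qed
    moreover have "0 < e / (\<bar>K\<bar> + 1)" using e by simp
    ultimately show "\<exists>p\<in>{schwartz_inf_seminorm m k | m k. True}. \<exists>d>0. \<forall>g\<in>schwartz_inf. p (\<lambda>n. g n - f n) < d \<longrightarrow> dist (?L g) (?L f) < e"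
      by (intro bexI[of _ "schwartz_inf_seminorm M 0"] exI[of _ "e / (\<bar>K\<bar> + 1)"]) auto
  qed (auto simp: schwartz_inf_seminorm_zero)
  have add: "?L (\<lambda>n. f n + g n) = ?L f + ?L g" if "f \<in> schwartz_inf" "g \<in> schwartz_inf" for f g
    using that u by (simp add: schwartz_inf_add pairing_add schwartz_infD)
  have mult: "?L (\<lambda>n. c * f n) = c * ?L f" if "f \<in> schwartz_inf" for c f
    using that by (simp add: schwartz_inf_cmult pairing_cmult)
  show ?thesis
    unfolding class_to_dual_seq_class[OF u] schwartz_inf_dual_def continuous_dual_def
    using cont add mult by blast
qed

text \<open>\<open>dual_to_class\<close> collects every tempered extension, so that these form a
  single class needs uniqueness modulo polynomials. It enters as the hypothesis
  \<open>annih\<close>, since its proof uses an admissible pair.\<close>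

lemma laplacian_inv_sqrt_class_seq_class:
  assumes u: "pgrow u" and w: "pgrow w"
    and adj: "\<And>g. g \<in> schwartz_inf \<Longrightarrow> (\<Sum>\<^sub>\<infinity>n. w n * g n) = (\<Sum>\<^sub>\<infinity>n. u n * laplacian_inv_sqrt g n)"
    and annih: "\<And>d. pgrow d \<Longrightarrow> (\<And>g. g \<in> schwartz_inf \<Longrightarrow> (\<Sum>\<^sub>\<infinity>n. d n * g n) = 0) \<Longrightarrow> d \<in> polynomials"
  shows "laplacian_inv_sqrt_class (seq_class u) = seq_class w"
proof -
  define D where "D = laplacian_inv_sqrt_dual (class_to_dual (seq_class u))"
  have D: "D g = (\<Sum>\<^sub>\<infinity>n. w n * g n)" if g: "g \<in> schwartz_inf" for g
  proof -
    have "D g = class_to_dual (seq_class u) (laplacian_inv_sqrt g)"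
      using g class_to_dual_in_dual[OF u] by (simp add: D_def laplacian_inv_sqrt_dual_def)
    also have "\<dots> = (\<Sum>\<^sub>\<infinity>n. u n * laplacian_inv_sqrt g n)"
      using laplacian_inv_sqrt_schwartz_inf[OF g] by (simp add: class_to_dual_seq_class[OF u])
    finally show ?thesis using adj[OF g] by simp
  qed
  have "M \<in> dual_to_class D \<longleftrightarrow> M \<in> seq_class w" for M
  proof
    assume "M \<in> dual_to_class D"
    then have M: "M \<in> tempered" "\<And>g. g \<in> schwartz_inf \<Longrightarrow> M g = D g" by (auto simp: dual_to_class_def)
    obtain v where v: "pgrow v" "M = of_seq v" using tempered_eq_of_seq[OF M(1)] by blast
    have "(\<lambda>n. v n + - 1 * w n) \<in> polynomials"
    proof (rule annih)
      show "pgrow (\<lambda>n. v n + - 1 * w n)" by (intro pgrow_add pgrow_cmult v w)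
      fix g assume g: "g \<in> schwartz_inf"
      have rg: "rapid g" using g by (rule schwartz_infD)
      have vg: "(\<Sum>\<^sub>\<infinity>n. v n * g n) = (\<Sum>\<^sub>\<infinity>n. w n * g n)"
        using M(2)[OF g] D[OF g] schwartz_inf_subset[OF g] by (simp add: v(2) of_seq_def)
      have "(\<Sum>\<^sub>\<infinity>n. (v n + - 1 * w n) * g n) = (\<Sum>\<^sub>\<infinity>n. v n * g n + - 1 * (w n * g n))"
        by (rule infsum_cong) (simp add: algebra_simps)
      also have "\<dots> = (\<Sum>\<^sub>\<infinity>n. v n * g n) + (\<Sum>\<^sub>\<infinity>n. - 1 * (w n * g n))"
        by (intro infsum_add summable_on_cmult_right pairing_summable' v w rg)
      also have "(\<Sum>\<^sub>\<infinity>n. - 1 * (w n * g n)) = - 1 * (\<Sum>\<^sub>\<infinity>n. w n * g n)" by (rule infsum_cmult_right')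
      finally show "(\<Sum>\<^sub>\<infinity>n. (v n + - 1 * w n) * g n) = 0" using vg by simp
    qed
    then show "M \<in> seq_class w" using v by (auto simp: seq_class_def)
  next
    assume "M \<in> seq_class w"
    then obtain v where v: "pgrow v" "M = of_seq v" "(\<lambda>n. v n - w n) \<in> polynomials" by (auto simp: seq_class_def)
    have "M g = D g" if g: "g \<in> schwartz_inf" for g
      using pairing_cong_schwartz_inf[OF v(1) w v(3) g] D[OF g] schwartz_inf_subset[OF g] by (simp add: v(2) of_seq_def)
    then show "M \<in> dual_to_class D" using v of_seq_tempered by (auto simp: dual_to_class_def)
  qed
  then show ?thesis unfolding laplacian_inv_sqrt_class_def D_def[symmetric] by blast
qed

lemma lift_class_seq_class:
  assumes w: "pgrow w"
    and pg: "\<And>v. pgrow v \<Longrightarrow> pgrow (T v)"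
    and diff: "\<And>v. (\<lambda>n. v n - w n) \<in> polynomials \<Longrightarrow> (\<lambda>n. T v n - T w n) \<in> polynomials"
  shows "lift_class T (seq_class w) = seq_class (T w)"
proof -
  have "mod_poly_rel `` {of_seq (T (to_seq L))} = seq_class (T w)" if L: "L \<in> seq_class w" for L
  proof -
    obtain v where v: "pgrow v" "L = of_seq v" "(\<lambda>n. v n - w n) \<in> polynomials" using L unfolding seq_class_def by blast
    have "mod_poly_rel `` {of_seq (T (to_seq L))} = seq_class (T v)"
      unfolding v(2) to_seq_of_seq by (rule mod_poly_rel_image) (rule pg[OF v(1)])
    also have "\<dots> = seq_class (T w)" by (rule seq_class_cong) (rule diff[OF v(3)])
    finally show ?thesis .
  qed
  then show ?thesis unfolding lift_class_def using seq_class_self[OF w] by auto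
qed

lemma lift_class_forward_diff:
  "pgrow w \<Longrightarrow> lift_class forward_diff (seq_class w) = seq_class (forward_diff w)"
proof (rule lift_class_seq_class)
  fix v assume "(\<lambda>n. v n - w n) \<in> polynomials"
  from polynomials_forward_diff[OF this]
  show "(\<lambda>n. forward_diff v n - forward_diff w n) \<in> polynomials" by (simp add: forward_diff_def algebra_simps)
qed (auto intro: pgrow_forward_diff)

lemma backward_diff_eq: "backward_diff f = (\<lambda>n. forward_diff f (n + - 1))"
  by (simp add: backward_diff_def forward_diff_def)

lemma lift_class_backward_diff:
  "pgrow w \<Longrightarrow> lift_class backward_diff (seq_class w) = seq_class (\<lambda>n. forward_diff w (n - 1))"
proof -
  assume w: "pgrow w"
  have "lift_class backward_diff (seq_class w) = seq_class (backward_diff w)"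
  proof (rule lift_class_seq_class[OF w])
    show "pgrow (backward_diff v)" if "pgrow v" for v
      unfolding backward_diff_eq by (intro pgrow_shift pgrow_forward_diff that)
    fix v assume "(\<lambda>n. v n - w n) \<in> polynomials"
    from polynomials_shift[OF polynomials_forward_diff[OF this], of "- 1"]
    show "(\<lambda>n. backward_diff v n - backward_diff w n) \<in> polynomials"
      by (simp add: forward_diff_def backward_diff_def algebra_simps)
  qed
  then show ?thesis by (simp add: backward_diff_eq)
qed

section \<open>Admissible pairs and the symbol of the Riesz transform\<close>

lemma powi_mono: "i \<le> j \<Longrightarrow> (2::real) powi i \<le> 2 powi j"
  by (simp add: power_int_increasing)

lemma powi_less_imp: "(2::real) powi i < 2 powi j \<Longrightarrow> i < j"
  using powi_mono[of j i] by linarith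

lemma coef_cmult: "coef (\<lambda>x. c * a x) n = c * coef a n"
  by (simp add: coef_def mult.assoc)

lemma coef_add:
  assumes "continuous_on {- pi..pi} a" "continuous_on {- pi..pi} b"
  shows "coef (\<lambda>x. a x + b x) n = coef a n + coef b n"
proof -
  have i: "(\<lambda>x. a x * expi (- n) x) integrable_on {- pi..pi}" "(\<lambda>x. b x * expi (- n) x) integrable_on {- pi..pi}"
    by (intro integrable_continuous_real continuous_on_mult continuous_expi assms)+
  show ?thesis
    unfolding coef_def distrib_right Henstock_Kurzweil_Integration.integral_add[OF i] by (rule distrib_left)
qed

lemma coef_laplacian_power:
  assumes a: "continuous_on {- pi..pi} a"
  shows "coef (\<lambda>x. of_real (2 - 2 * cos x) ^ k * a x) = (laplacian ^^ k) (coef a)"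
proof (induction k)
  case (Suc k)
  have "continuous_on {- pi..pi} (\<lambda>x. of_real (2 - 2 * cos x) ^ k * a x)"
    by (intro continuous_intros a)
  from coef_laplacian_symbol[OF this] show ?case by (simp only: power_Suc mult.assoc funpow.simps comp_apply Suc)
qed simp

lemma laplacian_power_conv:
  assumes "rapid a" "pgrow u"
  shows "(laplacian ^^ k) (conv a u) = conv ((laplacian ^^ k) a) u"
proof (induction k)
  case (Suc k)
  have "laplacian (conv ((laplacian ^^ k) a) u) = conv (laplacian ((laplacian ^^ k) a)) u"
    by (rule laplacian_conv) (rule conv_summable[OF rapid_laplacian_power[OF assms(1)] assms(2)])
  with Suc show ?case by simp
qed simp

lemma conv_diff_left:
  assumes "rapid a" "rapid b" "pgrow u"
  shows "conv (\<lambda>n. a n - b n) u n = conv a u n - conv b u n"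
proof -
  have "conv (\<lambda>n. a n - b n) u n = (\<Sum>\<^sub>\<infinity>m. a (n - m) * u m + - 1 * (b (n - m) * u m))"
    unfolding conv_def by (rule infsum_cong) (simp add: algebra_simps)
  also have "\<dots> = (\<Sum>\<^sub>\<infinity>m. a (n - m) * u m) + (\<Sum>\<^sub>\<infinity>m. - 1 * (b (n - m) * u m))"
    by (intro infsum_add summable_on_cmult_right conv_summable assms)
  also have "(\<Sum>\<^sub>\<infinity>m. - 1 * (b (n - m) * u m)) = - 1 * (\<Sum>\<^sub>\<infinity>m. b (n - m) * u m)" by (rule infsum_cmult_right')
  finally show ?thesis by (simp add: conv_def)
qed

lemma conv_add_left:
  assumes "rapid a" "rapid b" "pgrow u"
  shows "conv (\<lambda>n. a n + b n) u n = conv a u n + conv b u n"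
  unfolding conv_def distrib_right
  by (intro infsum_add conv_summable assms)

lemma conv_eq_pairing_reflect: "conv a u n = (\<Sum>\<^sub>\<infinity>m. u m * a (n - m))"
  unfolding conv_def by (rule infsum_cong) (rule mult.commute)

lemma conv_schwartz_inf_eq_zero:
  assumes "a \<in> schwartz_inf" "\<And>g. g \<in> schwartz_inf \<Longrightarrow> (\<Sum>\<^sub>\<infinity>n. d n * g n) = 0"
  shows "conv a d = (\<lambda>n. 0)"
  unfolding conv_eq_pairing_reflect[abs_def] using assms(2)[OF schwartz_inf_reflect[OF assms(1)]] by (intro ext)

lemma symb_fourier_family:
  assumes r: "\<And>v. v \<le> 0 \<Longrightarrow> rapid (f v)"
    and A: "\<And>v k x. v \<le> 0 \<Longrightarrow> x \<in> {- pi..pi} \<Longrightarrow> norm (fourier_deriv k (f v) x) \<le> A k * 2 powi (- int k * v)"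
  shows "symb k (\<lambda>v. fourier (f v))"
proof -
  \<comment> \<open>The j-th derivative rescaled to be bounded independently of \<open>v\<close>.
    The derivative of \<open>a j\<close> is then \<open>2 powi (- v)\<close> times
    \<open>a (Suc j)\<close>, as the definition of \<open>symb\<close> asks.\<close>
  define a where "a j v x = of_real (2 powi (int j * v)) * fourier_deriv j (f v) x" for j v x
  have a0: "symb 0 (a j)" for j
  proof (rule symb_0I)
    have pa: "per (a j v)" if "v \<le> 0" for v
      using fourier_periodic[of _ _ 1] r[OF that] by (simp add: per_def a_def fourier_deriv_eq)
    then show "a j v (x + 2 * pi) = a j v x" if "v \<le> 0" for v x using that by (simp add: per_def)
    fix v :: int and x assume v: "v \<le> 0"
    show "norm (a j v x) \<le> A j"
    proof (rule per_all[OF _ pa[OF v]])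
      fix x assume x: "x \<in> {- pi..pi}"
      have "norm (a j v x) = 2 powi (int j * v) * norm (fourier_deriv j (f v) x)"
        by (simp add: a_def norm_mult norm_power_int)
      also have "\<dots> \<le> 2 powi (int j * v) * (A j * 2 powi (- int j * v))"
        using A[OF v x, of j] by (intro mult_left_mono) auto
      also have "\<dots> = A j * (2 powi (int j * v) * 2 powi (- int j * v))" by simp
      also have "2 powi (int j * v) * 2 powi (- int j * v) = (1::real)"
        by (simp add: power_int_add[symmetric])
      finally show "norm (a j v x) \<le> A j" by simp
    qed
  qed
  have "symb k (a j)" for j
  proof (induction k arbitrary: j)
    case (Suc k)
    show ?case
    proof (rule symb_SucI[OF a0 _ Suc[of "Suc j"]])
      fix v :: int and x assume v: "v \<le> 0"
      have e: "(2::real) powi (- v) * 2 powi (int (Suc j) * v) = 2 powi (int j * v)"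
        by (simp add: power_int_add[symmetric] algebra_simps)
      have "(a j v has_vector_derivative of_real (2 powi (int j * v)) * fourier_deriv (Suc j) (f v) x) (at x)"
        unfolding a_def[abs_def] by (rule has_vector_derivative_mult_right[OF fourier_deriv_has_derivative[OF r[OF v]]])
      moreover have "of_real (2 powi (int j * v)) * fourier_deriv (Suc j) (f v) x = of_real (2 powi (- v)) * a (Suc j) v x"
        unfolding a_def e[symmetric] of_real_mult by (rule mult.assoc)
      ultimately show "(a j v has_vector_derivative of_real (2 powi (- v)) * a (Suc j) v x) (at x)" by (simp only:)
    qed
  qed (rule a0)
  from this[of 0] show ?thesis by (simp add: a_def[abs_def] fourier_deriv_def)
qed

definition shifted :: "int \<Rightarrow> (int \<Rightarrow> real \<Rightarrow> complex) \<Rightarrow> int \<Rightarrow> real \<Rightarrow> complex" where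
  "shifted e a v x = (if v + e \<le> 0 then a (v + e) x else 0)"

lemma symb_shifted: "symb k a \<Longrightarrow> symb k (shifted e a)"
  unfolding shifted_def[abs_def] by (rule symb_shift)

lemma symb_sum: "finite I \<Longrightarrow> (\<And>i. i \<in> I \<Longrightarrow> symb k (a i)) \<Longrightarrow> symb k (\<lambda>v x. \<Sum>i\<in>I. a i v x)"
  by (induction I rule: finite_induct) (auto intro: symb_const symb_add)

lemma half_abs_le_norm_expi:
  assumes "x \<in> {- pi..pi}"
  shows "\<bar>x\<bar> / 2 \<le> norm (expi (- 1) x - 1)"
proof -
  \<comment> \<open>With y at most pi/4, sin(2y) = 2 sin y cos y is at least 2y (cos y)^2, and (cos
    y)^2 is at least 1/2.\<close>
  define y where "y = \<bar>x\<bar> / 4"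
  have y: "0 \<le> y" "y \<le> pi / 4" using assms by (auto simp: y_def)
  have cosb: "1 / 2 \<le> (cos z)\<^sup>2" "0 \<le> cos z" if "0 \<le> z" "z \<le> pi / 4" for z
  proof -
    have "cos (pi / 4) \<le> cos z" using that by (intro cos_monotone_0_pi_le) auto
    then have "sqrt 2 / 2 \<le> cos z" by (simp add: cos_45)
    moreover from this show "0 \<le> cos z" by (rule order_trans[rotated]) simp
    ultimately have "(sqrt 2 / 2)\<^sup>2 \<le> (cos z)\<^sup>2" by (intro power_mono) auto
    then show "1 / 2 \<le> (cos z)\<^sup>2" by (simp add: power_divide)
  qed
  have siny: "y * cos y \<le> sin y"
  proof -
    have "sin 0 - 0 * cos 0 \<le> sin y - y * cos y"
    proof (rule DERIV_nonneg_imp_nondecreasing[of 0 y "\<lambda>t. sin t - t * cos t"])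
      show "0 \<le> y" by (rule y)
      fix t assume t: "0 \<le> t" "t \<le> y"
      have "((\<lambda>t. sin t - t * cos t) has_real_derivative t * sin t) (at t)"
        by (auto intro!: derivative_eq_intros)
      moreover have "0 \<le> t * sin t" using t y by (intro mult_nonneg_nonneg sin_ge_zero) auto
      ultimately show "\<exists>d. ((\<lambda>t. sin t - t * cos t) has_real_derivative d) (at t) \<and> 0 \<le> d" by blast
    qed
    then show ?thesis by simp
  qed
  have "y = 2 * (y * (1 / 2))" by simp
  also have "\<dots> \<le> 2 * (y * (cos y)\<^sup>2)" using cosb(1)[OF y] y by (intro mult_left_mono) auto
  also have "\<dots> = 2 * ((y * cos y) * cos y)" by (simp add: power2_eq_square)
  also have "\<dots> \<le> 2 * (sin y * cos y)" using siny cosb(2)[OF y] by (intro mult_left_mono mult_right_mono) auto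
  also have "\<dots> = sin (\<bar>x\<bar> / 2)" using sin_double[of y] by (simp add: y_def)
  finally have le: "\<bar>x\<bar> / 4 \<le> sin (\<bar>x\<bar> / 2)" by (simp add: y_def)
  have s: "\<bar>sin (x / 2)\<bar> = sin (\<bar>x\<bar> / 2)"
    using le by (cases "0 \<le> x") auto
  have "expi (- 1) x - 1 = exp (\<i> * of_real (- x)) - 1" by (simp add: expi_def)
  also have "norm \<dots> = norm (2 * sin (- x / 2))" using dist_exp_i_1[of "- x"] by simp
  finally have "norm (expi (- 1) x - 1) = 2 * \<bar>sin (x / 2)\<bar>" by simp
  with le s show ?thesis by simp
qed

lemma norm_expi_minus_1_squared: "(norm (expi (- 1) x - 1))\<^sup>2 = 2 - 2 * cos x"
proof -
  have "(norm (expi (- 1) x - 1))\<^sup>2 = (cos x - 1)\<^sup>2 + (sin x)\<^sup>2"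
    by (simp add: expi_cis cmod_power2)
  also have "\<dots> = 1 - 2 * cos x + ((sin x)\<^sup>2 + (cos x)\<^sup>2)" by (simp add: power2_eq_square algebra_simps)
  finally show ?thesis by simp
qed

text \<open>Since 2 - 2 cos x equals -e^(ix) (e^(-ix) - 1)^2, two applications of
  \<open>symb_band_diff\<close> suffice.\<close>

lemma symb_band_laplacian:
  assumes a: "\<And>k. symb k a" and b: "band a"
  shows "symb k (\<lambda>v x. of_real (2 powi (- v)) * of_real (2 powi (- v)) * of_real (2 - 2 * cos x) * a v x)"
    and "band (\<lambda>v x. of_real (2 powi (- v)) * of_real (2 powi (- v)) * of_real (2 - 2 * cos x) * a v x)"
proof -
  let ?d = "\<lambda>v x. of_real (2 powi (- v)) * (expi (- 1) x - 1) * a v x"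
  have d: "symb k ?d" for k by (rule symb_band_diff[OF a b])
  have bd: "band ?d" using b by (auto simp: band_def)
  have "symb k (\<lambda>v x. (- 1) * (expi 1 x * (of_real (2 powi (- v)) * (expi (- 1) x - 1) * ?d v x)))"
    by (intro symb_cmult symb_mult symb_expi symb_band_diff d bd)
  moreover have "(- 1) * (expi 1 x * (of_real (2 powi (- v)) * (expi (- 1) x - 1) * ?d v x)) =
     of_real (2 powi (- v)) * of_real (2 powi (- v)) * of_real (2 - 2 * cos x) * a v x" for v x
  proof -
    have "expi 1 x * expi (- 1) x = 1" by (simp add: expi_add[symmetric])
    then have e: "of_real (2 - 2 * cos x) = (- 1) * (expi 1 x * ((expi (- 1) x - 1) * (expi (- 1) x - 1)))"
      unfolding cos_expi by (simp add: algebra_simps)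
    show ?thesis unfolding e by (simp only: mult_ac)
  qed
  ultimately show "symb k (\<lambda>v x. of_real (2 powi (- v)) * of_real (2 powi (- v)) * of_real (2 - 2 * cos x) * a v x)"
    by (simp only:)
  show "band (\<lambda>v x. of_real (2 powi (- v)) * of_real (2 powi (- v)) * of_real (2 - 2 * cos x) * a v x)"
    using b by (auto simp: band_def)
qed

lemma symb_band_laplacian_power:
  assumes a: "\<And>k. symb k a" and b: "band a"
  shows "(\<forall>k. symb k (\<lambda>v x. (of_real (2 powi (- v)) * of_real (2 powi (- v)) * of_real (2 - 2 * cos x)) ^ j * a v x)) \<and>
    band (\<lambda>v x. (of_real (2 powi (- v)) * of_real (2 powi (- v)) * of_real (2 - 2 * cos x)) ^ j * a v x)"
proof (induction j)
  case 0
  then show ?case using assms by simp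
next
  case (Suc j)
  then have s: "\<And>k. symb k (\<lambda>v x. (of_real (2 powi (- v)) * of_real (2 powi (- v)) * of_real (2 - 2 * cos x)) ^ j * a v x)"
    and b: "band (\<lambda>v x. (of_real (2 powi (- v)) * of_real (2 powi (- v)) * of_real (2 - 2 * cos x)) ^ j * a v x)" by blast+
  show ?case
    using symb_band_laplacian[OF s b] by (simp only: power_Suc mult.assoc) blast
qed

text \<open>In \<open>symb_coef_decay\<close> the natural weight is 1 + 2^v |n|. Here the factor
  2^(2jv) gained from j Laplacians pays for the passage to the weight \<open>wt\<close>, which does
  not depend on the scale; the factor 2^v that remains makes a sum over scales converge.\<close>

lemma coef_laplacian_power_decay:
  assumes a: "\<And>k. symb k a" and b: "band a" and jK: "K \<le> 2 * j"
  shows "\<exists>C\<ge>0. \<forall>v\<le>0. \<forall>n. norm ((laplacian ^^ j) (coef (a v)) n) \<le> C * 2 powi v / wt n ^ K"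
proof -
  define c where "c v x = (of_real (2 powi (- v)) * of_real (2 powi (- v)) * of_real (2 - 2 * cos x)) ^ j * a v x" for v x
  have c: "\<And>k. symb k c" "band c" using symb_band_laplacian_power[OF a b, of j] by (simp_all only: c_def[abs_def])
  obtain C where C: "0 \<le> C" "\<And>v n. v \<le> 0 \<Longrightarrow> norm (coef (c v) n) \<le> C * 2 powi v / (1 + 2 powi v * \<bar>of_int n\<bar>) ^ K"
    using symb_coef_decay[OF c, of K] by blast
  have "norm ((laplacian ^^ j) (coef (a v)) n) \<le> C * 2 powi v / wt n ^ K" if v: "v \<le> 0" for v n
  proof -
    define q where "q = (2::real) powi v"
    have q: "0 < q" "q \<le> 1" using powi_nonpos_le_1[OF v] by (simp_all add: q_def)
    have qm: "(2::real) powi (- v) = inverse q" by (simp add: q_def power_int_minus)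
    have "coef (\<lambda>x. of_real (2 - 2 * cos x) ^ j * a v x) n = coef (\<lambda>x. of_real ((q * q) ^ j) * c v x) n"
    proof -
      have "of_real (2 - 2 * cos x) ^ j * a v x = of_real ((q * q) ^ j) * c v x" for x
        unfolding c_def qm using q by (simp add: power_mult_distrib field_simps)
      then show ?thesis by (simp only:)
    qed
    then have eq: "(laplacian ^^ j) (coef (a v)) n = of_real ((q * q) ^ j) * coef (c v) n"
      by (simp only: coef_laplacian_power[OF symb_continuous[OF a v]] coef_cmult)
    have "norm ((laplacian ^^ j) (coef (a v)) n) = (q * q) ^ j * norm (coef (c v) n)"
    proof -
      have "norm (of_real ((q * q) ^ j) :: complex) = (q * q) ^ j"
        unfolding norm_of_real by (rule abs_of_nonneg) (use q in simp)
      then show ?thesis unfolding eq norm_mult by (simp only:)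
    qed
    also have "\<dots> \<le> q ^ K * (C * q / (q * wt n) ^ K)"
    proof (rule mult_mono)
      have "(q * q) ^ j = q ^ (2 * j)" by (simp add: power_mult power2_eq_square)
      also have "\<dots> \<le> q ^ K" using q jK by (intro power_decreasing) auto
      finally show "(q * q) ^ j \<le> q ^ K" .
      have "q * wt n \<le> 1 + q * \<bar>real_of_int n\<bar>" using q by (simp add: wt_def algebra_simps)
      then have "(q * wt n) ^ K \<le> (1 + q * \<bar>real_of_int n\<bar>) ^ K" using q by (intro power_mono) auto
      then have "C * q / (1 + q * \<bar>real_of_int n\<bar>) ^ K \<le> C * q / (q * wt n) ^ K"
        using C(1) q by (intro divide_left_mono) (auto intro!: mult_pos_pos zero_less_power add_pos_nonneg)
      then show "norm (coef (c v) n) \<le> C * q / (q * wt n) ^ K"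
        using C(2)[OF v, of n] unfolding q_def[symmetric] by linarith
    qed (use q in auto)
    also have "\<dots> = C * q / wt n ^ K" using q by (simp add: power_mult_distrib)
    finally show ?thesis by (simp only: q_def)
  qed
  with C(1) show ?thesis by blast
qed

section \<open>Symbols built from an admissible pair\<close>

locale admissible =
  fixes \<phi> \<psi> :: "int \<Rightarrow> int \<Rightarrow> complex"
  assumes adm: "admissible_pair \<phi> \<psi>"
begin

lemma rapid_family: "v \<le> 0 \<Longrightarrow> rapid (\<phi> v)" "v \<le> 0 \<Longrightarrow> rapid (\<psi> v)"
  using adm unfolding admissible_pair_def schwartz_iff_rapid by blast+

definition ph :: "int \<Rightarrow> real \<Rightarrow> complex" where "ph v = fourier (\<phi> v)"
definition ps :: "int \<Rightarrow> real \<Rightarrow> complex" where "ps v = fourier (\<psi> v)"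

lemma symb_ph: "symb k ph" and symb_ps: "symb k ps"
proof -
  obtain A :: "nat \<Rightarrow> real" where A: "\<forall>\<nu>\<le>0. \<forall>k. \<forall>x\<in>{-pi..pi}.
        norm (fourier_deriv k (\<phi> \<nu>) x) \<le> A k * 2 powi (- int k * \<nu>) \<and>
        norm (fourier_deriv k (\<psi> \<nu>) x) \<le> A k * 2 powi (- int k * \<nu>)"
    using adm unfolding admissible_pair_def by blast
  show "symb k ph" unfolding ph_def[abs_def]
    by (rule symb_fourier_family[OF rapid_family(1), where A = A]) (use A in blast)+
  show "symb k ps" unfolding ps_def[abs_def]
    by (rule symb_fourier_family[OF rapid_family(2), where A = A]) (use A in blast)+
qed

lemma ph_shell:
  assumes "v \<le> 0" "x \<in> {- pi..pi}" "ph v x \<noteq> 0"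
  shows "2 powi (v - 2) * pi < \<bar>x\<bar>" "\<bar>x\<bar> \<le> 2 powi v * pi"
proof -
  have "fourier_supp (\<phi> v) \<subseteq> freq_shell v" using adm assms(1) unfolding admissible_pair_def by blast
  moreover have "x \<in> fourier_supp (\<phi> v)"
    unfolding fourier_supp_def by (rule subsetD[OF closure_subset]) (use assms in \<open>simp add: ph_def\<close>)
  ultimately have "x \<in> freq_shell v" by blast
  then show "2 powi (v - 2) * pi < \<bar>x\<bar>" "\<bar>x\<bar> \<le> 2 powi v * pi" by (auto simp: freq_shell_def)
qed

lemma has_sum_ph_ps:
  "x \<in> {- pi..pi} \<Longrightarrow> x \<noteq> 0 \<Longrightarrow> ((\<lambda>v. cnj (ph v x) * ps v x) has_sum 1) {..0}"
  using adm unfolding admissible_pair_def ph_def ps_def by blast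

lemma band_shifted_ph: "e \<le> 1 \<Longrightarrow> band (shifted e ph)"
  unfolding band_def
proof (intro allI impI ballI)
  fix v :: int and x :: real
  assume e: "e \<le> 1" and v: "v \<le> 0" and x: "x \<in> {- pi..pi}" and lt: "2 powi (v + 1) * pi < \<bar>x\<bar>"
  show "shifted e ph v x = 0"
  proof (rule ccontr)
    assume "shifted e ph v x \<noteq> 0"
    then have "v + e \<le> 0" "ph (v + e) x \<noteq> 0" by (auto simp: shifted_def split: if_splits)
    then have "\<bar>x\<bar> \<le> 2 powi (v + e) * pi" using x by (intro ph_shell)
    also have "\<dots> \<le> 2 powi (v + 1) * pi" using e by (intro mult_right_mono powi_mono) auto
    finally show False using lt by simp
  qed
qed

lemma band_ph: "band ph"
  using band_shifted_ph[of 0] unfolding band_def shifted_def by simp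

text \<open>The three terms of the resolution of the identity that can meet the support of
  \<open>ph v\<close>. The result is a smooth localisation that reproduces
  \<open>\<phi> v\<close>.\<close>

definition loc :: "int \<Rightarrow> real \<Rightarrow> complex" where
  "loc v x = (\<Sum>e\<in>{- 1, 0, 1}. cnj (shifted e ph v x) * shifted e ps v x)"

lemma symb_loc: "symb k loc"
  unfolding loc_def[abs_def] by (intro symb_sum symb_mult symb_cnj symb_shifted symb_ph symb_ps) simp

lemma band_loc: "band loc"
  using band_shifted_ph[of "- 1"] band_shifted_ph[of 0] band_shifted_ph[of 1]
  unfolding band_def loc_def by auto

text \<open>The shells of two scales that differ by at least 2 are disjoint, so at a point where
  \<open>ph v\<close> is nonzero condition (ii) reduces to the scales v - 1, v and v + 1.
  Periodicity extends the identity beyond \<open>{- pi..pi}\<close>.\<close>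

lemma loc_eq_1:
  assumes v: "v \<le> 0" and nz: "ph v x \<noteq> 0"
  shows "loc v x = 1"
proof -
  have main: "loc v x = 1" if x: "x \<in> {- pi..pi}" and nz: "ph v x \<noteq> 0" for x
  proof -
    have sh: "2 powi (v - 2) * pi < \<bar>x\<bar>" "\<bar>x\<bar> \<le> 2 powi v * pi" using ph_shell[OF v x nz] .
    have "0 < 2 powi (v - 2) * pi" by simp
    with sh(1) have "0 < \<bar>x\<bar>" by linarith
    then have x0: "x \<noteq> 0" by simp
    define F where "F = {m. m \<le> 0 \<and> v - 1 \<le> m \<and> m \<le> v + 1}"
    have "((\<lambda>m. cnj (ph m x) * ps m x) has_sum (\<Sum>m\<in>F. cnj (ph m x) * ps m x)) {..0}"
    proof (rule has_sum_finite_neutralI)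
      show "finite F" by (rule finite_subset[of _ "{v - 1..v + 1}"]) (auto simp: F_def)
      show "F \<subseteq> {..0}" by (auto simp: F_def)
      fix m assume m: "m \<in> {..0} - F"
      show "cnj (ph m x) * ps m x = 0"
      proof (rule ccontr)
        assume "cnj (ph m x) * ps m x \<noteq> 0"
        then have "ph m x \<noteq> 0" by auto
        then have "2 powi (m - 2) * pi < \<bar>x\<bar>" "\<bar>x\<bar> \<le> 2 powi m * pi" using ph_shell[of m x] m x by auto
        then have "2 powi (m - 2) * pi < 2 powi v * pi" "2 powi (v - 2) * pi < 2 powi m * pi" using sh by linarith+
        then have "(2::real) powi (m - 2) < 2 powi v" "(2::real) powi (v - 2) < 2 powi m" by simp_all
        then have "m - 2 < v" "v - 2 < m" by (auto dest: powi_less_imp)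
        then show False using m by (auto simp: F_def)
      qed
    qed simp
    from has_sum_unique[OF this has_sum_ph_ps[OF x x0]] have "(\<Sum>m\<in>F. cnj (ph m x) * ps m x) = 1" .
    moreover have "loc v x = (\<Sum>m\<in>F. cnj (ph m x) * ps m x)"
    \<comment> \<open>At the top scale there is no neighbour v + 1; \<open>shifted\<close>
      contributes 0 for it.\<close>
    proof (cases "v = 0")
      case True
      then have "F = {- 1, 0}" by (auto simp: F_def)
      with True show ?thesis by (simp add: loc_def shifted_def)
    next
      case False
      then have "F = {v - 1, v, v + 1}" using v by (auto simp: F_def)
      with False v show ?thesis by (simp add: loc_def shifted_def)
    qed
    ultimately show ?thesis by simp
  qed
  obtain k :: int where k: "x + 2 * pi * of_int k \<in> {- pi..pi}" using representative_ex by blast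
  have "ph v (x + 2 * pi * of_int k) = ph v x" "loc v (x + 2 * pi * of_int k) = loc v x"
    using per_int[OF symb_per[OF symb_ph v]] per_int[OF symb_per[OF symb_loc v]] by auto
  then show ?thesis using main[OF k] nz by simp
qed

lemma cnj_mult_self: "cnj z * z = of_real ((norm z)\<^sup>2)"
  by (simp only: complex_norm_square mult.commute)

text \<open>Adding \<open>\<bar>1 - loc v x\<bar>\<^sup>2\<close> makes the denominators below bounded away from zero everywhere,
  without changing them on the support of \<open>ph v\<close>.\<close>

definition den :: "int \<Rightarrow> real \<Rightarrow> complex" where
  "den v x = (\<Sum>e\<in>{- 1, 0, 1}. cnj (shifted e ph v x) * shifted e ph v x) + cnj (1 - loc v x) * (1 - loc v x)"

text \<open>The symbol of the forward difference rescaled to size 1 and localised. Its squared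
  modulus is the rescaled Laplacian symbol wherever \<open>loc\<close> is 1, so the next definition
  needs no absolute value of sin(x/2).\<close>

definition dft :: "int \<Rightarrow> real \<Rightarrow> complex" where
  "dft v x = of_real (2 powi (- v)) * (expi (- 1) x - 1) * loc v x"

definition lap :: "int \<Rightarrow> real \<Rightarrow> complex" where
  "lap v x = cnj (dft v x) * dft v x + cnj (1 - loc v x) * (1 - loc v x)"

lemma symb_den: "symb k den"
  unfolding den_def[abs_def]
  by (intro symb_add symb_sum symb_mult symb_cnj symb_diff symb_const symb_shifted symb_ph symb_loc) simp

lemma symb_dft: "symb k dft"
  unfolding dft_def[abs_def] by (rule symb_band_diff[OF symb_loc band_loc])

lemma symb_lap: "symb k lap"
  unfolding lap_def[abs_def]
  by (intro symb_add symb_mult symb_cnj symb_diff symb_const symb_dft symb_loc)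

lemma Re_den: "Re (den v x) = (\<Sum>e\<in>{- 1, 0, 1}. (norm (shifted e ph v x))\<^sup>2) + (norm (1 - loc v x))\<^sup>2"
  unfolding den_def cnj_mult_self by simp

lemma Re_lap: "Re (lap v x) = (norm (dft v x))\<^sup>2 + (norm (1 - loc v x))\<^sup>2"
  unfolding lap_def cnj_mult_self by simp

lemma den_real: "den v x = of_real (Re (den v x))"
  unfolding Re_den unfolding den_def cnj_mult_self by simp

lemma lap_real: "lap v x = of_real (Re (lap v x))"
  unfolding Re_lap unfolding lap_def cnj_mult_self by simp

lemma norm_loc_ge: "norm (1 - loc v x) < 1 / 2 \<Longrightarrow> 1 / 2 < norm (loc v x)"
  using norm_triangle_ineq[of "1 - loc v x" "loc v x"] by simp

lemma quarter_le: "1 / 2 \<le> norm z \<Longrightarrow> 1 / 4 \<le> (norm (z :: complex))\<^sup>2"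
  using power_mono[of "1 / 2" "norm z" 2] by (simp add: power_divide)

lemma den_lower: "\<exists>c>0. \<forall>v\<le>0. \<forall>x. c \<le> Re (den v x)"
proof -
  obtain D where D: "0 \<le> D" "\<And>v x. v \<le> 0 \<Longrightarrow> norm (ps v x) \<le> D" using symb_bound[OF symb_ps[of 0]] by blast
  \<comment> \<open>If all three factors \<open>shifted e ph v x\<close> were smaller than
    \<open>d\<close>, then \<open>loc\<close> would be at most 3 d (D + 1) = 1/2, against its lower
    bound in this case.\<close>
  define d where "d = 1 / (6 * (D + 1))"
  have d: "0 < d" using D by (simp add: d_def)
  have "min (1 / 4) (d\<^sup>2) \<le> Re (den v x)" if v: "v \<le> 0" for v x
  proof (cases "norm (1 - loc v x) < 1 / 2")
    case False
    then have "1 / 4 \<le> (norm (1 - loc v x))\<^sup>2" by (intro quarter_le) simp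
    moreover have "0 \<le> (\<Sum>e\<in>{- 1, 0, 1}. (norm (shifted e ph v x))\<^sup>2)" by (intro sum_nonneg) simp
    ultimately show ?thesis unfolding Re_den by linarith
  next
    case True
    have "\<exists>e\<in>{- 1, 0, 1}. d \<le> norm (shifted e ph v x)"
    proof (rule ccontr)
      assume "\<not> ?thesis"
      then have lt: "norm (shifted e ph v x) \<le> d" if "e \<in> {- 1, 0, 1}" for e using that by force
      have "norm (loc v x) \<le> (\<Sum>e\<in>{- 1, 0, 1::int}. d * (D + 1))"
        unfolding loc_def
      proof (rule sum_norm_le)
        fix e :: int assume e: "e \<in> {- 1, 0, 1}"
        have "norm (shifted e ps v x) \<le> D + 1" using D(1) D(2)[of "v + e" x] by (auto simp: shifted_def)
        then show "norm (cnj (shifted e ph v x) * shifted e ps v x) \<le> d * (D + 1)"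
          unfolding norm_mult complex_mod_cnj using lt[OF e] d by (intro mult_mono) auto
      qed
      also have "\<dots> = 1 / 2" using D by (simp add: d_def)
      finally show False using norm_loc_ge[OF True] by simp
    qed
    then obtain e where e: "e \<in> {- 1, 0, 1}" "d \<le> norm (shifted e ph v x)" by blast
    have "d\<^sup>2 \<le> (norm (shifted e ph v x))\<^sup>2" using e d by (intro power_mono) auto
    also have "\<dots> \<le> (\<Sum>e\<in>{- 1, 0, 1}. (norm (shifted e ph v x))\<^sup>2)" using e by (intro member_le_sum) auto
    also have "\<dots> \<le> Re (den v x)" unfolding Re_den by simp
    finally show ?thesis by linarith
  qed
  moreover have "0 < min (1 / 4) (d\<^sup>2)" using d by simp
  ultimately show ?thesis by blast
qed

text \<open>If \<open>loc\<close> is close to 1, some \<open>ph (v + e)\<close> is nonzero and |x|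
  exceeds 2^(v - 3) pi. The rescaled difference symbol is then at least pi/16, hence at least 1/8;
  times |loc| > 1/2 this is 1/16, whose square is the constant.\<close>

lemma lap_lower: "v \<le> 0 \<Longrightarrow> 1 / 256 \<le> Re (lap v x)"
proof -
  assume v: "v \<le> 0"
  show ?thesis
  proof (rule per_all[OF _ symb_per[OF symb_lap v]])
    fix x assume x: "x \<in> {- pi..pi}"
    show "1 / 256 \<le> Re (lap v x)"
    proof (cases "norm (1 - loc v x) < 1 / 2")
      case False
      then have "1 / 4 \<le> (norm (1 - loc v x))\<^sup>2" by (intro quarter_le) simp
      moreover have "0 \<le> (norm (dft v x))\<^sup>2" by simp
      ultimately show ?thesis unfolding Re_lap by linarith
    next
      case True
      then have l: "1 / 2 < norm (loc v x)" by (rule norm_loc_ge)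
      then have "loc v x \<noteq> 0" by auto
      then obtain e where e: "e \<in> {- 1, 0, 1}" "cnj (shifted e ph v x) * shifted e ps v x \<noteq> 0"
        unfolding loc_def by (meson sum.not_neutral_contains_not_neutral)
      then have "v + e \<le> 0" "ph (v + e) x \<noteq> 0" by (auto simp: shifted_def split: if_splits)
      then have "2 powi (v + e - 2) * pi < \<bar>x\<bar>" using x by (intro ph_shell)
      moreover have "2 powi (v - 3) * pi \<le> 2 powi (v + e - 2) * pi"
        using e by (intro mult_right_mono powi_mono) auto
      ultimately have "2 powi (v - 3) * pi / 2 \<le> norm (expi (- 1) x - 1)"
        using half_abs_le_norm_expi[OF x] by linarith
      then have "2 powi (- v) * (2 powi (v - 3) * pi / 2) \<le> 2 powi (- v) * norm (expi (- 1) x - 1)"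
        by (intro mult_left_mono) auto
      moreover have "2 powi (- v) * (2 powi (v - 3) * pi / 2) = pi / 16"
      proof -
        have "(2::real) powi (- v) * 2 powi (v - 3) = 2 powi (- 3)" by (simp add: power_int_add[symmetric])
        then have "(2::real) powi (- v) * 2 powi (v - 3) = 1 / 8" by (simp add: power_int_minus)
        then show ?thesis by simp
      qed
      ultimately have "1 / 8 \<le> 2 powi (- v) * norm (expi (- 1) x - 1)" using pi_ge_two by linarith
      then have "1 / 8 * (1 / 2) \<le> (2 powi (- v) * norm (expi (- 1) x - 1)) * norm (loc v x)"
        using l by (intro mult_mono) auto
      also have "\<dots> = norm (dft v x)" by (simp add: dft_def norm_mult norm_power_int)
      finally have "(1 / 16)\<^sup>2 \<le> (norm (dft v x))\<^sup>2" by (intro power_mono) auto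
      then have "1 / 256 \<le> (norm (dft v x))\<^sup>2" by (simp add: power_divide)
      moreover have "0 \<le> (norm (1 - loc v x))\<^sup>2" by simp
      ultimately show ?thesis unfolding Re_lap by linarith
    qed
  qed
qed

definition den_rsqrt :: "int \<Rightarrow> real \<Rightarrow> complex" where
  "den_rsqrt v x = of_real (Re (den v x) powr (- 1 / 2))"

definition lap_rsqrt :: "int \<Rightarrow> real \<Rightarrow> complex" where
  "lap_rsqrt v x = of_real (Re (lap v x) powr (- 1 / 2))"

lemma symb_den_rsqrt: "symb k den_rsqrt"
proof -
  obtain c where c: "0 < c" "\<And>v x. v \<le> 0 \<Longrightarrow> c \<le> Re (den v x)" using den_lower by blast
  show ?thesis unfolding den_rsqrt_def[abs_def]
    by (rule symb_rsqrt[OF den_real c(2) c(1) symb_den])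
qed

lemma symb_lap_rsqrt: "symb k lap_rsqrt"
  unfolding lap_rsqrt_def[abs_def]
  by (rule symb_rsqrt[OF lap_real lap_lower _ symb_lap]) simp_all

lemma rsqrt_squared: "0 < r \<Longrightarrow> (of_real (r powr (- 1 / 2)) :: complex) * of_real (r powr (- 1 / 2)) = of_real (1 / r)"
  by (simp add: of_real_mult[symmetric] powr_add[symmetric] powr_minus_divide del: of_real_mult)

lemma den_rsqrt_squared: "v \<le> 0 \<Longrightarrow> loc v x = 1 \<Longrightarrow>
   den_rsqrt v x * den_rsqrt v x * (\<Sum>e\<in>{- 1, 0, 1}. cnj (shifted e ph v x) * shifted e ph v x) = 1"
proof -
  assume v: "v \<le> 0" and l: "loc v x = 1"
  obtain c where c: "0 < c" "\<And>v x. v \<le> 0 \<Longrightarrow> c \<le> Re (den v x)" using den_lower by blast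
  have pos: "0 < Re (den v x)" using c(1) c(2)[OF v, of x] by linarith
  have s: "(\<Sum>e\<in>{- 1, 0, 1}. cnj (shifted e ph v x) * shifted e ph v x) = of_real (Re (den v x))"
    using den_real[of v x] l unfolding den_def by simp
  show ?thesis unfolding s den_rsqrt_def rsqrt_squared[OF pos] using pos by simp
qed

lemma Re_lap_eq: "loc v x = 1 \<Longrightarrow> Re (lap v x) = (2 powi (- v))\<^sup>2 * (2 - 2 * cos x)"
  unfolding Re_lap dft_def by (simp add: norm_mult norm_power_int power_mult_distrib norm_expi_minus_1_squared)

lemma lap_rsqrt_squared: "v \<le> 0 \<Longrightarrow> loc v x = 1 \<Longrightarrow>
   of_real (2 powi (- v)) * of_real (2 powi (- v)) * of_real (2 - 2 * cos x) * (lap_rsqrt v x * lap_rsqrt v x) = 1"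
proof -
  assume v: "v \<le> 0" and l: "loc v x = 1"
  have pos: "0 < Re (lap v x)" using lap_lower[OF v, of x] by linarith
  have "of_real (2 powi (- v)) * of_real (2 powi (- v)) * of_real (2 - 2 * cos x) = (of_real (Re (lap v x)) :: complex)"
    unfolding Re_lap_eq[OF l] power2_eq_square by simp
  then show ?thesis unfolding lap_rsqrt_def rsqrt_squared[OF pos] using pos by simp
qed

text \<open>A symbol that lives where \<open>loc\<close> is 1 stays away from frequency 0, so it can
  be divided by (2 - 2 cos x)^k within the class of symbols; \<open>lap_rsqrt\<close> squared is the
  smooth substitute for this division.\<close>

lemma coef_schwartz_inf:
  assumes a: "\<And>k. symb k a" and b: "band a" and v: "v \<le> 0" and loc: "\<And>x. a v x \<noteq> 0 \<Longrightarrow> loc v x = 1"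
  shows "coef (a v) \<in> schwartz_inf"
proof (rule schwartz_infI)
  fix k
  define c where "c v x = a v x * (lap_rsqrt v x * lap_rsqrt v x) ^ k" for v x
  have c: "symb j c" for j unfolding c_def[abs_def] by (intro symb_mult symb_power a symb_lap_rsqrt)
  have bc: "band c" unfolding c_def[abs_def] by (rule band_mult[OF b])
  define q where "q = (of_real (2 powi (- v)) * of_real (2 powi (- v)) :: complex)"
  define h where "h = (\<lambda>n. q ^ k * coef (c v) n)"
  have "rapid h" unfolding h_def by (intro rapid_cmult symb_coef_rapid c bc v)
  moreover have "coef (a v) = (laplacian ^^ k) h"
  proof
    fix n
    have id: "a v x = q ^ k * (of_real (2 - 2 * cos x) ^ k * c v x)" for x
    proof (cases "a v x = 0")
      case False
      have "q ^ k * (of_real (2 - 2 * cos x) ^ k * c v x) = (q * of_real (2 - 2 * cos x) * (lap_rsqrt v x * lap_rsqrt v x)) ^ k * a v x"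
        unfolding c_def by (simp add: power_mult_distrib)
      then show ?thesis unfolding q_def using lap_rsqrt_squared[OF v loc[OF False]] by simp
    qed (simp add: c_def)
    have "coef (a v) n = coef (\<lambda>x. q ^ k * (of_real (2 - 2 * cos x) ^ k * c v x)) n"
      by (rule arg_cong[where f = "\<lambda>f. coef f n"]) (rule ext, rule id)
    also have "\<dots> = (laplacian ^^ k) h n"
      unfolding coef_cmult coef_laplacian_power[OF symb_continuous[OF c v]] h_def laplacian_power_cmult ..
    finally show "coef (a v) n = (laplacian ^^ k) h n" .
  qed
  ultimately show "\<exists>h. rapid h \<and> coef (a v) = (laplacian ^^ k) h" by blast
qed

lemma phi_schwartz_inf: "v \<le> 0 \<Longrightarrow> \<phi> v \<in> schwartz_inf"
  using coef_schwartz_inf[OF symb_ph band_ph _ loc_eq_1] coef_fourier[OF rapid_family(1)] by (simp add: ph_def)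

lemma conv_phi_polynomial: "v \<le> 0 \<Longrightarrow> p \<in> polynomials \<Longrightarrow> conv (\<phi> v) p = (\<lambda>n. 0)"
  by (rule conv_schwartz_inf_eq_zero[OF phi_schwartz_inf]) (auto intro: pairing_polynomial_schwartz_inf)

section \<open>Uniqueness modulo polynomials\<close>

definition piece :: "int \<Rightarrow> real \<Rightarrow> complex" where
  "piece v x = cnj (ph v x) * ps v x"

lemma symb_piece: "symb k piece"
  unfolding piece_def[abs_def] by (intro symb_mult symb_cnj symb_ph symb_ps)

lemma band_piece: "band piece"
  using band_ph by (auto simp: band_def piece_def)

lemma piece_schwartz_inf: "v \<le> 0 \<Longrightarrow> coef (piece v) \<in> schwartz_inf"
  by (rule coef_schwartz_inf[OF symb_piece band_piece]) (auto simp: piece_def intro: loc_eq_1)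

text \<open>The pieces resolve the unit mass up to a remainder \<open>R M\<close> with frequencies
  below 2^(-M) pi. Each piece annihilates \<open>d\<close>, so \<open>d\<close> is reproduced by
  \<open>R M\<close> for every M. After j Laplacians the kernel of \<open>R M\<close> tends to 0 in
  a weight strong enough to beat the growth of \<open>d\<close>, so j Laplacians kill
  \<open>d\<close>.\<close>

lemma annihilator_polynomial:
  assumes d: "pgrow d" and ann: "\<And>g. g \<in> schwartz_inf \<Longrightarrow> (\<Sum>\<^sub>\<infinity>n. d n * g n) = 0"
  shows "d \<in> polynomials"
proof -
  obtain N D where D: "0 \<le> D" "\<And>n. norm (d n) \<le> D * wt n ^ N" using d by (metis pgrowE)
  \<comment> \<open>Against growth of order N the kernel must decay to order N + 2, which is at most
    2 j as \<open>coef_laplacian_power_decay\<close> requires.\<close>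
  define j where "j = N + 1"
  obtain C where C: "0 \<le> C" "\<And>v n. v \<le> 0 \<Longrightarrow> norm ((laplacian ^^ j) (coef (piece v)) n) \<le> C * 2 powi v / wt n ^ (N + 2)"
    using coef_laplacian_power_decay[OF symb_piece band_piece, of "N + 2" j] unfolding j_def by auto
  obtain A where A: "0 \<le> A" "\<And>v x. v \<le> 0 \<Longrightarrow> norm (piece v x) \<le> A" using symb_bound[OF symb_piece[of 0]] by blast
  define \<sigma> where "\<sigma> M x = 1 - (\<Sum>k\<le>M. piece (- int k) x)" for M x
  define R where "R M n = (if n = 0 then 1 else 0) - (\<Sum>k\<le>M. coef (piece (- int k)) n)" for M n
  have cp: "continuous_on S (piece (- int k))" for S k by (rule symb_continuous[OF symb_piece]) simp
  have c\<sigma>: "continuous_on S (\<sigma> M)" for S M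
    unfolding \<sigma>_def[abs_def] by (intro continuous_on_diff continuous_on_const continuous_on_sum cp)
  have R_coef: "coef (\<sigma> M) n = R M n" for M n
  proof (induction M)
    case 0
    have "coef (\<sigma> 0) n = coef (\<lambda>x. 1 + (- 1) * piece 0 x) n" by (simp add: \<sigma>_def[abs_def])
    also have "\<dots> = coef (\<lambda>x. 1) n + coef (\<lambda>x. (- 1) * piece 0 x) n"
      by (rule coef_add) (use cp[of _ 0] in \<open>auto intro!: continuous_intros\<close>)
    finally show ?case unfolding coef_cmult coef_one by (simp add: R_def)
  next
    case (Suc M)
    have "coef (\<sigma> (Suc M)) n = coef (\<lambda>x. \<sigma> M x + (- 1) * piece (- int (Suc M)) x) n"
      by (simp add: \<sigma>_def[abs_def] algebra_simps)
    also have "\<dots> = coef (\<sigma> M) n + coef (\<lambda>x. (- 1) * piece (- int (Suc M)) x) n"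
      by (rule coef_add) (intro continuous_on_mult continuous_on_const cp c\<sigma>)+
    finally show ?case unfolding coef_cmult Suc by (simp add: R_def)
  qed
  have rp: "rapid (coef (piece (- int k)))" for k by (rule symb_coef_rapid[OF symb_piece band_piece]) simp
  have R_Suc: "R (Suc M) = (\<lambda>n. R M n - coef (piece (- int (Suc M))) n)" for M
    by (rule ext) (simp add: R_def)
  have R_0: "R 0 = (\<lambda>n. unit_mass 0 n - coef (piece 0) n)" by (rule ext) (simp add: R_def unit_mass_def)
  have um: "rapid (unit_mass 0)" using unit_mass_schwartz by (simp add: schwartz_iff_rapid)
  have rdiff: "rapid (\<lambda>n. f n - g n)" if "rapid f" "rapid g" for f g
    using rapid_add[OF that(1) rapid_cmult[OF that(2), of "- 1"]] by simp
  have rR: "rapid (R M)" for M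
  proof (induction M)
    case 0
    show ?case unfolding R_0 by (rule rdiff[OF um]) (use rp[of 0] in simp)
  next
    case (Suc M)
    show ?case unfolding R_Suc by (rule rdiff[OF Suc rp])
  qed
  have zero: "conv (coef (piece (- int k))) d = (\<lambda>n. 0)" for k
    by (rule conv_schwartz_inf_eq_zero[OF piece_schwartz_inf ann]) simp
  \<comment> \<open>Convolution with the unit mass is the identity, and every subtracted piece
    contributes 0.\<close>
  have convR: "conv (R M) d n = d n" for M n
  proof (induction M)
    case 0
    have "conv (unit_mass 0) d = d" using conv_delta[of d] by (simp add: unit_mass_def)
    then show ?case unfolding R_0 using conv_diff_left[OF um rp[of 0] d, of n] zero[of 0] by simp
  next
    case (Suc M)
    then show ?case unfolding R_Suc using conv_diff_left[OF rR rp d, of M "Suc M" n] zero[of "Suc M"] by simp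
  qed
  define T where "T M = (laplacian ^^ j) (R M)" for M
  have convT: "conv (T M) d = (laplacian ^^ j) d" for M
  proof -
    have "conv (R M) d = d" by (rule ext) (rule convR)
    then show ?thesis unfolding T_def laplacian_power_conv[OF rR d, symmetric] by simp
  qed
  \<comment> \<open>Uniform in \<open>n\<close> but without decay in \<open>n\<close>: only the
    short frequency support of \<open>\<sigma> M\<close> is used. This does not suffice for
    convolving with \<open>d\<close>; it serves to remove the far end of the telescope
    below.\<close>
  have T_small: "norm (T M n) \<le> 4 ^ j * (1 + real (Suc M) * A) * (1 / 2) ^ M" for M n
  proof -
    have "T M = coef (\<lambda>x. of_real (2 - 2 * cos x) ^ j * \<sigma> M x)"
    proof -
      have "coef (\<sigma> M) = R M" by (rule ext) (rule R_coef)
      then show ?thesis unfolding T_def coef_laplacian_power[OF c\<sigma>] by simp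
    qed
    moreover have "norm (coef (\<lambda>x. of_real (2 - 2 * cos x) ^ j * \<sigma> M x) n) \<le> 4 ^ j * (1 + real (Suc M) * A) * (2 powi (- int M) * pi) / pi"
    proof (rule norm_coef_le)
      fix x assume x: "x \<in> {- pi..pi}"
      have w: "norm (of_real (2 - 2 * cos x) :: complex) \<le> 4"
      proof -
        have "\<bar>2 - 2 * cos x\<bar> \<le> 4" using cos_ge_minus_one[of x] cos_le_one[of x] by linarith
        then show ?thesis by (simp only: norm_of_real)
      qed
      have "norm (\<sigma> M x) \<le> norm (1::complex) + norm (\<Sum>k\<le>M. piece (- int k) x)"
        unfolding \<sigma>_def by (rule norm_triangle_ineq4)
      also have "norm (\<Sum>k\<le>M. piece (- int k) x) \<le> (\<Sum>k\<le>M. A)"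
        by (rule sum_norm_le) (use A in simp)
      finally have "norm (\<sigma> M x) \<le> 1 + real (Suc M) * A" by simp
      then have "norm (of_real (2 - 2 * cos x) :: complex) ^ j * norm (\<sigma> M x) \<le> 4 ^ j * (1 + real (Suc M) * A)"
        using w by (intro mult_mono power_mono) auto
      then show "norm (of_real (2 - 2 * cos x) ^ j * \<sigma> M x) \<le> 4 ^ j * (1 + real (Suc M) * A)"
        by (simp only: norm_mult norm_power)
      assume lt: "2 powi (- int M) * pi < \<bar>x\<bar>"
      have "0 < 2 powi (- int M) * pi" by simp
      with lt have "0 < \<bar>x\<bar>" by linarith
      then have x0: "x \<noteq> 0" by simp
      have "((\<lambda>v. piece v x) has_sum (\<Sum>v\<in>(\<lambda>k. - int k) ` {..M}. piece v x)) {..0}"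
      proof (rule has_sum_finite_neutralI)
        fix v assume v: "v \<in> {..0} - (\<lambda>k. - int k) ` {..M}"
        have vM: "v \<le> - int M"
        proof (rule ccontr)
          assume "\<not> v \<le> - int M"
          then have "v = - int (nat (- v))" "nat (- v) \<le> M" using v by auto
          then show False using v by blast
        qed
        show "piece v x = 0"
        proof (rule ccontr)
          assume "piece v x \<noteq> 0"
          then have "ph v x \<noteq> 0" by (auto simp: piece_def)
          then have "\<bar>x\<bar> \<le> 2 powi v * pi" using v x by (intro ph_shell) auto
          also have "\<dots> \<le> 2 powi (- int M) * pi" using vM by (intro mult_right_mono powi_mono) auto
          finally show False using lt by simp
        qed
      qed auto
      then have "((\<lambda>v. cnj (ph v x) * ps v x) has_sum (\<Sum>v\<in>(\<lambda>k. - int k) ` {..M}. piece v x)) {..0}"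
        by (simp only: piece_def)
      from has_sum_unique[OF this has_sum_ph_ps[OF x x0]]
      have "(\<Sum>v\<in>(\<lambda>k. - int k) ` {..M}. piece v x) = 1" .
      then have "(\<Sum>k\<le>M. piece (- int k) x) = 1" by (subst (asm) sum.reindex) (auto simp: inj_on_def)
      then show "of_real (2 - 2 * cos x) ^ j * \<sigma> M x = 0" by (simp add: \<sigma>_def)
    next
      show "0 \<le> 4 ^ j * (1 + real (Suc M) * A)" using A by (intro mult_nonneg_nonneg add_nonneg_nonneg) auto
      show "2 powi (- int M) * pi \<le> pi" using powi_nonpos_le_1[of "- int M"] by simp
    qed simp
    moreover have "(2::real) powi (- int M) = (1 / 2) ^ M" unfolding power_int_minus power_int_of_nat by (simp only: power_one_over inverse_eq_divide)
    ultimately show ?thesis by simp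
  qed
  have lim: "(\<lambda>M. 4 ^ j * (1 + real (Suc M) * A) * (1 / 2) ^ M) \<longlonglongrightarrow> 0"
  proof -
    have h: "norm (1 / 2 :: real) < 1" by simp
    have 1: "(\<lambda>M. real M * (1 / 2) ^ M) \<longlonglongrightarrow> (0::real)" by (rule powser_times_n_limit_0[OF h])
    have 2: "(\<lambda>M. (1 / 2) ^ M) \<longlonglongrightarrow> (0::real)" by (rule LIMSEQ_power_zero[OF h])
    have "(\<lambda>M. 4 ^ j * ((1 + A) * (1 / 2) ^ M + A * (real M * (1 / 2) ^ M))) \<longlonglongrightarrow> 4 ^ j * ((1 + A) * 0 + A * 0)"
      by (rule tendsto_mult[OF tendsto_const tendsto_add[OF tendsto_mult[OF tendsto_const 2] tendsto_mult[OF tendsto_const 1]]])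
    moreover have "4 ^ j * ((1 + A) * (1 / 2) ^ M + A * (real M * (1 / 2) ^ M)) = 4 ^ j * (1 + real (Suc M) * A) * (1 / 2) ^ M" for M
      by (simp add: algebra_simps)
    ultimately show ?thesis by simp
  qed
  \<comment> \<open>Consecutive remainders differ by one piece, whose decay estimate carries the
    factor 2^(-(M + L + 1)). This is written as a difference of geometric terms so that the sum
    telescopes.\<close>
  have T_diff: "norm (T M n) \<le> norm (T (M + L) n) + (C / wt n ^ (N + 2)) * ((1 / 2) ^ M - (1 / 2) ^ (M + L))" for M L n
  proof (induction L)
    case (Suc L)
    have "T (M + Suc L) n = T (M + L) n - (laplacian ^^ j) (coef (piece (- int (Suc (M + L))))) n"
    proof -
      have "R (M + Suc L) = (\<lambda>n. R (M + L) n + - 1 * coef (piece (- int (Suc (M + L)))) n)"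
        using R_Suc[of "M + L"] by simp
      then show ?thesis unfolding T_def by (simp only: laplacian_power_add laplacian_power_cmult) simp
    qed
    then have "norm (T (M + L) n) \<le> norm (T (M + Suc L) n) + norm ((laplacian ^^ j) (coef (piece (- int (Suc (M + L))))) n)"
      using norm_triangle_ineq[of "T (M + Suc L) n" "(laplacian ^^ j) (coef (piece (- int (Suc (M + L))))) n"] by simp
    also have "norm ((laplacian ^^ j) (coef (piece (- int (Suc (M + L))))) n) \<le> C * 2 powi (- int (Suc (M + L))) / wt n ^ (N + 2)"
      by (rule C(2)) simp
    also have "C * 2 powi (- int (Suc (M + L))) / wt n ^ (N + 2) = (C / wt n ^ (N + 2)) * ((1 / 2) ^ (M + L) - (1 / 2) ^ (M + Suc L))"
    proof -
      have "(2::real) powi (- int (Suc (M + L))) = (1 / 2) ^ Suc (M + L)"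
        unfolding power_int_minus power_int_of_nat by (simp only: power_one_over inverse_eq_divide)
      moreover have "(1 / 2) ^ (M + L) - (1 / 2) ^ (M + Suc L) = (1 / 2 :: real) ^ Suc (M + L)" by simp
      ultimately show ?thesis by (simp only: times_divide_eq_left)
    qed
    finally show ?case using Suc by (simp add: algebra_simps)
  qed simp
  \<comment> \<open>Letting L tend to infinity, \<open>T_small\<close> removes the term
    \<open>T (M + L)\<close> and leaves a bound with both decay in \<open>n\<close> and smallness in
    \<open>M\<close>.\<close>
  have T_bound: "norm (T M n) \<le> (C * (1 / 2) ^ M) / wt n ^ (N + 2)" for M n
  proof (rule LIMSEQ_le_const)
    have "(\<lambda>L. 4 ^ j * (1 + real (Suc (L + M)) * A) * (1 / 2) ^ (L + M)) \<longlonglongrightarrow> 0"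
      using LIMSEQ_ignore_initial_segment[OF lim, of M] .
    from tendsto_add[OF this tendsto_const[of "(C * (1 / 2) ^ M) / wt n ^ (N + 2)"]]
    show "(\<lambda>L. 4 ^ j * (1 + real (Suc (L + M)) * A) * (1 / 2) ^ (L + M) + (C * (1 / 2) ^ M) / wt n ^ (N + 2))
        \<longlonglongrightarrow> (C * (1 / 2) ^ M) / wt n ^ (N + 2)" by simp
    have "norm (T M n) \<le> 4 ^ j * (1 + real (Suc (L + M)) * A) * (1 / 2) ^ (L + M) + (C * (1 / 2) ^ M) / wt n ^ (N + 2)" for L
    proof -
      have "(C / wt n ^ (N + 2)) * ((1 / 2) ^ M - (1 / 2) ^ (M + L)) \<le> (C / wt n ^ (N + 2)) * (1 / 2) ^ M"
        using C(1) by (intro mult_left_mono) auto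
      then have "norm (T M n) \<le> norm (T (M + L) n) + (C / wt n ^ (N + 2)) * (1 / 2) ^ M"
        using T_diff[of M n L] by linarith
      moreover have "norm (T (M + L) n) \<le> 4 ^ j * (1 + real (Suc (L + M)) * A) * (1 / 2) ^ (L + M)"
        using T_small[of "M + L" n] by (simp only: add.commute[of M L])
      ultimately show ?thesis by simp
    qed
    then show "\<exists>N0. \<forall>L\<ge>N0. norm (T M n) \<le> 4 ^ j * (1 + real (Suc (L + M)) * A) * (1 / 2) ^ (L + M) + (C * (1 / 2) ^ M) / wt n ^ (N + 2)"
      by blast
  qed
  have "(laplacian ^^ j) d n = 0" for n
  proof -
    have le: "norm ((laplacian ^^ j) d n) \<le> (C * D * wt_sum * wt n ^ N) * (1 / 2) ^ M" for M
      using conv_wt(2)[OF T_bound D(2), of M n] unfolding convT by (simp add: mult_ac)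
    have "(\<lambda>M. (C * D * wt_sum * wt n ^ N) * (1 / 2) ^ M) \<longlonglongrightarrow> (C * D * wt_sum * wt n ^ N) * 0"
      by (rule tendsto_mult[OF tendsto_const LIMSEQ_power_zero]) simp
    then have "norm ((laplacian ^^ j) d n) \<le> (C * D * wt_sum * wt n ^ N) * 0"
      by (rule LIMSEQ_le_const) (intro exI allI impI le)
    then show ?thesis by simp
  qed
  then have "(laplacian ^^ j) d = (\<lambda>n. 0)" by (rule ext)
  then show ?thesis by (rule polynomials_if_laplacian_power_eq_zero)
qed

text \<open>On the support of \<open>ph v\<close> the factor \<open>lap_rsqrt\<close> equals 2^v /
  (2|sin(x/2)|), so this is \<open>ph v\<close> times (e^(-ix) - 1) / (2|sin(x/2)|). The factors
  2^(-v) and 2^v cancel; they are kept apart so that each factor is visibly a symbol.\<close>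

definition riesz_symbol :: "int \<Rightarrow> real \<Rightarrow> complex" where
  "riesz_symbol v x = of_real (2 powi (- v)) * (expi (- 1) x - 1) * ph v x * lap_rsqrt v x"

text \<open>The multiplier acting on the piece of scale v + e: multiplied by
  \<open>shifted e ph\<close> and summed over e these give back \<open>riesz_symbol\<close>, because
  \<open>den_rsqrt\<close> squared is the reciprocal of the sum of |ph (v + e)|^2 there.\<close>

definition riesz_part :: "int \<Rightarrow> int \<Rightarrow> real \<Rightarrow> complex" where
  "riesz_part e v x = riesz_symbol v x * (cnj (shifted e ph v x) * (den_rsqrt v x * den_rsqrt v x))"

lemma symb_riesz_symbol: "symb k riesz_symbol"
  unfolding riesz_symbol_def[abs_def] by (intro symb_mult[OF symb_band_diff[OF symb_ph band_ph]] symb_lap_rsqrt)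

lemma symb_riesz_part: "symb k (riesz_part e)"
  unfolding riesz_part_def[abs_def]
  by (intro symb_mult symb_cnj symb_shifted symb_riesz_symbol symb_ph symb_den_rsqrt)

lemma band_riesz_symbol: "band riesz_symbol"
  using band_ph by (auto simp: band_def riesz_symbol_def)

lemma band_riesz_part: "band (riesz_part e)"
  unfolding riesz_part_def[abs_def] by (rule band_mult[OF band_riesz_symbol])

lemma riesz_symbol_loc: "v \<le> 0 \<Longrightarrow> riesz_symbol v x \<noteq> 0 \<Longrightarrow> loc v x = 1"
  by (rule loc_eq_1) (auto simp: riesz_symbol_def)

text \<open>Here \<open>h\<close> is the inverse Laplacian of \<open>\<phi> v\<close>. With s =
  2|sin(x/2)|, \<open>ph v\<close> is s^2 times the series of \<open>h\<close>, and one factor s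
  cancels against the square root. Where \<open>ph v\<close> vanishes, s or the series of
  \<open>h\<close> vanishes.\<close>

lemma riesz_symbol_fourier:
  assumes v: "v \<le> 0" and h: "rapid h" "\<phi> v = laplacian h"
  shows "of_real (2 * \<bar>sin (x / 2)\<bar>) * fourier (forward_diff h) x = riesz_symbol v x"
proof -
  define s where "s = 2 * \<bar>sin (x / 2)\<bar>"
  have w: "2 - 2 * cos x = s * s" unfolding two_minus_two_cos s_def power2_eq_square ..
  have ph: "ph v x = of_real (s * s) * fourier h x"
    unfolding ph_def h(2) fourier_laplacian[OF h(1)] w ..
  show ?thesis
  proof (cases "ph v x = 0")
    case True
    then have "s = 0 \<or> fourier h x = 0" using ph by simp
    then show ?thesis using True by (auto simp: s_def[symmetric] riesz_symbol_def fourier_forward_diff[OF h(1)])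
  next
    case False
    define q where "q = (2::real) powi (- v)"
    have q: "0 < q" by (simp add: q_def)
    have s0: "0 \<le> s" by (simp add: s_def)
    have "s \<noteq> 0" using False ph by auto
    with s0 have s: "0 < s" by simp
    have "Re (lap v x) = (q * s)\<^sup>2"
      unfolding Re_lap_eq[OF loc_eq_1[OF v False]] w q_def[symmetric] by (simp add: power2_eq_square)
    then have "Re (lap v x) powr (- 1 / 2) = 1 / (q * s)"
    proof -
      assume e: "Re (lap v x) = (q * s)\<^sup>2"
      have pos: "0 < q * s" using q s by simp
      have "((q * s)\<^sup>2) powr (- 1 / 2) = (q * s) powr (of_nat 2 * (- 1 / 2))"
        using pos by (simp add: powr_powr powr_realpow[symmetric] del: powr_numeral)
      also have "\<dots> = 1 / (q * s)" using pos by (simp add: powr_minus_divide)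
      finally show ?thesis unfolding e .
    qed
    then have "lap_rsqrt v x = of_real (1 / (q * s))" by (simp only: lap_rsqrt_def)
    then have "riesz_symbol v x = of_real q * (expi (- 1) x - 1) * (of_real (s * s) * fourier h x) * of_real (1 / (q * s))"
      unfolding riesz_symbol_def ph q_def[symmetric] by (simp only:)
    also have "\<dots> = of_real s * ((expi (- 1) x - 1) * fourier h x)"
      using q s by (simp add: field_simps)
    finally show ?thesis unfolding fourier_forward_diff[OF h(1)] s_def[symmetric] ..
  qed
qed

text \<open>The difference is moved from \<open>w\<close> to the test function by a shift of the
  sum, after which \<open>adj\<close> applies and the inverse square root of the test function is
  known explicitly from \<open>laplacian_inv_sqrt_laplacian\<close>.\<close>

lemma conv_phi_forward_diff:
  assumes v: "v \<le> 0" and u: "pgrow u" and w: "pgrow w"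
    and adj: "\<And>g. g \<in> schwartz_inf \<Longrightarrow> (\<Sum>\<^sub>\<infinity>n. w n * g n) = (\<Sum>\<^sub>\<infinity>n. u n * laplacian_inv_sqrt g n)"
  shows "conv (\<phi> v) (forward_diff w) = conv (coef (riesz_symbol v)) u"
proof
  fix n
  obtain h where h: "rapid h" "\<phi> v = laplacian h"
    using schwartz_infD(2)[OF phi_schwartz_inf[OF v], of 1] by auto
  \<comment> \<open>The adjoint of the forward difference is minus the backward one, but the
    reflection \<open>n - m\<close> turns it back into the forward difference of
    \<open>\<phi> v\<close>.\<close>
  define g where "g m = forward_diff (\<phi> v) (n - m)" for m
  have g: "g \<in> schwartz_inf"
    unfolding g_def[abs_def] by (intro schwartz_inf_reflect schwartz_inf_forward_diff phi_schwartz_inf v)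
  have r\<phi>: "rapid (\<phi> v)" by (rule rapid_family(1)[OF v])
  have s: "(\<lambda>m. w (m + 1) * \<phi> v (n - m)) summable_on UNIV" "(\<lambda>m. - 1 * (w m * \<phi> v (n - m))) summable_on UNIV"
    "(\<lambda>m. w m * \<phi> v (n - (m - 1))) summable_on UNIV"
    using pairing_summable'[OF pgrow_shift[OF w] rapid_reflect[OF r\<phi>, of n], of 1]
      summable_on_cmult_right[OF pairing_summable'[OF w rapid_reflect[OF r\<phi>, of n]], of "- 1"]
      pairing_summable'[OF w rapid_shift[OF rapid_reflect[OF r\<phi>, of n], of "- 1"]]
    by simp_all
  have "conv (\<phi> v) (forward_diff w) n = (\<Sum>\<^sub>\<infinity>m. w (m + 1) * \<phi> v (n - m) + - 1 * (w m * \<phi> v (n - m)))"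
    unfolding conv_eq_pairing_reflect by (rule infsum_cong) (simp add: forward_diff_def algebra_simps)
  also have "\<dots> = (\<Sum>\<^sub>\<infinity>m. w (m + 1) * \<phi> v (n - m)) + (\<Sum>\<^sub>\<infinity>m. - 1 * (w m * \<phi> v (n - m)))"
    by (rule infsum_add[OF s(1,2)])
  also have "(\<Sum>\<^sub>\<infinity>m. w (m + 1) * \<phi> v (n - m)) = (\<Sum>\<^sub>\<infinity>m. w m * \<phi> v (n - (m - 1)))"
    by (rule pairing_shift)
  also have "(\<Sum>\<^sub>\<infinity>m. w m * \<phi> v (n - (m - 1))) + (\<Sum>\<^sub>\<infinity>m. - 1 * (w m * \<phi> v (n - m))) =
     (\<Sum>\<^sub>\<infinity>m. w m * \<phi> v (n - (m - 1)) + - 1 * (w m * \<phi> v (n - m)))"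
    by (rule infsum_add[OF s(3,2), symmetric])
  also have "\<dots> = (\<Sum>\<^sub>\<infinity>m. w m * g m)"
    by (rule infsum_cong) (simp add: g_def forward_diff_def algebra_simps)
  also have "\<dots> = (\<Sum>\<^sub>\<infinity>m. u m * laplacian_inv_sqrt g m)" by (rule adj[OF g])
  also have "\<dots> = (\<Sum>\<^sub>\<infinity>m. u m * coef (riesz_symbol v) (n - m))"
  proof (rule infsum_cong)
    fix m
    have gl: "g = laplacian (\<lambda>m. forward_diff h (n - m))"
    proof -
      have "forward_diff (laplacian h) = laplacian (forward_diff h)"
        using forward_diff_laplacian_power[of 1 h] by simp
      then show ?thesis
        unfolding g_def[abs_def] h(2) using laplacian_power_reflect[of 1 "forward_diff h" n] by simp
    qed
    have "laplacian_inv_sqrt g = conv sqrt_kernel (\<lambda>m. forward_diff h (n - m))"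
      unfolding gl by (rule laplacian_inv_sqrt_laplacian) (intro rapid_reflect rapid_forward_diff h)
    then have "laplacian_inv_sqrt g m = (\<Sum>\<^sub>\<infinity>k. sqrt_kernel (m - k) * forward_diff h (n - k))"
      by (simp add: conv_def)
    also have "\<dots> = (\<Sum>\<^sub>\<infinity>k. sqrt_kernel (m - (n - k)) * forward_diff h (n - (n - k)))"
      by (rule infsum_int_reflect[symmetric])
    \<comment> \<open>Evenness of the kernel undoes the reflection.\<close>
    also have "\<dots> = (\<Sum>\<^sub>\<infinity>k. sqrt_kernel ((n - m) - k) * forward_diff h k)"
    proof (rule infsum_cong)
      fix k
      have "sqrt_kernel (m - (n - k)) = sqrt_kernel (- ((n - m) - k))" by (rule arg_cong[where f = sqrt_kernel]) simp
      then show "sqrt_kernel (m - (n - k)) * forward_diff h (n - (n - k)) = sqrt_kernel ((n - m) - k) * forward_diff h k"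
        unfolding sqrt_kernel_even by simp
    qed
    also have "\<dots> = conv sqrt_kernel (forward_diff h) (n - m)" by (simp add: conv_def)
    also have "conv sqrt_kernel (forward_diff h) = coef (\<lambda>x. of_real (2 * \<bar>sin (x / 2)\<bar>) * fourier (forward_diff h) x)"
      unfolding sqrt_kernel_def
      by (rule coef_mult_fourier[symmetric]) (auto intro!: continuous_intros rapid_forward_diff h)
    also have "(\<lambda>x. of_real (2 * \<bar>sin (x / 2)\<bar>) * fourier (forward_diff h) x) = riesz_symbol v"
      by (rule ext) (rule riesz_symbol_fourier[OF v h])
    finally show "u m * laplacian_inv_sqrt g m = u m * coef (riesz_symbol v) (n - m)" by simp
  qed
  finally show "conv (\<phi> v) (forward_diff w) n = conv (coef (riesz_symbol v)) u n"
    by (simp only: conv_eq_pairing_reflect)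
qed

lemma riesz_decomposition:
  assumes v: "v \<le> 0" and u: "pgrow u"
  shows "conv (coef (riesz_symbol v)) u n =
    (\<Sum>e\<in>{- 1, 0, 1}. if v + e \<le> 0 then conv (coef (riesz_part e v)) (conv (\<phi> (v + e)) u) n else 0)"
proof -
  define b where "b e = (\<lambda>x. riesz_part e v x * shifted e ph v x)" for e
  have cr: "continuous_on S (riesz_part e v)" for S e by (rule symb_continuous[OF symb_riesz_part v])
  have cb: "continuous_on S (b e)" for S e
    unfolding b_def by (intro continuous_on_mult cr symb_continuous[OF symb_shifted[OF symb_ph] v])
  have id: "riesz_symbol v x = b (- 1) x + (b 0 x + b 1 x)" for x
  proof (cases "riesz_symbol v x = 0")
    case False
    have "b (- 1) x + (b 0 x + b 1 x) =
       riesz_symbol v x * (den_rsqrt v x * den_rsqrt v x * (\<Sum>e\<in>{- 1, 0, 1}. cnj (shifted e ph v x) * shifted e ph v x))"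
      by (simp add: b_def riesz_part_def algebra_simps)
    then show ?thesis using den_rsqrt_squared[OF v riesz_symbol_loc[OF v False]] by simp
  qed (simp add: b_def riesz_part_def)
  have rr: "rapid (coef (riesz_part e v))" for e by (rule symb_coef_rapid[OF symb_riesz_part band_riesz_part v])
  have bc: "coef (b e) = (if v + e \<le> 0 then conv (coef (riesz_part e v)) (\<phi> (v + e)) else (\<lambda>n. 0))" for e
  proof (cases "v + e \<le> 0")
    case True
    have "b e = (\<lambda>x. riesz_part e v x * fourier (\<phi> (v + e)) x)" using True by (simp add: b_def shifted_def ph_def)
    then have "coef (b e) = conv (coef (riesz_part e v)) (\<phi> (v + e))"
      using coef_mult_fourier[OF cr rapid_family(1)[OF True]] by simp
    then show ?thesis using True by simp
  next
    case False
    then have "b e = (\<lambda>x. 0)" by (simp add: b_def shifted_def)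
    then have "coef (b e) = (\<lambda>n. 0)" by (simp add: coef_def[abs_def])
    then show ?thesis using False by simp
  qed
  have rz: "rapid (\<lambda>n. 0)" using schwartz_zero by (simp add: schwartz_iff_rapid)
  have rb: "rapid (coef (b e))" for e
    unfolding bc using rapid_conv[OF rr rapid_family(1)] rz by simp
  have cbu: "conv (coef (b e)) u n = (if v + e \<le> 0 then conv (coef (riesz_part e v)) (conv (\<phi> (v + e)) u) n else 0)" for e
  proof (cases "v + e \<le> 0")
    case True
    then show ?thesis unfolding bc using conv_assoc[OF rr rapid_family(1)[OF True] u] by simp
  next
    case False
    then show ?thesis unfolding bc by (simp add: conv_def)
  qed
  have "coef (riesz_symbol v) = (\<lambda>n. coef (b (- 1)) n + (coef (b 0) n + coef (b 1) n))"
  proof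
    fix n
    have "coef (riesz_symbol v) n = coef (\<lambda>x. b (- 1) x + (b 0 x + b 1 x)) n"
      by (rule arg_cong[where f = "\<lambda>f. coef f n"]) (rule ext, rule id)
    also have "\<dots> = coef (b (- 1)) n + coef (\<lambda>x. b 0 x + b 1 x) n"
      by (rule coef_add) (intro continuous_on_add cb)+
    also have "coef (\<lambda>x. b 0 x + b 1 x) n = coef (b 0) n + coef (b 1) n" by (rule coef_add[OF cb cb])
    finally show "coef (riesz_symbol v) n = coef (b (- 1)) n + (coef (b 0) n + coef (b 1) n)" .
  qed
  then have "conv (coef (riesz_symbol v)) u n = conv (coef (b (- 1))) u n + (conv (coef (b 0)) u n + conv (coef (b 1)) u n)"
    by (simp only: conv_add_left[OF rb rapid_add[OF rb rb] u] conv_add_left[OF rb rb u])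
  then show ?thesis unfolding cbu by simp
qed

text \<open>The self-reproducing formula for a band-limited piece, with a kernel localised at scale
  2^(-v). It is the hypothesis \<open>rep\<close> of \<open>Peetre_bound\<close>.\<close>

lemma phi_reproducing:
  assumes v: "v \<le> 0" and u: "pgrow u"
  shows "conv (\<phi> v) u = conv (coef (loc v)) (conv (\<phi> v) u)"
proof -
  have rl: "rapid (coef (loc v))" by (rule symb_coef_rapid[OF symb_loc band_loc v])
  have r\<phi>: "rapid (\<phi> v)" by (rule rapid_family(1)[OF v])
  have "(\<lambda>x. loc v x * fourier (\<phi> v) x) = fourier (\<phi> v)"
  proof
    fix x
    show "loc v x * fourier (\<phi> v) x = fourier (\<phi> v) x"
      using loc_eq_1[OF v, of x] by (cases "ph v x = 0") (simp_all add: ph_def)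
  qed
  then have "conv (coef (loc v)) (\<phi> v) = coef (fourier (\<phi> v))"
    using coef_mult_fourier[OF symb_continuous[OF symb_loc v] r\<phi>] by simp
  then have "conv (coef (loc v)) (\<phi> v) = \<phi> v" using coef_fourier[OF r\<phi>] by simp
  then show ?thesis using conv_assoc[OF rl r\<phi> u] by simp
qed

end

section \<open>The Peetre maximal function\<close>

lemma norm_infsum_le_infsum:
  fixes f :: "'a \<Rightarrow> 'b :: banach"
  assumes g: "g summable_on A" and le: "\<And>x. x \<in> A \<Longrightarrow> norm (f x) \<le> g x"
  shows "norm (infsum f A) \<le> infsum g A"
proof -
  have "(\<lambda>x. norm (f x)) summable_on A" by (rule Infinite_Sum.abs_summable_on_comparison_test'[OF g le])
  then have "f summable_on A" by (rule abs_summable_summable)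
  then show ?thesis by (rule norm_infsum_le[OF has_sum_infsum has_sum_infsum[OF g] le])
qed

lemma finite_ex_max_image:
  fixes x :: "'i \<Rightarrow> 'a :: linorder"
  assumes "finite I" "I \<noteq> {}"
  shows "\<exists>j\<in>I. \<forall>i\<in>I. x i \<le> x j"
proof -
  have "Max (x ` I) \<in> x ` I" using assms by (intro Max_in) auto
  then obtain j where j: "j \<in> I" "Max (x ` I) = x j" by blast
  have "x i \<le> x j" if "i \<in> I" for i unfolding j(2)[symmetric] using assms that by (intro Max_ge) auto
  with j(1) show ?thesis by blast
qed

text \<open>Comparison with the largest term, which works for exponents below and above 1
  alike.\<close>

lemma sum_powr_le:
  fixes x :: "'i \<Rightarrow> real"
  assumes I: "finite I" and x: "\<And>i. i \<in> I \<Longrightarrow> 0 \<le> x i" and s: "0 \<le> s"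
  shows "(\<Sum>i\<in>I. x i) powr s \<le> real (card I) powr s * (\<Sum>i\<in>I. x i powr s)"
proof (cases "I = {}")
  case False
  obtain j where j: "j \<in> I" "\<And>i. i \<in> I \<Longrightarrow> x i \<le> x j"
    using finite_ex_max_image[OF I False] by metis
  have "(\<Sum>i\<in>I. x i) \<le> real (card I) * x j" using j(2) by (rule sum_bounded_above)
  then have "(\<Sum>i\<in>I. x i) powr s \<le> (real (card I) * x j) powr s"
    using s x by (intro powr_mono2 sum_nonneg) auto
  also have "\<dots> = real (card I) powr s * x j powr s" using x[OF j(1)] by (simp add: powr_mult)
  also have "\<dots> \<le> real (card I) powr s * (\<Sum>i\<in>I. x i powr s)"
    using I j(1) by (intro mult_left_mono member_le_sum) auto
  finally show ?thesis .
qed simp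

text \<open>An averaging kernel of width 1/t, normalised so that its total mass over the integers is
  at most 4 for every \<open>t \<le> 1\<close>.\<close>

definition avg_kernel :: "real \<Rightarrow> nat \<Rightarrow> real" where
  "avg_kernel t j = t / (1 + t * real j)\<^sup>2"

lemma avg_kernel_nonneg: "0 < t \<Longrightarrow> 0 \<le> avg_kernel t j"
  by (simp add: avg_kernel_def)

lemma avg_kernel_antimono:
  assumes "0 < t"
  shows "antimono (avg_kernel t)"
proof (rule antimonoI)
  fix i j :: nat assume "i \<le> j"
  then have "t * real i \<le> t * real j" using assms by (intro mult_left_mono) auto
  then have "(1 + t * real i)\<^sup>2 \<le> (1 + t * real j)\<^sup>2" using assms by (intro power_mono) auto
  moreover have "0 < 1 + t * real i" using assms by (simp add: add_pos_nonneg)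
  ultimately show "avg_kernel t j \<le> avg_kernel t i"
    unfolding avg_kernel_def using assms by (intro divide_left_mono mult_pos_pos zero_less_power) (auto intro: add_pos_nonneg)
qed

text \<open>Telescoping: with a = 1 + t n, t/(a + t)^2 is at most 1/a - 1/(a + t). The term j = 0 is
  t, which is at most 1.\<close>

lemma avg_kernel_sum_Suc: "0 < t \<Longrightarrow> t \<le> 1 \<Longrightarrow> (\<Sum>j<Suc n. avg_kernel t j) \<le> 2 - 1 / (1 + t * real n)"
proof (induction n)
  case 0
  then show ?case by (simp add: avg_kernel_def)
next
  case (Suc n)
  define a where "a = 1 + t * real n"
  have a: "1 \<le> a" using Suc.prems by (simp add: a_def)
  have e: "1 + t * real (Suc n) = a + t" by (simp add: a_def algebra_simps)
  have "t / (a + t)\<^sup>2 \<le> t / (a * (a + t))"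
    using a Suc.prems by (intro divide_left_mono) (auto simp: power2_eq_square intro!: mult_right_mono mult_pos_pos)
  also have "\<dots> = 1 / a - 1 / (a + t)" using a Suc.prems by (simp add: field_simps)
  finally have "avg_kernel t (Suc n) \<le> 1 / a - 1 / (a + t)" unfolding avg_kernel_def e .
  then show ?case using Suc unfolding e a_def[symmetric] by simp
qed

lemma avg_kernel_sum_nat:
  assumes "0 < t" "t \<le> 1"
  shows "(\<Sum>j<n. avg_kernel t j) \<le> 2"
proof (cases n)
  case (Suc m)
  have "0 \<le> 1 / (1 + t * real m)" using assms by simp
  then show ?thesis unfolding Suc using avg_kernel_sum_Suc[OF assms, of m] by linarith
qed simp

lemma avg_kernel_sum_int:
  assumes t: "0 < t" "t \<le> 1" and F: "finite F"
  shows "(\<Sum>m\<in>F. avg_kernel t (nat \<bar>m\<bar>)) \<le> 4"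
proof -
  have half: "(\<Sum>m\<in>G. avg_kernel t (nat \<bar>m\<bar>)) \<le> 2" if G: "finite G" "inj_on (\<lambda>m. nat \<bar>m\<bar>) G" for G :: "int set"
  proof -
    have "(\<Sum>m\<in>G. avg_kernel t (nat \<bar>m\<bar>)) = (\<Sum>j\<in>(\<lambda>m. nat \<bar>m\<bar>) ` G. avg_kernel t j)"
      by (simp add: sum.reindex[OF G(2)])
    also have "\<dots> \<le> (\<Sum>j<Suc (Max ((\<lambda>m. nat \<bar>m\<bar>) ` G)). avg_kernel t j)"
      using G(1) avg_kernel_nonneg[OF t(1)] by (intro sum_mono2) (auto simp: less_Suc_eq_le)
    also have "\<dots> \<le> 2" by (rule avg_kernel_sum_nat[OF t])
    finally show ?thesis .
  qed
  have "(\<Sum>m\<in>F. avg_kernel t (nat \<bar>m\<bar>)) = (\<Sum>m\<in>{m\<in>F. 0 \<le> m}. avg_kernel t (nat \<bar>m\<bar>)) + (\<Sum>m\<in>{m\<in>F. \<not> 0 \<le> m}. avg_kernel t (nat \<bar>m\<bar>))"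
    using F by (subst sum.union_disjoint[symmetric]) (auto intro!: sum.cong)
  moreover have "(\<Sum>m\<in>{m\<in>F. 0 \<le> m}. avg_kernel t (nat \<bar>m\<bar>)) \<le> 2" using F by (intro half) (auto intro!: inj_onI)
  moreover have "(\<Sum>m\<in>{m\<in>F. \<not> 0 \<le> m}. avg_kernel t (nat \<bar>m\<bar>)) \<le> 2" using F by (intro half) (auto intro!: inj_onI)
  ultimately show ?thesis by linarith
qed

lemma avg_kernel_summable:
  assumes t: "0 < t" "t \<le> 1"
  shows "(\<lambda>k. avg_kernel t (nat \<bar>n - k\<bar>)) summable_on UNIV" "(\<Sum>\<^sub>\<infinity>k. avg_kernel t (nat \<bar>n - k\<bar>)) \<le> 4"
proof -
  have s: "(\<lambda>m. avg_kernel t (nat \<bar>m\<bar>)) summable_on UNIV"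
    by (rule nonneg_bdd_above_summable_on)
      (auto intro!: avg_kernel_nonneg t bdd_aboveI[where M = 4] avg_kernel_sum_int)
  show "(\<lambda>k. avg_kernel t (nat \<bar>n - k\<bar>)) summable_on UNIV" by (subst summable_int_reflect) (rule s)
  have "(\<Sum>\<^sub>\<infinity>k. avg_kernel t (nat \<bar>n - k\<bar>)) = (\<Sum>\<^sub>\<infinity>m. avg_kernel t (nat \<bar>m\<bar>))"
    by (rule infsum_int_reflect)
  also have "\<dots> \<le> 4" by (rule infsum_le_finite_sums[OF s avg_kernel_sum_int[OF t]])
  finally show "(\<Sum>\<^sub>\<infinity>k. avg_kernel t (nat \<bar>n - k\<bar>)) \<le> 4" .
qed

lemma avg_summable:
  assumes t: "0 < t" "t \<le> 1" and x: "\<And>k. 0 \<le> x k" "\<And>k. x k \<le> B"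
  shows "(\<lambda>k. avg_kernel t (nat \<bar>n - k\<bar>) * x k) summable_on UNIV"
proof (rule summable_on_comparison_test)
  show "(\<lambda>k. avg_kernel t (nat \<bar>n - k\<bar>) * B) summable_on UNIV"
    by (rule summable_on_cmult_left) (rule avg_kernel_summable[OF t])
qed (use avg_kernel_nonneg[OF t(1)] x in \<open>auto intro: mult_left_mono\<close>)

text \<open>The supremum \<open>S\<close> below is the Peetre maximal function of \<open>f\<close> at \<open>n\<close>. It is finite because \<open>f\<close>
  is bounded, so the power \<open>S powr (1 - r)\<close> can be absorbed into the left-hand side.\<close>

lemma Peetre_bound:
  fixes f \<Phi> M :: "int \<Rightarrow> complex" and L :: nat
  assumes t: "0 < t" "t \<le> 1" and L: "2 \<le> L"
    and \<Phi>: "\<And>m. norm (\<Phi> m) \<le> C * t / (1 + t * \<bar>of_int m\<bar>) ^ L" and C: "0 \<le> C"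
    and M: "\<And>m. norm (M m) \<le> D * t / (1 + t * \<bar>of_int m\<bar>) ^ (L + 2)" and D: "0 \<le> D"
    and f: "\<And>k. norm (f k) \<le> B" and rep: "f = conv \<Phi> f"
  defines "r \<equiv> 2 / real L"
  shows "norm (conv M f n) powr r \<le> ((4 * D) powr r * C) * (\<Sum>\<^sub>\<infinity>k. avg_kernel t (nat \<bar>n - k\<bar>) * norm (f k) powr r)"
proof -
  define a where "a m = 1 + t * \<bar>of_int m :: real\<bar>" for m :: int
  have a1: "1 \<le> a m" for m using t by (simp add: a_def)
  then have a0: "0 < a m" for m using less_le_trans[OF zero_less_one] by blast
  have amul: "a (n - j) \<le> a (n - k) * a (k - j)" for j k
  proof -
    have "t * \<bar>of_int (n - j) :: real\<bar> \<le> t * (\<bar>of_int (n - k)\<bar> + \<bar>of_int (k - j)\<bar>)" using t by (intro mult_left_mono) auto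
    moreover have "0 \<le> (t * \<bar>of_int (n - k) :: real\<bar>) * (t * \<bar>of_int (k - j)\<bar>)" using t by simp
    ultimately show ?thesis unfolding a_def distrib_left distrib_right mult_1_left mult_1_right by linarith
  qed
  \<comment> \<open>The reason for r = 2/L: \<open>a ^ L\<close> to the power 1 - r is
    \<open>a ^ (L - 2)\<close>, which leaves exactly the two powers of \<open>a\<close> that form
    \<open>avg_kernel\<close>.\<close>
  have r: "0 < r" "r \<le> 1" "real L * (1 - r) = real (L - 2)" using L by (auto simp: r_def field_simps of_nat_diff)
  have avg: "avg_kernel t (nat \<bar>m\<bar>) = t / a m ^ 2" for m by (simp add: avg_kernel_def a_def)
  define b where "b k = norm (f k)" for k
  have b: "0 \<le> b k" "b k \<le> B" for k using f by (auto simp: b_def)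
  define S where "S = (SUP k. b k / a (n - k) ^ L)"
  have bdd: "bdd_above (range (\<lambda>k. b k / a (n - k) ^ L))"
  proof (rule bdd_aboveI2)
    fix k
    have "b k / a (n - k) ^ L \<le> b k / 1" using b a1 a0 by (intro divide_left_mono one_le_power) auto
    then show "b k / a (n - k) ^ L \<le> B" using b(2)[of k] by simp
  qed
  have bS: "b k \<le> S * a (n - k) ^ L" for k
  proof -
    have "b k / a (n - k) ^ L \<le> S" unfolding S_def by (rule cSUP_upper[OF UNIV_I bdd])
    then show ?thesis using a0[of "n - k"] by (simp add: pos_divide_le_eq)
  qed
  have S0: "0 \<le> S"
  proof -
    have "0 \<le> b n / a (n - n) ^ L" using b a0 by (intro divide_nonneg_nonneg) (auto simp: less_imp_le)
    also have "\<dots> \<le> S" unfolding S_def by (rule cSUP_upper[OF UNIV_I bdd])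
    finally show ?thesis .
  qed
  define A where "A = (\<Sum>\<^sub>\<infinity>k. avg_kernel t (nat \<bar>n - k\<bar>) * b k powr r)"
  have As: "(\<lambda>k. avg_kernel t (nat \<bar>n - k\<bar>) * b k powr r) summable_on UNIV"
    using b r by (intro avg_summable[OF t, where B = "B powr r"] powr_mono2) auto
  have A0: "0 \<le> A" unfolding A_def using avg_kernel_nonneg[OF t(1)] by (intro infsum_nonneg) simp
  \<comment> \<open>The reproducing formula is inserted at \<open>k\<close>. Each \<open>b j\<close>
    is split into its powers r and 1 - r, the latter bounded through \<open>S\<close>, and
    submultiplicativity of \<open>a\<close> exchanges the centre \<open>k\<close> for
    \<open>n\<close>.\<close>
  have step: "b k / a (n - k) ^ L \<le> C * S powr (1 - r) * A" for k
  proof -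
    define E where "E = a (n - k) ^ L * (C * S powr (1 - r))"
    have E0: "0 \<le> E" using C a0 by (simp add: E_def less_imp_le)
    have "norm (\<Phi> (k - j) * f j) \<le> E * (avg_kernel t (nat \<bar>n - j\<bar>) * b j powr r)" for j
    proof -
      have "b j powr (1 - r) \<le> (S * a (n - j) ^ L) powr (1 - r)" using b bS r by (intro powr_mono2) auto
      also have "\<dots> = S powr (1 - r) * a (n - j) ^ (L - 2)"
        using S0 a0[of "n - j"] r(3) by (simp add: powr_mult powr_realpow[symmetric] powr_powr)
      finally have "b j powr r * b j powr (1 - r) \<le> b j powr r * (S powr (1 - r) * a (n - j) ^ (L - 2))"
        by (intro mult_left_mono) auto
      moreover have "b j powr r * b j powr (1 - r) = b j" using b(1)[of j] by (simp add: powr_add[symmetric])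
      ultimately have 1: "b j \<le> b j powr r * (S powr (1 - r) * a (n - j) ^ (L - 2))" by simp
      have "a (n - j) ^ L \<le> (a (n - k) * a (k - j)) ^ L" using amul a0 by (intro power_mono) (auto simp: less_imp_le)
      moreover have "a (n - j) ^ L = a (n - j) ^ (L - 2) * a (n - j) ^ 2"
        using L by (simp only: power_add[symmetric] le_add_diff_inverse2)
      ultimately have "a (n - j) ^ (L - 2) * a (n - j) ^ 2 \<le> a (n - k) ^ L * a (k - j) ^ L"
        by (simp only: power_mult_distrib)
      then have 2: "a (n - j) ^ (L - 2) / a (k - j) ^ L \<le> a (n - k) ^ L / a (n - j) ^ 2"
        using a0[of "n - j"] a0[of "k - j"] by (simp add: divide_simps)
      have "norm (\<Phi> (k - j) * f j) \<le> C * t / a (k - j) ^ L * (b j powr r * (S powr (1 - r) * a (n - j) ^ (L - 2)))"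
        unfolding norm_mult using \<Phi>[of "k - j"] 1 a0 C t by (intro mult_mono) (auto simp: a_def b_def)
      also have "\<dots> = (C * t * b j powr r * S powr (1 - r)) * (a (n - j) ^ (L - 2) / a (k - j) ^ L)" by simp
      also have "\<dots> \<le> (C * t * b j powr r * S powr (1 - r)) * (a (n - k) ^ L / a (n - j) ^ 2)"
        using C t by (intro mult_left_mono 2) auto
      also have "\<dots> = E * (avg_kernel t (nat \<bar>n - j\<bar>) * b j powr r)" by (simp add: E_def avg)
      finally show ?thesis .
    qed
    then have "norm (\<Sum>\<^sub>\<infinity>j. \<Phi> (k - j) * f j) \<le> (\<Sum>\<^sub>\<infinity>j. E * (avg_kernel t (nat \<bar>n - j\<bar>) * b j powr r))"
      by (intro norm_infsum_le_infsum summable_on_cmult_right As) auto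
    moreover have "f k = (\<Sum>\<^sub>\<infinity>j. \<Phi> (k - j) * f j)" using fun_cong[OF rep, of k] by (simp add: conv_def)
    ultimately have "b k \<le> E * A" unfolding b_def A_def by (simp add: infsum_cmult_right')
    then show ?thesis using a0[of "n - k"] by (simp add: pos_divide_le_eq E_def mult_ac)
  qed
  have "S \<le> C * S powr (1 - r) * A" unfolding S_def[of] by (rule cSUP_least) (use step in \<open>auto simp: S_def[symmetric]\<close>)
  have Sr: "S powr r \<le> C * A"
  proof (cases "S = 0")
    case True
    then show ?thesis using C A0 by simp
  next
    case False
    then have S: "0 < S" using S0 by simp
    have "S powr r * S powr (1 - r) = S" using S by (simp add: powr_add[symmetric])
    then have "S powr r * S powr (1 - r) \<le> (C * A) * S powr (1 - r)"
      using \<open>S \<le> C * S powr (1 - r) * A\<close> by (simp add: mult_ac)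
    then show ?thesis using S by simp
  qed
  \<comment> \<open>The two additional powers of decay of \<open>M\<close> over \<open>a ^ L\<close>
    leave \<open>D * S\<close> times an averaging kernel, whose mass 4 enters the constant.\<close>
  have "norm (conv M f n) \<le> (\<Sum>\<^sub>\<infinity>k. D * S * avg_kernel t (nat \<bar>n - k\<bar>))"
    unfolding conv_def
  proof (rule norm_infsum_le_infsum)
    show "(\<lambda>k. D * S * avg_kernel t (nat \<bar>n - k\<bar>)) summable_on UNIV"
      by (rule summable_on_cmult_right) (rule avg_kernel_summable[OF t])
    fix k
    have "norm (M (n - k) * f k) \<le> (D * t / a (n - k) ^ (L + 2)) * (S * a (n - k) ^ L)"
      unfolding norm_mult using M[of "n - k"] bS[of k] a0 D t by (intro mult_mono) (auto simp: a_def b_def)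
    also have "\<dots> = D * S * avg_kernel t (nat \<bar>n - k\<bar>)" using a0[of "n - k"] by (simp add: avg power_add power2_eq_square field_simps)
    finally show "norm (M (n - k) * f k) \<le> D * S * avg_kernel t (nat \<bar>n - k\<bar>)" .
  qed
  also have "\<dots> = D * S * (\<Sum>\<^sub>\<infinity>k. avg_kernel t (nat \<bar>n - k\<bar>))" by (rule infsum_cmult_right')
  also have "\<dots> \<le> D * S * 4" using D S0 by (intro mult_left_mono avg_kernel_summable[OF t]) auto
  finally have "norm (conv M f n) powr r \<le> (4 * D * S) powr r" using r by (intro powr_mono2) (auto simp: mult_ac)
  also have "\<dots> = (4 * D) powr r * S powr r" using D S0 by (simp add: powr_mult)
  also have "\<dots> \<le> (4 * D) powr r * (C * A)" by (intro mult_left_mono Sr) auto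
  finally show ?thesis by (simp add: A_def b_def mult_ac)
qed

text \<open>\<open>vector_valued_inequality\<close> needs one finite index set for both variables,
  so the outer sum and the averages are cut to the same window first. The infinite averages arise as
  the window grows with the outer sum restricted to a fixed smaller one. The constant 4 is the mass
  of \<open>avg_kernel\<close>.\<close>

lemma avg_vector_valued:
  fixes s t :: real
  assumes s: "1 < s" and t: "0 < t" and st: "1 < s * t"
  shows "\<exists>D\<ge>0. \<forall>(x :: int \<Rightarrow> int \<Rightarrow> real) V N. finite V \<longrightarrow> V \<subseteq> {..0} \<longrightarrow> (\<forall>v n. 0 \<le> x v n) \<longrightarrow>
    (\<forall>v\<in>V. \<exists>B. \<forall>n. x v n \<le> B) \<longrightarrow>
    (\<forall>R. (\<Sum>n\<in>{- int R..int R}. (\<Sum>v\<in>V. x v n powr s) powr t) \<le> N) \<longrightarrow>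
    (\<forall>R. (\<Sum>n\<in>{- int R..int R}. (\<Sum>v\<in>V. (\<Sum>\<^sub>\<infinity>k. avg_kernel (2 powi v) (nat \<bar>n - k\<bar>) * x v k) powr s) powr t) \<le> D * N)"
proof -
  define C where "C = max_const 4"
  define D where "D = (if t = 1 then 4 powr (s - 1) * 4 else if 1 < t
      then (4 powr (s - 1) * C (t / (t - 1)) powr (1 - 1 / t)) powr t
      else 4 powr t * C ((s - 1) * t / (1 - t)) powr (1 - t))"
  have D0: "0 \<le> D" by (simp add: D_def)
  have main: "(\<Sum>n\<in>{- int R..int R}. (\<Sum>v\<in>V. (\<Sum>\<^sub>\<infinity>k. avg_kernel (2 powi v) (nat \<bar>n - k\<bar>) * x v k) powr s) powr t) \<le> D * N"
    if V: "finite V" "V \<subseteq> {..0}" and x: "\<forall>v n. 0 \<le> x v n" and bd: "\<forall>v\<in>V. \<exists>B. \<forall>n. x v n \<le> B"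
      and N: "\<forall>R. (\<Sum>n\<in>{- int R..int R}. (\<Sum>v\<in>V. x v n powr s) powr t) \<le> N"
    for x :: "int \<Rightarrow> int \<Rightarrow> real" and V N R
  proof -
    define K where "K v n k = avg_kernel (2 powi v) (nat \<bar>n - k\<bar>)" for v n k :: int
    have K0: "0 \<le> K v n k" for v n k by (simp add: K_def avg_kernel_nonneg)
    have le1: "(2::real) powi v \<le> 1" if "v \<in> V" for v using V(2) that powi_nonpos_le_1 by auto
    define Y where "Y R n = (\<Sum>v\<in>V. (\<Sum>k\<in>{- int R..int R}. K v n k * x v k) powr s) powr t" for R n
    have fin: "(\<Sum>n\<in>{- int Q..int Q}. Y Q n) \<le> D * N" for Q
    proof -
      have "(\<Sum>n\<in>{- int Q..int Q}. Y Q n) \<le> D * (\<Sum>n\<in>{- int Q..int Q}. (\<Sum>v\<in>V. x v n powr s) powr t)"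
        unfolding Y_def D_def
      proof (rule vector_valued_inequality)
        show "K v n k = K v k n" for v n k by (simp add: K_def abs_minus_commute)
        show "(\<Sum>k\<in>{- int Q..int Q}. K v n k) \<le> 4" if "v \<in> V" for v n
        proof -
          have "(\<Sum>k\<in>{- int Q..int Q}. K v n k) = (\<Sum>m\<in>(\<lambda>k. n - k) ` {- int Q..int Q}. avg_kernel (2 powi v) (nat \<bar>m\<bar>))"
            unfolding K_def by (subst sum.reindex) (auto simp: inj_on_def)
          also have "\<dots> \<le> 4" by (rule avg_kernel_sum_int) (auto intro: le1 that)
          finally show ?thesis .
        qed
        show "0 \<le> C r" for r by (simp add: C_def max_const_def)
        fix g :: "int \<Rightarrow> real" and r :: real assume g: "\<And>n. 0 \<le> g n" and r: "1 < r"
        obtain W where W: "\<forall>n. 0 \<le> W n"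
          "\<forall>c. antimono c \<longrightarrow> (\<forall>n. 0 \<le> c n) \<longrightarrow> (\<forall>n. (\<Sum>j<n. c j) \<le> 4) \<longrightarrow>
             (\<forall>n\<in>{- int Q..int Q}. (\<Sum>k\<in>{- int Q..int Q}. c (nat \<bar>n - k\<bar>) * g k) \<le> W n)"
          "(\<Sum>n\<in>{- int Q..int Q}. W n powr r) \<le> C r * (\<Sum>n\<in>{- int Q..int Q}. g n powr r)"
          using maximal_inequality_int[where g = g and s = r and B = 4 and R = Q, OF g r] unfolding C_def by auto
        have "(\<Sum>k\<in>{- int Q..int Q}. K v n k * g k) \<le> W n" if v: "v \<in> V" and n: "n \<in> {- int Q..int Q}" for v n
        proof -
          have "(\<Sum>j<m. avg_kernel (2 powi v) j) \<le> 4" for m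
            using avg_kernel_sum_nat[of "2 powi v" m] le1[OF v] by simp
          moreover have "antimono (avg_kernel (2 powi v))" by (rule avg_kernel_antimono) simp
          moreover have "\<forall>j. 0 \<le> avg_kernel (2 powi v) j" by (simp add: avg_kernel_nonneg)
          ultimately show ?thesis using W(2) n unfolding K_def by blast
        qed
        with W(1,3) show "\<exists>W. (\<forall>n. 0 \<le> W n) \<and>
          (\<forall>v\<in>V. \<forall>n\<in>{- int Q..int Q}. (\<Sum>k\<in>{- int Q..int Q}. K v n k * g k) \<le> W n) \<and>
          (\<Sum>n\<in>{- int Q..int Q}. W n powr r) \<le> C r * (\<Sum>n\<in>{- int Q..int Q}. g n powr r)" by blast
      qed (use V x K0 s t st in auto)
      also have "\<dots> \<le> D * N" using N D0 by (intro mult_left_mono) auto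
      finally show ?thesis .
    qed
    have conv: "(\<lambda>Q. \<Sum>k\<in>{- int Q..int Q}. K v n k * x v k) \<longlonglongrightarrow> (\<Sum>\<^sub>\<infinity>k. K v n k * x v k)" if v: "v \<in> V" for v n
    proof -
      obtain B where B: "\<And>n. x v n \<le> B" using bd v by blast
      have "(\<lambda>k. K v n k * x v k) summable_on UNIV" unfolding K_def
        by (rule avg_summable[OF _ le1[OF v] _ B]) (use x in auto)
      then show ?thesis by (rule has_sum_int_tendsto[OF has_sum_infsum])
    qed
    have Kx: "0 \<le> (\<Sum>k\<in>{- int Q..int Q}. K v n k * x v k)" for Q v n using K0 x by (intro sum_nonneg mult_nonneg_nonneg) auto
    have "(\<lambda>Q. \<Sum>n\<in>{- int R..int R}. Y Q n) \<longlonglongrightarrow>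
       (\<Sum>n\<in>{- int R..int R}. (\<Sum>v\<in>V. (\<Sum>\<^sub>\<infinity>k. K v n k * x v k) powr s) powr t)"
      unfolding Y_def
    proof (rule tendsto_sum, rule tendsto_powr2[OF tendsto_sum tendsto_const])
      fix n v assume v: "v \<in> V"
      show "(\<lambda>Q. (\<Sum>k\<in>{- int Q..int Q}. K v n k * x v k) powr s) \<longlonglongrightarrow> (\<Sum>\<^sub>\<infinity>k. K v n k * x v k) powr s"
        by (rule tendsto_powr2[OF conv[OF v] tendsto_const]) (use Kx s in auto)
    qed (use t in \<open>auto intro!: sum_nonneg always_eventually\<close>)
    then show ?thesis unfolding K_def
    proof (rule LIMSEQ_le_const2, intro exI[of _ R] allI impI)
      fix Q assume RQ: "R \<le> Q"
      have "(\<Sum>n\<in>{- int R..int R}. Y Q n) \<le> (\<Sum>n\<in>{- int Q..int Q}. Y Q n)"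
        using RQ by (intro sum_mono2) (auto simp: Y_def)
      also have "\<dots> \<le> D * N" by (rule fin)
      finally show "(\<Sum>n\<in>{- int R..int R}. Y Q n) \<le> D * N" .
    qed
  qed
  show ?thesis using D0 main by (intro exI[of _ D]) blast
qed

section \<open>Estimates for the frequency pieces of the Riesz transform\<close>

context admissible
begin

lemma riesz_pointwise:
  assumes L: "2 \<le> L"
  defines "r \<equiv> 2 / real L"
  shows "\<exists>C\<ge>0. \<forall>u v n. pgrow u \<longrightarrow> v \<le> 0 \<longrightarrow>
    (\<forall>e\<in>{- 1, 0, 1}. v + e \<le> 0 \<longrightarrow> (\<exists>B. \<forall>k. norm (conv (\<phi> (v + e)) u k) \<le> B)) \<longrightarrow>
    norm (conv (coef (riesz_symbol v)) u n) powr r \<le> C * (\<Sum>e\<in>{- 1, 0, 1}. if v + e \<le> 0 then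
      (\<Sum>\<^sub>\<infinity>k. avg_kernel (2 powi (v + e)) (nat \<bar>n - k\<bar>) * norm (conv (\<phi> (v + e)) u k) powr r) else 0)"
proof -
  obtain C where C: "0 \<le> C" "\<And>v n. v \<le> 0 \<Longrightarrow> norm (coef (loc v) n) \<le> C * 2 powi v / (1 + 2 powi v * \<bar>of_int n\<bar>) ^ L"
    using symb_coef_decay[OF symb_loc band_loc, of L] by blast
  have "\<forall>e. \<exists>D\<ge>0. \<forall>v\<le>0. \<forall>n. norm (coef (riesz_part e v) n) \<le> D * 2 powi v / (1 + 2 powi v * \<bar>of_int n\<bar>) ^ (L + 2)"
    using symb_coef_decay[OF symb_riesz_part band_riesz_part] by blast
  then obtain D where D: "\<And>e. 0 \<le> D e"
    "\<And>e v n. v \<le> 0 \<Longrightarrow> norm (coef (riesz_part e v) n) \<le> D e * 2 powi v / (1 + 2 powi v * \<bar>of_int n\<bar>) ^ (L + 2)"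
    by metis
  \<comment> \<open>Kernel bounds at scale v are restated at scale v + e: one factor 2 for the
    amplitude and 2^(L + 2) for the denominator. The sum over the three values of e gives a common
    constant.\<close>
  define E where "E = (D (- 1) + D 0 + D 1) * 2 ^ (L + 3)"
  have E0: "0 \<le> E" using D(1) by (simp add: E_def)
  have kernel: "norm (coef (riesz_part e v) n) \<le> E * 2 powi (v + e) / (1 + 2 powi (v + e) * \<bar>of_int n\<bar>) ^ (L + 2)"
    if v: "v \<le> 0" and e: "e \<in> {- 1, 0, 1}" for e v n
  proof -
    define q where "q = (2::real) powi v"
    define q' where "q' = (2::real) powi (v + e)"
    define y where "y = \<bar>of_int n :: real\<bar>"
    have q: "0 < q" "0 < q'" "q \<le> 2 * q'" "q' \<le> 2 * q" "0 \<le> y"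
      using e by (auto simp: q_def q'_def y_def power_int_add power_int_minus)
    have "q' * y \<le> 2 * (q * y)" using mult_right_mono[OF q(4) q(5)] by (simp add: mult.assoc)
    then have h: "(1 + q' * y) / 2 \<le> 1 + q * y" by simp
    have p1: "0 < 1 + q' * y" using q by (simp add: add_pos_nonneg)
    have "norm (coef (riesz_part e v) n) \<le> D e * q / (1 + q * y) ^ (L + 2)" using D(2)[OF v, of e n] by (simp add: q_def y_def)
    also have "\<dots> \<le> D e * (2 * q') / ((1 + q' * y) / 2) ^ (L + 2)"
      using D(1) q h p1 by (intro frac_le mult_left_mono power_mono zero_less_power) auto
    also have "\<dots> = (D e * 2 ^ (L + 3)) * q' / (1 + q' * y) ^ (L + 2)"
      by (simp add: power_divide power_add field_simps)
    also have "\<dots> \<le> E * q' / (1 + q' * y) ^ (L + 2)"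
      unfolding E_def using D(1)[of "- 1"] D(1)[of 0] D(1)[of 1] q p1 e
      by (intro divide_right_mono mult_right_mono) auto
    finally show ?thesis by (simp only: q_def q'_def y_def)
  qed
  have r: "0 < r" using L by (simp add: r_def)
  define F where "F = (4 * E) powr r * C"
  have F0: "0 \<le> F" using C by (simp add: F_def)
  have "norm (conv (coef (riesz_symbol v)) u n) powr r \<le> (3 powr r * F) * (\<Sum>e\<in>{- 1, 0, 1}. if v + e \<le> 0 then
      (\<Sum>\<^sub>\<infinity>k. avg_kernel (2 powi (v + e)) (nat \<bar>n - k\<bar>) * norm (conv (\<phi> (v + e)) u k) powr r) else 0)"
    if u: "pgrow u" and v: "v \<le> 0"
      and bd: "\<forall>e\<in>{- 1, 0, 1}. v + e \<le> 0 \<longrightarrow> (\<exists>B. \<forall>k. norm (conv (\<phi> (v + e)) u k) \<le> B)" for u v n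
  proof -
    define z where "z e = (if v + e \<le> 0 then conv (coef (riesz_part e v)) (conv (\<phi> (v + e)) u) n else 0)" for e
    define A where "A e = (if v + e \<le> 0 then
      (\<Sum>\<^sub>\<infinity>k. avg_kernel (2 powi (v + e)) (nat \<bar>n - k\<bar>) * norm (conv (\<phi> (v + e)) u k) powr r) else 0)" for e
    have zA: "norm (z e) powr r \<le> F * A e" if e: "e \<in> {- 1, 0, 1}" for e
    proof (cases "v + e \<le> 0")
      case True
      obtain B where B: "\<And>k. norm (conv (\<phi> (v + e)) u k) \<le> B" using bd e True by blast
      have "norm (conv (coef (riesz_part e v)) (conv (\<phi> (v + e)) u) n) powr r \<le>
        ((4 * E) powr r * C) * (\<Sum>\<^sub>\<infinity>k. avg_kernel (2 powi (v + e)) (nat \<bar>n - k\<bar>) * norm (conv (\<phi> (v + e)) u k) powr r)"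
        unfolding r_def
        by (rule Peetre_bound[where \<Phi> = "coef (loc (v + e))" and B = B])
          (use L C True E0 B phi_reproducing[OF True u] kernel[OF v e] powi_nonpos_le_1[OF True] in auto)
      then show ?thesis using True by (simp add: z_def A_def F_def)
    qed (simp add: z_def A_def)
    have "norm (conv (coef (riesz_symbol v)) u n) powr r = norm (\<Sum>e\<in>{- 1, 0, 1}. z e) powr r"
      unfolding riesz_decomposition[OF v u] z_def ..
    also have "\<dots> \<le> (\<Sum>e\<in>{- 1, 0, 1}. norm (z e)) powr r"
      using r by (intro powr_mono2 norm_sum) auto
    also have "\<dots> \<le> real (card {- 1, 0, 1 :: int}) powr r * (\<Sum>e\<in>{- 1, 0, 1}. norm (z e) powr r)"
      using r by (intro sum_powr_le) auto
    also have "\<dots> = 3 powr r * (\<Sum>e\<in>{- 1, 0, 1}. norm (z e) powr r)" by simp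
    also have "\<dots> \<le> 3 powr r * (\<Sum>e\<in>{- 1, 0, 1}. F * A e)" by (intro mult_left_mono sum_mono zA) auto
    also have "\<dots> = (3 powr r * F) * (\<Sum>e\<in>{- 1, 0, 1}. A e)" by (simp only: sum_distrib_left mult.assoc)
    finally show ?thesis by (simp only: A_def)
  qed
  then show ?thesis using F0 by (intro exI[of _ "3 powr r * F"]) (simp only: mult_nonneg_nonneg powr_ge_zero simp_thms, blast)
qed

text \<open>The pointwise bound is raised to the power s = q/r and summed; with t = p/q one has s t
  = p/r, so both exponents required for the averaging inequality exceed 1. \<open>V'\<close> has to
  contain the neighbours of \<open>V\<close>, since each piece is bounded by three scales.\<close>

lemma riesz_finite_estimate:
  assumes p: "0 < p" and q: "0 < q"
  shows "\<exists>D\<ge>0. \<forall>u V V' N. pgrow u \<longrightarrow> finite V \<longrightarrow> V \<subseteq> {..0} \<longrightarrow> finite V' \<longrightarrow> V' \<subseteq> {..0} \<longrightarrow>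
    (\<forall>v\<in>V. \<forall>e\<in>{- 1, 0, 1}. v + e \<le> 0 \<longrightarrow> v + e \<in> V') \<longrightarrow>
    (\<forall>R. (\<Sum>n\<in>{- int R..int R}. (\<Sum>v\<in>V'. (2 powr (of_int v * \<alpha>) * norm (conv (\<phi> v) u n)) powr q) powr (p / q)) \<le> N) \<longrightarrow>
    (\<forall>R. (\<Sum>n\<in>{- int R..int R}. (\<Sum>v\<in>V. (2 powr (of_int v * \<alpha>) * norm (conv (coef (riesz_symbol v)) u n)) powr q) powr (p / q)) \<le> D * N)"
proof -
  define m where "m = min 1 (min p q)"
  have m: "0 < m" "m \<le> 1" "m \<le> p" "m \<le> q" using p q by (auto simp: m_def)
  \<comment> \<open>Makes r = 2/L smaller than 1, p and q while keeping the special form that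
    \<open>Peetre_bound\<close> asks for.\<close>
  obtain L :: nat where L: "2 / m < real L" using reals_Archimedean2 by blast
  have L2: "2 < real L" using m by (intro le_less_trans[OF _ L]) (simp add: field_simps)
  define r where "r = 2 / real L"
  have "r < m" using L L2 m by (simp add: r_def field_simps)
  then have r: "0 < r" "r < p" "r < q" using L2 m by (auto simp: r_def)
  define s where "s = q / r"
  define t where "t = p / q"
  have st: "1 < s" "0 < t" "1 < s * t" "r * s = q" using r p q by (auto simp: s_def t_def)
  obtain C where C: "0 \<le> C" "\<And>u v n. pgrow u \<Longrightarrow> v \<le> 0 \<Longrightarrow>
      (\<forall>e\<in>{- 1, 0, 1}. v + e \<le> 0 \<longrightarrow> (\<exists>B. \<forall>k. norm (conv (\<phi> (v + e)) u k) \<le> B)) \<Longrightarrow>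
      norm (conv (coef (riesz_symbol v)) u n) powr r \<le> C * (\<Sum>e\<in>{- 1, 0, 1}. if v + e \<le> 0 then
      (\<Sum>\<^sub>\<infinity>k. avg_kernel (2 powi (v + e)) (nat \<bar>n - k\<bar>) * norm (conv (\<phi> (v + e)) u k) powr r) else 0)"
    using riesz_pointwise[of L] L2 unfolding r_def by auto
  obtain D where D: "0 \<le> D" "\<forall>(x :: int \<Rightarrow> int \<Rightarrow> real) V N. finite V \<longrightarrow> V \<subseteq> {..0} \<longrightarrow> (\<forall>v n. 0 \<le> x v n) \<longrightarrow>
    (\<forall>v\<in>V. \<exists>B. \<forall>n. x v n \<le> B) \<longrightarrow>
    (\<forall>R. (\<Sum>n\<in>{- int R..int R}. (\<Sum>v\<in>V. x v n powr s) powr t) \<le> N) \<longrightarrow>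
    (\<forall>R. (\<Sum>n\<in>{- int R..int R}. (\<Sum>v\<in>V. (\<Sum>\<^sub>\<infinity>k. avg_kernel (2 powi v) (nat \<bar>n - k\<bar>) * x v k) powr s) powr t) \<le> D * N)"
    using avg_vector_valued[OF st(1-3)] by (elim exE conjE) (rule that)
  \<comment> \<open>\<open>2 powr \<bar>\<alpha>\<bar>\<close> is the price of moving the weight
    2^(v \<alpha>) from scale v to v + e.\<close>
  define H where "H = (2 powr \<bar>\<alpha>\<bar>) powr r * C"
  have H0: "0 \<le> H" using C by (simp add: H_def)
  \<comment> \<open>\<open>3 powr s\<close> splits the power of a three-term sum; the last 3 arises
    because each scale of \<open>V'\<close> is a neighbour of at most three scales of
    \<open>V\<close>.\<close>
  define J where "J = H powr s * 3 powr s * 3"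
  have J0: "0 \<le> J" by (simp add: J_def)
  have "(\<Sum>n\<in>{- int R..int R}. (\<Sum>v\<in>V. (2 powr (of_int v * \<alpha>) * norm (conv (coef (riesz_symbol v)) u n)) powr q) powr (p / q))
      \<le> (J powr t * D) * N"
    if u: "pgrow u" and V: "finite V" "V \<subseteq> {..0}" and V': "finite V'" "V' \<subseteq> {..0}"
      and VV': "\<forall>v\<in>V. \<forall>e\<in>{- 1, 0, 1}. v + e \<le> 0 \<longrightarrow> v + e \<in> V'"
      and N: "\<forall>R. (\<Sum>n\<in>{- int R..int R}. (\<Sum>v\<in>V'. (2 powr (of_int v * \<alpha>) * norm (conv (\<phi> v) u n)) powr q) powr (p / q)) \<le> N"
    for u V V' N R
  proof -
    define x where "x v n = (2 powr (of_int v * \<alpha>) * norm (conv (\<phi> v) u n)) powr r" for v n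
    define G where "G v n = 2 powr (of_int v * \<alpha>) * norm (conv (coef (riesz_symbol v)) u n)" for v n
    define Y where "Y v n = (\<Sum>\<^sub>\<infinity>k. avg_kernel (2 powi v) (nat \<bar>n - k\<bar>) * x v k)" for v n
    have xs: "x v n powr s = (2 powr (of_int v * \<alpha>) * norm (conv (\<phi> v) u n)) powr q" for v n
      by (simp add: x_def powr_powr st(4))
    have Y0: "0 \<le> Y v n" for v n
      unfolding Y_def by (intro infsum_nonneg mult_nonneg_nonneg avg_kernel_nonneg) (simp_all add: x_def)
    have N': "\<forall>R. (\<Sum>n\<in>{- int R..int R}. (\<Sum>v\<in>V'. x v n powr s) powr t) \<le> N" using N unfolding xs t_def .
    \<comment> \<open>A single term is bounded by the whole sum, hence every piece is a bounded
      sequence. Without this the Peetre supremum could be infinite.\<close>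
    have bdx: "x v n \<le> N powr (1 / (s * t))" if v: "v \<in> V'" for v n
    proof -
      have "(x v n powr s) powr t \<le> (\<Sum>v\<in>V'. x v n powr s) powr t"
        using V' v st by (intro powr_mono2 member_le_sum) auto
      also have "\<dots> \<le> (\<Sum>n\<in>{- int (nat \<bar>n\<bar>)..int (nat \<bar>n\<bar>)}. (\<Sum>v\<in>V'. x v n powr s) powr t)"
        by (rule member_le_sum[where f = "\<lambda>n. (\<Sum>v\<in>V'. x v n powr s) powr t"]) auto
      also have "\<dots> \<le> N" using N' by blast
      finally have "((x v n powr s) powr t) powr (1 / (s * t)) \<le> N powr (1 / (s * t))"
        using st by (intro powr_mono2) auto
      moreover have "((x v n powr s) powr t) powr (1 / (s * t)) = x v n"
        using st by (simp add: powr_powr) (simp add: x_def)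
      ultimately show ?thesis by simp
    qed
    have bdf: "\<exists>B. \<forall>k. norm (conv (\<phi> v) u k) \<le> B" if v: "v \<in> V'" for v
    proof (intro exI allI)
      fix k
      have "x v k powr (1 / r) \<le> (N powr (1 / (s * t))) powr (1 / r)"
        using bdx[OF v] r by (intro powr_mono2) (auto simp: x_def)
      then have "2 powr (of_int v * \<alpha>) * norm (conv (\<phi> v) u k) \<le> (N powr (1 / (s * t))) powr (1 / r)"
        using r by (simp add: x_def powr_powr)
      then show "norm (conv (\<phi> v) u k) \<le> (N powr (1 / (s * t))) powr (1 / r) / 2 powr (of_int v * \<alpha>)"
        by (simp add: pos_le_divide_eq mult.commute)
    qed
    have point: "G v n powr r \<le> H * (\<Sum>e\<in>{- 1, 0, 1}. if v + e \<le> 0 then Y (v + e) n else 0)" if v: "v \<in> V" for v n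
    proof -
      have v0: "v \<le> 0" using v V by auto
      define A where "A e = (if v + e \<le> 0 then
        (\<Sum>\<^sub>\<infinity>k. avg_kernel (2 powi (v + e)) (nat \<bar>n - k\<bar>) * norm (conv (\<phi> (v + e)) u k) powr r) else 0)" for e
      have A0: "0 \<le> A e" for e unfolding A_def
        by (auto intro!: infsum_nonneg mult_nonneg_nonneg avg_kernel_nonneg)
      have "norm (conv (coef (riesz_symbol v)) u n) powr r \<le> C * (\<Sum>e\<in>{- 1, 0, 1}. A e)"
        unfolding A_def by (rule C(2)[OF u v0]) (use VV' v bdf in blast)
      then have "G v n powr r \<le> (2 powr (of_int v * \<alpha>)) powr r * (C * (\<Sum>e\<in>{- 1, 0, 1}. A e))"
        unfolding G_def by (simp add: powr_mult)
      also have "\<dots> = C * (\<Sum>e\<in>{- 1, 0, 1}. (2 powr (of_int v * \<alpha>)) powr r * A e)"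
        by (simp only: sum_distrib_left mult.left_commute)
      also have "\<dots> \<le> C * (\<Sum>e\<in>{- 1, 0, 1}. (2 powr \<bar>\<alpha>\<bar>) powr r * (if v + e \<le> 0 then Y (v + e) n else 0))"
      proof (intro mult_left_mono sum_mono C)
        fix e :: int assume e: "e \<in> {- 1, 0, 1}"
        show "(2 powr (of_int v * \<alpha>)) powr r * A e \<le> (2 powr \<bar>\<alpha>\<bar>) powr r * (if v + e \<le> 0 then Y (v + e) n else 0)"
        proof (cases "v + e \<le> 0")
          case True
          have "of_int v * \<alpha> = of_int (v + e) * \<alpha> + - (of_int e * \<alpha>)" by (simp add: algebra_simps)
          also have "\<dots> \<le> of_int (v + e) * \<alpha> + \<bar>\<alpha>\<bar>" using e by auto
          finally have "(2 powr (of_int v * \<alpha>)) powr r \<le> (2 powr (of_int (v + e) * \<alpha> + \<bar>\<alpha>\<bar>)) powr r"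
            using r by (intro powr_mono2 powr_mono) auto
          also have "\<dots> = (2 powr \<bar>\<alpha>\<bar>) powr r * (2 powr (of_int (v + e) * \<alpha>)) powr r"
            by (simp add: powr_add powr_mult)
          finally have "(2 powr (of_int v * \<alpha>)) powr r * A e \<le> ((2 powr \<bar>\<alpha>\<bar>) powr r * (2 powr (of_int (v + e) * \<alpha>)) powr r) * A e"
            by (rule mult_right_mono[OF _ A0])
          also have "(2 powr (of_int (v + e) * \<alpha>)) powr r * A e = Y (v + e) n"
            unfolding A_def Y_def x_def using True
            by (simp add: infsum_cmult_right'[symmetric] powr_mult mult_ac)
          then have "((2 powr \<bar>\<alpha>\<bar>) powr r * (2 powr (of_int (v + e) * \<alpha>)) powr r) * A e = (2 powr \<bar>\<alpha>\<bar>) powr r * Y (v + e) n"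
            by (simp only: mult.assoc)
          finally show ?thesis using True by simp
        qed (simp add: A_def)
      qed
      also have "\<dots> = H * (\<Sum>e\<in>{- 1, 0, 1}. if v + e \<le> 0 then Y (v + e) n else 0)"
        unfolding H_def by (simp only: sum_distrib_left mult_ac)
      finally show ?thesis .
    qed
    have inner: "(\<Sum>v\<in>V. G v n powr q) \<le> J * (\<Sum>v\<in>V'. Y v n powr s)" for n
    proof -
      define y where "y v e = (if v + e \<le> 0 then Y (v + e) n else 0)" for v e
      have y0: "0 \<le> y v e" for v e using Y0 by (simp add: y_def)
      have "G v n powr q \<le> (H powr s * 3 powr s) * (\<Sum>e\<in>{- 1, 0, 1}. y v e powr s)" if v: "v \<in> V" for v
      proof -
        have "G v n powr q = (G v n powr r) powr s" by (simp add: powr_powr st(4))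
        also have "\<dots> \<le> (H * (\<Sum>e\<in>{- 1, 0, 1}. y v e)) powr s"
          using point[OF v, of n] st unfolding y_def by (intro powr_mono2) auto
        also have "\<dots> = H powr s * (\<Sum>e\<in>{- 1, 0, 1}. y v e) powr s"
          by (rule powr_mult)
        also have "\<dots> \<le> H powr s * (real (card {- 1, 0, 1 :: int}) powr s * (\<Sum>e\<in>{- 1, 0, 1}. y v e powr s))"
          using y0 st by (intro mult_left_mono sum_powr_le) auto
        finally show ?thesis by (simp add: mult.assoc)
      qed
      then have "(\<Sum>v\<in>V. G v n powr q) \<le> (\<Sum>v\<in>V. (H powr s * 3 powr s) * (\<Sum>e\<in>{- 1, 0, 1}. y v e powr s))"
        by (rule sum_mono)
      also have "\<dots> = (H powr s * 3 powr s) * (\<Sum>v\<in>V. \<Sum>e\<in>{- 1, 0, 1}. y v e powr s)"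
        by (simp only: sum_distrib_left[symmetric])
      finally have G1: "(\<Sum>v\<in>V. G v n powr q) \<le> (H powr s * 3 powr s) * (\<Sum>v\<in>V. \<Sum>e\<in>{- 1, 0, 1}. y v e powr s)" .
      have "(\<Sum>v\<in>V. \<Sum>e\<in>{- 1, 0, 1}. y v e powr s) = (\<Sum>e\<in>{- 1, 0, 1}. \<Sum>v\<in>V. y v e powr s)" by (rule sum.swap)
      also have "\<dots> \<le> (\<Sum>e\<in>{- 1, 0, 1 :: int}. \<Sum>v\<in>V'. Y v n powr s)"
      proof (rule sum_mono)
        fix e :: int assume e: "e \<in> {- 1, 0, 1}"
        have "(\<Sum>v\<in>V. y v e powr s) = (\<Sum>v\<in>{v\<in>V. v + e \<le> 0}. Y (v + e) n powr s)"
          using V by (simp add: y_def if_distrib[of "\<lambda>z. z powr s"] sum.inter_filter[symmetric] cong: if_cong)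
        also have "\<dots> = (\<Sum>v\<in>(\<lambda>v. v + e) ` {v\<in>V. v + e \<le> 0}. Y v n powr s)"
          by (subst sum.reindex) (auto simp: inj_on_def)
        also have "\<dots> \<le> (\<Sum>v\<in>V'. Y v n powr s)"
          using V' VV' e by (intro sum_mono2) auto
        finally show "(\<Sum>v\<in>V. y v e powr s) \<le> (\<Sum>v\<in>V'. Y v n powr s)" .
      qed
      also have "\<dots> = 3 * (\<Sum>v\<in>V'. Y v n powr s)" by simp
      finally have "(H powr s * 3 powr s) * (\<Sum>v\<in>V. \<Sum>e\<in>{- 1, 0, 1}. y v e powr s) \<le> J * (\<Sum>v\<in>V'. Y v n powr s)"
        unfolding J_def mult.assoc[of _ 3] by (rule mult_left_mono) simp
      from order_trans[OF G1 this] show ?thesis .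
    qed
    have "(\<Sum>n\<in>{- int R..int R}. (\<Sum>v\<in>V. G v n powr q) powr t) \<le>
      (\<Sum>n\<in>{- int R..int R}. J powr t * (\<Sum>v\<in>V'. Y v n powr s) powr t)"
    proof (rule sum_mono)
      fix n
      have "(\<Sum>v\<in>V. G v n powr q) powr t \<le> (J * (\<Sum>v\<in>V'. Y v n powr s)) powr t"
        using inner[of n] st by (intro powr_mono2) (auto intro!: sum_nonneg)
      also have "\<dots> = J powr t * (\<Sum>v\<in>V'. Y v n powr s) powr t" by (rule powr_mult)
      finally show "(\<Sum>v\<in>V. G v n powr q) powr t \<le> J powr t * (\<Sum>v\<in>V'. Y v n powr s) powr t" .
    qed
    also have "\<dots> = J powr t * (\<Sum>n\<in>{- int R..int R}. (\<Sum>v\<in>V'. Y v n powr s) powr t)" by (simp only: sum_distrib_left)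
    also have "\<dots> \<le> J powr t * (D * N)"
    proof (rule mult_left_mono)
      show "(\<Sum>n\<in>{- int R..int R}. (\<Sum>v\<in>V'. Y v n powr s) powr t) \<le> D * N"
        unfolding Y_def by (rule D(2)[rule_format, OF V']) (use bdx N' in \<open>auto simp: x_def\<close>)
    qed simp
    finally show ?thesis unfolding G_def t_def by (simp only: mult.assoc)
  qed
  then show ?thesis using D(1) by (intro exI[of _ "J powr t * D"]) (simp only: mult_nonneg_nonneg powr_ge_zero simp_thms, blast)
qed

end

section \<open>Besov and Triebel--Lizorkin norms\<close>

lemma ennpowr_ennreal: "0 \<le> x \<Longrightarrow> ennpowr (ennreal x) a = ennreal (x powr a)"
  by (simp add: ennpowr_def)

lemma ennpowr_top: "ennpowr top a = top"
  by (simp add: ennpowr_def)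

lemma ennpowr_mono:
  assumes "x \<le> y" "0 \<le> a"
  shows "ennpowr x a \<le> ennpowr y a"
proof (cases y)
  case (real r)
  then obtain z where "0 \<le> z" "x = ennreal z" using assms(1) by (cases x) (auto simp: top_unique)
  then show ?thesis using assms real by (simp add: ennpowr_ennreal powr_mono2)
qed (simp add: ennpowr_top)

lemma ennpowr_ennpowr: "ennpowr (ennpowr x a) b = ennpowr x (a * b)"
  by (cases x) (simp_all add: ennpowr_ennreal ennpowr_top powr_powr)

lemma ennpowr_1: "ennpowr x 1 = x"
  by (cases x) (simp_all add: ennpowr_ennreal ennpowr_top)

lemma ennpowr_mult:
  assumes "0 < c"
  shows "ennpowr (ennreal c * x) a = ennreal (c powr a) * ennpowr x a"
proof (cases x)
  case (real r)
  then have "ennpowr (ennreal c * x) a = ennpowr (ennreal (c * r)) a" using assms by (simp add: ennreal_mult)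
  also have "\<dots> = ennreal (c powr a * r powr a)" using assms real(1) by (subst ennpowr_ennreal) (auto simp: powr_mult)
  finally show ?thesis using real by (simp add: ennpowr_ennreal ennreal_mult)
next
  case top
  then show ?thesis using assms by (simp add: ennpowr_top ennreal_mult_top)
qed

lemma ennpowr_less_top: "ennpowr x a < top \<longleftrightarrow> x < top"
  by (cases x) (simp_all add: ennpowr_ennreal ennpowr_top)

text \<open>A positive power is monotone with the monotone inverse of exponent 1/a, hence it
  commutes with suprema.\<close>

lemma ennpowr_SUP:
  assumes a: "0 < a"
  shows "ennpowr (SUP i\<in>I. f i) a = (SUP i\<in>I. ennpowr (f i) a)"
proof (cases "I = {}")
  case True
  then show ?thesis by (simp add: ennpowr_def bot_ennreal)
next
  case False
  define M where "M = (SUP i\<in>I. ennpowr (f i) a)"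
  show ?thesis
  proof (rule antisym)
    have "f i \<le> ennpowr M (1 / a)" if "i \<in> I" for i
    proof -
      have "ennpowr (ennpowr (f i) a) (1 / a) \<le> ennpowr M (1 / a)"
        unfolding M_def using a by (intro ennpowr_mono SUP_upper that) auto
      then show ?thesis using a by (simp add: ennpowr_ennpowr ennpowr_1)
    qed
    then have "ennpowr (SUP i\<in>I. f i) a \<le> ennpowr (ennpowr M (1 / a)) a"
      using a by (intro ennpowr_mono SUP_least) auto
    then show "ennpowr (SUP i\<in>I. f i) a \<le> (SUP i\<in>I. ennpowr (f i) a)"
      using a by (simp add: ennpowr_ennpowr ennpowr_1 M_def)
  qed (use a in \<open>auto intro!: SUP_least ennpowr_mono SUP_upper\<close>)
qed

lemma infsum_ennreal_SUP:
  fixes f :: "'a \<Rightarrow> ennreal" and S :: "nat \<Rightarrow> 'a set"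
  assumes S: "\<And>i. finite (S i)" "\<And>i. S i \<subseteq> A" "\<And>F. finite F \<Longrightarrow> F \<subseteq> A \<Longrightarrow> \<exists>i. F \<subseteq> S i"
  shows "infsum f A = (SUP i. sum f (S i))"
proof -
  have "infsum f A = (SUP F\<in>{F. finite F \<and> F \<subseteq> A}. sum f F)" by (rule nonneg_infsum_complete) simp
  also have "\<dots> = (SUP i. sum f (S i))"
  proof (rule antisym)
    show "(SUP F\<in>{F. finite F \<and> F \<subseteq> A}. sum f F) \<le> (SUP i. sum f (S i))"
    proof (rule SUP_least)
      fix F assume F: "F \<in> {F. finite F \<and> F \<subseteq> A}"
      then obtain i where "F \<subseteq> S i" using S(3) by blast
      then have "sum f F \<le> sum f (S i)" using S(1) by (intro sum_mono2) auto
      also have "\<dots> \<le> (SUP i. sum f (S i))" by (rule SUP_upper) simp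
      finally show "sum f F \<le> (SUP i. sum f (S i))" .
    qed
  qed (use S in \<open>auto intro!: SUP_least SUP_upper\<close>)
  finally show ?thesis .
qed

lemma finite_int_bounded:
  fixes F :: "int set"
  assumes "finite F"
  shows "\<exists>R. F \<subseteq> {- int R..int R}"
proof (intro exI subsetI)
  fix x assume "x \<in> F"
  then have "\<bar>x\<bar> \<le> (\<Sum>y\<in>F. \<bar>y\<bar>)" using assms by (intro member_le_sum) auto
  then show "x \<in> {- int (nat (\<Sum>y\<in>F. \<bar>y\<bar>))..int (nat (\<Sum>y\<in>F. \<bar>y\<bar>))}" by auto
qed

lemma infsum_int_SUP:
  fixes f :: "int \<Rightarrow> ennreal"
  shows "(\<Sum>\<^sub>\<infinity>n. f n) = (SUP R. \<Sum>n\<in>{- int R..int R}. f n)"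
  by (rule infsum_ennreal_SUP) (auto dest: finite_int_bounded)

lemma infsum_nonpos_SUP:
  fixes f :: "int \<Rightarrow> ennreal"
  shows "infsum f {..0} = (SUP M. \<Sum>v\<in>{- int M..0}. f v)"
proof (rule infsum_ennreal_SUP)
  fix F :: "int set" assume "finite F" and sub: "F \<subseteq> {..0}"
  then obtain R where "F \<subseteq> {- int R..int R}" using finite_int_bounded by blast
  with sub have "F \<subseteq> {- int R..int R} \<inter> {..0}" by blast
  also have "\<dots> \<subseteq> {- int R..0}" by auto
  finally have "F \<subseteq> {- int R..0}" .
  then show "\<exists>M. F \<subseteq> {- int M..0}" by blast
qed auto

lemma finite_sum_le_infsum_ennreal:
  fixes f :: "'a \<Rightarrow> ennreal"
  assumes "finite F" "F \<subseteq> A"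
  shows "sum f F \<le> infsum f A"
  unfolding nonneg_infsum_complete[of A f, simplified] by (rule SUP_upper) (use assms in simp)

text \<open>From finite windows to infinite series. The truncation of \<open>b\<close> at scale -M
  is compared with that of \<open>a\<close> one scale further down, the room needed for neighbouring
  scales. The supremum over M passes through the finite sum over n by monotonicity.\<close>

lemma mixed_infsum_le:
  fixes a b :: "int \<Rightarrow> int \<Rightarrow> real"
  assumes t: "0 < t" and D: "0 \<le> D" and a: "\<And>v n. 0 \<le> a v n" and b: "\<And>v n. 0 \<le> b v n"
    and le: "\<And>M N R. (\<And>R. (\<Sum>n\<in>{- int R..int R}. (\<Sum>v\<in>{- int (Suc M)..0}. a v n) powr t) \<le> N) \<Longrightarrow>
      (\<Sum>n\<in>{- int R..int R}. (\<Sum>v\<in>{- int M..0}. b v n) powr t) \<le> D * N"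
    and fin: "(\<Sum>\<^sub>\<infinity>n. ennpowr (\<Sum>\<^sub>\<infinity>v\<in>{..0}. ennreal (a v n)) t) < top"
  shows "(\<Sum>\<^sub>\<infinity>n. ennpowr (\<Sum>\<^sub>\<infinity>v\<in>{..0}. ennreal (b v n)) t)
    \<le> ennreal D * (\<Sum>\<^sub>\<infinity>n. ennpowr (\<Sum>\<^sub>\<infinity>v\<in>{..0}. ennreal (a v n)) t)"
proof -
  define A where "A = (\<Sum>\<^sub>\<infinity>n. ennpowr (\<Sum>\<^sub>\<infinity>v\<in>{..0}. ennreal (a v n)) t)"
  obtain N where N: "0 \<le> N" "A = ennreal N" using fin unfolding A_def[symmetric] by (cases A) auto
  have real: "ennreal (\<Sum>n\<in>{- int R..int R}. (\<Sum>v\<in>{- int M..0}. c v n) powr t) =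
     (\<Sum>n\<in>{- int R..int R}. ennpowr (\<Sum>v\<in>{- int M..0}. ennreal (c v n)) t)" if "\<And>v n. 0 \<le> c v n" for c M R
    using that by (simp add: ennpowr_ennreal sum_nonneg)
  have "(\<Sum>n\<in>{- int R..int R}. (\<Sum>v\<in>{- int M..0}. a v n) powr t) \<le> N" for R M
  proof -
    have "ennreal (\<Sum>n\<in>{- int R..int R}. (\<Sum>v\<in>{- int M..0}. a v n) powr t)
      \<le> (\<Sum>n\<in>{- int R..int R}. ennpowr (\<Sum>\<^sub>\<infinity>v\<in>{..0}. ennreal (a v n)) t)"
      unfolding real[OF a] using t by (intro sum_mono ennpowr_mono finite_sum_le_infsum_ennreal) auto
    also have "\<dots> \<le> A" unfolding A_def by (rule finite_sum_le_infsum_ennreal) auto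
    finally show ?thesis using N by simp
  qed
  then have fb: "(\<Sum>n\<in>{- int R..int R}. (\<Sum>v\<in>{- int M..0}. b v n) powr t) \<le> D * N" for R M by (rule le)
  have inc: "incseq (\<lambda>M. ennpowr (\<Sum>v\<in>{- int M..0}. ennreal (b v n)) t)" for n
    using t by (intro incseq_SucI ennpowr_mono sum_mono2) auto
  have "(\<Sum>\<^sub>\<infinity>n. ennpowr (\<Sum>\<^sub>\<infinity>v\<in>{..0}. ennreal (b v n)) t) =
     (SUP R. \<Sum>n\<in>{- int R..int R}. SUP M. ennpowr (\<Sum>v\<in>{- int M..0}. ennreal (b v n)) t)"
    unfolding infsum_int_SUP infsum_nonpos_SUP ennpowr_SUP[OF t] ..
  also have "\<dots> = (SUP R. SUP M. \<Sum>n\<in>{- int R..int R}. ennpowr (\<Sum>v\<in>{- int M..0}. ennreal (b v n)) t)"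
    by (simp only: ennreal_SUP_sum[OF inc])
  also have "\<dots> \<le> ennreal (D * N)"
    unfolding real[OF b, symmetric] by (intro SUP_least ennreal_leI fb)
  also have "\<dots> = ennreal D * A" using D N by (simp add: ennreal_mult)
  finally show ?thesis by (simp only: A_def)
qed

section \<open>The mixed norms: neighbouring scales and invariance under translation\<close>

lemma lp_norm_cong: "(\<And>i. i \<in> I \<Longrightarrow> a i = b i) \<Longrightarrow> lp_norm p I a = lp_norm p I b"
  unfolding lp_norm_def by (simp cong: infsum_cong SUP_cong)

lemma lp_norm_int_shift: "lp_norm p UNIV (\<lambda>n::int. a (n - 1)) = lp_norm p UNIV a"
proof -
  have "range (\<lambda>n. a (n - 1)) = range a"
  proof
    have "a n = a (n + 1 - 1)" for n by simp
    then show "range a \<subseteq> range (\<lambda>n. a (n - 1))" by blast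
  qed blast
  moreover have "(\<Sum>\<^sub>\<infinity>n. ennpowr (a (n - 1)) c) = (\<Sum>\<^sub>\<infinity>n. ennpowr (a n) c)" for c
    using infsum_int_shift[of "\<lambda>n. ennpowr (a n) c" "- 1"] by simp
  ultimately show ?thesis by (simp only: lp_norm_def)
qed

lemma le_lp_norm:
  assumes i: "i \<in> I" and p: "0 < p"
  shows "a i \<le> lp_norm p I a"
proof (cases "p = \<infinity>")
  case True
  then show ?thesis using i by (simp add: lp_norm_def SUP_upper)
next
  case False
  then have p: "0 < enn2real p" using p by (simp add: enn2real_positive_iff less_top)
  have "ennpowr (a i) (enn2real p) \<le> (\<Sum>\<^sub>\<infinity>i\<in>I. ennpowr (a i) (enn2real p))"
    using finite_sum_le_infsum_ennreal[of "{i}" I "\<lambda>i. ennpowr (a i) (enn2real p)"] i by simp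
  then have "ennpowr (ennpowr (a i) (enn2real p)) (1 / enn2real p) \<le> lp_norm p I a"
    unfolding lp_norm_def using False p by (simp add: ennpowr_mono)
  then show ?thesis using p by (simp add: ennpowr_ennpowr ennpowr_1)
qed

text \<open>Each scale is dominated by one neighbour, and one scale can serve at most three others,
  hence the factor 3 inside the q-th power sum.\<close>

lemma lp_norm_neighbour:
  assumes q: "0 < q" and C: "0 < C"
    and le: "\<And>v. v \<le> 0 \<Longrightarrow> \<exists>e\<in>{- 1, 0, 1}. v + e \<le> 0 \<and> a v \<le> ennreal C * b (v + e)"
  shows "lp_norm q {..0 :: int} a \<le> ennreal (C * 3 powr (1 / enn2real q)) * lp_norm q {..0} b"
proof (cases "q = \<infinity>")
  case True
  have "(SUP v\<in>{..0}. a v) \<le> ennreal C * (SUP v\<in>{..0}. b v)"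
  proof (rule SUP_least)
    fix v :: int assume "v \<in> {..0}"
    then obtain e where e: "v + e \<le> 0" "a v \<le> ennreal C * b (v + e)" using le by fastforce
    note e(2)
    also have "ennreal C * b (v + e) \<le> ennreal C * (SUP v\<in>{..0}. b v)"
      using e(1) by (intro mult_left_mono SUP_upper) auto
    finally show "a v \<le> ennreal C * (SUP v\<in>{..0}. b v)" .
  qed
  \<comment> \<open>For q = \<infinity> the value \<open>enn2real q\<close> is 0, so
    \<open>1 / enn2real q\<close> is 0 and the factor \<open>3 powr 0\<close> is 1.\<close>
  then show ?thesis using True by (simp add: lp_norm_def)
next
  case False
  define Q where "Q = enn2real q"
  have Q: "0 < Q" using q False by (simp add: Q_def enn2real_positive_iff less_top)
  define h where "h v = ennpowr (b v) Q" for v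
  define y where "y v e = (if v + e \<le> 0 then h (v + e) else 0)" for v e
  have ay: "ennpowr (a v) Q \<le> ennreal (C powr Q) * (\<Sum>e\<in>{- 1, 0, 1}. y v e)" if v: "v \<le> 0" for v
  proof -
    obtain e where e: "e \<in> {- 1, 0, 1}" "v + e \<le> 0" "a v \<le> ennreal C * b (v + e)" using le[OF v] by blast
    have "ennpowr (a v) Q \<le> ennpowr (ennreal C * b (v + e)) Q" using e(3) Q by (intro ennpowr_mono) auto
    also have "\<dots> = ennreal (C powr Q) * y v e" using e(2) by (simp add: ennpowr_mult[OF C] y_def h_def)
    also have "\<dots> \<le> ennreal (C powr Q) * (\<Sum>e\<in>{- 1, 0, 1}. y v e)"
      by (intro mult_left_mono member_le_sum[OF e(1)]) auto
    finally show ?thesis .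
  qed
  have fin: "(\<Sum>v\<in>{- int M..0}. ennpowr (a v) Q) \<le> ennreal (C powr Q * 3) * infsum h {..0}" for M
  proof -
    have "(\<Sum>v\<in>{- int M..0}. ennpowr (a v) Q) \<le> (\<Sum>v\<in>{- int M..0}. ennreal (C powr Q) * (\<Sum>e\<in>{- 1, 0, 1}. y v e))"
      by (intro sum_mono ay) simp
    also have "\<dots> = ennreal (C powr Q) * (\<Sum>v\<in>{- int M..0}. \<Sum>e\<in>{- 1, 0, 1}. y v e)"
      by (simp only: sum_distrib_left)
    also have "\<dots> = ennreal (C powr Q) * (\<Sum>e\<in>{- 1, 0, 1}. \<Sum>v\<in>{- int M..0}. y v e)"
      by (simp only: sum.swap[of _ _ "{- 1, 0, 1}"])
    also have "\<dots> \<le> ennreal (C powr Q) * (\<Sum>e\<in>{- 1, 0, 1 :: int}. infsum h {..0})"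
    proof (intro mult_left_mono sum_mono)
      fix e :: int
      have "(\<Sum>v\<in>{- int M..0}. y v e) = (\<Sum>v\<in>{v\<in>{- int M..0}. v + e \<le> 0}. h (v + e))"
        unfolding y_def by (rule sum.inter_filter[symmetric]) simp
      also have "\<dots> = (\<Sum>v\<in>(\<lambda>v. v + e) ` {v\<in>{- int M..0}. v + e \<le> 0}. h v)"
        by (subst sum.reindex) (auto simp: inj_on_def)
      also have "\<dots> \<le> infsum h {..0}"
        by (rule finite_sum_le_infsum_ennreal) (auto intro!: finite_imageI intro: finite_subset[of _ "{- int M..0}"])
      finally show "(\<Sum>v\<in>{- int M..0}. y v e) \<le> infsum h {..0}" .
    qed simp
    also have "\<dots> = ennreal (C powr Q * 3) * infsum h {..0}"
      by (simp add: ennreal_mult mult.assoc)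
    finally show ?thesis .
  qed
  have "infsum (\<lambda>v. ennpowr (a v) Q) {..0} \<le> ennreal (C powr Q * 3) * infsum h {..0}"
    unfolding infsum_nonpos_SUP[of "\<lambda>v. ennpowr (a v) Q"] by (intro SUP_least fin)
  then have "ennpowr (infsum (\<lambda>v. ennpowr (a v) Q) {..0}) (1 / Q) \<le> ennpowr (ennreal (C powr Q * 3) * infsum h {..0}) (1 / Q)"
    using Q by (intro ennpowr_mono) auto
  also have "\<dots> = ennreal ((C powr Q * 3) powr (1 / Q)) * ennpowr (infsum h {..0}) (1 / Q)"
    using C by (intro ennpowr_mult) simp
  also have "(C powr Q * 3) powr (1 / Q) = C * 3 powr (1 / Q)" using C Q by (simp add: powr_mult powr_powr)
  finally show ?thesis using False by (simp add: lp_norm_def Q_def h_def)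
qed

lemma conv_int_shift: "conv a (\<lambda>n. h (n - 1)) n = conv a h (n - 1)"
proof -
  have "(\<Sum>\<^sub>\<infinity>m. a (n - 1 - (m + - 1)) * h (m + - 1)) = (\<Sum>\<^sub>\<infinity>m. a (n - 1 - m) * h m)"
    by (rule infsum_int_shift)
  then show ?thesis by (simp add: conv_def)
qed

lemma besov_seq_norm_shift: "besov_seq_norm \<phi> \<alpha> p q (\<lambda>n. h (n - 1)) = besov_seq_norm \<phi> \<alpha> p q h"
  unfolding besov_seq_norm_def conv_int_shift
  by (simp only: lp_norm_int_shift[where a = "\<lambda>n. ennreal (norm (conv (\<phi> v) h n))" for v])

lemma triebel_lizorkin_seq_norm_shift:
  "triebel_lizorkin_seq_norm \<phi> \<alpha> p q (\<lambda>n. h (n - 1)) = triebel_lizorkin_seq_norm \<phi> \<alpha> p q h"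
  unfolding triebel_lizorkin_seq_norm_def conv_int_shift
  by (rule lp_norm_int_shift[where a = "\<lambda>n. lp_norm q {..0}
       (\<lambda>\<nu>. ennreal (2 powr (of_int \<nu> * \<alpha>)) * ennreal (norm (conv (\<phi> \<nu>) h n)))"])

lemma besov_seq_norm_cong:
  "(\<And>v. v \<le> 0 \<Longrightarrow> conv (\<phi> v) f = conv (\<phi> v) g) \<Longrightarrow> besov_seq_norm \<phi> \<alpha> p q f = besov_seq_norm \<phi> \<alpha> p q g"
  unfolding besov_seq_norm_def by (intro lp_norm_cong) simp

lemma triebel_lizorkin_seq_norm_cong:
  "(\<And>v. v \<le> 0 \<Longrightarrow> conv (\<phi> v) f = conv (\<phi> v) g) \<Longrightarrow>
     triebel_lizorkin_seq_norm \<phi> \<alpha> p q f = triebel_lizorkin_seq_norm \<phi> \<alpha> p q g"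
  unfolding triebel_lizorkin_seq_norm_def by (intro lp_norm_cong) simp

lemma triebel_lizorkin_seq_norm_eq:
  assumes p: "0 < p" "p < \<infinity>" and q: "0 < q" "q < \<infinity>"
  shows "triebel_lizorkin_seq_norm \<phi> \<alpha> p q f =
    ennpowr (\<Sum>\<^sub>\<infinity>n. ennpowr (\<Sum>\<^sub>\<infinity>v\<in>{..0}. ennreal ((2 powr (of_int v * \<alpha>) * norm (conv (\<phi> v) f n)) powr enn2real q))
      (enn2real p / enn2real q)) (1 / enn2real p)"
proof -
  have "p \<noteq> top" "q \<noteq> top" using p q by auto
  then show ?thesis
    by (simp add: triebel_lizorkin_seq_norm_def lp_norm_def ennpowr_ennpowr ennreal_mult[symmetric] ennpowr_ennreal)
qed

section \<open>Boundedness on the function spaces\<close>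

context admissible
begin

lemma conv_phi_cong:
  assumes v: "v \<le> 0" and u: "pgrow u" and d: "(\<lambda>n. w n - u n) \<in> polynomials"
  shows "conv (\<phi> v) w = conv (\<phi> v) u"
proof
  fix n
  have r: "rapid (\<phi> v)" by (rule rapid_family(1)[OF v])
  have "conv (\<phi> v) w n = (\<Sum>\<^sub>\<infinity>m. \<phi> v (n - m) * u m + \<phi> v (n - m) * (w m - u m))"
    unfolding conv_def by (rule infsum_cong) (simp add: algebra_simps)
  also have "\<dots> = conv (\<phi> v) u n + conv (\<phi> v) (\<lambda>m. w m - u m) n"
    unfolding conv_def by (rule infsum_add[OF conv_summable[OF r u] conv_summable[OF r polynomials_pgrow[OF d]]])
  finally show "conv (\<phi> v) w n = conv (\<phi> v) u n" by (simp add: conv_phi_polynomial[OF v d])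
qed

lemma class_norm_eq:
  assumes u: "pgrow u"
    and N: "\<And>f g. (\<And>v. v \<le> 0 \<Longrightarrow> conv (\<phi> v) f = conv (\<phi> v) g) \<Longrightarrow> N f = N g"
  shows "the_elem ((\<lambda>L. N (to_seq L)) ` seq_class u) = N u"
proof (rule the_elem_image_const)
  show "seq_class u \<noteq> {}" using seq_class_self[OF u] by blast
  fix L assume "L \<in> seq_class u"
  then obtain w where w: "L = of_seq w" "(\<lambda>n. w n - u n) \<in> polynomials" unfolding seq_class_def by blast
  show "N (to_seq L) = N u" unfolding w(1) to_seq_of_seq by (rule N) (rule conv_phi_cong[OF _ u w(2)])
qed

text \<open>The same sequence \<open>h\<close>, the forward difference of a representative of the
  inverse square root, describes both transforms: the backward one is its translate.\<close>

lemma riesz_class: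
  assumes "F \<in> tempered_mod_poly"
  shows "\<exists>u h. pgrow u \<and> pgrow h \<and> F = seq_class u \<and> riesz_forward F = seq_class h \<and>
    riesz_backward F = seq_class (\<lambda>n. h (n - 1)) \<and> (\<forall>v\<le>0. conv (\<phi> v) h = conv (coef (riesz_symbol v)) u)"
proof -
  obtain u where u: "pgrow u" "F = seq_class u" using tempered_mod_polyE[OF assms] by blast
  obtain w where w: "pgrow w" "\<And>g. g \<in> schwartz_inf \<Longrightarrow> (\<Sum>\<^sub>\<infinity>n. w n * g n) = (\<Sum>\<^sub>\<infinity>n. u n * laplacian_inv_sqrt g n)"
    using laplacian_inv_sqrt_dual_exists[OF u(1)] by blast
  have c: "laplacian_inv_sqrt_class F = seq_class w"
    unfolding u(2) by (rule laplacian_inv_sqrt_class_seq_class[OF u(1) w annihilator_polynomial])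
  show ?thesis
    by (rule exI[of _ u], rule exI[of _ "forward_diff w"])
      (simp add: u pgrow_forward_diff[OF w(1)] riesz_forward_def riesz_backward_def c[unfolded u(2)]
        lift_class_forward_diff[OF w(1)] lift_class_backward_diff[OF w(1)] conv_phi_forward_diff[OF _ u(1) w])
qed

text \<open>Both kinds of spaces enter through three properties of the quasi-norm on sequences only:
  it depends just on the frequency pieces, it is translation invariant, and it satisfies the Riesz
  estimate when finite. The second is what transfers the bound to the backward transform.\<close>

lemma bounded_on_riesz:
  assumes cong: "\<And>f g. (\<And>v. v \<le> 0 \<Longrightarrow> conv (\<phi> v) f = conv (\<phi> v) g) \<Longrightarrow> N f = N g"
    and shift: "\<And>h. N (\<lambda>n. h (n - 1)) = N h"
    and bound: "\<exists>C. \<forall>u h. pgrow u \<longrightarrow> (\<forall>v\<le>0. conv (\<phi> v) h = conv (coef (riesz_symbol v)) u) \<longrightarrow> N u < \<infinity> \<longrightarrow>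
      N h \<le> ennreal C * N u"
  defines "Nc \<equiv> \<lambda>F. the_elem ((\<lambda>L. N (to_seq L)) ` F)"
  shows "bounded_on {F \<in> tempered_mod_poly. Nc F < \<infinity>} Nc riesz_forward"
    and "bounded_on {F \<in> tempered_mod_poly. Nc F < \<infinity>} Nc riesz_backward"
proof -
  obtain C where C: "\<And>u h. pgrow u \<Longrightarrow> (\<forall>v\<le>0. conv (\<phi> v) h = conv (coef (riesz_symbol v)) u) \<Longrightarrow> N u < \<infinity> \<Longrightarrow>
      N h \<le> ennreal C * N u" using bound by blast
  have Nc: "Nc (seq_class u) = N u" if "pgrow u" for u unfolding Nc_def by (rule class_norm_eq[OF that cong])
  have main: "T F \<in> tempered_mod_poly \<and> Nc (T F) < \<infinity> \<and> Nc (T F) \<le> ennreal C * Nc F"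
    if F: "F \<in> tempered_mod_poly" "Nc F < \<infinity>" and T: "T = riesz_forward \<or> T = riesz_backward" for T F
  proof -
    obtain u h where uh: "pgrow u" "pgrow h" "F = seq_class u" "riesz_forward F = seq_class h"
      "riesz_backward F = seq_class (\<lambda>n. h (n - 1))" "\<forall>v\<le>0. conv (\<phi> v) h = conv (coef (riesz_symbol v)) u"
      using riesz_class[OF F(1)] by blast
    have h': "pgrow (\<lambda>n. h (n - 1))" using pgrow_shift[OF uh(2), of "- 1"] by simp
    obtain k where k: "pgrow k" "T F = seq_class k" "N k = N h" using T uh(2,4,5) h' shift by metis
    have fin: "N u < \<infinity>" using F(2) Nc[OF uh(1)] uh(3) by simp
    have le: "N k \<le> ennreal C * N u" unfolding k(3) by (rule C[OF uh(1,6) fin])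
    also have "\<dots> < \<infinity>" using fin by (simp add: ennreal_mult_less_top)
    finally have "N k < \<infinity>" .
    moreover have "Nc (T F) = N k" unfolding k(2) by (rule Nc[OF k(1)])
    moreover have "Nc F = N u" unfolding uh(3) by (rule Nc[OF uh(1)])
    moreover have "T F \<in> tempered_mod_poly" unfolding k(2) by (rule seq_class_tempered_mod_poly[OF k(1)])
    ultimately show ?thesis using le by simp
  qed
  show "bounded_on {F \<in> tempered_mod_poly. Nc F < \<infinity>} Nc riesz_forward"
    "bounded_on {F \<in> tempered_mod_poly. Nc F < \<infinity>} Nc riesz_backward"
    unfolding bounded_on_def using main by blast+
qed

lemma triebel_lizorkin_bound:
  assumes p: "0 < p" "p < \<infinity>" and q: "0 < q" "q < \<infinity>"
  shows "\<exists>C. \<forall>u h. pgrow u \<longrightarrow> (\<forall>v\<le>0. conv (\<phi> v) h = conv (coef (riesz_symbol v)) u) \<longrightarrow>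
    triebel_lizorkin_seq_norm \<phi> \<alpha> p q u < \<infinity> \<longrightarrow>
    triebel_lizorkin_seq_norm \<phi> \<alpha> p q h \<le> ennreal C * triebel_lizorkin_seq_norm \<phi> \<alpha> p q u"
proof -
  define P where "P = enn2real p"
  define Q where "Q = enn2real q"
  have PQ: "0 < P" "0 < Q" using p q by (simp_all add: P_def Q_def enn2real_positive_iff)
  obtain D where D: "0 \<le> D" "\<forall>u V V' N. pgrow u \<longrightarrow> finite V \<longrightarrow> V \<subseteq> {..0} \<longrightarrow> finite V' \<longrightarrow> V' \<subseteq> {..0} \<longrightarrow>
    (\<forall>v\<in>V. \<forall>e\<in>{- 1, 0, 1}. v + e \<le> 0 \<longrightarrow> v + e \<in> V') \<longrightarrow>
    (\<forall>R. (\<Sum>n\<in>{- int R..int R}. (\<Sum>v\<in>V'. (2 powr (of_int v * \<alpha>) * norm (conv (\<phi> v) u n)) powr Q) powr (P / Q)) \<le> N) \<longrightarrow>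
    (\<forall>R. (\<Sum>n\<in>{- int R..int R}. (\<Sum>v\<in>V. (2 powr (of_int v * \<alpha>) * norm (conv (coef (riesz_symbol v)) u n)) powr Q) powr (P / Q)) \<le> D * N)"
    using riesz_finite_estimate[OF PQ, of \<alpha>] by (elim exE conjE) (rule that)
  \<comment> \<open>\<open>D + 1\<close> in place of \<open>D\<close>, because
    \<open>ennpowr_mult\<close> asks for a strictly positive factor.\<close>
  have "triebel_lizorkin_seq_norm \<phi> \<alpha> p q h \<le> ennreal ((D + 1) powr (1 / P)) * triebel_lizorkin_seq_norm \<phi> \<alpha> p q u"
    if u: "pgrow u" and h: "\<forall>v\<le>0. conv (\<phi> v) h = conv (coef (riesz_symbol v)) u"
      and fin: "triebel_lizorkin_seq_norm \<phi> \<alpha> p q u < \<infinity>" for u h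
  proof -
    define a where "a v n = (2 powr (of_int v * \<alpha>) * norm (conv (\<phi> v) u n)) powr Q" for v n
    define b where "b v n = (2 powr (of_int v * \<alpha>) * norm (conv (\<phi> v) h n)) powr Q" for v n
    define A where "A = (\<Sum>\<^sub>\<infinity>n. ennpowr (\<Sum>\<^sub>\<infinity>v\<in>{..0}. ennreal (a v n)) (P / Q))"
    define B where "B = (\<Sum>\<^sub>\<infinity>n. ennpowr (\<Sum>\<^sub>\<infinity>v\<in>{..0}. ennreal (b v n)) (P / Q))"
    have nA: "triebel_lizorkin_seq_norm \<phi> \<alpha> p q u = ennpowr A (1 / P)"
      unfolding triebel_lizorkin_seq_norm_eq[OF assms] A_def a_def P_def Q_def ..
    have nB: "triebel_lizorkin_seq_norm \<phi> \<alpha> p q h = ennpowr B (1 / P)"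
      unfolding triebel_lizorkin_seq_norm_eq[OF assms] B_def b_def P_def Q_def ..
    have "B \<le> ennreal (D + 1) * A"
      unfolding A_def B_def
    proof (rule mixed_infsum_le)
      fix M N R
      assume N: "\<And>R. (\<Sum>n\<in>{- int R..int R}. (\<Sum>v\<in>{- int (Suc M)..0}. a v n) powr (P / Q)) \<le> N"
      have N0: "0 \<le> N" by (rule order_trans[OF _ N[of 0]]) simp
      have b_eq: "(\<Sum>v\<in>{- int M..0}. b v n) = (\<Sum>v\<in>{- int M..0}. (2 powr (of_int v * \<alpha>) * norm (conv (coef (riesz_symbol v)) u n)) powr Q)" for n
        unfolding b_def using h by (intro sum.cong) auto
      have "(\<Sum>n\<in>{- int R..int R}. (\<Sum>v\<in>{- int M..0}. b v n) powr (P / Q)) \<le> D * N"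
        unfolding b_eq by (rule D(2)[rule_format, OF u, where V' = "{- int (Suc M)..0}"]) (use N in \<open>auto simp: a_def\<close>)
      also have "\<dots> \<le> (D + 1) * N" using N0 by (intro mult_right_mono) auto
      finally show "(\<Sum>n\<in>{- int R..int R}. (\<Sum>v\<in>{- int M..0}. b v n) powr (P / Q)) \<le> (D + 1) * N" .
    next
      show "(\<Sum>\<^sub>\<infinity>n. ennpowr (\<Sum>\<^sub>\<infinity>v\<in>{..0}. ennreal (a v n)) (P / Q)) < top"
        using fin unfolding nA A_def by (simp add: ennpowr_less_top)
    qed (use PQ D in \<open>auto simp: a_def b_def\<close>)
    then have "ennpowr B (1 / P) \<le> ennpowr (ennreal (D + 1) * A) (1 / P)" using PQ by (intro ennpowr_mono) auto
    also have "\<dots> = ennreal ((D + 1) powr (1 / P)) * ennpowr A (1 / P)" using D(1) by (intro ennpowr_mult) simp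
    finally show ?thesis unfolding nA nB .
  qed
  then show ?thesis by blast
qed

text \<open>The finite estimate at a single scale, with q replaced by p and without weight. Choosing
  the neighbour with the largest sum gives domination by one scale, a form to which any outer norm
  over scales applies, including the supremum.\<close>

lemma lp_bound:
  assumes P: "0 < P"
  defines "S \<equiv> \<lambda>v f. \<Sum>\<^sub>\<infinity>n. ennreal (norm (conv (\<phi> v) f n) powr P)"
  shows "\<exists>D>0. \<forall>u h v. pgrow u \<longrightarrow> (\<forall>v\<le>0. conv (\<phi> v) h = conv (coef (riesz_symbol v)) u) \<longrightarrow> v \<le> 0 \<longrightarrow>
    (\<forall>v\<le>0. S v u < top) \<longrightarrow> (\<exists>e\<in>{- 1, 0, 1}. v + e \<le> 0 \<and> S v h \<le> ennreal D * S (v + e) u)"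
proof -
  obtain D where D: "0 \<le> D" "\<forall>u V V' N. pgrow u \<longrightarrow> finite V \<longrightarrow> V \<subseteq> {..0} \<longrightarrow> finite V' \<longrightarrow> V' \<subseteq> {..0} \<longrightarrow>
    (\<forall>v\<in>V. \<forall>e\<in>{- 1, 0, 1}. v + e \<le> 0 \<longrightarrow> v + e \<in> V') \<longrightarrow>
    (\<forall>R. (\<Sum>n\<in>{- int R..int R}. (\<Sum>v\<in>V'. (2 powr (of_int v * 0) * norm (conv (\<phi> v) u n)) powr P) powr (P / P)) \<le> N) \<longrightarrow>
    (\<forall>R. (\<Sum>n\<in>{- int R..int R}. (\<Sum>v\<in>V. (2 powr (of_int v * 0) * norm (conv (coef (riesz_symbol v)) u n)) powr P) powr (P / P)) \<le> D * N)"
    using riesz_finite_estimate[OF P P, of 0] by (elim exE conjE) (rule that)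
  have "\<exists>e\<in>{- 1, 0, 1}. v + e \<le> 0 \<and> S v h \<le> ennreal (D * 3 + 1) * S (v + e) u"
    if u: "pgrow u" and h: "\<forall>v\<le>0. conv (\<phi> v) h = conv (coef (riesz_symbol v)) u" and v: "v \<le> 0"
      and fin: "\<forall>v\<le>0. S v u < top" for u h v
  proof -
    define E where "E = {e\<in>{- 1, 0, 1}. v + e \<le> 0}"
    have "card E \<le> card {- 1, 0, 1 :: int}" by (rule card_mono) (auto simp: E_def)
    also have "\<dots> = 3" by simp
    finally have E: "finite E" "E \<noteq> {}" "card E \<le> 3" using v by (auto simp: E_def)
    obtain e where e: "e \<in> E" "\<forall>i\<in>E. S (v + i) u \<le> S (v + e) u"
      using finite_ex_max_image[OF E(1,2), of "\<lambda>i. S (v + i) u"] by blast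
    obtain N where N: "0 \<le> N" "S (v + e) u = ennreal N"
      using fin e(1) by (cases "S (v + e) u") (auto simp: E_def)
    have part: "(\<Sum>n\<in>{- int R..int R}. norm (conv (\<phi> (v + i)) u n) powr P) \<le> N" if i: "i \<in> E" for R i
    proof -
      have "ennreal (\<Sum>n\<in>{- int R..int R}. norm (conv (\<phi> (v + i)) u n) powr P) \<le> S (v + i) u"
        unfolding S_def using finite_sum_le_infsum_ennreal[of "{- int R..int R}" UNIV "\<lambda>n. ennreal (norm (conv (\<phi> (v + i)) u n) powr P)"]
        by simp
      also have "\<dots> \<le> ennreal N" using e(2) i N by simp
      finally show ?thesis using N by simp
    qed
    have hyp: "(\<Sum>n\<in>{- int R..int R}. (\<Sum>w\<in>(\<lambda>e. v + e) ` E. (2 powr (of_int w * 0) * norm (conv (\<phi> w) u n)) powr P) powr (P / P)) \<le> 3 * N" for R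
    proof -
      have "(\<Sum>n\<in>{- int R..int R}. (\<Sum>w\<in>(\<lambda>e. v + e) ` E. (2 powr (of_int w * 0) * norm (conv (\<phi> w) u n)) powr P) powr (P / P))
        = (\<Sum>n\<in>{- int R..int R}. \<Sum>i\<in>E. norm (conv (\<phi> (v + i)) u n) powr P)"
        using P by (simp add: sum.reindex sum_nonneg)
      also have "\<dots> = (\<Sum>i\<in>E. \<Sum>n\<in>{- int R..int R}. norm (conv (\<phi> (v + i)) u n) powr P)" by (rule sum.swap)
      also have "\<dots> \<le> real (card E) * N" using part by (intro sum_bounded_above) auto
      also have "\<dots> \<le> 3 * N" using E(3) N(1) by (intro mult_right_mono) auto
      finally show ?thesis .
    qed
    have "(\<Sum>n\<in>{- int R..int R}. (\<Sum>w\<in>{v}. (2 powr (of_int w * 0) * norm (conv (coef (riesz_symbol w)) u n)) powr P) powr (P / P)) \<le> D * (3 * N)" for R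
      by (rule D(2)[rule_format, OF u, where V' = "(\<lambda>e. v + e) ` E"]) (use v hyp E(1) in \<open>auto simp: E_def\<close>)
    then have fb: "(\<Sum>n\<in>{- int R..int R}. norm (conv (\<phi> v) h n) powr P) \<le> D * (3 * N)" for R
      using P h v by simp
    have "S v h \<le> ennreal (D * (3 * N))"
      unfolding S_def infsum_int_SUP by (rule SUP_least) (simp add: ennreal_leI fb)
    also have "\<dots> \<le> ennreal ((D * 3 + 1) * N)" using N by (intro ennreal_leI) (simp add: algebra_simps)
    also have "\<dots> = ennreal (D * 3 + 1) * S (v + e) u" using D(1) N by (simp add: ennreal_mult)
    finally show ?thesis using e(1) by (auto simp: E_def)
  qed
  then show ?thesis using D(1) by (intro exI[of _ "D * 3 + 1"]) auto
qed

lemma besov_bound: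
  assumes p: "0 < p" "p < \<infinity>" and q: "0 < q"
  shows "\<exists>C. \<forall>u h. pgrow u \<longrightarrow> (\<forall>v\<le>0. conv (\<phi> v) h = conv (coef (riesz_symbol v)) u) \<longrightarrow>
    besov_seq_norm \<phi> \<alpha> p q u < \<infinity> \<longrightarrow>
    besov_seq_norm \<phi> \<alpha> p q h \<le> ennreal C * besov_seq_norm \<phi> \<alpha> p q u"
proof -
  define P where "P = enn2real p"
  have P: "0 < P" using p by (simp add: P_def enn2real_positive_iff)
  define S where "S v f = (\<Sum>\<^sub>\<infinity>n. ennreal (norm (conv (\<phi> v) f n) powr P))" for v f
  have lpS: "lp_norm p UNIV (\<lambda>n. ennreal (norm (conv (\<phi> v) f n))) = ennpowr (S v f) (1 / P)" for v f
    using p by (simp add: lp_norm_def S_def P_def ennpowr_ennreal)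
  obtain D where D: "0 < D" "\<And>u h v. pgrow u \<Longrightarrow> (\<forall>v\<le>0. conv (\<phi> v) h = conv (coef (riesz_symbol v)) u) \<Longrightarrow> v \<le> 0 \<Longrightarrow>
    (\<forall>v\<le>0. S v u < top) \<Longrightarrow> (\<exists>e\<in>{- 1, 0, 1}. v + e \<le> 0 \<and> S v h \<le> ennreal D * S (v + e) u)"
    using lp_bound[OF P] unfolding S_def by blast
  define E where "E = 2 powr \<bar>\<alpha>\<bar> * D powr (1 / P)"
  have E0: "0 < E" using D(1) by (simp add: E_def)
  have "besov_seq_norm \<phi> \<alpha> p q h \<le> ennreal (E * 3 powr (1 / enn2real q)) * besov_seq_norm \<phi> \<alpha> p q u"
    if u: "pgrow u" and h: "\<forall>v\<le>0. conv (\<phi> v) h = conv (coef (riesz_symbol v)) u"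
      and fin: "besov_seq_norm \<phi> \<alpha> p q u < \<infinity>" for u h
  proof -
    \<comment> \<open>A finite norm over the scales forces each single scale to be finite, for q =
      \<infinity> as well; this is the finiteness that \<open>lp_bound\<close> demands.\<close>
    have S_fin: "\<forall>v\<le>0. S v u < top"
    proof (intro allI impI)
      fix v :: int assume v: "v \<le> 0"
      have "ennreal (2 powr (of_int v * \<alpha>)) * ennpowr (S v u) (1 / P) \<le> besov_seq_norm \<phi> \<alpha> p q u"
        unfolding besov_seq_norm_def lpS by (rule le_lp_norm[where a = "\<lambda>v. ennreal (2 powr (of_int v * \<alpha>)) * ennpowr (S v u) (1 / P)"]) (use v q in auto)
      also have "\<dots> < top" using fin by simp
      finally have "ennpowr (S v u) (1 / P) < top" by (auto simp: ennreal_mult_less_top)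
      then show "S v u < top" by (simp add: ennpowr_less_top)
    qed
    show ?thesis
      unfolding besov_seq_norm_def lpS
    proof (rule lp_norm_neighbour[OF q E0])
      fix v :: int assume v: "v \<le> 0"
      obtain e where e: "e \<in> {- 1, 0, 1}" "v + e \<le> 0" "S v h \<le> ennreal D * S (v + e) u"
        using D(2)[OF u h v S_fin] by blast
      have "ennpowr (S v h) (1 / P) \<le> ennpowr (ennreal D * S (v + e) u) (1 / P)"
        using e(3) P by (intro ennpowr_mono) auto
      also have "\<dots> = ennreal (D powr (1 / P)) * ennpowr (S (v + e) u) (1 / P)" by (rule ennpowr_mult[OF D(1)])
      finally have 1: "ennpowr (S v h) (1 / P) \<le> ennreal (D powr (1 / P)) * ennpowr (S (v + e) u) (1 / P)" .
      have "of_int v * \<alpha> = \<bar>\<alpha>\<bar> + of_int (v + e) * \<alpha> - (\<bar>\<alpha>\<bar> + of_int e * \<alpha>)" by (simp add: algebra_simps)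
      also have "\<dots> \<le> \<bar>\<alpha>\<bar> + of_int (v + e) * \<alpha>" using e(1) by auto
      finally have "2 powr (of_int v * \<alpha>) \<le> 2 powr (\<bar>\<alpha>\<bar> + of_int (v + e) * \<alpha>)" by (intro powr_mono) auto
      then have 2: "ennreal (2 powr (of_int v * \<alpha>)) \<le> ennreal (2 powr \<bar>\<alpha>\<bar>) * ennreal (2 powr (of_int (v + e) * \<alpha>))"
        by (simp add: powr_add ennreal_mult[symmetric] ennreal_leI)
      have "ennreal (2 powr (of_int v * \<alpha>)) * ennpowr (S v h) (1 / P) \<le>
        (ennreal (2 powr \<bar>\<alpha>\<bar>) * ennreal (2 powr (of_int (v + e) * \<alpha>))) * (ennreal (D powr (1 / P)) * ennpowr (S (v + e) u) (1 / P))"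
        by (intro mult_mono 1 2) auto
      also have "\<dots> = ennreal E * (ennreal (2 powr (of_int (v + e) * \<alpha>)) * ennpowr (S (v + e) u) (1 / P))"
        by (simp add: E_def ennreal_mult mult_ac)
      finally show "\<exists>e\<in>{- 1, 0, 1}. v + e \<le> 0 \<and> ennreal (2 powr (of_int v * \<alpha>)) * ennpowr (S v h) (1 / P) \<le>
        ennreal E * (ennreal (2 powr (of_int (v + e) * \<alpha>)) * ennpowr (S (v + e) u) (1 / P))"
        using e(1,2) by blast
    qed
  qed
  then show ?thesis by blast
qed

lemma besov_riesz:
  assumes "0 < p" "p < \<infinity>" "0 < q"
  shows "bounded_on (besov \<phi> \<alpha> p q) (besov_norm \<phi> \<alpha> p q) riesz_forward"
    and "bounded_on (besov \<phi> \<alpha> p q) (besov_norm \<phi> \<alpha> p q) riesz_backward"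
  unfolding besov_def besov_norm_def[abs_def]
  by (rule bounded_on_riesz; (rule besov_seq_norm_cong besov_seq_norm_shift besov_bound[OF assms]; assumption?))+

lemma triebel_lizorkin_riesz:
  assumes "0 < p" "p < \<infinity>" "0 < q" "q < \<infinity>"
  shows "bounded_on (triebel_lizorkin \<phi> \<alpha> p q) (triebel_lizorkin_norm \<phi> \<alpha> p q) riesz_forward"
    and "bounded_on (triebel_lizorkin \<phi> \<alpha> p q) (triebel_lizorkin_norm \<phi> \<alpha> p q) riesz_backward"
  unfolding triebel_lizorkin_def triebel_lizorkin_norm_def[abs_def]
  by (rule bounded_on_riesz; (rule triebel_lizorkin_seq_norm_cong triebel_lizorkin_seq_norm_shift triebel_lizorkin_bound[OF assms]; assumption?))+

end

theorem theorem5p4: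
  fixes \<phi> \<psi> :: "int \<Rightarrow> int \<Rightarrow> complex"
  assumes "admissible_pair \<phi> \<psi>"
  shows
    "(\<forall>(\<alpha> :: real) (p :: ennreal) (q :: ennreal).
        0 < p \<and> p < \<infinity> \<and> 0 < q \<and> q \<le> \<infinity> \<longrightarrow>
        bounded_on (besov \<phi> \<alpha> p q) (besov_norm \<phi> \<alpha> p q) riesz_forward \<and>
        bounded_on (besov \<phi> \<alpha> p q) (besov_norm \<phi> \<alpha> p q) riesz_backward) \<and>
     (\<forall>(\<alpha> :: real) (p :: ennreal) (q :: ennreal).
        0 < p \<and> p < \<infinity> \<and> 0 < q \<and> q < \<infinity> \<longrightarrow>
        bounded_on (triebel_lizorkin \<phi> \<alpha> p q) (triebel_lizorkin_norm \<phi> \<alpha> p q) riesz_forward \<and>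
        bounded_on (triebel_lizorkin \<phi> \<alpha> p q) (triebel_lizorkin_norm \<phi> \<alpha> p q) riesz_backward)"
proof -
  interpret admissible \<phi> \<psi> by (rule admissible.intro[OF assms])
  show ?thesis
    by (intro conjI allI impI; elim conjE) (rule besov_riesz triebel_lizorkin_riesz; assumption)+
qed

end
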